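(* Let $H:[0,\infty)\to[\mu,\nu]\subset(0,1)$ be $\beta$-Hölder continuous with $\sup_{s\ge0}H(s)<\beta$, let $B=(B(t),\,t\ge0)$ be a multifractional Brownian motion with Hurst function $H$ (in either the moving average or the harmonizable representation), and let $L(t,x)$ be its jointly continuous local time. Then, for any fixed $t_0\ge0$, the local time of $B$ is locally asymptotically self-similar with parameter $1-H(t_0)$ in the following sense: for every $x\in\mathbb{R}$, the processes $\{Y_\rho(t,x),\,t\in[0,1]\}_{\rho>0}$ defined by $$Y_\rho(t,x)=\frac{L(t_0+\rho t,\ \rho^{H(t_0)}x+B(t_0))-L(t_0,\ \rho^{H(t_0)}x+B(t_0))}{\rho^{1-H(t_0)}}$$ converge in law, as $\rho\to0$, to the local time $\{\ell(t,x),\,t\in[0,1]\}$ of the fractional Brownian motion $B^{H(t_0)}$ with Hurst parameter $H(t_0)$, that is, $$\lim_{\rho\to0}\mathrm{law}\{Y_\rho(t,x),\,t\in[0,1]\}=\mathrm{law}\{\ell(t,x),\,t\in[0,1]\},$$ where the convergence is in the space of continuous functions on $[0,1]$ endowed with the norm of uniform convergence.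
   Context: Multifractional Brownian motion with Hurst function $H$ is given by either of the following representations. Moving average representation: $B(t)=\frac{1}{\Gamma(H(t)+1/2)}\Big(\int_{-\infty}^{0}[(t-u)^{H(t)-1/2}-(-u)^{H(t)-1/2}]\,W(du)+\int_0^t(t-u)^{H(t)-1/2}\,W(du)\Big)$, $t\ge 0$, with $W$ a standard Brownian motion on $(-\infty,\infty)$. Harmonizable representation: $B(t)=\int_{\mathbb{R}}\frac{e^{it\xi}-1}{|\xi|^{H(t)+1/2}}\,\widehat W(d\xi)$, where $\widehat W$ is the Fourier transform of real white noise $W$, i.e. $\int f\,d\widehat W=\int\widehat f\,dW$ for $f\in L^2(\mathbb{R})$, with $\widehat f$ the unitary Fourier transform; this process is real-valued. The fractional Brownian motion $B^{H(t_0)}$ with Hurst parameter $H(t_0)$ is the process obtained from the same representation with constant Hurst function equal to $H(t_0)$. Local time: $L(t,x)=L([0,t],x)$, where $L(A,\cdot)$ is the density with respect to Lebesgue measure of the occupation measure $D\mapsto\lambda\{s\in A:B(s)\in D\}$ ($\lambda$ is Lebesgue measure); $\ell(t,x)$ is defined in the same way from $B^{H(t_0)}$. Under the stated hypotheses on $H$ it is known that both have versions jointly continuous in $(t,x)$; these versions are used. *)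

theory Defs
  imports "HOL-Probability.Probability"
begin

definition holder_continuous_on :: "real set \<Rightarrow> real \<Rightarrow> (real \<Rightarrow> real) \<Rightarrow> bool" where
  "holder_continuous_on S \<beta> f \<longleftrightarrow>
     0 < \<beta> \<and> (\<exists>C. \<forall>s\<in>S. \<forall>t\<in>S. \<bar>f s - f t\<bar> \<le> C * \<bar>s - t\<bar> powr \<beta>)"

section \<open>Wiener integrals\<close>

definition two_sided_brownian_motion :: "'a measure \<Rightarrow> (real \<Rightarrow> 'a \<Rightarrow> real) \<Rightarrow> bool" where
  "two_sided_brownian_motion M W \<longleftrightarrow>
     prob_space M \<and>
     (\<forall>t. W t \<in> borel_measurable M) \<and>
     (AE \<omega> in M. W 0 \<omega> = 0) \<and>
     (AE \<omega> in M. continuous_on UNIV (\<lambda>t. W t \<omega>)) \<and>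
     (\<forall>s t. s < t \<longrightarrow>
        distributed M lborel (\<lambda>\<omega>. W t \<omega> - W s \<omega>) (\<lambda>y. ennreal (normal_density 0 (sqrt (t - s)) y))) \<and>
     (\<forall>(\<tau> :: nat \<Rightarrow> real) n. mono \<tau> \<longrightarrow>
        prob_space.indep_vars M (\<lambda>_. borel) (\<lambda>i \<omega>. W (\<tau> (Suc i)) \<omega> - W (\<tau> i) \<omega>) {..<n})"

text \<open>A list of triples \<open>(a, b, c)\<close> with \<open>a \<le> b\<close> encodes the step function
  \<open>\<Sum> c 1\<^bsub>(a,b]\<^esub>\<close>.\<close>

definition step_fun :: "(real \<times> real \<times> 'b::real_vector) list \<Rightarrow> real \<Rightarrow> 'b" where
  "step_fun S u = (\<Sum>(a, b, c)\<leftarrow>S. indicat_real {a<..b} u *\<^sub>R c)"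

definition step_integral ::
  "(real \<Rightarrow> 'a \<Rightarrow> real) \<Rightarrow> (real \<times> real \<times> 'b::real_vector) list \<Rightarrow> 'a \<Rightarrow> 'b" where
  "step_integral W S \<omega> = (\<Sum>(a, b, c)\<leftarrow>S. (W b \<omega> - W a \<omega>) *\<^sub>R c)"

text \<open>\<open>X\<close> is a version of \<open>\<integral> f dW\<close>, the \<open>L\<^sup>2\<close>-isometric extension of the integral of step
  functions.  Convergence of the step functions to \<open>f\<close> forces \<open>f\<close> to be in \<open>L\<^sup>2\<close>.\<close>

definition has_wiener_integral ::
  "'a measure \<Rightarrow> (real \<Rightarrow> 'a \<Rightarrow> real) \<Rightarrow> (real \<Rightarrow> 'b::euclidean_space) \<Rightarrow> ('a \<Rightarrow> 'b) \<Rightarrow> bool" where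
  "has_wiener_integral M W f X \<longleftrightarrow>
     f \<in> borel_measurable lborel \<and> X \<in> borel_measurable M \<and>
     (\<exists>S :: nat \<Rightarrow> (real \<times> real \<times> 'b) list.
        (\<forall>n. \<forall>(a, b, c) \<in> set (S n). a \<le> b) \<and>
        (\<lambda>n. \<integral>\<^sup>+u. ennreal ((norm (step_fun (S n) u - f u))\<^sup>2) \<partial>lborel) \<longlonglongrightarrow> 0 \<and>
        (\<lambda>n. \<integral>\<^sup>+\<omega>. ennreal ((norm (step_integral W (S n) \<omega> - X \<omega>))\<^sup>2) \<partial>M) \<longlonglongrightarrow> 0)"

text \<open>\<open>g\<close> is a version of the unitary (Plancherel) Fourier transform of the square integrable
  function \<open>f\<close>.  Such an \<open>f\<close> need not be integrable, so the transform is the \<open>L\<^sup>2\<close>-limit of the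
  transforms of the truncations of \<open>f\<close> to \<open>[-n, n]\<close>.\<close>

definition has_fourier_transform :: "(real \<Rightarrow> complex) \<Rightarrow> (real \<Rightarrow> complex) \<Rightarrow> bool" where
  "has_fourier_transform f g \<longleftrightarrow>
     f \<in> borel_measurable lborel \<and> integrable lborel (\<lambda>\<xi>. (norm (f \<xi>))\<^sup>2) \<and>
     g \<in> borel_measurable lborel \<and>
     (\<lambda>n::nat. \<integral>\<^sup>+x. ennreal ((norm
        ((1 / sqrt (2 * pi)) *\<^sub>R (LINT \<xi>:{- real n..real n}|lborel. cis (- (x * \<xi>)) * f \<xi>) - g x))\<^sup>2)
        \<partial>lborel) \<longlonglongrightarrow> 0"

text \<open>\<open>X\<close> is a version of the integral of \<open>f\<close> against the Fourier transform of the white noise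
  \<open>W(du)\<close>.\<close>

definition has_harmonizable_integral ::
  "'a measure \<Rightarrow> (real \<Rightarrow> 'a \<Rightarrow> real) \<Rightarrow> (real \<Rightarrow> complex) \<Rightarrow> ('a \<Rightarrow> complex) \<Rightarrow> bool" where
  "has_harmonizable_integral M W f X \<longleftrightarrow>
     (\<exists>g. has_fourier_transform f g \<and> has_wiener_integral M W g X)"

section \<open>Multifractional Brownian motion\<close>

datatype mbm_representation = Moving_Average | Harmonizable

definition moving_average_at ::
  "'a measure \<Rightarrow> (real \<Rightarrow> 'a \<Rightarrow> real) \<Rightarrow> real \<Rightarrow> real \<Rightarrow> ('a \<Rightarrow> real) \<Rightarrow> bool" where
  "moving_average_at M W h t Z \<longleftrightarrow>
     (\<exists>X Y. has_wiener_integral M W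
              (\<lambda>u. indicat_real {..<0} u * ((t - u) powr (h - 1/2) - (- u) powr (h - 1/2))) X \<and>
            has_wiener_integral M W
              (\<lambda>u. indicat_real {0..t} u * (t - u) powr (h - 1/2)) Y \<and>
            (AE \<omega> in M. Z \<omega> = 1 / Gamma (h + 1/2) * (X \<omega> + Y \<omega>)))"

definition harmonizable_at ::
  "'a measure \<Rightarrow> (real \<Rightarrow> 'a \<Rightarrow> real) \<Rightarrow> real \<Rightarrow> real \<Rightarrow> ('a \<Rightarrow> real) \<Rightarrow> bool" where
  "harmonizable_at M W h t Z \<longleftrightarrow>
     (\<exists>X. has_harmonizable_integral M W
            (\<lambda>\<xi>. (exp (\<i> * of_real (t * \<xi>)) - 1) / of_real (\<bar>\<xi>\<bar> powr (h + 1/2))) X \<and>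
          (AE \<omega> in M. complex_of_real (Z \<omega>) = X \<omega>))"

text \<open>The stochastic integrals determine each \<open>B t\<close> only up to a null set; joint measurability of
  the chosen version is what makes its occupation measures meaningful, and it holds for every
  version with continuous paths.  Values of \<open>H\<close> and \<open>B\<close> at negative times are irrelevant.\<close>

definition multifractional_brownian_motion ::
  "mbm_representation \<Rightarrow> 'a measure \<Rightarrow> (real \<Rightarrow> real) \<Rightarrow> (real \<Rightarrow> 'a \<Rightarrow> real) \<Rightarrow> bool" where
  "multifractional_brownian_motion R M H B \<longleftrightarrow>
     (\<lambda>(t, \<omega>). B t \<omega>) \<in> borel_measurable (restrict_space borel {0..} \<Otimes>\<^sub>M M) \<and>
     (\<exists>W. two_sided_brownian_motion M W \<and>
        (\<forall>t\<ge>0. case R of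
            Moving_Average \<Rightarrow> moving_average_at M W (H t) t (B t)
          | Harmonizable \<Rightarrow> harmonizable_at M W (H t) t (B t)))"

definition fractional_brownian_motion ::
  "mbm_representation \<Rightarrow> 'a measure \<Rightarrow> real \<Rightarrow> (real \<Rightarrow> 'a \<Rightarrow> real) \<Rightarrow> bool" where
  "fractional_brownian_motion R M h B \<longleftrightarrow> multifractional_brownian_motion R M (\<lambda>_. h) B"

section \<open>Local times\<close>

definition occupation_measure :: "(real \<Rightarrow> real) \<Rightarrow> real set \<Rightarrow> real measure" where
  "occupation_measure b A = distr (restrict_space lborel A) borel b"

definition jointly_continuous_local_time ::
  "'a measure \<Rightarrow> (real \<Rightarrow> 'a \<Rightarrow> real) \<Rightarrow> (real \<Rightarrow> real \<Rightarrow> 'a \<Rightarrow> real) \<Rightarrow> bool" where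
  "jointly_continuous_local_time M B L \<longleftrightarrow>
     (\<forall>t\<ge>0. \<forall>x. L t x \<in> borel_measurable M) \<and>
     (\<forall>t\<ge>0. \<forall>x. \<forall>\<omega>\<in>space M. 0 \<le> L t x \<omega>) \<and>
     (\<forall>\<omega>\<in>space M. continuous_on ({0..} \<times> UNIV) (\<lambda>(t, x). L t x \<omega>)) \<and>
     (AE \<omega> in M. \<forall>t\<ge>0.
        occupation_measure (\<lambda>s. B s \<omega>) {0..t} = density lborel (\<lambda>x. ennreal (L t x \<omega>)))"

section \<open>Convergence in law on the space of continuous functions on the unit interval\<close>

definition C01 :: "(real \<Rightarrow> real) metric" where
  "C01 = cfunspace (top_of_set {0..1}) euclidean_metric"

definition borel_metric :: "'c metric \<Rightarrow> 'c measure" where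
  "borel_metric m = sigma (mspace m) {U. openin (mtopology_of m) U}"

text \<open>Elements of \<open>C01\<close> are undefined outside the unit interval, hence the restriction.\<close>

definition law_C01 :: "'a measure \<Rightarrow> (real \<Rightarrow> 'a \<Rightarrow> real) \<Rightarrow> (real \<Rightarrow> real) measure" where
  "law_C01 M Y = distr M (borel_metric C01) (\<lambda>\<omega>. restrict (\<lambda>t. Y t \<omega>) {0..1})"

definition weakly_converges ::
  "'c metric \<Rightarrow> ('i \<Rightarrow> 'c measure) \<Rightarrow> 'c measure \<Rightarrow> 'i filter \<Rightarrow> bool" where
  "weakly_converges m P Q F \<longleftrightarrow>
     (\<forall>\<phi> :: 'c \<Rightarrow> real.
        continuous_map (mtopology_of m) euclideanreal \<phi> \<and> bounded (\<phi> ` mspace m) \<longrightarrow>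
        ((\<lambda>i. \<integral>f. \<phi> f \<partial>P i) \<longlongrightarrow> (\<integral>f. \<phi> f \<partial>Q)) F)"

definition rescaled_local_time ::
  "(real \<Rightarrow> real) \<Rightarrow> (real \<Rightarrow> 'a \<Rightarrow> real) \<Rightarrow> (real \<Rightarrow> real \<Rightarrow> 'a \<Rightarrow> real) \<Rightarrow>
   real \<Rightarrow> real \<Rightarrow> real \<Rightarrow> real \<Rightarrow> 'a \<Rightarrow> real" where
  "rescaled_local_time H B L t0 \<rho> x t \<omega> =
     (L (t0 + \<rho> * t) (\<rho> powr H t0 * x + B t0 \<omega>) \<omega> - L t0 (\<rho> powr H t0 * x + B t0 \<omega>) \<omega>)
       / \<rho> powr (1 - H t0)"

end

theory Submission
  imports Defs
begin

text \<open>The rescaled increments \<open>P\<^sub>\<rho>(s) = (B(t\<^sub>0 + \<rho>s) - B(t\<^sub>0)) / \<rho>\<^bsup>H(t\<^sub>0)\<^esup>\<close> are centred Gaussian, and the quantity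
  of interest is exactly their local time at \<open>x\<close>. Because \<open>H\<close> is \<open>\<beta>\<close>-Hoelder with \<open>H < \<beta>\<close>, replacing
  \<open>H(t\<^sub>0 + \<rho>s)\<close> by \<open>H(t\<^sub>0)\<close> changes the kernel of \<open>P\<^sub>\<rho>\<close> in \<open>L\<^sup>2\<close> by \<open>o(1)\<close>, so the finite-dimensional laws
  converge to those of fractional Brownian motion. The kernels satisfy, uniformly in small \<open>\<rho>\<close>, an upper bound on
  the variance of increments and the lower bound \<open>c (\<alpha>\<^sup>2s\<^bsup>2\<nu>\<^esup> + \<gamma>\<^sup>2d\<^bsup>2\<nu>\<^esup>)\<close> on the variance of
  \<open>\<alpha> P\<^sub>\<rho>(s) + \<gamma> (P\<^sub>\<rho>(s + d) - P\<^sub>\<rho>(s))\<close>. By Fourier inversion these bounds make the local time uniformly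
  close in mean, in the sup norm over time, to Riemann sums of Gaussian densities of \<open>P\<^sub>\<rho> - x\<close>. Such sums
  are bounded continuous functions of finitely many values of \<open>P\<^sub>\<rho>\<close>, and their laws converge by the convergence of
  mixed moments and the Stone--Weierstrass theorem.\<close>

section \<open>Square integrable functions\<close>

text \<open>Gaussianity enters through one identity: the expectation of \<open>cis\<close> of a
  linear combination of values is \<open>exp (- v / 2)\<close>, where \<open>v\<close> is the
  squared L2 norm of the same combination of kernels. Covariance matrices and joint densities never
  appear. For the harmonizable representation this needs Plancherel, since the noise integrates the
  transform of the kernel.

  No tightness criterion is used. At fixed times the local time is compared with its smoothed
  version in mean square; both increase in time, so finitely many grid points control the whole
  interval. All constants are common to small \<open>rho\<close> and to the limit process, so one
  Riemann sum serves every \<open>rho\<close>, and the limits in \<open>rho\<close> and in the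
  approximation can be exchanged.

  The gap between \<open>H\<close> and \<open>beta\<close> makes the freezing error
  \<open>rho powr (2 * beta - 2 * H t0)\<close> vanish and lets the lower variance bound survive
  freezing. The bound \<open>nu < 1\<close> makes the singularities \<open>s powr (- nu)\<close> and
  \<open>d powr (- nu)\<close> of the pair expectations integrable.\<close>

abbreviation l2sq :: "(real \<Rightarrow> 'b::real_normed_vector) \<Rightarrow> real" where
  "l2sq f \<equiv> \<integral>u. (norm (f u))\<^sup>2 \<partial>lborel"

definition square_integrable :: "'a measure \<Rightarrow> ('a \<Rightarrow> 'b::euclidean_space) \<Rightarrow> bool" where
  "square_integrable M f \<longleftrightarrow> f \<in> borel_measurable M \<and> integrable M (\<lambda>x. (norm (f x))\<^sup>2)"

lemma norm_add_square_le:
  fixes a b :: "'b::real_inner"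
  shows "(norm (a + b))\<^sup>2 \<le> 2 * (norm a)\<^sup>2 + 2 * (norm b)\<^sup>2"
proof -
  have "(norm (a + b))\<^sup>2 + (norm (a - b))\<^sup>2 = 2 * (norm a)\<^sup>2 + 2 * (norm b)\<^sup>2"
    by (simp add: power2_norm_eq_inner inner_simps)
  then show ?thesis by (smt (verit) zero_le_power2)
qed

lemma norm_diff_square_le:
  fixes a b :: "'b::real_inner"
  shows "(norm (a - b))\<^sup>2 \<le> 2 * (norm a)\<^sup>2 + 2 * (norm b)\<^sup>2"
  using norm_add_square_le[of a "- b"] by simp

lemma square_integrable_scaleR:
  "square_integrable M f \<Longrightarrow> square_integrable M (\<lambda>x. c *\<^sub>R f x)"
  by (auto simp: square_integrable_def power_mult_distrib)

lemma square_integrable_add: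
  assumes "square_integrable M f" "square_integrable M g"
  shows "square_integrable M (\<lambda>x. f x + g x)"
  unfolding square_integrable_def
proof
  have [measurable]: "f \<in> borel_measurable M" "g \<in> borel_measurable M"
    using assms by (auto simp: square_integrable_def)
  show "(\<lambda>x. f x + g x) \<in> borel_measurable M" by simp
  show "integrable M (\<lambda>x. (norm (f x + g x))\<^sup>2)"
  proof (rule Bochner_Integration.integrable_bound)
    show "integrable M (\<lambda>x. 2 * (norm (f x))\<^sup>2 + 2 * (norm (g x))\<^sup>2)"
      using assms by (auto simp: square_integrable_def)
  qed (auto intro!: AE_I2 norm_add_square_le)
qed

lemma square_integrable_diff:
  assumes "square_integrable M f" "square_integrable M g"
  shows "square_integrable M (\<lambda>x. f x - g x)"
  using square_integrable_add[OF assms(1) square_integrable_scaleR[OF assms(2), of "-1"]] by simp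

lemma square_integrable_sum:
  assumes "\<And>i. i \<in> I \<Longrightarrow> square_integrable M (f i)"
  shows "square_integrable M (\<lambda>x. \<Sum>i\<in>I. f i x)"
  using assms
proof (induction I rule: infinite_finite_induct)
  case (insert i I)
  then show ?case using square_integrable_add[of M "f i" "\<lambda>x. \<Sum>i\<in>I. f i x"] by simp
qed (auto simp: square_integrable_def)

lemma integral_square_add_le:
  fixes f g :: "'a \<Rightarrow> 'b::euclidean_space"
  assumes "square_integrable M f" "square_integrable M g"
  shows "(\<integral>x. (norm (f x + g x))\<^sup>2 \<partial>M) \<le> 2 * (\<integral>x. (norm (f x))\<^sup>2 \<partial>M) + 2 * (\<integral>x. (norm (g x))\<^sup>2 \<partial>M)"
proof -
  have "(\<integral>x. (norm (f x + g x))\<^sup>2 \<partial>M) \<le> (\<integral>x. 2 * (norm (f x))\<^sup>2 + 2 * (norm (g x))\<^sup>2 \<partial>M)"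
    using assms square_integrable_add[OF assms]
    by (intro integral_mono) (auto simp: square_integrable_def norm_add_square_le)
  then show ?thesis using assms by (simp add: square_integrable_def)
qed

text \<open>Young's inequality for the cross term \<open>2 * (b \<bullet> d)\<close> with
  \<open>d = a - b\<close>. The weight \<open>e\<close> on the norm of \<open>b\<close> may be
  chosen small, so closeness in L2 transfers squared norms without a Cauchy-Schwarz inequality for
  integrals.\<close>

lemma norm_square_diff_le:
  fixes a b :: "'b::real_inner"
  assumes "0 < e"
  shows "\<bar>(norm a)\<^sup>2 - (norm b)\<^sup>2\<bar> \<le> e * (norm b)\<^sup>2 + (1 + 1 / e) * (norm (a - b))\<^sup>2"
proof -
  define d where "d = a - b"
  have "(norm a)\<^sup>2 - (norm b)\<^sup>2 = (norm d)\<^sup>2 + 2 * (b \<bullet> d)"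
    by (simp add: d_def power2_norm_eq_inner inner_simps inner_commute)
  moreover have "\<bar>b \<bullet> d\<bar> \<le> norm b * norm d" by (rule Cauchy_Schwarz_ineq2)
  moreover have "2 * (norm b * norm d) \<le> e * (norm b)\<^sup>2 + (1 / e) * (norm d)\<^sup>2"
  proof -
    have "0 \<le> (e * norm b - norm d)\<^sup>2 / e" using assms by simp
    also have "\<dots> = e * (norm b)\<^sup>2 + (1 / e) * (norm d)\<^sup>2 - 2 * (norm b * norm d)"
      using assms by (simp add: power2_eq_square field_simps)
    finally show ?thesis by simp
  qed
  ultimately show ?thesis unfolding d_def[symmetric]
    by (smt (verit) distrib_right mult_1 mult_cancel_right1 zero_le_power2)
qed

lemma integral_square_diff_le:
  fixes f g :: "'a \<Rightarrow> 'b::euclidean_space"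
  assumes "square_integrable M f" "square_integrable M g" "0 < e"
  shows "\<bar>(\<integral>x. (norm (f x))\<^sup>2 \<partial>M) - (\<integral>x. (norm (g x))\<^sup>2 \<partial>M)\<bar>
     \<le> e * (\<integral>x. (norm (g x))\<^sup>2 \<partial>M) + (1 + 1 / e) * (\<integral>x. (norm (f x - g x))\<^sup>2 \<partial>M)"
proof -
  note d = square_integrable_diff[OF assms(1,2)]
  have "\<bar>(\<integral>x. (norm (f x))\<^sup>2 \<partial>M) - (\<integral>x. (norm (g x))\<^sup>2 \<partial>M)\<bar>
      = \<bar>\<integral>x. (norm (f x))\<^sup>2 - (norm (g x))\<^sup>2 \<partial>M\<bar>"
    using assms by (simp add: square_integrable_def)
  also have "\<dots> \<le> (\<integral>x. \<bar>(norm (f x))\<^sup>2 - (norm (g x))\<^sup>2\<bar> \<partial>M)" by (rule integral_abs_bound)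
  also have "\<dots> \<le> (\<integral>x. e * (norm (g x))\<^sup>2 + (1 + 1 / e) * (norm (f x - g x))\<^sup>2 \<partial>M)"
    using assms d by (intro integral_mono) (auto simp: square_integrable_def norm_square_diff_le)
  also have "\<dots> = e * (\<integral>x. (norm (g x))\<^sup>2 \<partial>M) + (1 + 1 / e) * (\<integral>x. (norm (f x - g x))\<^sup>2 \<partial>M)"
    using assms d by (simp add: square_integrable_def)
  finally show ?thesis .
qed

lemma integral_square_ge:
  fixes f g :: "'a \<Rightarrow> 'b::euclidean_space"
  assumes "square_integrable M f" "square_integrable M g"
  shows "(\<integral>x. (norm (g x))\<^sup>2 \<partial>M) / 2 - (\<integral>x. (norm (f x - g x))\<^sup>2 \<partial>M) \<le> (\<integral>x. (norm (f x))\<^sup>2 \<partial>M)"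
  using integral_square_add_le[OF assms(1) square_integrable_diff[OF assms(2,1)]]
  by (simp add: norm_minus_commute)

lemma tendsto_integral_square:
  fixes f g :: "'i \<Rightarrow> 'a \<Rightarrow> 'b::euclidean_space"
  assumes f: "eventually (\<lambda>i. square_integrable M (f i)) F"
    and g: "eventually (\<lambda>i. square_integrable M (g i)) F"
    and d: "((\<lambda>i. \<integral>x. (norm (f i x - g i x))\<^sup>2 \<partial>M) \<longlongrightarrow> 0) F"
    and l: "((\<lambda>i. \<integral>x. (norm (g i x))\<^sup>2 \<partial>M) \<longlongrightarrow> l) F"
  shows "((\<lambda>i. \<integral>x. (norm (f i x))\<^sup>2 \<partial>M) \<longlongrightarrow> l) F"
proof (rule Lim_transform[OF l], rule tendstoI)
  fix r :: real assume r: "0 < r"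
  have gen: "q * (r / (4 * q)) = r / 4" if "0 < q" for q :: real using that by simp
  \<comment> \<open>Eventually the squared norm of \<open>g i\<close> is at most
    \<open>\<bar>l\<bar> + 1\<close>, so this weight keeps the first term of
    \<open>integral_square_diff_le\<close> below \<open>r / 4\<close>; the distance term gets
    another \<open>r / 4\<close>.\<close>
  define e where "e = r / (4 * (\<bar>l\<bar> + 1))"
  have e: "0 < e" using r by (simp add: e_def)
  have 1: "eventually (\<lambda>i. dist (\<integral>x. (norm (g i x))\<^sup>2 \<partial>M) l < 1) F"
    using tendstoD[OF l, of 1] by simp
  have 2: "eventually (\<lambda>i. dist (\<integral>x. (norm (f i x - g i x))\<^sup>2 \<partial>M) 0 < r / (4 * (1 + 1 / e))) F"
    using r e by (intro tendstoD[OF d]) (simp add: add_pos_pos)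
  show "eventually (\<lambda>i. dist ((\<integral>x. (norm (f i x))\<^sup>2 \<partial>M) - (\<integral>x. (norm (g i x))\<^sup>2 \<partial>M)) 0 < r) F"
    using f g 1 2
  proof eventually_elim
    case (elim i)
    have "e * (\<integral>x. (norm (g i x))\<^sup>2 \<partial>M) \<le> e * (\<bar>l\<bar> + 1)"
      using elim(3) e by (intro mult_left_mono) (auto simp: dist_real_def)
    also have "\<dots> = r / 4" by (simp add: e_def add_nonneg_eq_0_iff) (simp add: field_simps)
    finally have a: "e * (\<integral>x. (norm (g i x))\<^sup>2 \<partial>M) \<le> r / 4" .
    have p: "0 < 1 + 1 / e" using e by (simp add: add_pos_pos)
    have "(1 + 1 / e) * (\<integral>x. (norm (f i x - g i x))\<^sup>2 \<partial>M) \<le> (1 + 1 / e) * (r / (4 * (1 + 1 / e)))"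
      using elim(4) p by (intro mult_left_mono) (auto simp: dist_real_def)
    also have "\<dots> = r / 4" using gen[OF p] .
    finally have b: "(1 + 1 / e) * (\<integral>x. (norm (f i x - g i x))\<^sup>2 \<partial>M) \<le> r / 4" .
    show ?case
      using order_trans[OF integral_square_diff_le[OF elim(1,2) e] add_mono[OF a b]] r
      by (simp add: dist_real_def)
  qed
qed

lemma nn_integral_square_eq:
  "square_integrable M f \<Longrightarrow> (\<integral>\<^sup>+x. ennreal ((norm (f x))\<^sup>2) \<partial>M) = ennreal (\<integral>x. (norm (f x))\<^sup>2 \<partial>M)"
  by (rule nn_integral_eq_integral) (auto simp: square_integrable_def)

lemma square_integrableI:
  assumes [measurable]: "f \<in> borel_measurable M" and "(\<integral>\<^sup>+x. ennreal ((norm (f x))\<^sup>2) \<partial>M) < \<infinity>"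
  shows "square_integrable M f"
  unfolding square_integrable_def using assms(2) by (auto intro!: integrableI_bounded)

lemma square_integrable_bound:
  fixes f :: "'a \<Rightarrow> 'b::euclidean_space" and g :: "'a \<Rightarrow> 'c::euclidean_space"
  assumes g: "square_integrable M g" and [measurable]: "f \<in> borel_measurable M"
    and b: "AE x in M. norm (f x) \<le> norm (g x)"
  shows "square_integrable M f"
  unfolding square_integrable_def
proof
  show "integrable M (\<lambda>x. (norm (f x))\<^sup>2)"
    by (rule Bochner_Integration.integrable_bound[where f="\<lambda>x. (norm (g x))\<^sup>2"])
      (use g b in \<open>auto simp: square_integrable_def intro: power_mono\<close>)
qed simp

text \<open>Where the norm exceeds \<eta> it is at most its square divided by \<eta>. The free level
  \<eta> plays the part of the Cauchy-Schwarz inequality and is tuned at each use.\<close>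

lemma (in prob_space) norm_le_of_square_integrable:
  assumes "square_integrable M f" "0 < (\<eta>::real)"
  shows "integrable M (\<lambda>x. norm (f x))"
    and "(\<integral>x. norm (f x) \<partial>M) \<le> \<eta> + (\<integral>x. (norm (f x))\<^sup>2 \<partial>M) / \<eta>"
proof -
  have [measurable]: "f \<in> borel_measurable M" using assms by (simp add: square_integrable_def)
  have i: "integrable M (\<lambda>x. \<eta> + (norm (f x))\<^sup>2 / \<eta>)"
    using assms by (auto simp: square_integrable_def)
  have le: "norm (f x) \<le> \<eta> + (norm (f x))\<^sup>2 / \<eta>" for x
  proof (cases "norm (f x) \<le> \<eta>")
    case False
    then have "norm (f x) * \<eta> \<le> (norm (f x))\<^sup>2"
      using assms by (simp add: power2_eq_square mult_left_mono)
    then have "norm (f x) \<le> (norm (f x))\<^sup>2 / \<eta>" using assms by (simp add: pos_le_divide_eq)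
    then show ?thesis using assms by linarith
  qed (use assms in \<open>simp add: add_increasing2\<close>)
  show j: "integrable M (\<lambda>x. norm (f x))"
    by (rule Bochner_Integration.integrable_bound[OF i]) (use le in \<open>auto intro!: AE_I2 order_trans[OF _ abs_ge_self]\<close>)
  have "(\<integral>x. norm (f x) \<partial>M) \<le> (\<integral>x. \<eta> + (norm (f x))\<^sup>2 / \<eta> \<partial>M)"
    by (rule integral_mono[OF j i]) (rule le)
  also have "\<dots> = \<eta> + (\<integral>x. (norm (f x))\<^sup>2 \<partial>M) / \<eta>"
    using assms by (simp add: square_integrable_def prob_space)
  finally show "(\<integral>x. norm (f x) \<partial>M) \<le> \<eta> + (\<integral>x. (norm (f x))\<^sup>2 \<partial>M) / \<eta>" .
qed

section \<open>Gaussian Fourier integrals, null sequences in L2, and Fubini with bounded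
  kernels\<close>

lemma borel_measurable_cis[measurable]:
  fixes f :: "'a \<Rightarrow> real"
  assumes [measurable]: "f \<in> borel_measurable M"
  shows "(\<lambda>x. cis (f x)) \<in> borel_measurable M"
  unfolding cis_conv_exp by measurable

lemma integrable_cis_times_real:
  fixes f g :: "'a \<Rightarrow> real"
  assumes [measurable]: "g \<in> borel_measurable M" and f: "integrable M f"
  shows "integrable M (\<lambda>x. cis (g x) * complex_of_real (f x))"
proof (rule Bochner_Integration.integrable_bound[OF f])
  have [measurable]: "f \<in> borel_measurable M" using f by simp
  show "(\<lambda>x. cis (g x) * complex_of_real (f x)) \<in> borel_measurable M"
    unfolding cis_conv_exp by measurable
qed (simp add: norm_mult)

lemma integral_cis_normal_density:
  assumes s: "0 < \<sigma>"
  shows "(\<integral>x. cis (\<theta> * x) * complex_of_real (normal_density m \<sigma> x) \<partial>lborel)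
    = cis (\<theta> * m) * complex_of_real (exp (- (\<sigma> * \<theta>)\<^sup>2 / 2))"
proof -
  have c: "(\<integral>x. complex_of_real (std_normal_density x) * cis (t * x) \<partial>lborel) = complex_of_real (exp (- t\<^sup>2 / 2))" for t
  proof -
    have "complex_of_real (exp (- t\<^sup>2 / 2)) = char std_normal_distribution t"
      by (simp add: char_std_normal_distribution)
    also have "\<dots> = (\<integral>x. complex_of_real (std_normal_density x) * cis (t * x) \<partial>lborel)"
      unfolding char_def cis_conv_exp
      by (subst integral_density) (auto simp: normal_density_nonneg scaleR_conv_of_real)
    finally show ?thesis ..
  qed
  have "(\<integral>x. cis (\<theta> * x) * complex_of_real (normal_density m \<sigma> x) \<partial>lborel)
    = \<sigma> *\<^sub>R (\<integral>x. cis (\<theta> * (m + \<sigma> * x)) * complex_of_real (normal_density m \<sigma> (m + \<sigma> * x)) \<partial>lborel)"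
    using s by (subst lborel_integral_real_affine[where c=\<sigma> and t=m]) auto
  also have "\<dots> = (\<integral>x. cis (\<theta> * m) * (complex_of_real (std_normal_density x) * cis ((\<sigma> * \<theta>) * x)) \<partial>lborel)"
    unfolding integral_scaleR_right[symmetric]
  proof (rule Bochner_Integration.integral_cong[OF refl])
    fix x
    have "\<sigma> * normal_density m \<sigma> (m + \<sigma> * x) = std_normal_density x"
      using s by (simp add: normal_density_def real_sqrt_mult power_mult_distrib)
    then have "complex_of_real \<sigma> * complex_of_real (normal_density m \<sigma> (m + \<sigma> * x)) = complex_of_real (std_normal_density x)"
      by (metis of_real_mult)
    moreover have "cis (\<theta> * (m + \<sigma> * x)) = cis (\<theta> * m) * cis ((\<sigma> * \<theta>) * x)"
      by (simp add: cis_mult algebra_simps)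
    ultimately show "\<sigma> *\<^sub>R (cis (\<theta> * (m + \<sigma> * x)) * complex_of_real (normal_density m \<sigma> (m + \<sigma> * x)))
      = cis (\<theta> * m) * (complex_of_real (std_normal_density x) * cis ((\<sigma> * \<theta>) * x))"
      by (simp add: scaleR_conv_of_real mult_ac)
  qed
  also have "\<dots> = cis (\<theta> * m) * complex_of_real (exp (- (\<sigma> * \<theta>)\<^sup>2 / 2))"
    by (subst integral_mult_right_zero) (simp only: c)
  finally show ?thesis .
qed

lemma nn_integral_square_tendsto_0_add:
  fixes p q :: "nat \<Rightarrow> 'a \<Rightarrow> 'b::euclidean_space"
  assumes [measurable]: "\<And>n. p n \<in> borel_measurable N" "\<And>n. q n \<in> borel_measurable N"
    and p: "(\<lambda>n. \<integral>\<^sup>+x. ennreal ((norm (p n x))\<^sup>2) \<partial>N) \<longlonglongrightarrow> 0"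
    and q: "(\<lambda>n. \<integral>\<^sup>+x. ennreal ((norm (q n x))\<^sup>2) \<partial>N) \<longlonglongrightarrow> 0"
  shows "(\<lambda>n. \<integral>\<^sup>+x. ennreal ((norm (p n x + q n x))\<^sup>2) \<partial>N) \<longlonglongrightarrow> 0"
proof (rule tendsto_sandwich[OF always_eventually always_eventually tendsto_const])
  show "(\<lambda>n. 2 * (\<integral>\<^sup>+x. ennreal ((norm (p n x))\<^sup>2) \<partial>N) + 2 * (\<integral>\<^sup>+x. ennreal ((norm (q n x))\<^sup>2) \<partial>N)) \<longlonglongrightarrow> 0"
    using tendsto_add[OF tendsto_mult_ennreal[OF tendsto_const[of 2] p] tendsto_mult_ennreal[OF tendsto_const[of 2] q]] by simp
  have "(\<integral>\<^sup>+x. ennreal ((norm (p n x + q n x))\<^sup>2) \<partial>N)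
    \<le> (\<integral>\<^sup>+x. 2 * ennreal ((norm (p n x))\<^sup>2) + 2 * ennreal ((norm (q n x))\<^sup>2) \<partial>N)" for n
    by (intro nn_integral_mono)
      (auto simp: ennreal_mult'[symmetric] ennreal_plus[symmetric] norm_add_square_le simp flip: ennreal_numeral simp del: ennreal_plus)
  then show "\<forall>n. (\<integral>\<^sup>+x. ennreal ((norm (p n x + q n x))\<^sup>2) \<partial>N)
    \<le> 2 * (\<integral>\<^sup>+x. ennreal ((norm (p n x))\<^sup>2) \<partial>N) + 2 * (\<integral>\<^sup>+x. ennreal ((norm (q n x))\<^sup>2) \<partial>N)"
    by (auto simp: nn_integral_add nn_integral_cmult)
qed simp

lemma nn_integral_square_tendsto_0_bounded_linear:
  fixes g :: "nat \<Rightarrow> 'a \<Rightarrow> 'b::euclidean_space" and T :: "'b \<Rightarrow> 'c::euclidean_space"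
  assumes T: "linear T" and [measurable]: "\<And>n. g n \<in> borel_measurable N"
    and l: "(\<lambda>n. \<integral>\<^sup>+x. ennreal ((norm (g n x))\<^sup>2) \<partial>N) \<longlonglongrightarrow> 0"
  shows "(\<lambda>n. \<integral>\<^sup>+x. ennreal ((norm (T (g n x)))\<^sup>2) \<partial>N) \<longlonglongrightarrow> 0"
proof -
  obtain K where K: "\<And>x. norm (T x) \<le> K * norm x" "0 \<le> K"
    using bounded_linear.nonneg_bounded[of T] T by (auto simp: linear_conv_bounded_linear mult.commute)
  have sq: "(norm (T x))\<^sup>2 \<le> K\<^sup>2 * (norm x)\<^sup>2" for x
    using power_mono[OF K(1)[of x], of 2] by (simp add: power_mult_distrib)
  show ?thesis
  proof (rule tendsto_sandwich[OF always_eventually always_eventually tendsto_const])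
  show "(\<lambda>n. ennreal (K\<^sup>2) * (\<integral>\<^sup>+x. ennreal ((norm (g n x))\<^sup>2) \<partial>N)) \<longlonglongrightarrow> 0"
    using tendsto_mult_ennreal[OF tendsto_const[of "ennreal (K\<^sup>2)"] l] by simp
  show "\<forall>n. (\<integral>\<^sup>+x. ennreal ((norm (T (g n x)))\<^sup>2) \<partial>N) \<le> ennreal (K\<^sup>2) * (\<integral>\<^sup>+x. ennreal ((norm (g n x))\<^sup>2) \<partial>N)"
    using sq by (auto simp: nn_integral_cmult[symmetric] ennreal_mult[symmetric] intro!: nn_integral_mono ennreal_leI)
  qed simp
qed

lemma (in pair_sigma_finite) integrable_mult_kernel:
  fixes a :: "'a \<Rightarrow> 'c :: {real_normed_field, banach, second_countable_topology}" and b :: "'b \<Rightarrow> 'c" and k :: "'a \<Rightarrow> 'b \<Rightarrow> 'c"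
  assumes a: "integrable M1 a" and b: "integrable M2 b"
    and [measurable]: "(\<lambda>(x, y). k x y) \<in> borel_measurable (M1 \<Otimes>\<^sub>M M2)" and k: "\<And>x y. norm (k x y) \<le> C"
  shows "integrable (M1 \<Otimes>\<^sub>M M2) (\<lambda>(x, y). a x * b y * k x y)"
proof (rule Bochner_Integration.integrable_bound)
  have [measurable]: "a \<in> borel_measurable M1" "b \<in> borel_measurable M2" using a b by auto
  have "integrable (M1 \<Otimes>\<^sub>M M2) (\<lambda>(x, y). a x * b y)"
    by (rule Fubini_integrable) (use a b in \<open>auto simp: norm_mult\<close>)
  then show "integrable (M1 \<Otimes>\<^sub>M M2) (\<lambda>z. C *\<^sub>R (case z of (x, y) \<Rightarrow> a x * b y))" by simp
  have "0 \<le> C" using order_trans[OF norm_ge_zero k] .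
  then show "AE z in M1 \<Otimes>\<^sub>M M2. norm (case z of (x, y) \<Rightarrow> a x * b y * k x y)
    \<le> norm (C *\<^sub>R (case z of (x, y) \<Rightarrow> a x * b y))"
    using k by (auto simp: norm_mult mult.commute[of C] intro!: AE_I2 mult_left_mono)
  show "(\<lambda>(x, y). a x * b y * k x y) \<in> borel_measurable (M1 \<Otimes>\<^sub>M M2)" by measurable
qed

text \<open>Fubini in the form that fits Fourier inversion: the two weights are integrable and the
  kernel coupling the variables is merely bounded, being a character or a bounded functional of a
  path.\<close>

lemma (in pair_sigma_finite) integral_mult_kernel_swap:
  fixes a :: "'a \<Rightarrow> 'c :: {real_normed_field, banach, second_countable_topology}" and b :: "'b \<Rightarrow> 'c" and k :: "'a \<Rightarrow> 'b \<Rightarrow> 'c"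
  assumes a: "integrable M1 a" and b: "integrable M2 b"
    and k: "(\<lambda>(x, y). k x y) \<in> borel_measurable (M1 \<Otimes>\<^sub>M M2)" "\<And>x y. norm (k x y) \<le> C"
  shows "(\<integral>x. a x * (\<integral>y. b y * k x y \<partial>M2) \<partial>M1) = (\<integral>y. b y * (\<integral>x. a x * k x y \<partial>M1) \<partial>M2)"
proof -
  have "b y * (\<integral>x. a x * k x y \<partial>M1) = (\<integral>x. a x * b y * k x y \<partial>M1)" for y
    unfolding integral_mult_right_zero[symmetric] by (simp add: mult_ac)
  moreover have "a x * (\<integral>y. b y * k x y \<partial>M2) = (\<integral>y. a x * b y * k x y \<partial>M2)" for x
    unfolding integral_mult_right_zero[symmetric] by (simp add: mult_ac)
  ultimately show ?thesis
    using Fubini_integral[OF integrable_mult_kernel[OF assms]] by simp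
qed

section \<open>Characteristic functions of Wiener integrals\<close>

lemma emeasure_lborel_Ioc_finite: "emeasure lborel {a<..b::real} < \<infinity>"
  by (rule emeasure_bounded_finite) simp

lemma norm_cis_diff_le: "norm (cis a - cis b) \<le> \<bar>a - b\<bar>"
proof -
  have "cis a - cis b = cis b * (cis (a - b) - 1)"
    by (simp add: right_diff_distrib cis_mult)
  moreover have "cmod (cis (a - b) - 1) \<le> \<bar>a - b\<bar>"
    using iexp_approx1[of "a - b" 0] by (simp add: cis_conv_exp)
  ultimately show ?thesis by (simp add: norm_mult)
qed

text \<open>An interval with endpoints in the grid \<open>ts\<close> is the disjoint union of the
  grid cells inside it, so its increment telescopes over these cells. Overlapping steps thereby
  become steps on disjoint cells, whose coefficient adds up all \<open>c\<close> whose interval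
  contains the cell.\<close>

lemma step_refinement_aux:
  fixes ts :: "real list" and S :: "(real \<times> real \<times> 'b::real_vector) list" and w :: "real \<Rightarrow> real"
  assumes ts: "sorted_wrt (<) ts"
    and S: "\<forall>(a, b, c)\<in>set S. a \<le> b \<and> a \<in> set ts \<and> b \<in> set ts"
  shows "(\<Sum>(a, b, c)\<leftarrow>S. (w b - w a) *\<^sub>R c) =
    (\<Sum>i<length ts - 1. (w (ts ! Suc i) - w (ts ! i)) *\<^sub>R
       (\<Sum>(a, b, c)\<leftarrow>S. if a \<le> ts ! i \<and> ts ! Suc i \<le> b then c else 0))"
  using S
proof (induction S)
  case (Cons x S)
  obtain a b c where x: "x = (a, b, c)" by (cases x)
  obtain p q where pq: "p < length ts" "a = ts ! p" "q < length ts" "b = ts ! q"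
    using Cons.prems x by (auto simp: in_set_conv_nth)
  have less: "ts ! i < ts ! j \<longleftrightarrow> i < j" if "i < length ts" "j < length ts" for i j
    using that ts sorted_wrt_nth_less[OF ts] by (metis less_asym linorder_neqE_nat order.irrefl)
  then have le: "ts ! i \<le> ts ! j \<longleftrightarrow> i \<le> j" if "i < length ts" "j < length ts" for i j
    using that by (meson not_le)
  have "p \<le> q" using Cons.prems x pq le by auto
  have "(\<Sum>i<length ts - 1. (w (ts ! Suc i) - w (ts ! i)) *\<^sub>R (if a \<le> ts ! i \<and> ts ! Suc i \<le> b then c else 0))
    = (\<Sum>i\<in>{p..<q}. (w (ts ! Suc i) - w (ts ! i)) *\<^sub>R c)"
    by (rule sum.mono_neutral_cong_right) (use pq le in auto)
  also have "\<dots> = (w b - w a) *\<^sub>R c"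
    using sum_Suc_diff'[OF \<open>p \<le> q\<close>, of "\<lambda>i. w (ts ! i)"] pq by (simp flip: scaleR_sum_left)
  finally show ?case using Cons.IH Cons.prems
    by (simp add: x scaleR_add_right sum.distrib)
qed simp

text \<open>Taking \<open>w\<close> to be a path of the Brownian motion or \<open>\<lambda>t. indicator {..t} u\<close> gives compatible
  expansions of a step integral and of its integrand over the increments of a partition.\<close>

lemma step_refinement:
  fixes S :: "(real \<times> real \<times> 'b::real_vector) list"
  assumes S: "\<forall>(a, b, c)\<in>set S. a \<le> b"
  obtains \<tau> :: "nat \<Rightarrow> real" and n d where "mono \<tau>" "\<And>i. i < n \<Longrightarrow> \<tau> i < \<tau> (Suc i)"
    "\<And>w :: real \<Rightarrow> real. (\<Sum>(a, b, c)\<leftarrow>S. (w b - w a) *\<^sub>R c) = (\<Sum>i<n. (w (\<tau> (Suc i)) - w (\<tau> i)) *\<^sub>R d i)"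
proof -
  define A where "A = (\<Union>(a, b, c)\<in>set S. {a, b})"
  define ts where "ts = sorted_list_of_set A"
  have fin: "finite A" by (auto simp: A_def)
  have ts: "sorted_wrt (<) ts" "set ts = A" using fin by (auto simp: ts_def)
  \<comment> \<open>Independence of Brownian increments is stated for monotone sequences on all of
    nat, so the grid is continued by its last point, or by 0 when it is empty; the extra increments
    vanish.\<close>
  define \<tau> where "\<tau> i = (if ts = [] then 0 else ts ! min i (length ts - 1))" for i
  define d where "d i = (\<Sum>(a, b, c)\<leftarrow>S. if a \<le> ts ! i \<and> ts ! Suc i \<le> b then c else 0)" for i
  show thesis
  proof
    show "mono \<tau>"
    proof
      fix i j :: nat assume ij: "i \<le> j"
      have s: "sorted ts" using ts(1) by (simp add: strict_sorted_imp_sorted)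
      show "\<tau> i \<le> \<tau> j"
      proof (cases "ts = []")
        case False
        then have "length ts > 0" by simp
        then have "min j (length ts - 1) < length ts" by linarith
        then show ?thesis using False ij unfolding \<tau>_def
          by (simp add: sorted_nth_mono[OF s] min.coboundedI1)
      qed (simp add: \<tau>_def)
    qed
    show "\<tau> i < \<tau> (Suc i)" if "i < length ts - 1" for i
      using that sorted_wrt_nth_less[OF ts(1), of i "Suc i"] by (auto simp: \<tau>_def min_def)
    fix w :: "real \<Rightarrow> real"
    have "(\<Sum>(a, b, c)\<leftarrow>S. (w b - w a) *\<^sub>R c)
      = (\<Sum>i<length ts - 1. (w (ts ! Suc i) - w (ts ! i)) *\<^sub>R d i)"
      unfolding d_def using S ts by (intro step_refinement_aux) (auto simp: A_def)
    also have "\<dots> = (\<Sum>i<length ts - 1. (w (\<tau> (Suc i)) - w (\<tau> i)) *\<^sub>R d i)"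
      by (rule sum.cong) (auto simp: \<tau>_def min_def)
    finally show "(\<Sum>(a, b, c)\<leftarrow>S. (w b - w a) *\<^sub>R c)
      = (\<Sum>i<length ts - 1. (w (\<tau> (Suc i)) - w (\<tau> i)) *\<^sub>R d i)" .
  qed
qed

text \<open>The order of the endpoints makes the indicator of a half-open interval an increment of
  \<open>t \<mapsto> indicator {..t} u\<close>, which is the form to which
  \<open>step_refinement\<close> applies.\<close>

lemma step_fun_eq:
  assumes "\<forall>(a, b, c)\<in>set S. a \<le> b"
  shows "step_fun S u = (\<Sum>(a, b, c)\<leftarrow>S. (indicat_real {..b} u - indicat_real {..a} u) *\<^sub>R c)"
  using assms unfolding step_fun_def
  by (induction S) (auto simp: indicator_def)

lemma step_fun_measurable[measurable]:
  fixes S :: "(real \<times> real \<times> 'b::euclidean_space) list"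
  shows "step_fun S \<in> borel_measurable borel"
proof -
  have "(\<lambda>u. step_fun S u) \<in> borel_measurable borel"
    unfolding step_fun_def by (induction S) (auto split: prod.splits)
  then show ?thesis by simp
qed

lemma square_integrable_step_fun:
  fixes S :: "(real \<times> real \<times> 'b::euclidean_space) list"
  shows "square_integrable lborel (step_fun S)"
proof -
  have "square_integrable lborel (\<lambda>u. step_fun S u)"
  proof (induction S)
    case (Cons x S)
    obtain a b c where x: "x = (a, b, c)" by (cases x)
    have "integrable lborel (\<lambda>u. indicat_real {a<..b} u *\<^sub>R (norm c)\<^sup>2)"
      by (intro integrable_scaleR_left integrable_real_indicator emeasure_lborel_Ioc_finite) auto
    moreover have "(norm (indicat_real {a<..b} u *\<^sub>R c))\<^sup>2 = indicat_real {a<..b} u *\<^sub>R (norm c)\<^sup>2" for u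
      by (auto simp: indicator_def)
    ultimately have "square_integrable lborel (\<lambda>u. indicat_real {a<..b} u *\<^sub>R c)"
      unfolding square_integrable_def by auto
    from square_integrable_add[OF this Cons.IH] show ?case by (simp add: step_fun_def x)
  qed (simp add: step_fun_def square_integrable_def)
  then show ?thesis by simp
qed

lemma step_integral_measurable[measurable]:
  fixes S :: "(real \<times> real \<times> 'b::euclidean_space) list"
  assumes [measurable]: "\<And>t. W t \<in> borel_measurable M"
  shows "step_integral W S \<in> borel_measurable M"
proof -
  have "(\<lambda>\<omega>. step_integral W S \<omega>) \<in> borel_measurable M"
    unfolding step_integral_def by (induction S) (auto split: prod.splits)
  then show ?thesis by simp
qed

lemma expectation_cis_normal:
  assumes X: "distributed M lborel X (\<lambda>y. ennreal (normal_density 0 \<sigma> y))" and s: "0 < \<sigma>"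
  shows "(\<integral>\<omega>. cis (d * X \<omega>) \<partial>M) = complex_of_real (exp (- (\<sigma> * d)\<^sup>2 / 2))"
proof -
  have [measurable]: "X \<in> borel_measurable M" using X by (auto simp: distributed_def)
  have "(\<integral>\<omega>. cis (d * X \<omega>) \<partial>M) = (\<integral>y. cis (d * y) \<partial>distr M lborel X)"
    by (subst integral_distr) auto
  also have "distr M lborel X = density lborel (\<lambda>y. ennreal (normal_density 0 \<sigma> y))"
    using X by (auto simp: distributed_def)
  also have "(\<integral>y. cis (d * y) \<partial>density lborel (\<lambda>y. ennreal (normal_density 0 \<sigma> y)))
     = (\<integral>y. cis (d * y) * complex_of_real (normal_density 0 \<sigma> y) \<partial>lborel)"
    by (subst integral_density) (auto simp: normal_density_nonneg scaleR_conv_of_real mult.commute)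
  also have "\<dots> = complex_of_real (exp (- (\<sigma> * d)\<^sup>2 / 2))"
    by (subst integral_cis_normal_density[OF s]) simp
  finally show ?thesis .
qed

text \<open>On a common partition the integral is a sum of independent centred normal variables, so
  its characteristic function is a product and the exponents add up. The sum of the exponents is
  half the squared norm of the step function because the disjoint cells kill all mixed
  products.\<close>

lemma expectation_cis_step_integral:
  fixes S :: "(real \<times> real \<times> real) list"
  assumes W: "two_sided_brownian_motion M W" and S: "\<forall>(a, b, c)\<in>set S. a \<le> b"
  shows "(\<integral>\<omega>. cis (step_integral W S \<omega>) \<partial>M) = complex_of_real (exp (- l2sq (\<lambda>u. step_fun S u) / 2))"
proof -
  interpret prob_space M using W by (simp add: two_sided_brownian_motion_def)
  have Wm[measurable]: "\<And>t. W t \<in> borel_measurable M"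
    and N: "\<And>s t. s < t \<Longrightarrow> distributed M lborel (\<lambda>\<omega>. W t \<omega> - W s \<omega>) (\<lambda>y. ennreal (normal_density 0 (sqrt (t - s)) y))"
    and I: "\<And>(\<tau> :: nat \<Rightarrow> real) n. mono \<tau> \<Longrightarrow> indep_vars (\<lambda>_. borel) (\<lambda>i \<omega>. W (\<tau> (Suc i)) \<omega> - W (\<tau> i) \<omega>) {..<n}"
    using W unfolding two_sided_brownian_motion_def by blast+
  obtain \<tau> :: "nat \<Rightarrow> real" and n d where \<tau>: "mono \<tau>" "\<And>i. i < n \<Longrightarrow> \<tau> i < \<tau> (Suc i)" and
    w: "\<And>w :: real \<Rightarrow> real. (\<Sum>(a, b, c)\<leftarrow>S. (w b - w a) *\<^sub>R c) = (\<Sum>i<n. (w (\<tau> (Suc i)) - w (\<tau> i)) *\<^sub>R d i)"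
    by (rule step_refinement[OF S]) blast
  let ?X = "\<lambda>i \<omega>. d i * (W (\<tau> (Suc i)) \<omega> - W (\<tau> i) \<omega>)"
  have ind: "indep_vars (\<lambda>_. borel) ?X {..<n}"
    by (rule indep_vars_compose2[OF I[OF \<tau>(1)], where Y="\<lambda>i x. d i * x"]) auto
  have "(\<integral>\<omega>. cis (step_integral W S \<omega>) \<partial>M) = (\<integral>\<omega>. iexp (\<Sum>i<n. ?X i \<omega>) \<partial>M)"
    unfolding step_integral_def w[of "\<lambda>t. W t _"] by (simp add: cis_conv_exp mult.commute)
  also have "\<dots> = char (distr M borel (\<lambda>\<omega>. \<Sum>i<n. ?X i \<omega>)) 1"
    unfolding char_def by (subst integral_distr) (auto intro!: borel_measurable_sum)
  also have "\<dots> = (\<Prod>i<n. char (distr M borel (?X i)) 1)" by (rule char_distr_sum[OF ind])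
  also have "\<dots> = (\<Prod>i<n. complex_of_real (exp (- (d i)\<^sup>2 * (\<tau> (Suc i) - \<tau> i) / 2)))"
  proof (rule prod.cong[OF refl])
    fix i assume i: "i \<in> {..<n}"
    have "char (distr M borel (?X i)) 1 = (\<integral>\<omega>. cis (d i * (W (\<tau> (Suc i)) \<omega> - W (\<tau> i) \<omega>)) \<partial>M)"
      unfolding char_def by (subst integral_distr) (auto simp: cis_conv_exp)
    also have "\<dots> = complex_of_real (exp (- (d i)\<^sup>2 * (\<tau> (Suc i) - \<tau> i) / 2))"
      using \<tau>(2)[of i] i by (subst expectation_cis_normal[OF N]) (auto simp: power_mult_distrib mult.commute)
    finally show "char (distr M borel (?X i)) 1 = complex_of_real (exp (- (d i)\<^sup>2 * (\<tau> (Suc i) - \<tau> i) / 2))" .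
  qed
  also have "\<dots> = complex_of_real (exp (\<Sum>i<n. - (d i)\<^sup>2 * (\<tau> (Suc i) - \<tau> i) / 2))"
    by (simp add: exp_sum)
  also have "(\<Sum>i<n. - (d i)\<^sup>2 * (\<tau> (Suc i) - \<tau> i) / 2) = - l2sq (\<lambda>u. step_fun S u) / 2"
  proof -
    let ?A = "\<lambda>i. {\<tau> i<..\<tau> (Suc i)}"
    have sf: "step_fun S u = (\<Sum>i<n. indicat_real (?A i) u * d i)" for u
      unfolding step_fun_eq[OF S] w[of "\<lambda>t. indicator {..t} u"]
      by (rule sum.cong) (use \<tau>(2) in \<open>force simp: indicator_def\<close>)+
    have disj: "indicat_real (?A i) u * indicat_real (?A j) u = (if i = j then indicat_real (?A i) u else 0)" for i j u
    proof (cases i j rule: linorder_cases)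
      case less then show ?thesis using monoD[OF \<tau>(1), of "Suc i" j] by (auto simp: indicator_def)
    next
      case greater then show ?thesis using monoD[OF \<tau>(1), of "Suc j" i] by (auto simp: indicator_def)
    qed (auto simp: indicator_def)
    have "(norm (step_fun S u))\<^sup>2 = (\<Sum>i<n. indicat_real (?A i) u * (d i)\<^sup>2)" for u
    proof -
      define J where "J i = indicat_real (?A i) u" for i
      have "(norm (step_fun S u))\<^sup>2 = (\<Sum>i<n. \<Sum>j<n. (J i * J j) * (d i * d j))"
        unfolding sf J_def[symmetric] by (simp add: power2_eq_square sum_product mult_ac)
      also have "\<dots> = (\<Sum>i<n. \<Sum>j<n. if i = j then indicat_real (?A i) u * (d i * d j) else 0)"
        unfolding J_def disj by (intro sum.cong) auto
      also have "\<dots> = (\<Sum>i<n. indicat_real (?A i) u * (d i)\<^sup>2)"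
        by (simp add: power2_eq_square)
      finally show ?thesis .
    qed
    moreover have "(\<integral>u. (\<Sum>i<n. indicat_real (?A i) u * (d i)\<^sup>2) \<partial>lborel) = (\<Sum>i<n. (\<tau> (Suc i) - \<tau> i) * (d i)\<^sup>2)"
    proof (subst Bochner_Integration.integral_sum)
      show "integrable lborel (\<lambda>u. indicat_real (?A i) u * (d i)\<^sup>2)" for i
        by (intro integrable_mult_left integrable_real_indicator emeasure_lborel_Ioc_finite) auto
      show "(\<Sum>i<n. \<integral>u. indicat_real (?A i) u * (d i)\<^sup>2 \<partial>lborel) = (\<Sum>i<n. (\<tau> (Suc i) - \<tau> i) * (d i)\<^sup>2)"
        by (intro sum.cong refl) (use \<tau>(2) in \<open>force simp: less_imp_le\<close>)
    qed
    ultimately show ?thesis by (simp add: sum_divide_distrib sum_negf mult.commute)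
  qed
  finally show ?thesis .
qed

lemma has_wiener_integral_square_integrable:
  fixes f :: "real \<Rightarrow> 'b::euclidean_space"
  assumes "has_wiener_integral M W f X"
  shows "square_integrable lborel f"
proof -
  obtain S :: "nat \<Rightarrow> (real \<times> real \<times> 'b) list"
    where S: "(\<lambda>n. \<integral>\<^sup>+u. ennreal ((norm (step_fun (S n) u - f u))\<^sup>2) \<partial>lborel) \<longlonglongrightarrow> 0"
      and [measurable]: "f \<in> borel_measurable lborel"
    using assms by (auto simp: has_wiener_integral_def)
  have "eventually (\<lambda>n. (\<integral>\<^sup>+u. ennreal ((norm (step_fun (S n) u - f u))\<^sup>2) \<partial>lborel) < \<infinity>) sequentially"
    using order_tendstoD(2)[OF S, of \<infinity>] by simp
  then obtain n where n: "(\<integral>\<^sup>+u. ennreal ((norm (step_fun (S n) u - f u))\<^sup>2) \<partial>lborel) < \<infinity>"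
    by (auto simp: eventually_sequentially)
  have "square_integrable lborel (\<lambda>u. step_fun (S n) u - f u)"
    by (rule square_integrableI) (use n in auto)
  from square_integrable_diff[OF square_integrable_step_fun[of "S n"] this] show ?thesis by simp
qed

text \<open>Both sides of the formula for step functions pass to the limit: squared norms because
  the integrands converge in L2, and expectations because \<open>cis\<close> is 1-Lipschitz and
  convergence in L2 implies convergence in L1 on a probability space.\<close>

lemma has_wiener_integral_expectation_cis:
  fixes f :: "real \<Rightarrow> real"
  assumes W: "two_sided_brownian_motion M W" and X: "has_wiener_integral M W f X"
  shows "(\<integral>\<omega>. cis (X \<omega>) \<partial>M) = complex_of_real (exp (- l2sq f / 2))"
proof -
  interpret prob_space M using W by (simp add: two_sided_brownian_motion_def)
  have Wm[measurable]: "\<And>t. W t \<in> borel_measurable M" using W by (auto simp: two_sided_brownian_motion_def)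
  obtain S :: "nat \<Rightarrow> (real \<times> real \<times> real) list"
    where S: "\<And>n. \<forall>(a, b, c)\<in>set (S n). a \<le> b"
      "(\<lambda>n. \<integral>\<^sup>+u. ennreal ((norm (step_fun (S n) u - f u))\<^sup>2) \<partial>lborel) \<longlonglongrightarrow> 0"
      "(\<lambda>n. \<integral>\<^sup>+\<omega>. ennreal ((norm (step_integral W (S n) \<omega> - X \<omega>))\<^sup>2) \<partial>M) \<longlonglongrightarrow> 0"
    and Xm[measurable]: "X \<in> borel_measurable M"
    using X by (auto simp: has_wiener_integral_def)
  have fs: "square_integrable lborel f" by (rule has_wiener_integral_square_integrable[OF X])
  have d: "square_integrable lborel (\<lambda>u. step_fun (S n) u - f u)" for n
    by (intro square_integrable_diff square_integrable_step_fun fs)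
  have "(\<lambda>n. \<integral>u. (norm (step_fun (S n) u - f u))\<^sup>2 \<partial>lborel) \<longlonglongrightarrow> 0"
    using S(2) unfolding nn_integral_square_eq[OF d]
    by (subst (asm) ennreal_0[symmetric], subst (asm) tendsto_ennreal_iff) auto
  then have "(\<lambda>n. \<integral>u. (norm (step_fun (S n) u))\<^sup>2 \<partial>lborel) \<longlonglongrightarrow> l2sq f"
    by - (rule tendsto_integral_square[where g="\<lambda>_. f"], simp_all add: square_integrable_step_fun fs)
  then have lim1: "(\<lambda>n. \<integral>\<omega>. cis (step_integral W (S n) \<omega>) \<partial>M) \<longlonglongrightarrow>
     complex_of_real (exp (- l2sq f / 2))"
    unfolding expectation_cis_step_integral[OF W S(1)] by (intro tendsto_intros) simp_all
  have ci: "integrable M (\<lambda>\<omega>. cis (Y \<omega>))" if [measurable]: "Y \<in> borel_measurable M" for Y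
    by (rule integrable_const_bound[where B=1]) (auto simp: cis_conv_exp)
  have lim2: "(\<lambda>n. \<integral>\<omega>. cis (step_integral W (S n) \<omega>) \<partial>M) \<longlonglongrightarrow> (\<integral>\<omega>. cis (X \<omega>) \<partial>M)"
  proof (rule LIM_zero_cancel, rule tendstoI)
    fix r :: real assume r: "0 < r"
    \<comment> \<open>With level \<open>r / 4\<close> in
      \<open>norm_le_of_square_integrable\<close>, a second moment below
      \<open>r\<^sup>2 / 16\<close> gives a mean distance of at most
      \<open>r / 4 + r / 4\<close>.\<close>
    have "eventually (\<lambda>n. (\<integral>\<^sup>+\<omega>. ennreal ((norm (step_integral W (S n) \<omega> - X \<omega>))\<^sup>2) \<partial>M) < ennreal (r\<^sup>2 / 16)) sequentially"
      using r by (intro order_tendstoD(2)[OF S(3)]) simp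
    then show "eventually (\<lambda>n. dist ((\<integral>\<omega>. cis (step_integral W (S n) \<omega>) \<partial>M) - (\<integral>\<omega>. cis (X \<omega>) \<partial>M)) 0 < r) sequentially"
    proof eventually_elim
      case (elim n)
      have sq: "square_integrable M (\<lambda>\<omega>. step_integral W (S n) \<omega> - X \<omega>)"
        using elim by (intro square_integrableI) (auto intro: order.strict_trans)
      have small: "(\<integral>\<omega>. (norm (step_integral W (S n) \<omega> - X \<omega>))\<^sup>2 \<partial>M) < r\<^sup>2 / 16"
        using elim unfolding nn_integral_square_eq[OF sq] by (subst (asm) ennreal_less_iff) auto
      have "norm ((\<integral>\<omega>. cis (step_integral W (S n) \<omega>) \<partial>M) - (\<integral>\<omega>. cis (X \<omega>) \<partial>M))
        = norm (\<integral>\<omega>. cis (step_integral W (S n) \<omega>) - cis (X \<omega>) \<partial>M)"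
        by (subst Bochner_Integration.integral_diff) (auto intro!: ci)
      also have "\<dots> \<le> (\<integral>\<omega>. norm (cis (step_integral W (S n) \<omega>) - cis (X \<omega>)) \<partial>M)"
        by (rule integral_norm_bound)
      also have "\<dots> \<le> (\<integral>\<omega>. norm (step_integral W (S n) \<omega> - X \<omega>) \<partial>M)"
        by (rule integral_mono[OF _ norm_le_of_square_integrable(1)[OF sq r]])
          (auto intro!: integrable_norm Bochner_Integration.integrable_diff ci simp: norm_cis_diff_le)
      also have "\<dots> \<le> r / 4 + (\<integral>\<omega>. (norm (step_integral W (S n) \<omega> - X \<omega>))\<^sup>2 \<partial>M) / (r / 4)"
        using r by (intro norm_le_of_square_integrable(2)[OF sq]) simp
      also have "\<dots> \<le> r / 4 + (r\<^sup>2 / 16) / (r / 4)"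
        using small r by (intro add_left_mono divide_right_mono) auto
      also have "\<dots> < r" using r by (simp add: power2_eq_square)
      finally show ?case by simp
    qed
  qed
  from LIMSEQ_unique[OF lim2 lim1] show ?thesis .
qed

section \<open>Linear operations on Wiener integrals\<close>

lemma step_fun_map:
  assumes "linear T"
  shows "step_fun (map (\<lambda>(a, b, c). (a, b, T c)) S) u = T (step_fun S u)"
    and "step_integral W (map (\<lambda>(a, b, c). (a, b, T c)) S) \<omega> = T (step_integral W S \<omega>)"
  using assms unfolding step_fun_def step_integral_def
  by (induction S) (auto simp: linear_add linear_cmul linear_0)

lemma has_wiener_integral_linear:
  fixes f :: "real \<Rightarrow> 'b::euclidean_space" and T :: "'b \<Rightarrow> 'c::euclidean_space"
  assumes X: "has_wiener_integral M W f X" and W: "\<And>t. W t \<in> borel_measurable M" and T: "linear T"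
  shows "has_wiener_integral M W (\<lambda>u. T (f u)) (\<lambda>\<omega>. T (X \<omega>))"
proof -
  note [measurable] = W
  obtain S :: "nat \<Rightarrow> (real \<times> real \<times> 'b) list"
    where S: "\<And>n. \<forall>(a, b, c)\<in>set (S n). a \<le> b"
      "(\<lambda>n. \<integral>\<^sup>+u. ennreal ((norm (step_fun (S n) u - f u))\<^sup>2) \<partial>lborel) \<longlonglongrightarrow> 0"
      "(\<lambda>n. \<integral>\<^sup>+\<omega>. ennreal ((norm (step_integral W (S n) \<omega> - X \<omega>))\<^sup>2) \<partial>M) \<longlonglongrightarrow> 0"
    and [measurable]: "X \<in> borel_measurable M" "f \<in> borel_measurable lborel"
    using X by (auto simp: has_wiener_integral_def)
  have [measurable]: "T \<in> borel_measurable borel"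
    using T by (simp add: linear_conv_bounded_linear borel_measurable_continuous_onI linear_continuous_on)
  have d: "T x - T y = T (x - y)" for x y using T by (simp add: linear_diff)
  show ?thesis unfolding has_wiener_integral_def
  proof (intro conjI exI[of _ "\<lambda>n. map (\<lambda>(a, b, c). (a, b, T c)) (S n)"])
    show "\<forall>n. \<forall>(a, b, c)\<in>set (map (\<lambda>(a, b, c). (a, b, T c)) (S n)). a \<le> b" using S(1) by fastforce
  qed (unfold step_fun_map[OF T] d, auto intro!: nn_integral_square_tendsto_0_bounded_linear[OF T] S(2,3))
qed

lemma has_wiener_integral_add:
  fixes f g :: "real \<Rightarrow> 'b::euclidean_space"
  assumes X: "has_wiener_integral M W f X" and Y: "has_wiener_integral M W g Y"
    and W: "\<And>t. W t \<in> borel_measurable M"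
  shows "has_wiener_integral M W (\<lambda>u. f u + g u) (\<lambda>\<omega>. X \<omega> + Y \<omega>)"
proof -
  note [measurable] = W
  obtain S :: "nat \<Rightarrow> (real \<times> real \<times> 'b) list"
    where S: "\<And>n. \<forall>(a, b, c)\<in>set (S n). a \<le> b"
      "(\<lambda>n. \<integral>\<^sup>+u. ennreal ((norm (step_fun (S n) u - f u))\<^sup>2) \<partial>lborel) \<longlonglongrightarrow> 0"
      "(\<lambda>n. \<integral>\<^sup>+\<omega>. ennreal ((norm (step_integral W (S n) \<omega> - X \<omega>))\<^sup>2) \<partial>M) \<longlonglongrightarrow> 0"
    and [measurable]: "X \<in> borel_measurable M" "f \<in> borel_measurable lborel"
    using X by (auto simp: has_wiener_integral_def)
  obtain S' :: "nat \<Rightarrow> (real \<times> real \<times> 'b) list"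
    where S': "\<And>n. \<forall>(a, b, c)\<in>set (S' n). a \<le> b"
      "(\<lambda>n. \<integral>\<^sup>+u. ennreal ((norm (step_fun (S' n) u - g u))\<^sup>2) \<partial>lborel) \<longlonglongrightarrow> 0"
      "(\<lambda>n. \<integral>\<^sup>+\<omega>. ennreal ((norm (step_integral W (S' n) \<omega> - Y \<omega>))\<^sup>2) \<partial>M) \<longlonglongrightarrow> 0"
    and [measurable]: "Y \<in> borel_measurable M" "g \<in> borel_measurable lborel"
    using Y by (auto simp: has_wiener_integral_def)
  have app: "step_fun (A @ A') u = step_fun A u + step_fun A' u"
    "step_integral W (A @ A') \<omega> = step_integral W A \<omega> + step_integral W A' \<omega>" for A A' :: "(real \<times> real \<times> 'b) list" and u \<omega>
    by (auto simp: step_fun_def step_integral_def)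
  show ?thesis unfolding has_wiener_integral_def
  proof (intro conjI exI[of _ "\<lambda>n. S n @ S' n"])
    show "\<forall>n. \<forall>(a, b, c)\<in>set (S n @ S' n). a \<le> b" using S(1) S'(1) by fastforce
    show "(\<lambda>n. \<integral>\<^sup>+u. ennreal ((norm (step_fun (S n @ S' n) u - (f u + g u)))\<^sup>2) \<partial>lborel) \<longlonglongrightarrow> 0"
      unfolding app add_diff_add by (intro nn_integral_square_tendsto_0_add S S') auto
    show "(\<lambda>n. \<integral>\<^sup>+\<omega>. ennreal ((norm (step_integral W (S n @ S' n) \<omega> - (X \<omega> + Y \<omega>)))\<^sup>2) \<partial>M) \<longlonglongrightarrow> 0"
      unfolding app add_diff_add by (intro nn_integral_square_tendsto_0_add S S') auto
  qed auto
qed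

lemma has_wiener_integral_zero: "has_wiener_integral M W (\<lambda>_. 0) (\<lambda>_. 0)"
  unfolding has_wiener_integral_def
  by (auto intro!: exI[of _ "\<lambda>_. []"] simp: step_fun_def step_integral_def)

lemma has_wiener_integral_sum:
  fixes f :: "'i \<Rightarrow> real \<Rightarrow> 'b::euclidean_space"
  assumes "\<And>i. i \<in> I \<Longrightarrow> has_wiener_integral M W (f i) (X i)" and W: "\<And>t. W t \<in> borel_measurable M"
  shows "has_wiener_integral M W (\<lambda>u. \<Sum>i\<in>I. c i *\<^sub>R f i u) (\<lambda>\<omega>. \<Sum>i\<in>I. c i *\<^sub>R X i \<omega>)"
  using assms(1)
proof (induction I rule: infinite_finite_induct)
  case (insert i I)
  have "has_wiener_integral M W (\<lambda>u. c i *\<^sub>R f i u) (\<lambda>\<omega>. c i *\<^sub>R X i \<omega>)"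
    by (rule has_wiener_integral_linear[OF insert.prems W]) (auto intro!: linearI simp: algebra_simps)
  from has_wiener_integral_add[OF this insert.IH W] insert show ?case by simp
qed (auto simp: has_wiener_integral_zero)

text \<open>The integrand is complex although the integral is real. Then the Wiener integral of
  \<open>Im f\<close> vanishes almost surely, so its characteristic function equals 1, which forces
  \<open>Im f\<close> to have norm 0. Hence the full norm of \<open>f\<close> is that of its real
  part.\<close>

lemma has_wiener_integral_real_valued:
  fixes f :: "real \<Rightarrow> complex"
  assumes W: "two_sided_brownian_motion M W" and X: "has_wiener_integral M W f X"
    and Z: "AE \<omega> in M. complex_of_real (Z \<omega>) = X \<omega>" and [measurable]: "Z \<in> borel_measurable M"
  shows "(\<integral>\<omega>. cis (Z \<omega>) \<partial>M) = complex_of_real (exp (- l2sq f / 2))"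
proof -
  interpret prob_space M using W by (simp add: two_sided_brownian_motion_def)
  have Wm: "\<And>t. W t \<in> borel_measurable M" using W by (auto simp: two_sided_brownian_motion_def)
  have [measurable]: "X \<in> borel_measurable M" using X by (simp add: has_wiener_integral_def)
  have R: "has_wiener_integral M W (\<lambda>u. Re (f u)) (\<lambda>\<omega>. Re (X \<omega>))"
    and I: "has_wiener_integral M W (\<lambda>u. Im (f u)) (\<lambda>\<omega>. Im (X \<omega>))"
    by (rule has_wiener_integral_linear[OF X Wm], simp add: bounded_linear.linear bounded_linear_Re bounded_linear_Im)+
  have "(\<integral>\<omega>. cis (Im (X \<omega>)) \<partial>M) = (\<integral>\<omega>. 1 \<partial>M)"
    by (rule integral_cong_AE) (use Z in \<open>auto simp: cis_conv_exp elim!: eventually_mono dest: arg_cong[where f=Im]\<close>)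
  then have "complex_of_real (exp (- l2sq (\<lambda>u. Im (f u)) / 2)) = 1"
    unfolding has_wiener_integral_expectation_cis[OF W I] by (simp add: prob_space)
  then have "exp (- l2sq (\<lambda>u. Im (f u)) / 2) = 1"
    by (simp only: of_real_eq_1_iff)
  then have I0: "l2sq (\<lambda>u. Im (f u)) = 0" by simp
  have "l2sq f = (\<integral>u. (norm (Re (f u)))\<^sup>2 + (norm (Im (f u)))\<^sup>2 \<partial>lborel)"
    by (simp add: cmod_power2)
  also have "\<dots> = l2sq (\<lambda>u. Re (f u))"
    using has_wiener_integral_square_integrable[OF R] has_wiener_integral_square_integrable[OF I] I0
    by (subst Bochner_Integration.integral_add) (auto simp: square_integrable_def)
  finally have e: "l2sq f = l2sq (\<lambda>u. Re (f u))" .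
  have "(\<integral>\<omega>. cis (Z \<omega>) \<partial>M) = (\<integral>\<omega>. cis (Re (X \<omega>)) \<partial>M)"
    by (rule integral_cong_AE) (use Z in \<open>auto simp: cis_conv_exp elim!: eventually_mono dest: arg_cong[where f=Re]\<close>)
  then show ?thesis unfolding has_wiener_integral_expectation_cis[OF W R] e .
qed

section \<open>The Plancherel theorem\<close>

lemma borel_measurable_cnj[measurable]:
  assumes [measurable]: "f \<in> borel_measurable M"
  shows "(\<lambda>x. cnj (f x)) \<in> borel_measurable M"
  by (rule borel_measurable_continuous_on[OF _ assms]) (intro continuous_intros)

lemma integral_translate_square:
  fixes f :: "real \<Rightarrow> 'b::euclidean_space"
  assumes "square_integrable lborel f"
  shows "square_integrable lborel (\<lambda>x. f (x + z))"
    and "l2sq (\<lambda>x. f (x + z)) = l2sq f"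
proof -
  have [measurable]: "f \<in> borel_measurable borel" using assms by (simp add: square_integrable_def)
  show "square_integrable lborel (\<lambda>x. f (x + z))"
    using assms lborel_integrable_real_affine[of "\<lambda>x. (norm (f x))\<^sup>2" 1 z]
    by (auto simp: square_integrable_def add.commute)
  show "l2sq (\<lambda>x. f (x + z)) = l2sq f"
    using lborel_integral_real_affine[of 1 "\<lambda>x. (norm (f x))\<^sup>2" z] by (simp add: add.commute)
qed

text \<open>A Scheffe argument: Fatou's lemma for \<open>2|f|\<^sup>2 + 2|f(\<cdot> + z)|\<^sup>2 - |f(\<cdot> + z) - f|\<^sup>2\<close> replaces the
  density of continuous functions in \<open>L\<^sup>2\<close>.\<close>

lemma translation_continuous_L2:
  fixes f :: "real \<Rightarrow> 'b::euclidean_space"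
  assumes f: "square_integrable lborel f" and c: "AE x in lborel. isCont f x" and z: "z \<longlonglongrightarrow> 0"
  shows "(\<lambda>n. \<integral>x. (norm (f (x + z n) - f x))\<^sup>2 \<partial>lborel) \<longlonglongrightarrow> 0"
proof -
  define F where "F = l2sq f"
  have [measurable]: "f \<in> borel_measurable borel" using f by (simp add: square_integrable_def)
  note t = integral_translate_square[OF f]
  note d = square_integrable_diff[OF t(1) f]
  define D where "D n = l2sq (\<lambda>x. f (x + z n) - f x)" for n
  define h where "h n x = 2 * (norm (f (x + z n)))\<^sup>2 + 2 * (norm (f x))\<^sup>2 - (norm (f (x + z n) - f x))\<^sup>2" for n x
  have h0: "0 \<le> h n x" for n x
    using norm_diff_square_le[of "f (x + z n)" "f x"] by (simp add: h_def)
  have hi: "integrable lborel (h n)" "integral\<^sup>L lborel (h n) = 4 * F - D n" for n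
    using t[of "z n"] f d[of "z n"] unfolding h_def D_def F_def by (auto simp: square_integrable_def)
  have "ennreal (4 * F) = (\<integral>\<^sup>+x. ennreal (4 * (norm (f x))\<^sup>2) \<partial>lborel)"
    unfolding F_def using f by (subst nn_integral_eq_integral) (auto simp: square_integrable_def)
  also have "\<dots> = (\<integral>\<^sup>+x. liminf (\<lambda>n. ennreal (h n x)) \<partial>lborel)"
  proof (rule nn_integral_cong_AE, use c in eventually_elim)
    case (elim x)
    have "(\<lambda>n. x + z n) \<longlonglongrightarrow> x" using tendsto_add[OF tendsto_const[of x] z] by simp
    then have "(\<lambda>n. f (x + z n)) \<longlonglongrightarrow> f x" by (rule isCont_tendsto_compose[OF elim])
    then have "(\<lambda>n. h n x) \<longlonglongrightarrow> 2 * (norm (f x))\<^sup>2 + 2 * (norm (f x))\<^sup>2 - (norm (f x - f x))\<^sup>2"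
      unfolding h_def by (intro tendsto_intros)
    then have "(\<lambda>n. ennreal (h n x)) \<longlonglongrightarrow> ennreal (4 * (norm (f x))\<^sup>2)"
      by (intro tendsto_ennrealI) simp
    then show ?case by (rule lim_imp_Liminf[OF sequentially_bot, symmetric])
  qed
  also have "\<dots> \<le> liminf (\<lambda>n. \<integral>\<^sup>+x. ennreal (h n x) \<partial>lborel)"
    by (rule nn_integral_liminf) (auto simp: h_def)
  also have "\<dots> = liminf (\<lambda>n. ennreal (4 * F - D n))"
    using hi h0 by (simp add: nn_integral_eq_integral)
  finally have le: "ennreal (4 * F) \<le> liminf (\<lambda>n. ennreal (4 * F - D n))" .
  have D0: "0 \<le> D n" for n by (simp add: D_def)
  have F0: "0 \<le> F" by (simp add: F_def)
  show ?thesis unfolding D_def[symmetric]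
  proof (rule tendstoI)
    fix r :: real assume r: "0 < r"
    show "eventually (\<lambda>n. dist (D n) 0 < r) sequentially"
    \<comment> \<open>Negative numbers are cut off at 0 in ennreal, so comparing
      \<open>4 * F - r\<close> with \<open>4 * F - D n\<close> is faithful only when
      \<open>4 * F - r\<close> is nonnegative. In the other case the trivial bound
      \<open>D n \<le> 4 * F\<close> is already small enough.\<close>
    proof (cases "4 * F < r")
      case True
      have "D n \<le> 4 * F" for n
        using integral_nonneg_AE[where M=lborel and f="h n"] h0 hi[of n] by auto
      then show ?thesis using True D0 by (auto intro!: always_eventually intro: order.strict_trans1)
    next
      case False
      then have "ennreal (4 * F - r) < liminf (\<lambda>n. ennreal (4 * F - D n))"
        using r F0 by (intro order.strict_trans2[OF _ le]) (simp add: ennreal_less_iff)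
      then have "eventually (\<lambda>n. ennreal (4 * F - r) < ennreal (4 * F - D n)) sequentially"
        by (rule less_LiminfD)
      then show ?thesis
      proof eventually_elim
        case (elim n)
        then have "4 * F - r < 4 * F - D n"
          using False by (subst (asm) ennreal_less_iff) auto
        then show ?case using D0 by simp
      qed
    qed
  qed
qed

section \<open>Plancherel for integrable functions by Gaussian summation\<close>

definition fourier_integral :: "(real \<Rightarrow> complex) \<Rightarrow> real \<Rightarrow> complex" where
  "fourier_integral f x = (\<integral>\<xi>. cis (- (x * \<xi>)) * f \<xi> \<partial>lborel)"

lemma fourier_integral_measurable[measurable]:
  assumes [measurable]: "f \<in> borel_measurable borel"
  shows "fourier_integral f \<in> borel_measurable borel"
proof -
  have "(\<lambda>x. fourier_integral f x) \<in> borel_measurable borel"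
    unfolding fourier_integral_def by measurable
  then show ?thesis by simp
qed

text \<open>Up to a constant the Gaussian is the normal density of standard deviation
  \<open>1 / \<epsilon>\<close>, so its characteristic function is known. Its transform is a normal
  density of width \<open>\<epsilon>\<close>, which concentrates at 0 as the damping is
  removed.\<close>

lemma integral_cis_gaussian:
  assumes e: "0 < \<epsilon>"
  shows "(\<integral>x. complex_of_real (exp (- (\<epsilon> * x)\<^sup>2 / 2)) * cis (x * u) \<partial>lborel) = complex_of_real (2 * pi * normal_density 0 \<epsilon> u)"
    and "integrable lborel (\<lambda>x. complex_of_real (exp (- (\<epsilon> * x)\<^sup>2 / 2)))"
proof -
  have eq: "exp (- (\<epsilon> * x)\<^sup>2 / 2) = sqrt (2 * pi) / \<epsilon> * normal_density 0 (1 / \<epsilon>) x" for x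
  proof -
    have "sqrt (2 * pi * (1 / \<epsilon>)\<^sup>2) = sqrt (2 * pi) / \<epsilon>"
      using e by (simp add: real_sqrt_mult real_sqrt_divide power_divide)
    then show ?thesis using e unfolding normal_density_def by (simp add: power_mult_distrib field_simps power_divide)
  qed
  show "integrable lborel (\<lambda>x. complex_of_real (exp (- (\<epsilon> * x)\<^sup>2 / 2)))"
    unfolding eq using e by (intro integrable_of_real integrable_mult_right integrable_normal_density) simp
  have "(\<integral>x. complex_of_real (exp (- (\<epsilon> * x)\<^sup>2 / 2)) * cis (x * u) \<partial>lborel)
    = (\<integral>x. complex_of_real (sqrt (2 * pi) / \<epsilon>) * (cis (u * x) * complex_of_real (normal_density 0 (1 / \<epsilon>) x)) \<partial>lborel)"
    unfolding eq by (simp add: mult_ac)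
  also have "\<dots> = complex_of_real (sqrt (2 * pi) / \<epsilon>) * (cis (u * 0) * complex_of_real (exp (- (1 / \<epsilon> * u)\<^sup>2 / 2)))"
    using e by (subst integral_mult_right_zero, subst integral_cis_normal_density) auto
  also have "\<dots> = complex_of_real (sqrt (2 * pi) / \<epsilon> * exp (- (1 / \<epsilon> * u)\<^sup>2 / 2))" by simp
  also have "sqrt (2 * pi) / \<epsilon> * exp (- (1 / \<epsilon> * u)\<^sup>2 / 2) = 2 * pi * normal_density 0 \<epsilon> u"
  proof -
    have "sqrt (2 * pi * \<epsilon>\<^sup>2) = sqrt (2 * pi) * \<epsilon>" using e by (simp add: real_sqrt_mult)
    moreover have "2 * pi = sqrt (2 * pi) * sqrt (2 * pi)" by simp
    ultimately show ?thesis using e unfolding normal_density_def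
      by (simp add: power_divide power_mult_distrib field_simps)
  qed
  finally show "(\<integral>x. complex_of_real (exp (- (\<epsilon> * x)\<^sup>2 / 2)) * cis (x * u) \<partial>lborel) = complex_of_real (2 * pi * normal_density 0 \<epsilon> u)" .
qed

lemma normal_density_le: "0 < \<sigma> \<Longrightarrow> normal_density m \<sigma> x \<le> 1 / (sqrt (2 * pi) * \<sigma>)"
  by (simp add: normal_density_def real_sqrt_mult field_simps)

text \<open>Damping makes every integral absolutely convergent. Interchanging them turns the left
  side into the autocorrelation of \<open>f\<close>, averaged over the shift \<open>z\<close> with a
  normal density. The real part of the autocorrelation is the squared norm minus half the squared
  distance between \<open>f\<close> and its translate.\<close>

lemma fourier_integral_gaussian_regularization:
  assumes f: "integrable lborel f" "square_integrable lborel f" and e: "0 < \<epsilon>"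
  shows "(\<integral>x. (norm (fourier_integral f x))\<^sup>2 * exp (- (\<epsilon> * x)\<^sup>2 / 2) \<partial>lborel)
    = 2 * pi * l2sq f
      - pi * (\<integral>z. normal_density 0 \<epsilon> z * l2sq (\<lambda>x. f (x + z) - f x) \<partial>lborel)"
    and "integrable lborel (\<lambda>x. (norm (fourier_integral f x))\<^sup>2 * exp (- (\<epsilon> * x)\<^sup>2 / 2))"
proof -
  have [measurable]: "f \<in> borel_measurable borel" using f by simp
  define G where "G x = complex_of_real (exp (- (\<epsilon> * x)\<^sup>2 / 2))" for x
  have Gm[measurable]: "G \<in> borel_measurable borel" unfolding G_def by measurable
  have G: "integrable lborel G" unfolding G_def using integral_cis_gaussian(2)[OF e] .
  let ?T = "fourier_integral f"
  have bT: "norm (?T x) \<le> (\<integral>\<xi>. norm (f \<xi>) \<partial>lborel)" for x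
    unfolding fourier_integral_def by (rule order_trans[OF integral_norm_bound]) (simp add: norm_mult)
  have GT: "integrable lborel (\<lambda>x. G x * ?T x)"
  proof (rule Bochner_Integration.integrable_bound)
    show "integrable lborel (\<lambda>x. G x * complex_of_real (\<integral>\<xi>. norm (f \<xi>) \<partial>lborel))" using G by simp
    show "AE x in lborel. norm (G x * ?T x) \<le> norm (G x * complex_of_real (\<integral>\<xi>. norm (f \<xi>) \<partial>lborel))"
      using bT by (auto simp: norm_mult intro!: mult_left_mono)
  qed simp
  have GTT: "integrable lborel (\<lambda>x. G x * ?T x * cnj (?T x))"
  proof (rule Bochner_Integration.integrable_bound)
    show "integrable lborel (\<lambda>x. (G x * ?T x) * complex_of_real (\<integral>\<xi>. norm (f \<xi>) \<partial>lborel))" using GT by simp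
    show "AE x in lborel. norm (G x * ?T x * cnj (?T x)) \<le> norm ((G x * ?T x) * complex_of_real (\<integral>\<xi>. norm (f \<xi>) \<partial>lborel))"
      using bT by (auto simp: norm_mult intro!: mult_left_mono)
  qed simp
  have sqeq: "complex_of_real ((norm (?T x))\<^sup>2 * exp (- (\<epsilon> * x)\<^sup>2 / 2)) = G x * ?T x * cnj (?T x)" for x
    by (simp only: G_def of_real_mult complex_norm_square mult_ac)
  show int: "integrable lborel (\<lambda>x. (norm (?T x))\<^sup>2 * exp (- (\<epsilon> * x)\<^sup>2 / 2))"
    using GTT unfolding sqeq[symmetric] by (simp only: complex_of_real_integrable_eq)
  have fc: "integrable lborel (\<lambda>x. cnj (f x))" using f by simp
  define N where "N u = complex_of_real (normal_density 0 \<epsilon> u)" for u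
  have Nm[measurable]: "N \<in> borel_measurable borel" unfolding N_def by measurable
  have Nb: "norm (N u) \<le> 1 / (sqrt (2 * pi) * \<epsilon>)" for u
    using normal_density_le[OF e, of 0 u] by (simp add: N_def)
  \<comment> \<open>Damped Fourier inversion: the inverse transform of the damped transform is the
    average of \<open>f\<close> around \<open>\<eta>\<close> with a normal weight.\<close>
  have inner: "(\<integral>x. G x * ?T x * cis (x * \<eta>) \<partial>lborel) = 2 * pi * (\<integral>z. f (\<eta> + z) * N z \<partial>lborel)" for \<eta>
  proof -
    have "cis (- (x * \<xi>)) * f \<xi> * cis (x * \<eta>) = f \<xi> * cis (x * (\<eta> - \<xi>))" for x \<xi>
    proof -
      have "f \<xi> * (cis (- (x * \<xi>)) * cis (x * \<eta>)) = f \<xi> * cis (x * (\<eta> - \<xi>))"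
        unfolding cis_mult by (simp add: algebra_simps)
      then show ?thesis by (simp only: mult_ac)
    qed
    then have "?T x * cis (x * \<eta>) = (\<integral>\<xi>. f \<xi> * cis (x * (\<eta> - \<xi>)) \<partial>lborel)" for x
      unfolding fourier_integral_def integral_mult_left_zero[symmetric] by (simp only:)
    then have "(\<integral>x. G x * ?T x * cis (x * \<eta>) \<partial>lborel) = (\<integral>x. G x * (\<integral>\<xi>. f \<xi> * cis (x * (\<eta> - \<xi>)) \<partial>lborel) \<partial>lborel)"
      by (simp only: mult.assoc)
    also have "\<dots> = (\<integral>\<xi>. f \<xi> * (\<integral>x. G x * cis (x * (\<eta> - \<xi>)) \<partial>lborel) \<partial>lborel)"
      by (rule lborel_pair.integral_mult_kernel_swap[OF G f(1), where C=1]) auto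
    also have "\<dots> = (\<integral>\<xi>. f \<xi> * (2 * pi * N (\<xi> - \<eta>)) \<partial>lborel)"
      unfolding G_def integral_cis_gaussian(1)[OF e] by (simp add: N_def normal_density_def power2_commute)
    also have "\<dots> = 2 * pi * (\<integral>\<xi>. f \<xi> * N (\<xi> - \<eta>) \<partial>lborel)"
      by (subst integral_mult_right_zero[symmetric]) (simp add: mult_ac)
    also have "(\<integral>\<xi>. f \<xi> * N (\<xi> - \<eta>) \<partial>lborel) = (\<integral>z. f (\<eta> + z) * N z \<partial>lborel)"
      using lborel_integral_real_affine[of 1 "\<lambda>\<xi>. f \<xi> * N (\<xi> - \<eta>)" \<eta>] by simp
    finally show ?thesis .
  qed
  have pm: "(\<lambda>(z, x). norm (f (x + z)) * norm (f x)) \<in> borel_measurable (lborel \<Otimes>\<^sub>M lborel)" by measurable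
  have pb: "norm a * norm b \<le> (norm a)\<^sup>2 + (norm b)\<^sup>2" for a b :: complex
    using sum_squares_bound[of "norm a" "norm b"] mult_nonneg_nonneg[OF norm_ge_zero[of a] norm_ge_zero[of b]] by linarith
  have prod: "integrable lborel (\<lambda>x. f (x + z) * cnj (f x))" for z
  proof (rule Bochner_Integration.integrable_bound)
    show "integrable lborel (\<lambda>x. (norm (f (x + z)))\<^sup>2 + (norm (f x))\<^sup>2)"
      using f(2) integral_translate_square(1)[OF f(2), of z] by (auto simp: square_integrable_def)
    show "AE x in lborel. norm (f (x + z) * cnj (f x)) \<le> norm ((norm (f (x + z)))\<^sup>2 + (norm (f x))\<^sup>2)"
      using pb by (auto simp: norm_mult)
  qed measurable
  define F where "F = l2sq f"
  define D where "D z = l2sq (\<lambda>x. f (x + z) - f x)" for z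
  have Dm[measurable]: "D \<in> borel_measurable borel"
  proof -
    have "(\<lambda>z. D z) \<in> borel_measurable borel" unfolding D_def by measurable
    then show ?thesis by simp
  qed
  have D: "0 \<le> D z" "D z \<le> 4 * F" for z
    using integral_square_add_le[OF integral_translate_square(1)[OF f(2), of z] square_integrable_scaleR[OF f(2), of "-1"]]
      integral_translate_square(2)[OF f(2), of z] by (auto simp: D_def F_def)
  have Rein: "Re (\<integral>x. f (x + z) * cnj (f x) \<partial>lborel) = F - D z / 2" for z
  proof -
    have "Re (f (x + z) * cnj (f x)) = ((norm (f (x + z)))\<^sup>2 + (norm (f x))\<^sup>2 - (norm (f (x + z) - f x))\<^sup>2) / 2" for x
      by (simp add: cmod_power2) (simp add: power2_eq_square algebra_simps)
    then have "Re (\<integral>x. f (x + z) * cnj (f x) \<partial>lborel) = (\<integral>x. ((norm (f (x + z)))\<^sup>2 + (norm (f x))\<^sup>2 - (norm (f (x + z) - f x))\<^sup>2) / 2 \<partial>lborel)"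
      by (simp only: integral_Re[OF prod[of z], symmetric])
    also have "\<dots> = F - D z / 2"
      using f(2) integral_translate_square[OF f(2), of z] square_integrable_diff[OF integral_translate_square(1)[OF f(2), of z] f(2)]
      unfolding F_def D_def square_integrable_def by (simp add: field_simps)
    finally show ?thesis .
  qed
  have bnorm: "(\<integral>x. norm (f (x + z) * cnj (f x)) \<partial>lborel) \<le> 2 * F" for z
  proof -
    have "(\<integral>x. norm (f (x + z) * cnj (f x)) \<partial>lborel) \<le> (\<integral>x. (norm (f (x + z)))\<^sup>2 + (norm (f x))\<^sup>2 \<partial>lborel)"
    proof (rule integral_mono[OF integrable_norm[OF prod]])
      show "integrable lborel (\<lambda>x. (norm (f (x + z)))\<^sup>2 + (norm (f x))\<^sup>2)"
        using f(2) integral_translate_square(1)[OF f(2), of z] by (auto simp: square_integrable_def)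
      show "norm (f (x + z) * cnj (f x)) \<le> (norm (f (x + z)))\<^sup>2 + (norm (f x))\<^sup>2" for x
        using pb[of "f (x + z)" "f x"] by (simp add: norm_mult)
    qed
    also have "\<dots> = 2 * F"
      using f(2) integral_translate_square[OF f(2), of z] by (simp add: F_def square_integrable_def)
    finally show ?thesis .
  qed
  have Ni: "integrable lborel (\<lambda>z. normal_density 0 \<epsilon> z)" using e by simp
  \<comment> \<open>For fixed \<open>z\<close> the product of \<open>f\<close> and its translate has
    L1 norm at most \<open>2 * F\<close> by \<open>bnorm\<close>, uniformly in \<open>z\<close>, so
    the integrable normal weight gives joint integrability.\<close>
  have trip: "integrable (lborel \<Otimes>\<^sub>M lborel) (\<lambda>(z, x). N z * (f (x + z) * cnj (f x)))"
  proof (rule lborel_pair.Fubini_integrable)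
    show "integrable lborel (\<lambda>z. \<integral>x. norm (case (z, x) of (z, x) \<Rightarrow> N z * (f (x + z) * cnj (f x))) \<partial>lborel)"
    proof (rule Bochner_Integration.integrable_bound)
      show "integrable lborel (\<lambda>z. normal_density 0 \<epsilon> z * (2 * F))" using Ni by simp
      show "AE z in lborel. norm (\<integral>x. norm (case (z, x) of (z, x) \<Rightarrow> N z * (f (x + z) * cnj (f x))) \<partial>lborel) \<le> norm (normal_density 0 \<epsilon> z * (2 * F))"
      proof (rule AE_I2)
        fix z
        have "(\<integral>x. norm (case (z, x) of (z, x) \<Rightarrow> N z * (f (x + z) * cnj (f x))) \<partial>lborel) = normal_density 0 \<epsilon> z * (\<integral>x. norm (f (x + z) * cnj (f x)) \<partial>lborel)"
          by (simp add: norm_mult N_def)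
        moreover have "\<dots> \<le> normal_density 0 \<epsilon> z * (2 * F)" by (intro mult_left_mono bnorm) simp
        ultimately show "norm (\<integral>x. norm (case (z, x) of (z, x) \<Rightarrow> N z * (f (x + z) * cnj (f x))) \<partial>lborel) \<le> norm (normal_density 0 \<epsilon> z * (2 * F))"
          by (auto intro!: order_trans[OF _ abs_ge_self] simp: integral_nonneg_AE)
      qed
    qed measurable
    show "AE z in lborel. integrable lborel (\<lambda>x. case (z, x) of (z, x) \<Rightarrow> N z * (f (x + z) * cnj (f x)))"
      using prod by simp
  qed measurable
  have "complex_of_real (\<integral>x. (norm (?T x))\<^sup>2 * exp (- (\<epsilon> * x)\<^sup>2 / 2) \<partial>lborel) = (\<integral>x. G x * ?T x * cnj (?T x) \<partial>lborel)"
    unfolding sqeq[symmetric] by (rule integral_complex_of_real[symmetric])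
  also have "\<dots> = (\<integral>x. G x * ?T x * (\<integral>\<eta>. cnj (f \<eta>) * cis (x * \<eta>) \<partial>lborel) \<partial>lborel)"
  proof -
    have "cnj (?T x) = (\<integral>\<eta>. cnj (f \<eta>) * cis (x * \<eta>) \<partial>lborel)" for x
      unfolding fourier_integral_def by (subst Bochner_Integration.integral_cnj[symmetric]) (simp add: cis_cnj mult.commute)
    then show ?thesis by simp
  qed
  also have "\<dots> = (\<integral>\<eta>. cnj (f \<eta>) * (\<integral>x. G x * ?T x * cis (x * \<eta>) \<partial>lborel) \<partial>lborel)"
    by (rule lborel_pair.integral_mult_kernel_swap[OF GT fc, where C=1]) auto
  also have "\<dots> = 2 * pi * (\<integral>\<eta>. (\<integral>z. N z * (f (\<eta> + z) * cnj (f \<eta>)) \<partial>lborel) \<partial>lborel)"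
    unfolding inner integral_mult_right_zero[symmetric] by (simp add: mult_ac)
  also have "\<dots> = 2 * pi * (\<integral>z. (\<integral>\<eta>. N z * (f (\<eta> + z) * cnj (f \<eta>)) \<partial>lborel) \<partial>lborel)"
    using lborel_pair.Fubini_integral[OF trip] by simp
  finally have eq: "complex_of_real (\<integral>x. (norm (?T x))\<^sup>2 * exp (- (\<epsilon> * x)\<^sup>2 / 2) \<partial>lborel)
     = 2 * pi * (\<integral>z. N z * (\<integral>\<eta>. f (\<eta> + z) * cnj (f \<eta>) \<partial>lborel) \<partial>lborel)" by simp
  have outer: "integrable lborel (\<lambda>z. N z * (\<integral>\<eta>. f (\<eta> + z) * cnj (f \<eta>) \<partial>lborel))"
    using lborel_pair.integrable_fst[OF trip] by simp
  have "(\<integral>x. (norm (?T x))\<^sup>2 * exp (- (\<epsilon> * x)\<^sup>2 / 2) \<partial>lborel) = 2 * pi * Re (\<integral>z. N z * (\<integral>\<eta>. f (\<eta> + z) * cnj (f \<eta>) \<partial>lborel) \<partial>lborel)"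
    using arg_cong[OF eq, of Re] by simp
  also have "\<dots> = 2 * pi * (\<integral>z. normal_density 0 \<epsilon> z * (F - D z / 2) \<partial>lborel)"
    by (subst integral_Re[OF outer, symmetric]) (simp add: N_def Rein)
  also have "(\<integral>z. normal_density 0 \<epsilon> z * (F - D z / 2) \<partial>lborel) = (\<integral>z. normal_density 0 \<epsilon> z * F - (normal_density 0 \<epsilon> z * D z) / 2 \<partial>lborel)"
    by (simp add: algebra_simps)
  also have "\<dots> = F - (\<integral>z. normal_density 0 \<epsilon> z * D z \<partial>lborel) / 2"
  proof -
    have "integrable lborel (\<lambda>z. normal_density 0 \<epsilon> z * D z)"
    proof (rule Bochner_Integration.integrable_bound)
      show "integrable lborel (\<lambda>z. normal_density 0 \<epsilon> z * (4 * F))" using Ni by simp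
      show "AE z in lborel. norm (normal_density 0 \<epsilon> z * D z) \<le> norm (normal_density 0 \<epsilon> z * (4 * F))"
        using D by (auto simp: abs_mult F_def intro!: AE_I2 mult_left_mono)
    qed measurable
    then show ?thesis using Ni e by simp
  qed
  finally show "(\<integral>x. (norm (?T x))\<^sup>2 * exp (- (\<epsilon> * x)\<^sup>2 / 2) \<partial>lborel)
    = 2 * pi * l2sq f
      - pi * (\<integral>z. normal_density 0 \<epsilon> z * l2sq (\<lambda>x. f (x + z) - f x) \<partial>lborel)"
    unfolding F_def[symmetric] D_def[symmetric] by (simp add: algebra_simps)
qed

text \<open>As the damping disappears, the correction term vanishes because translates of an almost
  everywhere continuous function converge in L2. The damped integrals lie below the undamped one,
  and Fatou's lemma gives the opposite bound, so the limit is the undamped integral.\<close>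

lemma plancherel_integrable:
  assumes f: "integrable lborel f" "square_integrable lborel f" and c: "AE x in lborel. isCont f x"
  shows "square_integrable lborel (fourier_integral f)"
    and "l2sq (\<lambda>x. fourier_integral f x) = 2 * pi * l2sq f"
proof -
  have [measurable]: "f \<in> borel_measurable borel" using f by simp
  define F where "F = l2sq f"
  define D where "D z = l2sq (\<lambda>x. f (x + z) - f x)" for z
  have Dm[measurable]: "D \<in> borel_measurable borel"
  proof -
    have "(\<lambda>z. D z) \<in> borel_measurable borel" unfolding D_def by measurable
    then show ?thesis by simp
  qed
  have D: "0 \<le> D z" "D z \<le> 4 * F" for z
    using integral_square_add_le[OF integral_translate_square(1)[OF f(2), of z] square_integrable_scaleR[OF f(2), of "-1"]]
      integral_translate_square(2)[OF f(2), of z] by (auto simp: D_def F_def)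
  define e where "e n = 1 / real (Suc n)" for n
  have e: "0 < e n" for n by (simp add: e_def)
  have e0: "e \<longlonglongrightarrow> 0" unfolding e_def by (rule LIMSEQ_inverse_real_of_nat[unfolded inverse_eq_divide])
  define I where "I n = (\<integral>x. (norm (fourier_integral f x))\<^sup>2 * exp (- (e n * x)\<^sup>2 / 2) \<partial>lborel)" for n
  \<comment> \<open>Substituting \<open>e n * z\<close> trades the shrinking normal weight for a
    fixed one with shrinking translates, which is the form needed for dominated convergence with
    bound \<open>4 * F\<close>.\<close>
  have I: "I n = 2 * pi * F - pi * (\<integral>z. std_normal_density z * D (e n * z) \<partial>lborel)" for n
  proof -
    have "(\<integral>z. normal_density 0 (e n) z * D z \<partial>lborel) = (\<integral>z. e n * (normal_density 0 (e n) (e n * z) * D (e n * z)) \<partial>lborel)"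
      using e[of n] by (subst lborel_integral_real_affine[where c="e n" and t=0]) auto
    also have "\<dots> = (\<integral>z. std_normal_density z * D (e n * z) \<partial>lborel)"
    proof (rule Bochner_Integration.integral_cong[OF refl])
      fix z
      have "e n * normal_density 0 (e n) (e n * z) = std_normal_density z"
        using e[of n] by (simp add: normal_density_def real_sqrt_mult power_mult_distrib)
      then show "e n * (normal_density 0 (e n) (e n * z) * D (e n * z)) = std_normal_density z * D (e n * z)"
        by (simp flip: mult.assoc)
    qed
    finally show ?thesis
      using fourier_integral_gaussian_regularization(1)[OF f e[of n]] by (simp add: I_def F_def D_def)
  qed
  have "(\<lambda>n. \<integral>z. std_normal_density z * D (e n * z) \<partial>lborel) \<longlonglongrightarrow> (\<integral>z. 0 \<partial>(lborel :: real measure))"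
  proof (rule integral_dominated_convergence)
    show "integrable lborel (\<lambda>z. std_normal_density z * (4 * F))" by simp
    show "AE z in lborel. (\<lambda>n. std_normal_density z * D (e n * z)) \<longlonglongrightarrow> 0"
    proof (rule AE_I2)
      fix z
      have "(\<lambda>n. D (e n * z)) \<longlonglongrightarrow> 0"
        unfolding D_def using tendsto_mult_right[OF e0, of z] by (intro translation_continuous_L2[OF f(2) c]) simp
      from tendsto_mult_left[OF this] show "(\<lambda>n. std_normal_density z * D (e n * z)) \<longlonglongrightarrow> 0" by simp
    qed
    show "\<And>n. AE z in lborel. norm (std_normal_density z * D (e n * z)) \<le> std_normal_density z * (4 * F)"
      using D by (auto simp: abs_mult intro!: mult_left_mono)
  qed measurable
  then have Ilim: "I \<longlonglongrightarrow> 2 * pi * F" unfolding I using tendsto_intros by (auto intro!: tendsto_eq_intros)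
  define J where "J = (\<integral>\<^sup>+x. ennreal ((norm (fourier_integral f x))\<^sup>2) \<partial>lborel)"
  have nI: "(\<integral>\<^sup>+x. ennreal ((norm (fourier_integral f x))\<^sup>2 * exp (- (e n * x)\<^sup>2 / 2)) \<partial>lborel) = ennreal (I n)" for n
    unfolding I_def by (rule nn_integral_eq_integral[OF fourier_integral_gaussian_regularization(2)[OF f e]]) simp
  have "ennreal (I n) \<le> J" for n
    unfolding J_def nI[symmetric]
    by (intro nn_integral_mono ennreal_leI) (simp add: mult_left_le)
  then have "ennreal (2 * pi * F) \<le> J"
    using Ilim by (intro LIMSEQ_le_const2[OF tendsto_ennrealI]) auto
  moreover have "J \<le> ennreal (2 * pi * F)"
  proof -
    have "J = (\<integral>\<^sup>+x. liminf (\<lambda>n. ennreal ((norm (fourier_integral f x))\<^sup>2 * exp (- (e n * x)\<^sup>2 / 2))) \<partial>lborel)"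
      unfolding J_def
    proof (rule nn_integral_cong)
      fix x
      have "(\<lambda>n. (norm (fourier_integral f x))\<^sup>2 * exp (- (e n * x)\<^sup>2 / 2)) \<longlonglongrightarrow> (norm (fourier_integral f x))\<^sup>2 * exp (- (0 * x)\<^sup>2 / 2)"
        by (intro tendsto_intros e0) simp
      then have "(\<lambda>n. ennreal ((norm (fourier_integral f x))\<^sup>2 * exp (- (e n * x)\<^sup>2 / 2))) \<longlonglongrightarrow> ennreal ((norm (fourier_integral f x))\<^sup>2)"
        by (intro tendsto_ennrealI) simp
      then show "ennreal ((norm (fourier_integral f x))\<^sup>2) = liminf (\<lambda>n. ennreal ((norm (fourier_integral f x))\<^sup>2 * exp (- (e n * x)\<^sup>2 / 2)))"
        by (rule lim_imp_Liminf[OF sequentially_bot, symmetric])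
    qed
    also have "\<dots> \<le> liminf (\<lambda>n. ennreal (I n))"
      unfolding nI[symmetric] by (rule nn_integral_liminf) simp
    also have "\<dots> = ennreal (2 * pi * F)"
      by (rule lim_imp_Liminf[OF sequentially_bot tendsto_ennrealI[OF Ilim]])
    finally show ?thesis .
  qed
  ultimately have J: "J = ennreal (2 * pi * F)" by simp
  show s: "square_integrable lborel (fourier_integral f)"
    by (rule square_integrableI) (use J in \<open>auto simp: J_def\<close>)
  have "ennreal (l2sq (\<lambda>x. fourier_integral f x)) = ennreal (2 * pi * F)"
    using J unfolding J_def nn_integral_square_eq[OF s] .
  then show "l2sq (\<lambda>x. fourier_integral f x) = 2 * pi * l2sq f"
    by (subst (asm) ennreal_inj) (auto simp: F_def)
qed

lemma truncation_integrable:
  fixes f :: "real \<Rightarrow> complex"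
  assumes f: "square_integrable lborel f"
  shows "integrable lborel (\<lambda>\<xi>. indicat_real {- r..r} \<xi> *\<^sub>R f \<xi>)"
    and "square_integrable lborel (\<lambda>\<xi>. indicat_real {- r..r} \<xi> *\<^sub>R f \<xi>)"
proof -
  have [measurable]: "f \<in> borel_measurable borel" using f by (simp add: square_integrable_def)
  show "square_integrable lborel (\<lambda>\<xi>. indicat_real {- r..r} \<xi> *\<^sub>R f \<xi>)"
    by (rule square_integrable_bound[OF f]) (auto simp: indicator_def)
  show "integrable lborel (\<lambda>\<xi>. indicat_real {- r..r} \<xi> *\<^sub>R f \<xi>)"
  proof (rule Bochner_Integration.integrable_bound)
    show "integrable lborel (\<lambda>\<xi>. indicat_real {- r..r} \<xi> + (norm (f \<xi>))\<^sup>2)"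
      using f by (auto simp: square_integrable_def intro!: integrable_real_indicator emeasure_bounded_finite)
    have "norm z \<le> 1 + (norm z)\<^sup>2" for z :: complex
      by (smt (verit) power2_eq_square mult_le_cancel_left1 norm_ge_zero zero_le_power2)
    then show "AE \<xi> in lborel. norm (indicat_real {- r..r} \<xi> *\<^sub>R f \<xi>) \<le> norm (indicat_real {- r..r} \<xi> + (norm (f \<xi>))\<^sup>2)"
      by (auto simp: indicator_def)
  qed simp
qed

text \<open>The truncations to bounded intervals are integrable as well as square integrable, so the
  integrable case applies to them, and both norms pass to the limit. Truncation adds at most two
  points of discontinuity, which form a null set.\<close>

lemma plancherel:
  assumes fg: "has_fourier_transform f g" and c: "AE x in lborel. isCont f x"
  shows "l2sq g = l2sq f"
proof -
  have f: "square_integrable lborel f"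
    and [measurable]: "f \<in> borel_measurable borel" "g \<in> borel_measurable borel"
    using fg by (auto simp: has_fourier_transform_def square_integrable_def)
  define fn where "fn n \<xi> = indicat_real {- real n..real n} \<xi> *\<^sub>R f \<xi>" for n \<xi>
  have fn: "integrable lborel (fn n)" "square_integrable lborel (fn n)" for n
    unfolding fn_def using truncation_integrable[OF f, of "real n"] by auto
  have cn: "AE x in lborel. isCont (fn n) x" for n
  proof -
    have "AE x in lborel. x \<noteq> real n \<and> x \<noteq> - real n"
      using AE_lborel_singleton[of "real n"] AE_lborel_singleton[of "- real n"] by eventually_elim auto
    with c show ?thesis
    proof eventually_elim
      case (elim x)
      show ?case
      proof (cases "x \<in> {- real n..real n}")
        case True
        then have "eventually (\<lambda>y. y \<in> {- real n<..<real n}) (nhds x)"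
          using elim by (intro eventually_nhds_in_open) auto
        then have "eventually (\<lambda>y. fn n y = f y) (nhds x)"
          by eventually_elim (auto simp: fn_def)
        then show ?thesis using elim by (simp add: isCont_cong)
      next
        case False
        then have "eventually (\<lambda>y. y \<in> - {- real n..real n}) (nhds x)"
          by (intro eventually_nhds_in_open) auto
        then have "eventually (\<lambda>y. fn n y = 0) (nhds x)"
          by eventually_elim (auto simp: fn_def)
        then show ?thesis by (simp add: isCont_cong[where g="\<lambda>_. 0"])
      qed
    qed
  qed
  \<comment> \<open>The normalization of the unitary transform enters here; its square cancels the
    factor \<open>2 * pi\<close> of \<open>plancherel_integrable\<close>.\<close>
  let ?c = "1 / sqrt (2 * pi)"
  define Tn where "Tn n x = ?c *\<^sub>R fourier_integral (fn n) x" for n x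
  have Tn: "square_integrable lborel (Tn n)" for n
    unfolding Tn_def by (intro square_integrable_scaleR plancherel_integrable fn cn)
  have Tn2: "l2sq (Tn n) = l2sq (fn n)" for n
  proof -
    have "l2sq (Tn n) = (\<integral>x. (1 / (2 * pi)) * (norm (fourier_integral (fn n) x))\<^sup>2 \<partial>lborel)"
      by (simp add: Tn_def power_mult_distrib power_divide norm_divide)
    then show ?thesis using plancherel_integrable(2)[OF fn cn, of n] by simp
  qed
  have teq: "?c *\<^sub>R (LINT \<xi>:{- real n..real n}|lborel. cis (- (x * \<xi>)) * f \<xi>) = Tn n x" for n x
    by (simp add: Tn_def fourier_integral_def set_lebesgue_integral_def fn_def)
  have lim: "(\<lambda>n. \<integral>\<^sup>+x. ennreal ((norm (Tn n x - g x))\<^sup>2) \<partial>lborel) \<longlonglongrightarrow> 0"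
    using fg unfolding has_fourier_transform_def teq by simp
  have g: "square_integrable lborel g"
  proof -
    have "eventually (\<lambda>n. (\<integral>\<^sup>+x. ennreal ((norm (Tn n x - g x))\<^sup>2) \<partial>lborel) < \<infinity>) sequentially"
      using order_tendstoD(2)[OF lim, of \<infinity>] by simp
    then obtain n where n: "(\<integral>\<^sup>+x. ennreal ((norm (Tn n x - g x))\<^sup>2) \<partial>lborel) < \<infinity>"
      by (auto simp: eventually_sequentially)
    have [measurable]: "Tn n \<in> borel_measurable borel" using Tn by (simp add: square_integrable_def)
    have "square_integrable lborel (\<lambda>x. Tn n x - g x)" by (rule square_integrableI) (use n in auto)
    from square_integrable_diff[OF Tn[of n] this] show ?thesis by simp
  qed
  have "(\<lambda>n. \<integral>x. (norm (Tn n x - g x))\<^sup>2 \<partial>lborel) \<longlonglongrightarrow> 0"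
    using lim unfolding nn_integral_square_eq[OF square_integrable_diff[OF Tn g]]
    by (subst (asm) ennreal_0[symmetric], subst (asm) tendsto_ennreal_iff) auto
  then have "(\<lambda>n. \<integral>x. (norm (Tn n x))\<^sup>2 \<partial>lborel) \<longlonglongrightarrow> l2sq g"
    by - (rule tendsto_integral_square[where g="\<lambda>_. g"], simp_all add: Tn g)
  moreover have "(\<lambda>n. \<integral>x. (norm (fn n x))\<^sup>2 \<partial>lborel) \<longlonglongrightarrow> l2sq f"
  proof (rule integral_dominated_convergence[where w="\<lambda>x. (norm (f x))\<^sup>2"])
    show "integrable lborel (\<lambda>x. (norm (f x))\<^sup>2)" using f by (simp add: square_integrable_def)
    show "AE x in lborel. (\<lambda>n. (norm (fn n x))\<^sup>2) \<longlonglongrightarrow> (norm (f x))\<^sup>2"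
    proof (rule AE_I2)
      fix x :: real
      obtain N :: nat where N: "\<bar>x\<bar> \<le> real N" using real_arch_simple by blast
      have "eventually (\<lambda>n. (norm (fn n x))\<^sup>2 = (norm (f x))\<^sup>2) sequentially"
        using eventually_ge_at_top[of N] by eventually_elim (use N in \<open>auto simp: fn_def indicator_def abs_le_iff\<close>)
      then show "(\<lambda>n. (norm (fn n x))\<^sup>2) \<longlonglongrightarrow> (norm (f x))\<^sup>2" by (rule tendsto_eventually)
    qed
    show "AE x in lborel. norm ((norm (fn n x))\<^sup>2) \<le> (norm (f x))\<^sup>2" for n
      by (auto simp: fn_def indicator_def)
  qed (auto simp: fn_def)
  ultimately show ?thesis unfolding Tn2 by (rule LIMSEQ_unique)
qed

section \<open>Linear combinations of Fourier transforms\<close>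

lemma has_fourier_transform_zero: "has_fourier_transform (\<lambda>_. 0) (\<lambda>_. 0)"
  by (simp add: has_fourier_transform_def)

lemma has_fourier_transform_add_scaleR:
  assumes f: "has_fourier_transform f f'" and g: "has_fourier_transform g g'"
  shows "has_fourier_transform (\<lambda>\<xi>. c *\<^sub>R f \<xi> + g \<xi>) (\<lambda>\<xi>. c *\<^sub>R f' \<xi> + g' \<xi>)"
proof -
  define T where "T h n x = (1 / sqrt (2 * pi)) *\<^sub>R (LINT \<xi>:{- real n..real n}|lborel. cis (- (x * \<xi>)) * h \<xi>)"
    for h :: "real \<Rightarrow> complex" and n :: nat and x :: real
  have sq: "square_integrable lborel f" "square_integrable lborel g"
    and [measurable]: "f \<in> borel_measurable borel" "g \<in> borel_measurable borel"
      "f' \<in> borel_measurable borel" "g' \<in> borel_measurable borel"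
    using f g by (auto simp: has_fourier_transform_def square_integrable_def)
  have Tm[measurable]: "T h n \<in> borel_measurable borel" if [measurable]: "h \<in> borel_measurable borel" for h n
  proof -
    have "(\<lambda>x. T h n x) \<in> borel_measurable borel" unfolding T_def set_lebesgue_integral_def by measurable
    then show ?thesis by simp
  qed
  have int: "set_integrable lborel {- real n..real n} (\<lambda>\<xi>. cis (- (x * \<xi>)) * h \<xi>)"
    if h: "square_integrable lborel h" for h n x
  proof -
    have [measurable]: "h \<in> borel_measurable borel" using h by (simp add: square_integrable_def)
    show ?thesis unfolding set_integrable_def
      by (rule Bochner_Integration.integrable_bound[OF truncation_integrable(1)[OF h, of "real n"]])
        (auto simp: norm_mult)
  qed
  have Tadd: "T (\<lambda>\<xi>. c *\<^sub>R f \<xi> + g \<xi>) n x = c *\<^sub>R T f n x + T g n x" for n x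
  proof -
    have "(LINT \<xi>:{- real n..real n}|lborel. cis (- (x * \<xi>)) * (c *\<^sub>R f \<xi> + g \<xi>))
      = (LINT \<xi>:{- real n..real n}|lborel. c *\<^sub>R (cis (- (x * \<xi>)) * f \<xi>) + cis (- (x * \<xi>)) * g \<xi>)"
      by (simp add: algebra_simps)
    also have "\<dots> = c *\<^sub>R (LINT \<xi>:{- real n..real n}|lborel. cis (- (x * \<xi>)) * f \<xi>) + (LINT \<xi>:{- real n..real n}|lborel. cis (- (x * \<xi>)) * g \<xi>)"
      using int sq by (subst set_integral_add) (auto simp: set_integral_scaleR_right set_integrable_scaleR_right)
    finally show ?thesis unfolding T_def by (simp only: scaleR_add_right scaleR_left_commute)
  qed
  have lin: "linear (\<lambda>z::complex. c *\<^sub>R z)" by (rule linear_scaleR)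
  have lim: "(\<lambda>n. \<integral>\<^sup>+x. ennreal ((norm (T h n x - h' x))\<^sup>2) \<partial>lborel) \<longlonglongrightarrow> 0"
    if "has_fourier_transform h h'" for h h'
    using that unfolding has_fourier_transform_def T_def by simp
  have L: "(\<lambda>n. \<integral>\<^sup>+x. ennreal ((norm (c *\<^sub>R (T f n x - f' x) + (T g n x - g' x)))\<^sup>2) \<partial>lborel) \<longlonglongrightarrow> 0"
    by (intro nn_integral_square_tendsto_0_add nn_integral_square_tendsto_0_bounded_linear[OF lin] lim f g) measurable
  have "T (\<lambda>\<xi>. c *\<^sub>R f \<xi> + g \<xi>) n x - (c *\<^sub>R f' x + g' x) = c *\<^sub>R (T f n x - f' x) + (T g n x - g' x)" for n x
    unfolding Tadd by (simp add: algebra_simps)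
  with L have "(\<lambda>n. \<integral>\<^sup>+x. ennreal ((norm (T (\<lambda>\<xi>. c *\<^sub>R f \<xi> + g \<xi>) n x - (c *\<^sub>R f' x + g' x)))\<^sup>2) \<partial>lborel) \<longlonglongrightarrow> 0"
    by (simp only:)
  moreover have "square_integrable lborel (\<lambda>\<xi>. c *\<^sub>R f \<xi> + g \<xi>)"
    by (intro square_integrable_add square_integrable_scaleR sq)
  ultimately show ?thesis unfolding has_fourier_transform_def T_def by (auto simp: square_integrable_def)
qed

lemma has_fourier_transform_sum:
  assumes "\<And>i. i \<in> I \<Longrightarrow> has_fourier_transform (f i) (g i)"
  shows "has_fourier_transform (\<lambda>u. \<Sum>i\<in>I. c i *\<^sub>R f i u) (\<lambda>u. \<Sum>i\<in>I. c i *\<^sub>R g i u)"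
  using assms
proof (induction I rule: infinite_finite_induct)
  case (insert i I)
  then show ?case
    using has_fourier_transform_add_scaleR[of "f i" "g i" "\<lambda>u. \<Sum>i\<in>I. c i *\<^sub>R f i u" "\<lambda>u. \<Sum>i\<in>I. c i *\<^sub>R g i u" "c i"] by simp
qed (auto simp: has_fourier_transform_zero)

section \<open>The kernels of the two representations\<close>

definition power_envelope :: "real \<Rightarrow> real \<Rightarrow> real \<Rightarrow> real" where
  "power_envelope p q u = (if \<bar>u\<bar> \<le> 1 then \<bar>u\<bar> powr p else \<bar>u\<bar> powr q)"

lemma power_envelope_nonneg[simp]: "0 \<le> power_envelope p q u"
  by (simp add: power_envelope_def)

lemma power_envelope_measurable[measurable]: "power_envelope p q \<in> borel_measurable borel"
proof -
  have "(\<lambda>u. power_envelope p q u) \<in> borel_measurable borel" unfolding power_envelope_def by measurable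
  then show ?thesis by simp
qed

lemma integrable_powr_Icc:
  assumes "-1 < (p::real)"
  shows "integrable lborel (\<lambda>u. indicat_real {0..1} u * u powr p)"
proof -
  have "(\<lambda>x. x powr p) integrable_on {0..1::real}"
    using has_integral_powr_from_0[OF assms, of 1] by auto
  then have "(\<lambda>x. x powr p) absolutely_integrable_on {0..1::real}"
    by (intro nonnegative_absolutely_integrable_1) auto
  then have "integrable (completion lborel) (\<lambda>u::real. indicat_real {0..1} u * u powr p)"
    by (simp add: set_integrable_def)
  then show ?thesis by (subst (asm) integrable_completion) auto
qed

lemma integrable_powr_Ici:
  assumes "(p::real) < -1"
  shows "integrable lborel (\<lambda>u. indicat_real {1..} u * u powr p)"
proof -
  have "(\<lambda>x. x powr p) integrable_on {1::real..}"
    using has_integral_powr_to_inf[OF assms, of 1] by auto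
  then have "(\<lambda>x. x powr p) absolutely_integrable_on {1::real..}"
    by (intro nonnegative_absolutely_integrable_1) auto
  then have "integrable (completion lborel) (\<lambda>u::real. indicat_real {1..} u * u powr p)"
    by (simp add: set_integrable_def)
  then show ?thesis by (subst (asm) integrable_completion) auto
qed

text \<open>The two exponents separate the singularity at the origin from the decay at infinity.
  Such envelopes dominate the change of the kernels with the Hurst index, uniformly over a range of
  indices.\<close>

lemma square_integrable_power_envelope:
  assumes p: "-1 < 2 * p" and q: "2 * q < -1"
  shows "square_integrable lborel (power_envelope p q)"
proof -
  define g where "g u = indicat_real {0..1} u * u powr (2 * p) + indicat_real {1..} u * u powr (2 * q)" for u
  have g: "integrable lborel g"
    unfolding g_def using assms by (intro Bochner_Integration.integrable_add integrable_powr_Icc integrable_powr_Ici) auto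
  have gm: "integrable lborel (\<lambda>u. g (- u))"
    using lborel_integrable_real_affine[OF g, of "-1" 0] by simp
  show ?thesis unfolding square_integrable_def
  proof
    show "integrable lborel (\<lambda>u. (norm (power_envelope p q u))\<^sup>2)"
    proof (rule Bochner_Integration.integrable_bound)
      show "integrable lborel (\<lambda>u. g u + g (- u))" using g gm by simp
      have sq: "(x powr a)\<^sup>2 = x powr (2 * a)" for x a :: real
        by (simp add: power2_eq_square powr_add[symmetric])
      have "(norm (power_envelope p q u))\<^sup>2 \<le> g u + g (- u)" for u
        by (auto simp: power_envelope_def g_def sq indicator_def)
      then show "AE u in lborel. norm ((norm (power_envelope p q u))\<^sup>2) \<le> norm (g u + g (- u))"
        by (auto intro!: AE_I2 order_trans[OF _ abs_ge_self])
    qed measurable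
  qed measurable
qed

text \<open>A logarithm costs an arbitrarily small power, negative near 0 and positive near
  infinity. Differentiating a power in its exponent produces a logarithm, so this is where the small
  losses \<eta> below come from.\<close>

lemma abs_ln_le_powr:
  assumes "0 < x" "0 < \<eta>"
  shows "\<bar>ln x\<bar> \<le> (if x \<le> 1 then x powr (- \<eta>) else x powr \<eta>) / (\<eta>::real)"
proof (cases "x \<le> 1")
  case True
  have "ln (inverse x) \<le> inverse x powr \<eta> / \<eta>"
    using True assms by (intro ln_powr_bound) (auto simp: one_le_inverse_iff)
  then show ?thesis using True assms by (simp add: ln_inverse powr_minus inverse_powr)
next
  case False
  then show ?thesis using ln_powr_bound[of x \<eta>] assms by simp
qed

text \<open>The mean value theorem in the exponent: the derivative is
  \<open>x powr y * ln x\<close>. The least exponent is the worst for \<open>x \<le> 1\<close> and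
  the largest for \<open>x > 1\<close>, and the logarithm shifts either by \<eta>.\<close>

lemma powr_exponent_lipschitz:
  assumes x: "0 < x" and a: "a \<in> {a0..a1}" "b \<in> {a0..a1}" and e: "0 < (\<eta>::real)"
  shows "\<bar>x powr a - x powr b\<bar> \<le> \<bar>a - b\<bar> * ((if x \<le> 1 then x powr (a0 - \<eta>) else x powr (a1 + \<eta>)) / \<eta>)"
proof -
  define B where "B = (if x \<le> 1 then x powr (a0 - \<eta>) else x powr (a1 + \<eta>)) / \<eta>"
  have pw: "x powr a = exp (a * ln x)" for a using x by (simp add: powr_def)
  have "\<bar>exp (a * ln x) - exp (b * ln x)\<bar> \<le> B * \<bar>a - b\<bar>"
  proof (rule field_differentiable_bound[where S="{a0..a1}" and f="\<lambda>a. exp (a * ln x)" and f'="\<lambda>a. exp (a * ln x) * ln x", unfolded real_norm_def])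
    show "((\<lambda>a. exp (a * ln x)) has_field_derivative exp (y * ln x) * ln x) (at y within {a0..a1})" for y
      by (auto intro!: derivative_eq_intros)
    fix y assume y: "y \<in> {a0..a1}"
    have "\<bar>x powr y * ln x\<bar> \<le> (if x \<le> 1 then x powr a0 else x powr a1) * ((if x \<le> 1 then x powr (- \<eta>) else x powr \<eta>) / \<eta>)"
      unfolding abs_mult using x y
      by (intro mult_mono abs_ln_le_powr[OF x e]; cases "x \<le> 1") (simp_all add: powr_mono powr_mono' less_imp_le)
    also have "\<dots> = B" by (simp add: B_def powr_add[symmetric])
    finally show "\<bar>exp (y * ln x) * ln x\<bar> \<le> B" unfolding pw .
  qed (use a in auto)
  then show ?thesis unfolding pw[of a, symmetric] pw[of b, symmetric] by (simp add: B_def mult.commute)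
qed

text \<open>The moving average kernel at time 1 before division by the Gamma factor. Since
  \<open>0 powr a = 0\<close>, the positive parts merge the integrals over the negative axis and
  over the unit interval into one formula.\<close>

definition moving_average_profile :: "real \<Rightarrow> real \<Rightarrow> real" where
  "moving_average_profile a w = (max 0 (1 - w)) powr a - (max 0 (- w)) powr a"

text \<open>Each power decays too slowly far out, and only the difference between \<open>v\<close>
  and \<open>v + 1\<close> is square integrable. The mean value theorem in the argument gains one
  power of \<open>v\<close>; a second application in the exponent, inside the derivative, gains the
  factor \<open>\<bar>a - b\<bar>\<close>.\<close>

lemma moving_average_profile_tail:
  assumes v: "1 \<le> v" and a: "a \<in> {a0..a1}" "b \<in> {a0..a1}" and a0: "-1 < a0" and a1: "a1 + \<eta> < 1" "a1 < 1" and e: "0 < (\<eta>::real)"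
  shows "\<bar>((v + 1) powr a - v powr a) - ((v + 1) powr b - v powr b)\<bar> \<le> \<bar>a - b\<bar> * ((1 + 1 / \<eta>) * v powr (a1 - 1 + \<eta>))"
proof -
  define B where "B = \<bar>a - b\<bar> * ((1 + 1 / \<eta>) * v powr (a1 - 1 + \<eta>))"
  have "\<bar>((v + 1) powr a - (v + 1) powr b) - (v powr a - v powr b)\<bar> \<le> B * \<bar>(v + 1) - v\<bar>"
  proof (rule field_differentiable_bound[where S="{v..v+1}" and f="\<lambda>y. y powr a - y powr b" and f'="\<lambda>y. a * y powr (a - 1) - b * y powr (b - 1)", unfolded real_norm_def])
    fix y assume y: "y \<in> {v..v + 1}"
    then have y1: "1 \<le> y" "0 < y" using v by auto
    show "((\<lambda>y. y powr a - y powr b) has_field_derivative a * y powr (a - 1) - b * y powr (b - 1)) (at y within {v..v + 1})"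
      using y1 by (auto intro!: derivative_eq_intros has_real_derivative_powr[THEN has_field_derivative_at_within])
    have "a * y powr (a - 1) - b * y powr (b - 1) = (a - b) * y powr (a - 1) + b * (y powr (a - 1) - y powr (b - 1))"
      by (simp add: algebra_simps)
    then have "\<bar>a * y powr (a - 1) - b * y powr (b - 1)\<bar> \<le> \<bar>a - b\<bar> * y powr (a - 1) + \<bar>b\<bar> * \<bar>y powr (a - 1) - y powr (b - 1)\<bar>"
      using abs_triangle_ineq[of "(a - b) * y powr (a - 1)" "b * (y powr (a - 1) - y powr (b - 1))"] by (simp add: abs_mult)
    also have "\<dots> \<le> \<bar>a - b\<bar> * y powr (a1 - 1 + \<eta>) + 1 * (\<bar>a - b\<bar> * (y powr (a1 - 1 + \<eta>) / \<eta>))"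
    proof (intro add_mono mult_mono)
      show "y powr (a - 1) \<le> y powr (a1 - 1 + \<eta>)" using a e y1 by (intro powr_mono) auto
      have "\<bar>y powr (a - 1) - y powr (b - 1)\<bar> \<le> \<bar>(a - 1) - (b - 1)\<bar> * ((if y \<le> 1 then y powr ((a0 - 1) - \<eta>) else y powr ((a1 - 1) + \<eta>)) / \<eta>)"
        using a y1 by (intro powr_exponent_lipschitz[OF _ _ _ e]) auto
      also have "\<dots> \<le> \<bar>a - b\<bar> * (y powr (a1 - 1 + \<eta>) / \<eta>)" using y1 by auto
      finally show "\<bar>y powr (a - 1) - y powr (b - 1)\<bar> \<le> \<bar>a - b\<bar> * (y powr (a1 - 1 + \<eta>) / \<eta>)" .
    qed (use a a0 a1 in auto)
    also have "\<dots> = \<bar>a - b\<bar> * ((1 + 1 / \<eta>) * y powr (a1 - 1 + \<eta>))" by (simp add: algebra_simps)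
    also have "\<dots> \<le> B"
      unfolding B_def using y v e a1 by (intro mult_left_mono powr_mono2') auto
    finally show "\<bar>a * y powr (a - 1) - b * y powr (b - 1)\<bar> \<le> B" .
  qed auto
  then show ?thesis by (simp add: B_def algebra_simps)
qed

text \<open>The profile can be singular at 0 and at 1 and has a tail at minus infinity. One envelope
  centred at 1 and one centred at 0 cover the two singularities; the tail is absorbed by the latter,
  where cancellation improves the exponent by 1.\<close>

lemma moving_average_profile_lipschitz:
  assumes mu: "0 < \<mu>" "\<mu> < 1/2" and nu: "1/2 < \<nu>" "\<nu> < 1"
  obtains G where "square_integrable lborel G" "\<And>u. 0 \<le> G u"
    "\<And>h h' u. h \<in> {\<mu>..\<nu>} \<Longrightarrow> h' \<in> {\<mu>..\<nu>} \<Longrightarrow>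
      \<bar>moving_average_profile (h - 1/2) u - moving_average_profile (h' - 1/2) u\<bar> \<le> \<bar>h - h'\<bar> * (G u :: real)"
proof -
  \<comment> \<open>Being less than \<mu>, \<eta> keeps the exponent \<open>p\<close> at the
    singularities above -1/2; with \<open>\<nu> + \<eta> < 1\<close> it keeps the tail exponent
    \<open>q\<close> below -1/2.\<close>
  define \<eta> where "\<eta> = min \<mu> (1 - \<nu>) / 2"
  have e: "0 < \<eta>" "\<eta> < \<mu>" "\<nu> + \<eta> < 1" using mu nu by (auto simp: \<eta>_def min_def field_simps)
  define p where "p = \<mu> - 1/2 - \<eta>"
  define q where "q = \<nu> - 3/2 + \<eta>"
  have pq: "-1 < 2 * p" "2 * q < -1" "p < 0" using e mu by (auto simp: p_def q_def)
  \<comment> \<open>On [-1, 0) the term in \<open>1 - u\<close> is at most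
    \<open>2 * (- u) powr p / \<eta>\<close> because the base is at most 2 and \<open>p\<close> is
    negative; together with the term in \<open>- u\<close> this gives the 3. The tail needs only
    \<open>1 + 1 / \<eta>\<close>.\<close>
  define G where "G u = (1 / \<eta>) * power_envelope p q (1 - u) + (1 + 3 / \<eta>) * power_envelope p q u" for u
  have se: "square_integrable lborel (power_envelope p q)" using pq by (intro square_integrable_power_envelope) auto
  have se1: "square_integrable lborel (\<lambda>u. power_envelope p q (1 - u))"
    using se lborel_integrable_real_affine[of "\<lambda>u. (norm (power_envelope p q u))\<^sup>2" "-1" 1]
    by (auto simp: square_integrable_def)
  show thesis
  proof
    show "square_integrable lborel G"
      unfolding G_def using square_integrable_add[OF square_integrable_scaleR[OF se1, of "1 / \<eta>"] square_integrable_scaleR[OF se, of "1 + 3 / \<eta>"]] by simp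
    show "0 \<le> G u" for u using e by (simp add: G_def)
    fix h h' u :: real assume h: "h \<in> {\<mu>..\<nu>}" "h' \<in> {\<mu>..\<nu>}"
    let ?a = "h - 1/2" and ?b = "h' - 1/2"
    have ab: "?a \<in> {\<mu> - 1/2..\<nu> - 1/2}" "?b \<in> {\<mu> - 1/2..\<nu> - 1/2}" "\<bar>?a - ?b\<bar> = \<bar>h - h'\<bar>" using h by auto
    note lip = powr_exponent_lipschitz[OF _ ab(1,2) e(1), unfolded ab(3)]
    consider "1 \<le> u" | "0 \<le> u" "u < 1" | "- 1 \<le> u" "u < 0" | "u < - 1" by linarith
    then show "\<bar>moving_average_profile ?a u - moving_average_profile ?b u\<bar> \<le> \<bar>h - h'\<bar> * G u"
    proof cases
      case 1
      then show ?thesis using e by (simp add: moving_average_profile_def G_def)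
    next
      case 2
      have "\<bar>moving_average_profile ?a u - moving_average_profile ?b u\<bar> = \<bar>(1 - u) powr ?a - (1 - u) powr ?b\<bar>"
        using 2 by (simp add: moving_average_profile_def)
      also have "\<dots> \<le> \<bar>h - h'\<bar> * ((1 / \<eta>) * power_envelope p q (1 - u))"
        using lip[of "1 - u"] 2 by (simp add: power_envelope_def p_def)
      also have "\<dots> \<le> \<bar>h - h'\<bar> * G u" using e by (intro mult_left_mono) (auto simp: G_def)
      finally show ?thesis .
    next
      case 3
      have "\<bar>moving_average_profile ?a u - moving_average_profile ?b u\<bar>
        \<le> \<bar>(1 - u) powr ?a - (1 - u) powr ?b\<bar> + \<bar>(- u) powr ?a - (- u) powr ?b\<bar>"
        using 3 by (simp add: moving_average_profile_def)
      also have "\<dots> \<le> \<bar>h - h'\<bar> * ((1 - u) powr (\<nu> - 1/2 + \<eta>) / \<eta>) + \<bar>h - h'\<bar> * ((- u) powr p / \<eta>)"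
        using lip[of "1 - u"] lip[of "- u"] 3 by (intro add_mono) (auto simp: p_def)
      also have "\<dots> \<le> \<bar>h - h'\<bar> * (2 * (- u) powr p / \<eta>) + \<bar>h - h'\<bar> * ((- u) powr p / \<eta>)"
      proof (intro add_mono mult_left_mono divide_right_mono order_refl)
        have "(1 - u) powr (\<nu> - 1/2 + \<eta>) \<le> (1 - u) powr 1" using 3 e by (intro powr_mono) auto
        also have "\<dots> \<le> 2 * 1" using 3 by simp
        also have "\<dots> \<le> 2 * (- u) powr p"
          using 3 pq powr_mono2'[of p "- u" 1] by (intro mult_left_mono) auto
        finally show "(1 - u) powr (\<nu> - 1/2 + \<eta>) \<le> 2 * (- u) powr p" .
      qed (use e in auto)
      also have "\<dots> = \<bar>h - h'\<bar> * (3 / \<eta> * (- u) powr p)" by (simp add: algebra_simps)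
      also have "\<dots> \<le> \<bar>h - h'\<bar> * G u"
        using 3 e by (intro mult_left_mono) (auto simp: G_def power_envelope_def algebra_simps add_nonneg_nonneg)
      finally show ?thesis .
    next
      case 4
      have "\<bar>moving_average_profile ?a u - moving_average_profile ?b u\<bar>
        = \<bar>((- u + 1) powr ?a - (- u) powr ?a) - ((- u + 1) powr ?b - (- u) powr ?b)\<bar>"
        using 4 by (simp add: moving_average_profile_def add.commute)
      also have "\<dots> \<le> \<bar>h - h'\<bar> * ((1 + 1 / \<eta>) * (- u) powr q)"
        using moving_average_profile_tail[OF _ ab(1,2) _ _ _ e(1), of "- u"] 4 e nu mu
        by (simp add: q_def algebra_simps)
      also have "\<dots> \<le> \<bar>h - h'\<bar> * ((1 + 3 / \<eta>) * power_envelope p q u)"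
        using 4 e by (intro mult_left_mono) (auto simp: power_envelope_def intro!: mult_right_mono divide_right_mono)
      also have "\<dots> \<le> \<bar>h - h'\<bar> * G u" using e by (intro mult_left_mono) (auto simp: G_def)
      finally show ?thesis .
    qed
  qed
qed

text \<open>The moving average kernel is embedded into the complex numbers and carries its Gamma
  factor, so that all later estimates treat both representations as one family of complex L2
  functions.\<close>

fun mbm_kernel :: "mbm_representation \<Rightarrow> real \<Rightarrow> real \<Rightarrow> real \<Rightarrow> complex" where
  "mbm_kernel Moving_Average h t u =
     of_real ((max 0 (t - u) powr (h - 1/2) - max 0 (- u) powr (h - 1/2)) / Gamma (h + 1/2))"
| "mbm_kernel Harmonizable h t \<xi> = (cis (t * \<xi>) - 1) / of_real (\<bar>\<xi>\<bar> powr (h + 1/2))"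

lemma mbm_kernel_measurable[measurable]: "mbm_kernel R h t \<in> borel_measurable borel"
proof -
  have "(\<lambda>u. mbm_kernel R h t u) \<in> borel_measurable borel" by (cases R) simp_all
  then show ?thesis by simp
qed

lemma mbm_kernel_zero[simp]: "mbm_kernel R h 0 u = 0"
  by (cases R) simp_all

text \<open>On a compact interval of positive numbers the reciprocal \<open>rGamma\<close> has a
  continuous derivative, so compactness bounds it together with the function, and the mean value
  theorem applies.\<close>

lemma Gamma_reciprocal_lipschitz:
  assumes "0 < a"
  obtains C where "\<And>x y::real. x \<in> {a..b} \<Longrightarrow> y \<in> {a..b} \<Longrightarrow> \<bar>1 / Gamma x - 1 / Gamma y\<bar> \<le> C * \<bar>x - y\<bar>"
    "\<And>x::real. x \<in> {a..b} \<Longrightarrow> \<bar>1 / Gamma x\<bar> \<le> C" "0 \<le> C"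
proof -
  have np: "x \<notin> \<int>\<^sub>\<le>\<^sub>0" if "x \<in> {a..b}" for x using that assms by (auto simp: nonpos_Ints_def)
  have d: "(rGamma has_field_derivative - rGamma x * Digamma x) (at x within {a..b})" if "x \<in> {a..b}" for x
    by (rule has_field_derivative_rGamma_no_nonpos_int[OF np[OF that]])
  have c: "continuous_on {a..b} (rGamma :: real \<Rightarrow> real)"
    by (rule DERIV_continuous_on[OF d])
  have P: "continuous_on {a..b} (\<lambda>x. Digamma x :: real)"
    by (rule continuous_on_Polygamma) (use np in \<open>simp add: disjoint_iff\<close>)
  have c': "continuous_on {a..b} (\<lambda>x. - rGamma x * Digamma x :: real)"
    by (rule continuous_on_mult[OF continuous_on_minus[OF c] P])
  have bdd: "\<exists>C. \<forall>x\<in>{a..b}. \<bar>g x\<bar> \<le> C" if "continuous_on {a..b} g" for g :: "real \<Rightarrow> real"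
    using compact_imp_bounded[OF compact_continuous_image[OF that compact_Icc]] by (simp add: bounded_iff)
  obtain C1 where C1: "\<And>x. x \<in> {a..b} \<Longrightarrow> \<bar>- rGamma x * Digamma x\<bar> \<le> C1"
    using bdd[OF c'] by blast
  obtain C2 where C2: "\<And>x. x \<in> {a..b} \<Longrightarrow> \<bar>rGamma x :: real\<bar> \<le> C2"
    using bdd[OF c] by blast
  define C where "C = max 0 (max C1 C2)"
  have rG: "1 / Gamma x = rGamma x" for x :: real by (simp add: rGamma_inverse_Gamma inverse_eq_divide)
  show thesis
  proof (rule that[of C])
    fix x y :: real assume xy: "x \<in> {a..b}" "y \<in> {a..b}"
    have "\<bar>rGamma x - rGamma y\<bar> \<le> C1 * \<bar>x - y\<bar>"
      using d C1 xy
      by (intro field_differentiable_bound[where S="{a..b}" and f=rGamma and f'="\<lambda>x. - rGamma x * Digamma x", unfolded real_norm_def]) auto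
    also have "\<dots> \<le> C * \<bar>x - y\<bar>" by (intro mult_right_mono) (auto simp: C_def)
    finally show "\<bar>1 / Gamma x - 1 / Gamma y\<bar> \<le> C * \<bar>x - y\<bar>" unfolding rG .
  next
    fix x :: real assume "x \<in> {a..b}"
    from C2[OF this] show "\<bar>1 / Gamma x\<bar> \<le> C" unfolding rG by (simp add: C_def)
  qed (simp add: C_def)
qed

lemma norm_cis_minus_one: "norm (cis x - 1) \<le> \<bar>x\<bar>" "norm (cis x - 1) \<le> 2"
proof -
  show "norm (cis x - 1) \<le> \<bar>x\<bar>" using iexp_approx1[of x 0] by (simp add: cis_conv_exp)
  show "norm (cis x - 1) \<le> 2" using norm_triangle_ineq4[of "cis x" 1] by simp
qed

text \<open>The Lipschitz constant in the Hurst index is itself a square integrable function of the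
  integration variable. For the moving average the profile is combined with the reciprocal Gamma
  factor; for the harmonizable kernel the bounds \<open>\<bar>\<xi>\<bar>\<close> and 2 for
  \<open>cis \<xi> - 1\<close> handle the origin and the tail.\<close>

lemma mbm_kernel_unit_lipschitz:
  assumes mu: "0 < \<mu>" "\<mu> < 1/2" and nu: "1/2 < \<nu>" "\<nu> < 1"
  obtains G :: "real \<Rightarrow> real" where "square_integrable lborel G" "\<And>u. 0 \<le> G u"
    "\<And>h h' u. h \<in> {\<mu>..\<nu>} \<Longrightarrow> h' \<in> {\<mu>..\<nu>} \<Longrightarrow> norm (mbm_kernel R h 1 u - mbm_kernel R h' 1 u) \<le> \<bar>h - h'\<bar> * G u"
proof (cases R)
  case Moving_Average
  obtain G where G: "square_integrable lborel G" "\<And>u. 0 \<le> G u"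
    "\<And>h h' u. h \<in> {\<mu>..\<nu>} \<Longrightarrow> h' \<in> {\<mu>..\<nu>} \<Longrightarrow>
      \<bar>moving_average_profile (h - 1/2) u - moving_average_profile (h' - 1/2) u\<bar> \<le> \<bar>h - h'\<bar> * (G u :: real)"
    using moving_average_profile_lipschitz[OF assms] by blast
  obtain C where C: "\<And>x y::real. x \<in> {1/2..3/2} \<Longrightarrow> y \<in> {1/2..3/2} \<Longrightarrow> \<bar>1 / Gamma x - 1 / Gamma y\<bar> \<le> C * \<bar>x - y\<bar>"
    "\<And>x::real. x \<in> {1/2..3/2} \<Longrightarrow> \<bar>1 / Gamma x\<bar> \<le> C" "0 \<le> C"
    using Gamma_reciprocal_lipschitz[of "1/2" "3/2"] by auto
  let ?g = "\<lambda>h. moving_average_profile (h - 1/2)"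
  \<comment> \<open>At index 1/2 the exponent is 0 and the profile is bounded by an indicator. This
    reference point turns a bound on differences into a bound on the profile itself.\<close>
  have half: "\<bar>?g (1/2) u\<bar> \<le> indicat_real {0..1} u" for u
    by (auto simp: moving_average_profile_def indicator_def)
  have gb: "\<bar>?g h u\<bar> \<le> indicat_real {0..1} u + G u" if h: "h \<in> {\<mu>..\<nu>}" for h u
  proof -
    have "\<bar>?g h u - ?g (1/2) u\<bar> \<le> \<bar>h - 1/2\<bar> * G u" using h mu nu by (intro G(3)) auto
    also have "\<dots> \<le> 1 * G u" using h mu nu by (intro mult_right_mono G) (auto simp: abs_le_iff)
    finally show ?thesis using half[of u] by linarith
  qed
  define K where "K u = C * (indicat_real {0..1} u + 2 * G u)" for u
  have "square_integrable lborel (\<lambda>u. indicat_real {0..1::real} u)"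
  proof -
    have "(norm (indicat_real {0..1} u))\<^sup>2 = indicat_real {0..1} u" for u :: real by (auto simp: indicator_def)
    then show ?thesis by (auto simp: square_integrable_def intro!: integrable_real_indicator emeasure_bounded_finite)
  qed
  then have "square_integrable lborel (\<lambda>u. C *\<^sub>R (indicat_real {0..1} u + 2 *\<^sub>R G u))"
    by (intro square_integrable_scaleR square_integrable_add G)
  then have K: "square_integrable lborel K" unfolding K_def by simp
  show thesis
  proof (rule that[OF K])
    show "0 \<le> K u" for u using C(3) G(2)[of u] by (simp add: K_def)
    fix h h' u assume h: "h \<in> {\<mu>..\<nu>}" "h' \<in> {\<mu>..\<nu>}"
    let ?r = "\<lambda>h. 1 / Gamma (h + 1/2)"
    have "norm (mbm_kernel R h 1 u - mbm_kernel R h' 1 u) = \<bar>?r h * ?g h u - ?r h' * ?g h' u\<bar>"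
      unfolding Moving_Average mbm_kernel.simps of_real_diff[symmetric] norm_of_real moving_average_profile_def by simp
    also have "\<dots> = \<bar>?r h * (?g h u - ?g h' u) + (?r h - ?r h') * ?g h' u\<bar>" by (simp add: algebra_simps)
    also have "\<dots> \<le> \<bar>?r h\<bar> * \<bar>?g h u - ?g h' u\<bar> + \<bar>?r h - ?r h'\<bar> * \<bar>?g h' u\<bar>"
      by (rule order_trans[OF abs_triangle_ineq]) (simp only: abs_mult order_refl)
    also have "\<dots> \<le> C * (\<bar>h - h'\<bar> * G u) + C * \<bar>h - h'\<bar> * (indicat_real {0..1} u + G u)"
    proof (intro add_mono mult_mono G(3) gb h)
      show "\<bar>?r h\<bar> \<le> C" using h mu nu by (intro C(2)) auto
      have "\<bar>?r h - ?r h'\<bar> \<le> C * \<bar>(h + 1/2) - (h' + 1/2)\<bar>" using h mu nu by (intro C(1)) auto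
      then show "\<bar>?r h - ?r h'\<bar> \<le> C * \<bar>h - h'\<bar>" by simp
    qed (use C(3) in auto)
    also have "\<dots> = \<bar>h - h'\<bar> * K u" by (simp add: K_def algebra_simps)
    finally show "norm (mbm_kernel R h 1 u - mbm_kernel R h' 1 u) \<le> \<bar>h - h'\<bar> * K u" .
  qed
next
  case Harmonizable
  define \<eta> where "\<eta> = min \<mu> (1 - \<nu>) / 2"
  have e: "0 < \<eta>" "\<eta> < \<mu>" "\<nu> + \<eta> < 1" using mu nu by (auto simp: \<eta>_def min_def field_simps)
  \<comment> \<open>The factor \<open>cis \<xi> - 1\<close> improves the exponent
    \<open>- \<nu> - 1/2 - \<eta>\<close> at the origin by 1; in the tail it is just bounded by
    2.\<close>
  define p where "p = 1/2 - \<nu> - \<eta>"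
  define q where "q = - \<mu> - 1/2 + \<eta>"
  have pq: "-1 < 2 * p" "2 * q < -1" using e mu by (auto simp: p_def q_def)
  have "square_integrable lborel (power_envelope p q)" using pq by (rule square_integrable_power_envelope)
  from square_integrable_scaleR[OF this, of "2 / \<eta>"]
  have S: "square_integrable lborel (\<lambda>u. 2 / \<eta> * power_envelope p q u)" by simp
  show thesis
  proof (rule that[OF S])
    show "0 \<le> 2 / \<eta> * power_envelope p q u" for u using e by simp
    fix h h' \<xi> assume h: "h \<in> {\<mu>..\<nu>}" "h' \<in> {\<mu>..\<nu>}"
    show "norm (mbm_kernel R h 1 \<xi> - mbm_kernel R h' 1 \<xi>) \<le> \<bar>h - h'\<bar> * (2 / \<eta> * power_envelope p q \<xi>)"
    proof (cases "\<xi> = 0")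
      case True then show ?thesis using e unfolding Harmonizable by simp
    next
      case False
      define x where "x = \<bar>\<xi>\<bar>"
      have x: "0 < x" using False by (simp add: x_def)
      have k: "mbm_kernel R h 1 \<xi> = (cis \<xi> - 1) * of_real (x powr (- h - 1/2))" for h
      proof -
        have "- h - 1/2 = - (h + 1/2)" by simp
        then have eq: "x powr (- h - 1/2) = inverse (x powr (h + 1/2))" by (simp only: powr_minus)
        have "mbm_kernel R h 1 \<xi> = (cis \<xi> - 1) / of_real (x powr (h + 1/2))"
          by (simp add: Harmonizable x_def)
        then show ?thesis by (simp only: eq divide_inverse[of "cis \<xi> - 1"] of_real_inverse)
      qed
      have n: "norm (mbm_kernel R h 1 \<xi> - mbm_kernel R h' 1 \<xi>) = norm (cis \<xi> - 1) * \<bar>x powr (- h - 1/2) - x powr (- h' - 1/2)\<bar>"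
        unfolding k right_diff_distrib[symmetric] of_real_diff[symmetric] norm_mult norm_of_real ..
      have l: "\<bar>x powr (- h - 1/2) - x powr (- h' - 1/2)\<bar> \<le> \<bar>h - h'\<bar> * ((if x \<le> 1 then x powr (- \<nu> - 1/2 - \<eta>) else x powr (- \<mu> - 1/2 + \<eta>)) / \<eta>)"
        using powr_exponent_lipschitz[OF x _ _ e(1), of "- h - 1/2" "- \<nu> - 1/2" "- \<mu> - 1/2" "- h' - 1/2"] h
        by (simp add: abs_minus_commute)
      show ?thesis
      proof (cases "x \<le> 1")
        case True
        have "norm (cis \<xi> - 1) * \<bar>x powr (- h - 1/2) - x powr (- h' - 1/2)\<bar> \<le> x * (\<bar>h - h'\<bar> * (x powr (- \<nu> - 1/2 - \<eta>) / \<eta>))"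
          using l True norm_cis_minus_one(1)[of \<xi>] by (intro mult_mono) (auto simp: x_def)
        also have "\<dots> = \<bar>h - h'\<bar> * (1 / \<eta> * (x powr 1 * x powr (- \<nu> - 1/2 - \<eta>)))" using x by simp
        also have "x powr 1 * x powr (- \<nu> - 1/2 - \<eta>) = power_envelope p q \<xi>"
        proof -
          have "1 + (- \<nu> - 1/2 - \<eta>) = p" by (simp add: p_def)
          then show ?thesis using True unfolding powr_add[symmetric] by (simp only: power_envelope_def x_def if_True)
        qed
        also have "\<bar>h - h'\<bar> * (1 / \<eta> * power_envelope p q \<xi>) \<le> \<bar>h - h'\<bar> * (2 / \<eta> * power_envelope p q \<xi>)"
          using e by (intro mult_left_mono mult_right_mono divide_right_mono) auto
        finally show ?thesis using n by simp
      next
        case False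
        have "norm (cis \<xi> - 1) * \<bar>x powr (- h - 1/2) - x powr (- h' - 1/2)\<bar> \<le> 2 * (\<bar>h - h'\<bar> * (x powr (- \<mu> - 1/2 + \<eta>) / \<eta>))"
          using l False norm_cis_minus_one(2)[of \<xi>] by (intro mult_mono) auto
        also have "\<dots> = \<bar>h - h'\<bar> * (2 / \<eta> * power_envelope p q \<xi>)"
          using False by (simp add: power_envelope_def x_def q_def)
        finally show ?thesis using n by simp
      qed
    qed
  qed
qed

lemma square_integrable_mbm_kernel_half: "square_integrable lborel (mbm_kernel R (1/2) 1)"
proof (cases R)
  case Moving_Average
  have i: "square_integrable lborel (\<lambda>u. indicat_real {0..1::real} u)"
  proof -
    have "(norm (indicat_real {0..1} u))\<^sup>2 = indicat_real {0..1} u" for u :: real by (auto simp: indicator_def)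
    then show ?thesis by (auto simp: square_integrable_def intro!: integrable_real_indicator emeasure_bounded_finite)
  qed
  have "norm (mbm_kernel R (1/2) 1 u) \<le> norm (indicat_real {0..1} u)" for u
    by (auto simp: Moving_Average indicator_def)
  then show ?thesis by (intro square_integrable_bound[OF i]) auto
next
  case Harmonizable
  have i: "square_integrable lborel (\<lambda>u. 2 *\<^sub>R power_envelope 0 (-1) u)"
    by (intro square_integrable_scaleR square_integrable_power_envelope) auto
  have "norm (mbm_kernel R (1/2) 1 u) \<le> norm (2 *\<^sub>R power_envelope 0 (-1) u)" for u
  proof (cases "u = 0")
    case False
    have "norm (mbm_kernel R (1/2) 1 u) = norm (cis u - 1) / \<bar>u\<bar>"
      using False by (simp add: Harmonizable norm_divide)
    moreover have "norm (cis u - 1) / \<bar>u\<bar> \<le> 1" "norm (cis u - 1) / \<bar>u\<bar> \<le> 2 / \<bar>u\<bar>"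
      using norm_cis_minus_one[of u] False by (auto intro!: divide_right_mono simp: divide_le_eq_1)
    ultimately have b: "norm (mbm_kernel R (1/2) 1 u) \<le> 2" "norm (mbm_kernel R (1/2) 1 u) \<le> 2 / \<bar>u\<bar>" by linarith+
    have "norm (2 *\<^sub>R power_envelope 0 (-1) u) = (if \<bar>u\<bar> \<le> 1 then 2 else 2 / \<bar>u\<bar>)"
      using False by (simp add: power_envelope_def powr_minus_divide)
    then show ?thesis using b by presburger
  qed (simp add: Harmonizable)
  then show ?thesis by (intro square_integrable_bound[OF i]) auto
qed

lemma square_integrable_mbm_kernel_unit:
  assumes "0 < h" "h < 1"
  shows "square_integrable lborel (mbm_kernel R h 1)"
proof -
  \<comment> \<open>The range is enlarged so as to contain 1/2, where the kernel is explicitly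
    square integrable; \<open>h\<close> is then reached from there.\<close>
  define \<mu> \<nu> where "\<mu> = min h (1/4)" and "\<nu> = max h (3/4)"
  have m: "0 < \<mu>" "\<mu> < 1/2" "1/2 < \<nu>" "\<nu> < 1" using assms by (auto simp: \<mu>_def \<nu>_def)
  obtain G :: "real \<Rightarrow> real" where G: "square_integrable lborel G" "\<And>u. 0 \<le> G u"
    "\<And>h h' u. h \<in> {\<mu>..\<nu>} \<Longrightarrow> h' \<in> {\<mu>..\<nu>} \<Longrightarrow> norm (mbm_kernel R h 1 u - mbm_kernel R h' 1 u) \<le> \<bar>h - h'\<bar> * G u"
    using mbm_kernel_unit_lipschitz[OF m, of R] by blast
  have "square_integrable lborel (\<lambda>u. mbm_kernel R h 1 u - mbm_kernel R (1/2) 1 u)"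
  proof (rule square_integrable_bound[OF square_integrable_scaleR[OF G(1), of "\<bar>h - 1/2\<bar>"]])
    show "AE x in lborel. norm (mbm_kernel R h 1 x - mbm_kernel R (1/2) 1 x) \<le> norm (\<bar>h - 1/2\<bar> *\<^sub>R G x)"
      using G(3)[of h "1/2"] m G(2) by (auto simp: \<mu>_def \<nu>_def)
  qed measurable
  from square_integrable_add[OF this square_integrable_mbm_kernel_half[where R=R]] show ?thesis by simp
qed

text \<open>Dilating the integration variable by \<open>t\<close> for the moving average, by
  \<open>1 / t\<close> for the frequency, turns time \<open>t\<close> into time 1. The relation
  between \<open>c\<close> and \<kappa> cancels the Jacobian in squared norms. Neither depends on
  \<open>h\<close>, so combinations of kernels with different indices scale together.\<close>

lemma mbm_kernel_scaling:
  assumes t: "0 < t"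
  obtains c \<kappa> where "0 < c" "c * \<kappa>\<^sup>2 = 1" "\<And>h w. mbm_kernel R h t (c * w) = (\<kappa> * t powr h) *\<^sub>R mbm_kernel R h 1 w"
proof (cases R)
  case Moving_Average
  have "t * (t powr (-1/2))\<^sup>2 = t powr 1 * (t powr (-1/2) * t powr (-1/2))"
    using t by (simp add: power2_eq_square)
  also have "\<dots> = 1" using t unfolding powr_add[symmetric] by simp
  finally have 1: "t * (t powr (-1/2))\<^sup>2 = 1" .
  have "mbm_kernel R h t (t * w) = (t powr (-1/2) * t powr h) *\<^sub>R mbm_kernel R h 1 w" for h w
  proof -
    have mx: "t * max 0 x = max 0 (t * x)" for x
      using t by (simp add: max_def zero_le_mult_iff)
    have m: "max 0 (t - t * w) = t * max 0 (1 - w)" "max 0 (- (t * w)) = t * max 0 (- w)"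
      unfolding mx by (simp_all add: right_diff_distrib)
    have p: "t powr (-1/2) * t powr h = t powr (h - 1/2)"
      unfolding powr_add[symmetric] by simp
    have q: "(t * x) powr a = t powr a * x powr a" if "0 \<le> x" for x a
      using t that by (simp add: powr_mult)
    show ?thesis unfolding Moving_Average mbm_kernel.simps m p
      by (subst (1 2) q) (auto simp: scaleR_conv_of_real right_diff_distrib diff_divide_distrib)
  qed
  then show thesis using that[of t "t powr (-1/2)"] t 1 by blast
next
  case Harmonizable
  have "1 / t * (t powr (1/2))\<^sup>2 = 1"
    using t by (simp add: power2_eq_square powr_add[symmetric])
  moreover have "mbm_kernel R h t (1 / t * w) = (t powr (1/2) * t powr h) *\<^sub>R mbm_kernel R h 1 w" for h w
  proof -
    have "\<bar>1 / t * w\<bar> = \<bar>w\<bar> / t" using t by (simp add: abs_mult)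
    then have "\<bar>1 / t * w\<bar> powr (h + 1/2) = \<bar>w\<bar> powr (h + 1/2) / t powr (h + 1/2)"
      using t by (simp add: powr_divide)
    moreover have "t powr (1/2) * t powr h = t powr (h + 1/2)"
      unfolding powr_add[symmetric] by (simp add: add.commute)
    moreover have "t * (1 / t * w) = w" using t by simp
    ultimately show ?thesis unfolding Harmonizable mbm_kernel.simps by (simp add: scaleR_conv_of_real)
  qed
  ultimately show thesis using that[of "1 / t" "t powr (1/2)"] t by simp
qed

lemma integral_square_mbm_kernel_scaling:
  assumes t: "0 < t"
  shows "l2sq (\<lambda>u. a *\<^sub>R mbm_kernel R h t u - b *\<^sub>R mbm_kernel R h' t u)
    = l2sq (\<lambda>u. (a * t powr h) *\<^sub>R mbm_kernel R h 1 u - (b * t powr h') *\<^sub>R mbm_kernel R h' 1 u)"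
    and "square_integrable lborel (mbm_kernel R h 1) \<Longrightarrow> square_integrable lborel (mbm_kernel R h t)"
proof -
  obtain c \<kappa> where c: "0 < c" "c * \<kappa>\<^sup>2 = 1" "\<And>h w. mbm_kernel R h t (c * w) = (\<kappa> * t powr h) *\<^sub>R mbm_kernel R h 1 w"
    using mbm_kernel_scaling[OF t, of R] by blast
  show "l2sq (\<lambda>u. a *\<^sub>R mbm_kernel R h t u - b *\<^sub>R mbm_kernel R h' t u)
    = l2sq (\<lambda>u. (a * t powr h) *\<^sub>R mbm_kernel R h 1 u - (b * t powr h') *\<^sub>R mbm_kernel R h' 1 u)" (is "?L = ?R")
  proof -
    have e: "a *\<^sub>R mbm_kernel R h t (c * w) - b *\<^sub>R mbm_kernel R h' t (c * w)
      = \<kappa> *\<^sub>R ((a * t powr h) *\<^sub>R mbm_kernel R h 1 w - (b * t powr h') *\<^sub>R mbm_kernel R h' 1 w)" for w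
      unfolding c(3) by (simp add: scaleR_right_diff_distrib mult_ac)
    have "?L = c * l2sq (\<lambda>w. a *\<^sub>R mbm_kernel R h t (c * w) - b *\<^sub>R mbm_kernel R h' t (c * w))"
      using c(1) by (subst lborel_integral_real_affine[where c=c and t=0]) auto
    also have "\<dots> = (c * \<kappa>\<^sup>2) * ?R" unfolding e by (simp add: power_mult_distrib)
    finally show ?thesis by (simp add: c(2))
  qed
  assume s: "square_integrable lborel (mbm_kernel R h 1)"
  have "integrable lborel (\<lambda>w. (norm (mbm_kernel R h t (0 + c * w)))\<^sup>2)"
    using s by (simp add: c(3) power_mult_distrib square_integrable_def)
  then have "integrable lborel (\<lambda>w. (norm (mbm_kernel R h t w))\<^sup>2)"
    using c(1) by (subst (asm) lborel_integrable_real_affine_iff) auto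
  then show "square_integrable lborel (mbm_kernel R h t)" by (simp add: square_integrable_def)
qed

lemma square_integrable_mbm_kernel:
  assumes "0 < h" "h < 1" "0 \<le> t"
  shows "square_integrable lborel (mbm_kernel R h t)"
proof (cases "t = 0")
  case False
  then show ?thesis using assms integral_square_mbm_kernel_scaling(2)[of t R h] square_integrable_mbm_kernel_unit by simp
next
  case True
  have "mbm_kernel R h 0 = (\<lambda>_. 0)" by auto
  then show ?thesis by (simp add: True square_integrable_def)
qed

text \<open>The variance at time 1 of the process with constant Hurst function
  \<open>h\<close>.\<close>

definition mbm_variance :: "mbm_representation \<Rightarrow> real \<Rightarrow> real" where
  "mbm_variance R h = l2sq (\<lambda>u. mbm_kernel R h 1 u)"

text \<open>For a constant index the increments are stationary: shifting time is a translation of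
  the integration variable for the moving average and multiplication by a unimodular factor for the
  harmonizable kernel. Self-similarity then reduces lag \<open>d\<close> to lag 1.\<close>

lemma integral_square_mbm_kernel_increment_pos:
  assumes d: "0 < d" and s: "0 \<le> s"
  shows "l2sq (\<lambda>u. mbm_kernel R h (s + d) u - mbm_kernel R h s u) = d powr (2 * h) * mbm_variance R h"
proof -
  have "l2sq (\<lambda>u. mbm_kernel R h (s + d) u - mbm_kernel R h s u) = l2sq (\<lambda>u. mbm_kernel R h d u)"
  proof (cases R)
    case Moving_Average
    have shift: "mbm_kernel R h (s + d) (s + 1 * u) - mbm_kernel R h s (s + 1 * u) = mbm_kernel R h d u" for u
      unfolding Moving_Average mbm_kernel.simps of_real_diff[symmetric] by (simp add: diff_divide_distrib[symmetric])
    have "l2sq (\<lambda>u. mbm_kernel R h (s + d) u - mbm_kernel R h s u)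
      = l2sq (\<lambda>u. mbm_kernel R h (s + d) (s + 1 * u) - mbm_kernel R h s (s + 1 * u))"
      by (subst lborel_integral_real_affine[where c=1 and t=s]) auto
    then show ?thesis unfolding shift .
  next
    case Harmonizable
    have "mbm_kernel R h (s + d) u - mbm_kernel R h s u = cis (s * u) * mbm_kernel R h d u" for u
      unfolding Harmonizable mbm_kernel.simps
      by (simp add: diff_divide_distrib[symmetric] right_diff_distrib cis_mult distrib_right)
    then show ?thesis by (simp add: norm_mult)
  qed
  also have "\<dots> = l2sq (\<lambda>u. 1 *\<^sub>R mbm_kernel R h d u - 0 *\<^sub>R mbm_kernel R h d u)" by simp
  also have "\<dots> = (d powr h)\<^sup>2 * mbm_variance R h"
    unfolding integral_square_mbm_kernel_scaling(1)[OF d] by (simp add: mbm_variance_def power_mult_distrib)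
  also have "(d powr h)\<^sup>2 = d powr (2 * h)" by (simp add: power2_eq_square powr_add[symmetric])
  finally show ?thesis .
qed

lemma integral_square_mbm_kernel_increment:
  assumes "0 \<le> s" "0 \<le> t"
  shows "l2sq (\<lambda>u. mbm_kernel R h t u - mbm_kernel R h s u) = \<bar>t - s\<bar> powr (2 * h) * mbm_variance R h"
proof (cases s t rule: linorder_cases)
  case less
  then show ?thesis using integral_square_mbm_kernel_increment_pos[of "t - s" s R h] assms by simp
next
  case greater
  then show ?thesis using integral_square_mbm_kernel_increment_pos[of "s - t" t R h] assms
    by (simp add: norm_minus_commute)
qed simp

text \<open>The variance at time 1 stays away from 0 uniformly in the index as soon as the kernel is
  bounded below on one fixed interval.\<close>

lemma mbm_kernel_lower_bound:
  obtains m a b :: real where "0 < m" "a < b" "\<And>h u. h \<in> {0..1} \<Longrightarrow> u \<in> {a..b} \<Longrightarrow> m \<le> norm (mbm_kernel R h 1 u)"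
proof (cases R)
  case Moving_Average
  have np: "x \<notin> \<int>\<^sub>\<le>\<^sub>0" if "x \<in> {1/2..3/2}" for x :: real using that by (auto simp: nonpos_Ints_def)
  have "continuous_on {1/2..3/2} (rGamma :: real \<Rightarrow> real)"
    by (rule DERIV_continuous_on[OF has_field_derivative_rGamma_no_nonpos_int[OF np]])
  then obtain y where y: "y \<in> {1/2..3/2::real}" "\<And>x. x \<in> {1/2..3/2} \<Longrightarrow> rGamma y \<le> rGamma x"
    using continuous_attains_inf[of "{1/2..3/2::real}" rGamma] by auto
  have rG: "rGamma x = 1 / Gamma x" for x :: real by (simp add: rGamma_inverse_Gamma inverse_eq_divide)
  define m where "m = rGamma y / 2"
  have m: "0 < m" using y(1) by (simp add: m_def rG Gamma_real_pos)
  show thesis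
  proof (rule that[of m "1/4" "1/2"])
    fix h u :: real assume h: "h \<in> {0..1}" and u: "u \<in> {1/4..1/2}"
    have "1 / 2 \<le> (1 - u) powr 1" using u by simp
    also have "\<dots> \<le> (1 - u) powr (h - 1/2)" using u h by (intro powr_mono') auto
    finally have 1: "1 / 2 \<le> (1 - u) powr (h - 1/2)" .
    have "m \<le> (1/2) * (1 / Gamma (h + 1/2))"
      using y(2)[of "h + 1/2"] h by (simp add: m_def rG)
    also have "\<dots> \<le> (1 - u) powr (h - 1/2) * (1 / Gamma (h + 1/2))"
      using 1 h Gamma_real_pos[of "h + 1/2"] by (intro mult_right_mono) auto
    also have "\<dots> \<le> norm (mbm_kernel R h 1 u)"
      unfolding Moving_Average mbm_kernel.simps norm_of_real using u h Gamma_real_pos[of "h + 1/2"] by simp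
    finally show "m \<le> norm (mbm_kernel R h 1 u)" .
  qed (use m in auto)
next
  case Harmonizable
  \<comment> \<open>The square root bounds \<open>norm (cis u - 1)\<close> from below on [1, 2],
    where the cosine decreases, and 4 bounds \<open>u powr (h + 1/2)\<close> from above.\<close>
  define m where "m = sqrt (2 - 2 * cos 1) / 4"
  have c1: "cos (1::real) < 1" using cos_monotone_0_pi[of 0 1] pi_gt3 by simp
  show thesis
  proof (rule that[of m 1 2])
    show "0 < m" using c1 by (simp add: m_def)
    fix h u :: real assume h: "h \<in> {0..1}" and u: "u \<in> {1..2}"
    have "cos u \<le> cos 1" using u pi_gt3 by (intro cos_monotone_0_pi_le) auto
    moreover have "(norm (cis u - 1))\<^sup>2 = 2 - 2 * cos u"
    proof -
      have "(norm (cis u - 1))\<^sup>2 = (cos u)\<^sup>2 + (sin u)\<^sup>2 + 1 - 2 * cos u"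
        unfolding cmod_power2 by (simp add: power2_diff)
      then show ?thesis by simp
    qed
    ultimately have "2 - 2 * cos 1 \<le> (norm (cis u - 1))\<^sup>2" by simp
    then have 1: "sqrt (2 - 2 * cos 1) \<le> norm (cis u - 1)" by (simp add: real_le_lsqrt)
    have "u powr (h + 1/2) \<le> u powr 2" using u h by (intro powr_mono) auto
    also have "u powr 2 = u\<^sup>2" using u by simp
    also have "u\<^sup>2 \<le> 4" using u power_mono[of u 2 2] by simp
    finally have 2: "u powr (h + 1/2) \<le> 4" .
    have "m \<le> norm (cis u - 1) / u powr (h + 1/2)"
      unfolding m_def using 1 2 u c1 by (intro frac_le) auto
    also have "\<dots> = norm (mbm_kernel R h 1 u)"
      using u by (simp add: Harmonizable norm_divide)
    finally show "m \<le> norm (mbm_kernel R h 1 u)" .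
  qed simp
qed

text \<open>Scaling to time 1 splits the change of index into the change of \<open>t powr h\<close>
  and the change of the kernel at time 1. The variance is bounded above by comparison with index 1/2
  and below by \<open>mbm_kernel_lower_bound\<close>.\<close>

lemma mbm_kernel_lipschitz:
  assumes mu: "0 < \<mu>" and nu: "\<nu> < 1"
  obtains C c1 c2 where "0 \<le> C" "0 < c1"
    "\<And>h h' t. h \<in> {\<mu>..\<nu>} \<Longrightarrow> h' \<in> {\<mu>..\<nu>} \<Longrightarrow> t \<in> {0..T} \<Longrightarrow>
       (l2sq (\<lambda>u. mbm_kernel R h t u - mbm_kernel R h' t u)) \<le> C * (h - h')\<^sup>2"
    "\<And>h. h \<in> {\<mu>..\<nu>} \<Longrightarrow> c1 \<le> mbm_variance R h \<and> mbm_variance R h \<le> c2"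
proof -
  define \<mu>' \<nu>' where "\<mu>' = min \<mu> (1/4)" and "\<nu>' = max \<nu> (3/4)"
  have m: "0 < \<mu>'" "\<mu>' < 1/2" "1/2 < \<nu>'" "\<nu>' < 1" using assms by (auto simp: \<mu>'_def \<nu>'_def)
  have sub: "h \<in> {\<mu>'..\<nu>'}" if "h \<in> {\<mu>..\<nu>}" for h using that by (auto simp: \<mu>'_def \<nu>'_def)
  obtain G :: "real \<Rightarrow> real" where G: "square_integrable lborel G" "\<And>u. 0 \<le> G u"
    "\<And>h h' u. h \<in> {\<mu>'..\<nu>'} \<Longrightarrow> h' \<in> {\<mu>'..\<nu>'} \<Longrightarrow> norm (mbm_kernel R h 1 u - mbm_kernel R h' 1 u) \<le> \<bar>h - h'\<bar> * G u"
    using mbm_kernel_unit_lipschitz[OF m, of R] by blast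
  define g where "g = l2sq G"
  have g0: "0 \<le> g" by (simp add: g_def)
  have sq: "square_integrable lborel (mbm_kernel R h t)" if "h \<in> {\<mu>'..\<nu>'}" "0 \<le> t" for h t
    using that m by (intro square_integrable_mbm_kernel) auto
  have lip1: "l2sq (\<lambda>u. mbm_kernel R h 1 u - mbm_kernel R h' 1 u) \<le> (h - h')\<^sup>2 * g"
    if h: "h \<in> {\<mu>'..\<nu>'}" "h' \<in> {\<mu>'..\<nu>'}" for h h'
  proof -
    have "l2sq (\<lambda>u. mbm_kernel R h 1 u - mbm_kernel R h' 1 u) \<le> (\<integral>u. (h - h')\<^sup>2 * (norm (G u))\<^sup>2 \<partial>lborel)"
    proof (rule integral_mono)
      show "integrable lborel (\<lambda>u. (norm (mbm_kernel R h 1 u - mbm_kernel R h' 1 u))\<^sup>2)"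
        using square_integrable_diff[OF sq[OF h(1)] sq[OF h(2)], of 1 1] by (simp add: square_integrable_def)
      show "integrable lborel (\<lambda>u. (h - h')\<^sup>2 * (norm (G u))\<^sup>2)" using G(1) by (simp add: square_integrable_def)
      show "(norm (mbm_kernel R h 1 u - mbm_kernel R h' 1 u))\<^sup>2 \<le> (h - h')\<^sup>2 * (norm (G u))\<^sup>2" for u
        using power_mono[OF G(3)[OF h, of u] norm_ge_zero, of 2] by (simp add: power_mult_distrib)
    qed
    then show ?thesis by (simp add: g_def)
  qed
  define c2 where "c2 = 2 * g + 2 * mbm_variance R (1/2)"
  have upp: "mbm_variance R h \<le> c2" if h: "h \<in> {\<mu>'..\<nu>'}" for h
  proof -
    have half: "1/2 \<in> {\<mu>'..\<nu>'}" using m by auto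
    have "mbm_variance R h = l2sq (\<lambda>u. (mbm_kernel R h 1 u - mbm_kernel R (1/2) 1 u) + mbm_kernel R (1/2) 1 u)"
      by (simp add: mbm_variance_def)
    also have "\<dots> \<le> 2 * l2sq (\<lambda>u. mbm_kernel R h 1 u - mbm_kernel R (1/2) 1 u) + 2 * mbm_variance R (1/2)"
      unfolding mbm_variance_def using h half by (intro integral_square_add_le square_integrable_diff sq) auto
    also have "\<dots> \<le> 2 * ((h - 1/2)\<^sup>2 * g) + 2 * mbm_variance R (1/2)"
      using lip1[OF h half] by (intro add_mono mult_left_mono) auto
    also have "\<dots> \<le> c2"
      unfolding c2_def using h m g0
      by (intro add_mono mult_left_mono order_refl mult_left_le_one_le) (auto simp: power2_le_iff_abs_le abs_square_le_1 abs_le_iff)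
    finally show ?thesis .
  qed
  obtain m0 a b where low: "0 < m0" "a < b" "\<And>h u. h \<in> {0..1} \<Longrightarrow> u \<in> {a..b} \<Longrightarrow> m0 \<le> norm (mbm_kernel R h 1 u)"
    using mbm_kernel_lower_bound[of R] by blast
  define c1 where "c1 = m0\<^sup>2 * (b - a)"
  have c1: "0 < c1" using low by (simp add: c1_def)
  have lower: "c1 \<le> mbm_variance R h" if h: "h \<in> {\<mu>'..\<nu>'}" for h
  proof -
    have "c1 = (\<integral>u. indicat_real {a..b} u * m0\<^sup>2 \<partial>lborel)" using low by (simp add: c1_def)
    also have "\<dots> \<le> mbm_variance R h" unfolding mbm_variance_def
    proof (rule integral_mono)
      show "integrable lborel (\<lambda>u. indicat_real {a..b} u * m0\<^sup>2)"
        by (intro integrable_mult_left integrable_real_indicator emeasure_bounded_finite) auto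
      show "integrable lborel (\<lambda>u. (norm (mbm_kernel R h 1 u))\<^sup>2)" using sq[OF h, of 1] by (simp add: square_integrable_def)
      show "indicat_real {a..b} u * m0\<^sup>2 \<le> (norm (mbm_kernel R h 1 u))\<^sup>2" for u
        using low(1) low(3)[of h u] h m by (auto simp: indicator_def intro!: power_mono)
    qed
    finally show ?thesis .
  qed
  define T1 where "T1 = max 1 T"
  \<comment> \<open>The Lipschitz constant of \<open>t powr h\<close> in \<open>h\<close> with loss
    \<open>\<mu>'\<close>: on [0, 1] the envelope is 1, beyond it at most \<open>T1 * T1\<close>,
    and \<open>T1 * (1 + T1)\<close> dominates both.\<close>
  define K where "K = T1 * (1 + T1) * (1 / \<mu>')"
  define C where "C = 2 * K\<^sup>2 * c2 + 2 * T1\<^sup>2 * g"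
  have T1: "1 \<le> T1" "T \<le> T1" by (auto simp: T1_def)
  have c2: "0 \<le> c2" using g0 by (simp add: c2_def mbm_variance_def)
  show thesis
  proof (rule that[of C c1])
    show "0 \<le> C" using g0 c2 by (simp add: C_def)
    fix h h' t assume h: "h \<in> {\<mu>..\<nu>}" "h' \<in> {\<mu>..\<nu>}" and t: "t \<in> {0..T}"
    note h' = h[THEN sub]
    show "l2sq (\<lambda>u. mbm_kernel R h t u - mbm_kernel R h' t u) \<le> C * (h - h')\<^sup>2"
    proof (cases "t = 0")
      case True then show ?thesis using \<open>0 \<le> C\<close> by simp
    next
      case False
      then have t0: "0 < t" using t by simp
      have tb: "t powr x \<le> T1" if "0 \<le> x" "x \<le> 1" for x
      proof -
        have "t powr x \<le> T1 powr x" using t0 t T1 that by (intro powr_mono2) auto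
        also have "\<dots> \<le> T1 powr 1" using T1 that by (intro powr_mono) auto
        finally show ?thesis using T1 by simp
      qed
      have pl: "\<bar>t powr h - t powr h'\<bar> \<le> K * \<bar>h - h'\<bar>"
      proof -
        have "\<bar>t powr h - t powr h'\<bar> \<le> \<bar>h - h'\<bar> * ((if t \<le> 1 then t powr (\<mu>' - \<mu>') else t powr (\<nu>' + \<mu>')) / \<mu>')"
          using powr_exponent_lipschitz[OF t0 h' m(1)] .
        also have "\<dots> \<le> \<bar>h - h'\<bar> * (T1 * (1 + T1) / \<mu>')"
        proof (intro mult_left_mono divide_right_mono)
          have "t powr (\<nu>' + \<mu>') \<le> T1 * T1"
            unfolding powr_add using tb[of \<nu>'] tb[of \<mu>'] m T1 by (intro mult_mono) auto
          moreover have "1 \<le> T1 * (1 + T1)" using T1 mult_mono[of 1 T1 1 "1 + T1"] by simp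
          moreover have "T1 * T1 \<le> T1 * (1 + T1)" using T1 by simp
          ultimately show "(if t \<le> 1 then t powr (\<mu>' - \<mu>') else t powr (\<nu>' + \<mu>')) \<le> T1 * (1 + T1)"
            using t0 by auto
        qed (use m in auto)
        finally show ?thesis by (simp add: K_def mult.commute)
      qed
      have "l2sq (\<lambda>u. mbm_kernel R h t u - mbm_kernel R h' t u)
        = l2sq (\<lambda>u. (t powr h) *\<^sub>R mbm_kernel R h 1 u - (t powr h') *\<^sub>R mbm_kernel R h' 1 u)"
        using integral_square_mbm_kernel_scaling(1)[OF t0, of 1 R h 1 h'] by simp
      also have "\<dots> = l2sq (\<lambda>u. (t powr h - t powr h') *\<^sub>R mbm_kernel R h 1 u + (t powr h') *\<^sub>R (mbm_kernel R h 1 u - mbm_kernel R h' 1 u))"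
        by (simp add: algebra_simps)
      also have "\<dots> \<le> 2 * l2sq (\<lambda>u. (t powr h - t powr h') *\<^sub>R mbm_kernel R h 1 u)
          + 2 * l2sq (\<lambda>u. (t powr h') *\<^sub>R (mbm_kernel R h 1 u - mbm_kernel R h' 1 u))"
        using h' by (intro integral_square_add_le square_integrable_scaleR square_integrable_diff sq) auto
      also have "\<dots> = 2 * ((t powr h - t powr h')\<^sup>2 * mbm_variance R h)
          + 2 * ((t powr h')\<^sup>2 * l2sq (\<lambda>u. mbm_kernel R h 1 u - mbm_kernel R h' 1 u))"
        by (simp add: power_mult_distrib mbm_variance_def)
      also have "\<dots> \<le> 2 * ((K * \<bar>h - h'\<bar>)\<^sup>2 * c2) + 2 * (T1\<^sup>2 * ((h - h')\<^sup>2 * g))"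
      proof (intro add_mono mult_left_mono mult_mono)
        show "(t powr h - t powr h')\<^sup>2 \<le> (K * \<bar>h - h'\<bar>)\<^sup>2"
          using power_mono[OF pl abs_ge_zero, of 2] by simp
        show "mbm_variance R h \<le> c2" by (rule upp[OF h'(1)])
        show "(t powr h')\<^sup>2 \<le> T1\<^sup>2" using tb[of h'] h'(2) m by (intro power_mono) auto
        show "l2sq (\<lambda>u. mbm_kernel R h 1 u - mbm_kernel R h' 1 u) \<le> (h - h')\<^sup>2 * g" by (rule lip1[OF h'])
      qed (use g0 c2 in \<open>auto simp: mbm_variance_def\<close>)
      also have "\<dots> = C * (h - h')\<^sup>2" by (simp add: C_def power_mult_distrib algebra_simps)
      finally show ?thesis .
    qed
  qed (use c1 lower upp sub in auto)
qed

section \<open>From the kernels to the characteristic functions of the process\<close>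

lemma mbm_measurable:
  assumes B: "multifractional_brownian_motion R M H B" and t: "0 \<le> t"
  shows "B t \<in> borel_measurable M"
proof -
  have "(\<lambda>(t, \<omega>). B t \<omega>) \<in> borel_measurable (restrict_space borel {0..} \<Otimes>\<^sub>M M)"
    using B by (simp add: multifractional_brownian_motion_def)
  from measurable_Pair2[OF this, of t] t show ?thesis by (simp add: space_restrict_space)
qed

lemma isCont_harmonizable_kernel:
  assumes "\<xi> \<noteq> 0"
  shows "isCont (mbm_kernel Harmonizable h t) \<xi>"
proof -
  have "isCont (\<lambda>\<xi>. (cis (t * \<xi>) - 1) / complex_of_real (\<bar>\<xi>\<bar> powr (h + 1/2))) \<xi>"
    using assms unfolding cis_conv_exp by (intro continuous_intros) auto
  then show ?thesis unfolding mbm_kernel.simps[abs_def] .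
qed

text \<open>A finite combination of values is almost surely the Wiener integral of the same
  combination of integrands, because finitely many exceptional null sets are discarded. In the
  harmonizable case the integrand is a Fourier transform; Plancherel replaces its norm by that of
  the kernels, which are continuous away from frequency 0.\<close>

lemma mbm_expectation_cis:
  assumes B: "multifractional_brownian_motion R M H B" and t: "\<And>i. i \<in> I \<Longrightarrow> 0 \<le> t i"
  shows "(\<integral>\<omega>. cis (\<Sum>i\<in>I. a i * B (t i) \<omega>) \<partial>M)
    = complex_of_real (exp (- l2sq (\<lambda>u. \<Sum>i\<in>I. a i *\<^sub>R mbm_kernel R (H (t i)) (t i) u) / 2))"
proof -
  obtain W where W: "two_sided_brownian_motion M W"
    and rep: "\<And>t. 0 \<le> t \<Longrightarrow> (case R of
            Moving_Average \<Rightarrow> moving_average_at M W (H t) t (B t)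
          | Harmonizable \<Rightarrow> harmonizable_at M W (H t) t (B t))"
    using B by (auto simp: multifractional_brownian_motion_def)
  have Wm: "\<And>t. W t \<in> borel_measurable M" using W by (auto simp: two_sided_brownian_motion_def)
  have Bm: "\<And>i. i \<in> I \<Longrightarrow> B (t i) \<in> borel_measurable M" using mbm_measurable[OF B] t by auto
  then have Sm[measurable]: "(\<lambda>\<omega>. \<Sum>i\<in>I. a i * B (t i) \<omega>) \<in> borel_measurable M" by measurable
  show ?thesis
  proof (cases R)
    case Moving_Average
    define f where "f i u = (max 0 (t i - u) powr (H (t i) - 1/2) - max 0 (- u) powr (H (t i) - 1/2)) / Gamma (H (t i) + 1/2)" for i u
    have "\<exists>Z. has_wiener_integral M W (f i) Z \<and> (AE \<omega> in M. B (t i) \<omega> = Z \<omega>)" if i: "i \<in> I" for i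
    proof -
      obtain X Y where X: "has_wiener_integral M W
              (\<lambda>u. indicat_real {..<0} u * ((t i - u) powr (H (t i) - 1/2) - (- u) powr (H (t i) - 1/2))) X"
        and Y: "has_wiener_integral M W
              (\<lambda>u. indicat_real {0..t i} u * (t i - u) powr (H (t i) - 1/2)) Y"
        and Z: "AE \<omega> in M. B (t i) \<omega> = 1 / Gamma (H (t i) + 1/2) * (X \<omega> + Y \<omega>)"
        using rep[OF t[OF i]] by (auto simp: Moving_Average moving_average_at_def)
      have lin: "linear (\<lambda>x::real. 1 / Gamma (H (t i) + 1/2) * x)"
        by (intro linearI) (simp_all add: ring_distribs)
      have "f i = (\<lambda>u. 1 / Gamma (H (t i) + 1/2) * (indicat_real {..<0} u * ((t i - u) powr (H (t i) - 1/2) - (- u) powr (H (t i) - 1/2))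
        + indicat_real {0..t i} u * (t i - u) powr (H (t i) - 1/2)))"
        using t[OF i] by (auto simp: f_def fun_eq_iff indicator_def)
      with has_wiener_integral_linear[OF has_wiener_integral_add[OF X Y Wm] Wm lin] Z show ?thesis by auto
    qed
    then obtain Z where Z: "\<And>i. i \<in> I \<Longrightarrow> has_wiener_integral M W (f i) (Z i)" "\<And>i. i \<in> I \<Longrightarrow> AE \<omega> in M. B (t i) \<omega> = Z i \<omega>"
      by metis
    have S: "has_wiener_integral M W (\<lambda>u. \<Sum>i\<in>I. a i *\<^sub>R f i u) (\<lambda>\<omega>. \<Sum>i\<in>I. a i *\<^sub>R Z i \<omega>)"
      by (rule has_wiener_integral_sum[OF Z(1) Wm])
    then have [measurable]: "(\<lambda>\<omega>. \<Sum>i\<in>I. a i *\<^sub>R Z i \<omega>) \<in> borel_measurable M" unfolding has_wiener_integral_def by blast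
    have eq: "norm (\<Sum>i\<in>I. a i *\<^sub>R f i u) = norm (\<Sum>i\<in>I. a i *\<^sub>R mbm_kernel R (H (t i)) (t i) u)" for u
    proof -
      have "(\<Sum>i\<in>I. a i *\<^sub>R mbm_kernel R (H (t i)) (t i) u) = complex_of_real (\<Sum>i\<in>I. a i *\<^sub>R f i u)"
        by (simp add: Moving_Average f_def scaleR_conv_of_real)
      then show ?thesis by (simp only: norm_of_real real_norm_def)
    qed
    have "AE \<omega> in M. (\<Sum>i\<in>I. a i * B (t i) \<omega>) = (\<Sum>i\<in>I. a i *\<^sub>R Z i \<omega>)"
    proof (cases "finite I")
      case True
      then have "AE \<omega> in M. \<forall>i\<in>I. B (t i) \<omega> = Z i \<omega>" using Z(2) by (intro AE_finite_allI) auto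
      then show ?thesis by eventually_elim simp
    qed simp
    then have "(\<integral>\<omega>. cis (\<Sum>i\<in>I. a i * B (t i) \<omega>) \<partial>M) = (\<integral>\<omega>. cis (\<Sum>i\<in>I. a i *\<^sub>R Z i \<omega>) \<partial>M)"
      by (intro integral_cong_AE borel_measurable_cis Sm) (measurable, auto elim!: eventually_mono)
    also have "\<dots> = complex_of_real (exp (- l2sq (\<lambda>u. \<Sum>i\<in>I. a i *\<^sub>R f i u) / 2))"
      by (rule has_wiener_integral_expectation_cis[OF W S])
    finally show ?thesis unfolding eq .
  next
    case Harmonizable
    define f where "f i = mbm_kernel R (H (t i)) (t i)" for i
    have "\<exists>g X. has_fourier_transform (f i) g \<and> has_wiener_integral M W g X \<and> (AE \<omega> in M. complex_of_real (B (t i) \<omega>) = X \<omega>)"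
      if i: "i \<in> I" for i
    proof -
      have "f i = (\<lambda>\<xi>. (exp (\<i> * of_real (t i * \<xi>)) - 1) / of_real (\<bar>\<xi>\<bar> powr (H (t i) + 1/2)))"
        by (simp add: f_def Harmonizable cis_conv_exp fun_eq_iff)
      then show ?thesis
        using rep[OF t[OF i]] by (auto simp: Harmonizable harmonizable_at_def has_harmonizable_integral_def)
    qed
    then obtain g X where gX: "\<And>i. i \<in> I \<Longrightarrow> has_fourier_transform (f i) (g i)"
      "\<And>i. i \<in> I \<Longrightarrow> has_wiener_integral M W (g i) (X i)" "\<And>i. i \<in> I \<Longrightarrow> AE \<omega> in M. complex_of_real (B (t i) \<omega>) = X i \<omega>"
      by metis
    have S: "has_wiener_integral M W (\<lambda>u. \<Sum>i\<in>I. a i *\<^sub>R g i u) (\<lambda>\<omega>. \<Sum>i\<in>I. a i *\<^sub>R X i \<omega>)"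
      by (rule has_wiener_integral_sum[OF gX(2) Wm])
    have F: "has_fourier_transform (\<lambda>u. \<Sum>i\<in>I. a i *\<^sub>R f i u) (\<lambda>u. \<Sum>i\<in>I. a i *\<^sub>R g i u)"
      by (rule has_fourier_transform_sum[OF gX(1)])
    have "AE \<omega> in M. complex_of_real (\<Sum>i\<in>I. a i * B (t i) \<omega>) = (\<Sum>i\<in>I. a i *\<^sub>R X i \<omega>)"
    proof (cases "finite I")
      case True
      then have "AE \<omega> in M. \<forall>i\<in>I. complex_of_real (B (t i) \<omega>) = X i \<omega>" using gX(3) by (intro AE_finite_allI) auto
      then show ?thesis by eventually_elim (simp add: scaleR_conv_of_real)
    qed simp
    note E = has_wiener_integral_real_valued[OF W S this Sm]
    have "AE u in lborel. isCont (\<lambda>u. \<Sum>i\<in>I. a i *\<^sub>R f i u) u"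
    proof -
      have "AE u in lborel. u \<noteq> (0::real)" by (rule AE_lborel_singleton)
      then show ?thesis
        by eventually_elim (intro continuous_intros, unfold f_def Harmonizable, rule isCont_harmonizable_kernel)
    qed
    from plancherel[OF F this] E show ?thesis by (simp add: f_def)
  qed
qed

section \<open>Local behaviour of the kernels\<close>

text \<open>The derivative of the power beyond \<open>s \<ge> d\<close> is at most
  \<open>h * d powr (h - 1)\<close>. Compared with subadditivity this saves the factor
  \<open>h\<close> on the smaller summand, and the slack \<open>1 - h\<close> becomes the
  nondegeneracy constant of fractional Brownian motion.\<close>

lemma powr_add_le:
  assumes d: "0 < d" "d \<le> s" and h: "0 < h" "h < 1"
  shows "(s + d) powr h \<le> s powr h + h * d powr (h::real)"
proof -
  have der: "((\<lambda>x. x powr h) has_real_derivative h * x powr (h - 1)) (at x)" if "s \<le> x" for x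
    using that d by (intro has_real_derivative_powr) auto
  obtain z where z: "s < z" "z < s + d" "(s + d) powr h - s powr h = (s + d - s) * (h * z powr (h - 1))"
    using MVT2[of s "s + d" "\<lambda>x. x powr h" "\<lambda>x. h * x powr (h - 1)", OF _ der] d
    by auto
  have "z powr (h - 1) \<le> d powr (h - 1)" using z d h by (intro powr_mono2') auto
  then have "(s + d) powr h - s powr h \<le> d * (h * d powr (h - 1))"
    unfolding z(3) using d h by (intro mult_mono) auto
  also have "\<dots> = h * (d powr 1 * d powr (h - 1))" using d by simp
  also have "\<dots> = h * d powr h" unfolding powr_add[symmetric] by simp
  finally show ?thesis by simp
qed

text \<open>Up to a factor, the determinant of the covariance of two values of fractional Brownian motion
  is given by Heron's formula for the triangle with sides \<open>s\<^sup>h\<close>, \<open>d\<^sup>h\<close> and \<open>(s + d)\<^sup>h\<close>; the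
  two correlation bounds are the factorizations of \<open>(x + y)\<^sup>2 - z\<^sup>2\<close> and \<open>z\<^sup>2 - (x - y)\<^sup>2\<close>.\<close>

lemma fbm_quadratic_form_lower_bound:
  assumes s: "0 \<le> s" and d: "0 \<le> d" and h: "0 < h" "h \<le> \<nu>" and nu: "\<nu> < 1"
  shows "min (1 - \<nu>) (1/2) * (\<alpha>\<^sup>2 * s powr (2 * h) + \<gamma>\<^sup>2 * d powr (2 * h))
    \<le> \<alpha>\<^sup>2 * s powr (2 * h) + \<gamma>\<^sup>2 * d powr (2 * h) + \<alpha> * \<gamma> * ((s + d) powr (2 * h) - s powr (2 * h) - d powr (2 * h :: real))"
proof -
  \<comment> \<open>The term \<open>1 - \<nu>\<close> is the slack of \<open>powr_add_le\<close> and
    serves the upper correlation bound; the term 1/2 is what the lower correlation bound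
    allows.\<close>
  define \<kappa> where "\<kappa> = min (1 - \<nu>) (1/2 :: real)"
  have k: "0 < \<kappa>" "\<kappa> \<le> 1 - h" "\<kappa> \<le> 1/2" using nu h by (auto simp: \<kappa>_def min_def)
  define x y z where "x = s powr h" and "y = d powr h" and "z = (s + d) powr h"
  have sq: "s powr (2 * h) = x\<^sup>2" "d powr (2 * h) = y\<^sup>2" "(s + d) powr (2 * h) = z\<^sup>2"
    by (simp_all add: x_def y_def z_def power2_eq_square powr_add[symmetric])
  have xy0: "0 \<le> x" "0 \<le> y" by (auto simp: x_def y_def)
  have mono: "x \<le> z" "y \<le> z" using s d h by (auto simp: x_def y_def z_def intro!: powr_mono2)
  have "x + y - z \<ge> (1 - h) * min x y"
  proof (cases "s = 0 \<or> d = 0")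
    case True
    then show ?thesis using h xy0 by (auto simp: x_def y_def z_def min_def)
  next
    case False
    then have pos: "0 < s" "0 < d" using s d by auto
    show ?thesis
    proof (cases "d \<le> s")
      case True
      have "min x y = y" using True pos h by (auto simp: x_def y_def min_def intro!: powr_mono2 antisym)
      then show ?thesis using powr_add_le[of d s h] True pos h nu by (simp add: x_def y_def z_def algebra_simps)
    next
      case False
      have "min x y = x" using False pos h by (auto simp: x_def y_def min_def intro!: powr_mono2)
      then show ?thesis using powr_add_le[of s d h] False pos h nu by (simp add: x_def y_def z_def algebra_simps)
    qed
  qed
  then have a: "\<kappa> * min x y \<le> x + y - z"
    using k mult_right_mono[of \<kappa> "1 - h" "min x y"] xy0 by simp
  have xyz: "0 \<le> x + y - z" using a k xy0 by (intro order_trans[OF _ a]) auto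
  have mM: "min x y * max x y = x * y" by (simp add: min_def max_def)
  have "2 * \<kappa> * (x * y) = (\<kappa> * min x y) * (2 * max x y)" by (simp add: mM[symmetric])
  also have "\<dots> \<le> (x + y - z) * (x + y + z)"
    using a mono xy0 k xyz by (intro mult_mono) (auto simp: max_def)
  finally have up: "2 * \<kappa> * (x * y) \<le> 2 * (x * y) - (z\<^sup>2 - x\<^sup>2 - y\<^sup>2)"
    by (simp add: power2_eq_square algebra_simps)
  have "x * y = min x y * max x y" by (simp add: mM)
  also have "\<dots> \<le> (z - \<bar>x - y\<bar>) * (z + \<bar>x - y\<bar>)"
    using mono xy0 by (intro mult_mono) (auto simp: min_def max_def abs_if)
  also have "\<dots> = z\<^sup>2 - (x - y)\<^sup>2" by (simp add: power2_eq_square algebra_simps flip: abs_mult)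
  finally have "x * y \<le> z\<^sup>2 - (x - y)\<^sup>2" .
  moreover have "2 * \<kappa> * (x * y) \<le> x * y" using k xy0 mult_right_mono[of "2 * \<kappa>" 1 "x * y"] by simp
  ultimately have lo: "2 * \<kappa> * (x * y) \<le> 2 * (x * y) + (z\<^sup>2 - x\<^sup>2 - y\<^sup>2)"
    by (simp add: power2_eq_square algebra_simps)
  define e where "e = z\<^sup>2 - x\<^sup>2 - y\<^sup>2"
  have e: "\<bar>e\<bar> \<le> (1 - \<kappa>) * (2 * (x * y))" using up lo by (simp add: e_def abs_le_iff algebra_simps)
  have "\<bar>\<alpha> * \<gamma> * e\<bar> \<le> \<bar>\<alpha> * \<gamma>\<bar> * ((1 - \<kappa>) * (2 * (x * y)))"
    unfolding abs_mult[of "\<alpha> * \<gamma>"] using e by (intro mult_left_mono) auto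
  also have "\<dots> = (1 - \<kappa>) * (2 * (\<bar>\<alpha>\<bar> * x) * (\<bar>\<gamma>\<bar> * y))" by (simp add: abs_mult mult_ac)
  also have "\<dots> \<le> (1 - \<kappa>) * ((\<bar>\<alpha>\<bar> * x)\<^sup>2 + (\<bar>\<gamma>\<bar> * y)\<^sup>2)"
    using k by (intro mult_left_mono sum_squares_bound) auto
  finally have "- ((1 - \<kappa>) * (\<alpha>\<^sup>2 * x\<^sup>2 + \<gamma>\<^sup>2 * y\<^sup>2)) \<le> \<alpha> * \<gamma> * e"
    by (simp add: power_mult_distrib abs_le_iff)
  then show ?thesis unfolding \<kappa>_def[symmetric] sq e_def[symmetric] by (simp add: algebra_simps)
qed

text \<open>The norm of any combination is determined by the norms and mutual distances of its
  members. For kernels of constant index exactly these quantities are known in closed form.\<close>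

lemma norm_sum_square_polarization:
  fixes v :: "'i \<Rightarrow> 'b::real_inner"
  shows "(norm (\<Sum>i\<in>I. a i *\<^sub>R v i))\<^sup>2
    = (\<Sum>i\<in>I. \<Sum>j\<in>I. a i * a j * (((norm (v i))\<^sup>2 + (norm (v j))\<^sup>2 - (norm (v i - v j))\<^sup>2) / 2))"
proof -
  have "v i \<bullet> v j = ((norm (v i))\<^sup>2 + (norm (v j))\<^sup>2 - (norm (v i - v j))\<^sup>2) / 2" for i j
    by (simp add: power2_norm_eq_inner inner_simps inner_commute)
  moreover have "(norm (\<Sum>i\<in>I. a i *\<^sub>R v i))\<^sup>2 = (\<Sum>i\<in>I. \<Sum>j\<in>I. a i * a j * (v i \<bullet> v j))"
    unfolding power2_norm_eq_inner inner_sum_left inner_sum_right by (simp add: mult_ac inner_commute)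
  ultimately show ?thesis by (simp only:)
qed

lemma integral_square_sum_polarization:
  fixes f :: "'i \<Rightarrow> 'a \<Rightarrow> 'b::euclidean_space"
  assumes f: "\<And>i. i \<in> I \<Longrightarrow> square_integrable M (f i)"
  shows "(\<integral>x. (norm (\<Sum>i\<in>I. a i *\<^sub>R f i x))\<^sup>2 \<partial>M)
    = (\<Sum>i\<in>I. \<Sum>j\<in>I. a i * a j * (((\<integral>x. (norm (f i x))\<^sup>2 \<partial>M) + (\<integral>x. (norm (f j x))\<^sup>2 \<partial>M) - (\<integral>x. (norm (f i x - f j x))\<^sup>2 \<partial>M)) / 2))"
proof -
  have i: "integrable M (\<lambda>x. (norm (f i x))\<^sup>2)" "integrable M (\<lambda>x. (norm (f i x - f j x))\<^sup>2)"
    if "i \<in> I" "j \<in> I" for i j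
    using f[OF that(1)] square_integrable_diff[OF f[OF that(1)] f[OF that(2)]] by (auto simp: square_integrable_def)
  have "(\<integral>x. (norm (\<Sum>i\<in>I. a i *\<^sub>R f i x))\<^sup>2 \<partial>M)
    = (\<Sum>i\<in>I. \<Sum>j\<in>I. (\<integral>x. a i * a j * (((norm (f i x))\<^sup>2 + (norm (f j x))\<^sup>2 - (norm (f i x - f j x))\<^sup>2) / 2) \<partial>M))"
    unfolding norm_sum_square_polarization
    using i by (subst Bochner_Integration.integral_sum | auto)+
  also have "\<dots> = (\<Sum>i\<in>I. \<Sum>j\<in>I. a i * a j * (((\<integral>x. (norm (f i x))\<^sup>2 \<partial>M) + (\<integral>x. (norm (f j x))\<^sup>2 \<partial>M) - (\<integral>x. (norm (f i x - f j x))\<^sup>2 \<partial>M)) / 2))"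
    using i by (intro sum.cong refl) simp
  finally show ?thesis .
qed

lemma tendsto_integral_square_sum_0:
  fixes f :: "'r \<Rightarrow> 'i \<Rightarrow> 'a \<Rightarrow> 'b::euclidean_space"
  assumes "\<And>i. i \<in> I \<Longrightarrow> ((\<lambda>r. \<integral>x. (norm (f r i x))\<^sup>2 \<partial>M) \<longlongrightarrow> 0) F"
    and sq: "eventually (\<lambda>r. \<forall>i\<in>I. square_integrable M (f r i)) F"
  shows "((\<lambda>r. \<integral>x. (norm (\<Sum>i\<in>I. f r i x))\<^sup>2 \<partial>M) \<longlongrightarrow> 0) F"
  using assms
proof (induction I rule: infinite_finite_induct)
  case (insert i I)
  have IH: "((\<lambda>r. \<integral>x. (norm (\<Sum>i\<in>I. f r i x))\<^sup>2 \<partial>M) \<longlongrightarrow> 0) F"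
    using insert.prems by (intro insert.IH) (auto elim: eventually_mono)
  have lim: "((\<lambda>r. 2 * (\<integral>x. (norm (f r i x))\<^sup>2 \<partial>M) + 2 * (\<integral>x. (norm (\<Sum>i\<in>I. f r i x))\<^sup>2 \<partial>M)) \<longlongrightarrow> 2 * 0 + 2 * 0) F"
    by (intro tendsto_intros IH insert.prems) auto
  show ?case
  proof (rule tendsto_sandwich[OF _ _ tendsto_const lim[simplified]])
    show "eventually (\<lambda>r. (\<integral>x. (norm (\<Sum>i\<in>insert i I. f r i x))\<^sup>2 \<partial>M)
      \<le> 2 * (\<integral>x. (norm (f r i x))\<^sup>2 \<partial>M) + 2 * (\<integral>x. (norm (\<Sum>i\<in>I. f r i x))\<^sup>2 \<partial>M)) F"
      using insert.prems(2)
    proof eventually_elim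
      case (elim r)
      have "(\<integral>x. (norm (f r i x + (\<Sum>i\<in>I. f r i x)))\<^sup>2 \<partial>M)
        \<le> 2 * (\<integral>x. (norm (f r i x))\<^sup>2 \<partial>M) + 2 * (\<integral>x. (norm (\<Sum>i\<in>I. f r i x))\<^sup>2 \<partial>M)"
        using elim by (intro integral_square_add_le square_integrable_sum) auto
      then show ?case using insert.hyps by simp
    qed
  qed (auto intro!: always_eventually)
qed auto

text \<open>Two adjacent increments add up to a third one, so polarization expresses their inner
  product through the variances of the three.\<close>

lemma integral_square_fbm_pair:
  assumes h: "0 < h" "h < 1" and t: "0 \<le> r" "0 \<le> s" "0 \<le> d"
  shows "l2sq (\<lambda>u. \<alpha> *\<^sub>R (mbm_kernel R h (r + s) u - mbm_kernel R h r u)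
      + \<gamma> *\<^sub>R (mbm_kernel R h (r + s + d) u - mbm_kernel R h (r + s) u))
    = mbm_variance R h * (\<alpha>\<^sup>2 * s powr (2 * h) + \<gamma>\<^sup>2 * d powr (2 * h)
        + \<alpha> * \<gamma> * ((s + d) powr (2 * h) - s powr (2 * h) - d powr (2 * h)))"
proof -
  let ?X = "\<lambda>u. mbm_kernel R h (r + s) u - mbm_kernel R h r u"
  let ?Y = "\<lambda>u. mbm_kernel R h (r + s + d) u - mbm_kernel R h (r + s) u"
  let ?Z = "\<lambda>u. mbm_kernel R h (r + s + d) u - mbm_kernel R h r u"
  have sq: "square_integrable lborel (mbm_kernel R h t)" if "0 \<le> t" for t
    using that h by (intro square_integrable_mbm_kernel)
  have i: "integrable lborel (\<lambda>u. (norm (?X u))\<^sup>2)" "integrable lborel (\<lambda>u. (norm (?Y u))\<^sup>2)" "integrable lborel (\<lambda>u. (norm (?Z u))\<^sup>2)"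
    using t square_integrable_diff[OF sq sq] by (auto simp: square_integrable_def)
  have pol: "(norm (\<alpha> *\<^sub>R x + \<gamma> *\<^sub>R y))\<^sup>2 = \<alpha>\<^sup>2 * (norm x)\<^sup>2 + \<gamma>\<^sup>2 * (norm y)\<^sup>2 + \<alpha> * \<gamma> * ((norm (x + y))\<^sup>2 - (norm x)\<^sup>2 - (norm y)\<^sup>2)" for x y :: complex
    unfolding power2_norm_eq_inner
    by (simp add: inner_simps inner_commute) (simp add: power2_eq_square algebra_simps)
  have eq: "(norm (\<alpha> *\<^sub>R ?X u + \<gamma> *\<^sub>R ?Y u))\<^sup>2 = \<alpha>\<^sup>2 * (norm (?X u))\<^sup>2 + \<gamma>\<^sup>2 * (norm (?Y u))\<^sup>2
     + \<alpha> * \<gamma> * ((norm (?Z u))\<^sup>2 - (norm (?X u))\<^sup>2 - (norm (?Y u))\<^sup>2)" for u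
    unfolding pol by simp
  have "l2sq (\<lambda>u. \<alpha> *\<^sub>R ?X u + \<gamma> *\<^sub>R ?Y u)
    = \<alpha>\<^sup>2 * l2sq ?X + \<gamma>\<^sup>2 * l2sq ?Y
      + \<alpha> * \<gamma> * (l2sq ?Z - l2sq ?X - l2sq ?Y)"
    unfolding eq using i by simp
  then show ?thesis
    using integral_square_mbm_kernel_increment[of r "r + s" R h] integral_square_mbm_kernel_increment[of "r + s" "r + s + d" R h]
      integral_square_mbm_kernel_increment[of r "r + s + d" R h] t
    by (simp add: add.assoc algebra_simps)
qed

section \<open>Kernels of the rescaled increments near a fixed time\<close>

definition local_kernel :: "mbm_representation \<Rightarrow> (real \<Rightarrow> real) \<Rightarrow> real \<Rightarrow> real \<Rightarrow> real \<Rightarrow> real \<Rightarrow> complex" where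
  "local_kernel R H t0 \<rho> s u =
     (\<rho> powr (- H t0)) *\<^sub>R (mbm_kernel R (H (t0 + \<rho> * s)) (t0 + \<rho> * s) u - mbm_kernel R (H t0) t0 u)"

text \<open>The bound \<open>hb\<close> separates \<open>H\<close> from \<beta> uniformly. The gap
  between them is the power of \<rho> gained in the error estimates below.\<close>

locale mbm_hurst =
  fixes H :: "real \<Rightarrow> real" and \<mu> \<nu> \<beta> CH hb t0 :: real and R :: mbm_representation
  assumes mu: "0 < \<mu>" and nu: "\<nu> < 1" and Hrange: "\<And>s. 0 \<le> s \<Longrightarrow> H s \<in> {\<mu>..\<nu>}"
    and beta: "0 < \<beta>" and CH: "0 \<le> CH"
    and holder: "\<And>s t. 0 \<le> s \<Longrightarrow> 0 \<le> t \<Longrightarrow> \<bar>H s - H t\<bar> \<le> CH * \<bar>s - t\<bar> powr \<beta>"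
    and Hle: "\<And>s. 0 \<le> s \<Longrightarrow> H s \<le> hb" and hb: "hb < \<beta>" and t0: "0 \<le> t0"
begin

lemma H01: "0 \<le> s \<Longrightarrow> 0 < H s" "0 \<le> s \<Longrightarrow> H s < 1"
  using Hrange[of s] mu nu by auto

lemma square_integrable_kernel: "0 \<le> s \<Longrightarrow> 0 \<le> t \<Longrightarrow> square_integrable lborel (mbm_kernel R (H s) t)"
  using H01[of s] by (intro square_integrable_mbm_kernel) auto

lemma square_integrable_local_kernel:
  "0 \<le> \<rho> \<Longrightarrow> 0 \<le> s \<Longrightarrow> square_integrable lborel (local_kernel R H t0 \<rho> s)"
  unfolding local_kernel_def[abs_def]
  using t0 by (intro square_integrable_scaleR square_integrable_diff square_integrable_kernel) auto

text \<open>With the index frozen at \<open>H t0\<close>, self-similarity and stationary increments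
  make norms and mutual distances equal to those of the limit kernels for every \<rho>, so by
  polarization the comparison family \<open>g\<close> has the limiting norm exactly. The rest is the
  freezing error, of order \<open>\<rho> powr (2 * \<beta> - 2 * H t0)\<close>.\<close>

lemma local_kernel_tendsto:
  assumes I: "finite I" and s: "\<And>i. i \<in> I \<Longrightarrow> s i \<in> {0..1}"
  shows "((\<lambda>\<rho>. \<integral>u. (norm (\<Sum>i\<in>I. a i *\<^sub>R local_kernel R H t0 \<rho> (s i) u))\<^sup>2 \<partial>lborel)
     \<longlongrightarrow> (l2sq (\<lambda>u. \<Sum>i\<in>I. a i *\<^sub>R mbm_kernel R (H t0) (s i) u))) (at_right 0)"
proof -
  let ?h = "H t0"
  define g where "g \<rho> i u = (\<rho> powr (- ?h)) *\<^sub>R (mbm_kernel R ?h (t0 + \<rho> * s i) u - mbm_kernel R ?h t0 u)" for \<rho> i u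
  obtain C c1 c2 where C: "0 \<le> C" "0 < c1"
    "\<And>h h' t. h \<in> {\<mu>..\<nu>} \<Longrightarrow> h' \<in> {\<mu>..\<nu>} \<Longrightarrow> t \<in> {0..t0 + 1} \<Longrightarrow>
       (l2sq (\<lambda>u. mbm_kernel R h t u - mbm_kernel R h' t u)) \<le> C * (h - h')\<^sup>2"
    "\<And>h. h \<in> {\<mu>..\<nu>} \<Longrightarrow> c1 \<le> mbm_variance R h \<and> mbm_variance R h \<le> c2"
    using mbm_kernel_lipschitz[OF mu nu, of "t0 + 1" R] by blast
  have s0: "0 \<le> s i" "s i \<le> 1" if "i \<in> I" for i using s[OF that] by auto
  have small: "eventually (\<lambda>\<rho>::real. \<rho> \<in> {0<..<1}) (at_right 0)"
    by (rule eventually_at_right_real) simp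
  have gsq: "square_integrable lborel (g \<rho> i)" if "0 \<le> \<rho>" "i \<in> I" for \<rho> i
    unfolding g_def[abs_def] using that t0 s0[OF that(2)]
    by (intro square_integrable_scaleR square_integrable_diff square_integrable_kernel) auto
  have geq: "l2sq (\<lambda>u. \<Sum>i\<in>I. a i *\<^sub>R g \<rho> i u)
     = l2sq (\<lambda>u. \<Sum>i\<in>I. a i *\<^sub>R mbm_kernel R ?h (s i) u)" if r: "0 < \<rho>" for \<rho>
  proof -
    have sc: "l2sq (\<lambda>u. (\<rho> powr (- ?h)) *\<^sub>R (mbm_kernel R ?h (t0 + \<rho> * x) u - mbm_kernel R ?h (t0 + \<rho> * y) u))
      = l2sq (\<lambda>u. mbm_kernel R ?h x u - mbm_kernel R ?h y u)" if xy: "0 \<le> x" "0 \<le> y" for x y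
    proof -
      have "l2sq (\<lambda>u. (\<rho> powr (- ?h)) *\<^sub>R (mbm_kernel R ?h (t0 + \<rho> * x) u - mbm_kernel R ?h (t0 + \<rho> * y) u))
        = (\<rho> powr (- ?h))\<^sup>2 * (\<bar>\<rho> * x - \<rho> * y\<bar> powr (2 * ?h) * mbm_variance R ?h)"
        using integral_square_mbm_kernel_increment[of "t0 + \<rho> * y" "t0 + \<rho> * x" R ?h] r xy t0
        by (simp add: power_mult_distrib)
      also have "\<bar>\<rho> * x - \<rho> * y\<bar> = \<rho> * \<bar>x - y\<bar>" using r by (simp add: abs_mult flip: right_diff_distrib)
      also have "(\<rho> * \<bar>x - y\<bar>) powr (2 * ?h) = \<rho> powr (2 * ?h) * \<bar>x - y\<bar> powr (2 * ?h)"
        using r by (simp add: powr_mult)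
      also have "(\<rho> powr (- ?h))\<^sup>2 * (\<rho> powr (2 * ?h) * \<bar>x - y\<bar> powr (2 * ?h) * mbm_variance R ?h)
        = ((\<rho> powr (- ?h) * \<rho> powr (- ?h)) * \<rho> powr (2 * ?h)) * (\<bar>x - y\<bar> powr (2 * ?h) * mbm_variance R ?h)"
        by (simp add: power2_eq_square)
      also have "(\<rho> powr (- ?h) * \<rho> powr (- ?h)) * \<rho> powr (2 * ?h) = 1"
        using r unfolding powr_add[symmetric] by simp
      finally show ?thesis using integral_square_mbm_kernel_increment[of y x R ?h] xy by simp
    qed
    have gi: "l2sq (g \<rho> i) = l2sq (\<lambda>u. mbm_kernel R ?h (s i) u)" if "i \<in> I" for i
      using sc[of "s i" 0] s0[OF that] by (simp add: g_def)
    have gij: "l2sq (\<lambda>u. g \<rho> i u - g \<rho> j u) = l2sq (\<lambda>u. mbm_kernel R ?h (s i) u - mbm_kernel R ?h (s j) u)"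
      if "i \<in> I" "j \<in> I" for i j
      using sc[of "s i" "s j"] s0[OF that(1)] s0[OF that(2)] by (simp add: g_def flip: scaleR_diff_right)
    show ?thesis
      using r gi gij s0 t0
      by (subst (1 2) integral_square_sum_polarization)
        (auto intro!: gsq square_integrable_kernel sum.cong)
  qed
  show ?thesis
  proof (rule tendsto_integral_square[where g="\<lambda>\<rho> u. \<Sum>i\<in>I. a i *\<^sub>R g \<rho> i u"])
    show "eventually (\<lambda>\<rho>. square_integrable lborel (\<lambda>u. \<Sum>i\<in>I. a i *\<^sub>R local_kernel R H t0 \<rho> (s i) u)) (at_right 0)"
      using small by eventually_elim (use s0 in \<open>auto intro!: square_integrable_sum square_integrable_scaleR square_integrable_local_kernel\<close>)
    show "eventually (\<lambda>\<rho>. square_integrable lborel (\<lambda>u. \<Sum>i\<in>I. a i *\<^sub>R g \<rho> i u)) (at_right 0)"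
      using small by eventually_elim (auto intro!: square_integrable_sum square_integrable_scaleR gsq)
    show "((\<lambda>\<rho>. \<integral>u. (norm (\<Sum>i\<in>I. a i *\<^sub>R g \<rho> i u))\<^sup>2 \<partial>lborel)
     \<longlongrightarrow> (l2sq (\<lambda>u. \<Sum>i\<in>I. a i *\<^sub>R mbm_kernel R (H t0) (s i) u))) (at_right 0)"
      by (rule tendsto_eventually) (use small in \<open>eventually_elim, simp add: geq\<close>)
    have "((\<lambda>\<rho>. \<integral>u. (norm (\<Sum>i\<in>I. a i *\<^sub>R (local_kernel R H t0 \<rho> (s i) u - g \<rho> i u)))\<^sup>2 \<partial>lborel) \<longlongrightarrow> 0) (at_right 0)"
    proof (rule tendsto_integral_square_sum_0)
      show "eventually (\<lambda>\<rho>. \<forall>i\<in>I. square_integrable lborel (\<lambda>u. a i *\<^sub>R (local_kernel R H t0 \<rho> (s i) u - g \<rho> i u))) (at_right 0)"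
        using small by eventually_elim (use s0 in \<open>auto intro!: square_integrable_scaleR square_integrable_diff square_integrable_local_kernel gsq\<close>)
      fix i assume i: "i \<in> I"
      have e0: "0 < 2 * \<beta> - 2 * ?h" using Hle[OF t0] hb by simp
      define K where "K = (a i)\<^sup>2 * C * CH\<^sup>2"
      have lim: "((\<lambda>\<rho>. K * \<rho> powr (2 * \<beta> - 2 * ?h)) \<longlongrightarrow> K * 0) (at_right 0)"
      proof (intro tendsto_mult tendsto_const)
        have "((\<lambda>\<rho>::real. \<rho> powr (2 * \<beta> - 2 * ?h)) \<longlongrightarrow> 0 powr (2 * \<beta> - 2 * ?h)) (at_right 0)"
          using e0 by (intro tendsto_powr' tendsto_ident_at tendsto_const)
            (auto simp: eventually_at_right_less intro: eventually_mono[OF eventually_at_right_less])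
        then show "((\<lambda>\<rho>::real. \<rho> powr (2 * \<beta> - 2 * ?h)) \<longlongrightarrow> 0) (at_right 0)" by simp
      qed
      show "((\<lambda>\<rho>. \<integral>u. (norm (a i *\<^sub>R (local_kernel R H t0 \<rho> (s i) u - g \<rho> i u)))\<^sup>2 \<partial>lborel) \<longlongrightarrow> 0) (at_right 0)"
      proof (rule tendsto_sandwich[OF _ _ tendsto_const lim[simplified]])
        show "eventually (\<lambda>\<rho>. l2sq (\<lambda>u. a i *\<^sub>R (local_kernel R H t0 \<rho> (s i) u - g \<rho> i u)) \<le> K * \<rho> powr (2 * \<beta> - 2 * ?h)) (at_right 0)"
          using small
        proof eventually_elim
          case (elim \<rho>)
          let ?t = "t0 + \<rho> * s i"
          have t: "0 \<le> ?t" "?t \<in> {0..t0 + 1}" using elim s0[OF i] t0 mult_mono[of \<rho> 1 "s i" 1] by auto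
          have "\<bar>H ?t - ?h\<bar> \<le> CH * \<bar>?t - t0\<bar> powr \<beta>" by (rule holder[OF t(1) t0])
          also have "\<dots> \<le> CH * \<rho> powr \<beta>"
            using elim s0[OF i] CH beta by (intro mult_left_mono powr_mono2) (auto simp: abs_mult mult_left_le)
          finally have "(H ?t - ?h)\<^sup>2 \<le> (CH * \<rho> powr \<beta>)\<^sup>2" using abs_le_square_iff CH by fastforce
          then have b: "l2sq (\<lambda>u. mbm_kernel R (H ?t) ?t u - mbm_kernel R ?h ?t u) \<le> C * (CH * \<rho> powr \<beta>)\<^sup>2"
            using C(1) C(3)[OF Hrange[OF t(1)] Hrange[OF t0] t(2)] mult_left_mono by fastforce
          have "local_kernel R H t0 \<rho> (s i) u - g \<rho> i u = (\<rho> powr (- ?h)) *\<^sub>R (mbm_kernel R (H ?t) ?t u - mbm_kernel R ?h ?t u)" for u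
            by (simp add: local_kernel_def g_def algebra_simps)
          then have "l2sq (\<lambda>u. a i *\<^sub>R (local_kernel R H t0 \<rho> (s i) u - g \<rho> i u))
            = (a i)\<^sup>2 * (\<rho> powr (- ?h))\<^sup>2 * l2sq (\<lambda>u. mbm_kernel R (H ?t) ?t u - mbm_kernel R ?h ?t u)"
            by (simp add: power_mult_distrib)
          also have "\<dots> \<le> (a i)\<^sup>2 * (\<rho> powr (- ?h))\<^sup>2 * (C * (CH * \<rho> powr \<beta>)\<^sup>2)"
            using b by (intro mult_left_mono) auto
          also have "\<dots> = K * ((\<rho> powr (- ?h) * \<rho> powr (- ?h)) * (\<rho> powr \<beta> * \<rho> powr \<beta>))"
            by (simp add: K_def power_mult_distrib power2_eq_square)
          also have "(\<rho> powr (- ?h) * \<rho> powr (- ?h)) * (\<rho> powr \<beta> * \<rho> powr \<beta>) = \<rho> powr (2 * \<beta> - 2 * ?h)"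
            unfolding powr_add[symmetric] by (simp add: algebra_simps)
          finally show ?case .
        qed
      qed (auto intro!: always_eventually)
    qed
    then show "((\<lambda>\<rho>. \<integral>u. (norm ((\<Sum>i\<in>I. a i *\<^sub>R local_kernel R H t0 \<rho> (s i) u) - (\<Sum>i\<in>I. a i *\<^sub>R g \<rho> i u)))\<^sup>2 \<partial>lborel) \<longlongrightarrow> 0) (at_right 0)"
      by (simp add: scaleR_diff_right sum_subtractf)
  qed
qed

text \<open>Freezing the Hurst function at the middle time \<open>t0 + \<rho> * s\<close> makes both increments in the
  quadratic form incur an error of the order of their own length to the power \<open>\<beta>\<close>.\<close>

lemma local_kernel_bounds:
  obtains c K \<rho>0 where "0 < c" "0 \<le> K" "0 < \<rho>0"
    "\<And>\<rho> s d \<alpha> \<gamma>. 0 < \<rho> \<Longrightarrow> \<rho> < \<rho>0 \<Longrightarrow> 0 \<le> s \<Longrightarrow> 0 \<le> d \<Longrightarrow> s + d \<le> 1 \<Longrightarrow>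
      c * (\<alpha>\<^sup>2 * s powr (2 * \<nu>) + \<gamma>\<^sup>2 * d powr (2 * \<nu>))
      \<le> l2sq (\<lambda>u. \<alpha> *\<^sub>R local_kernel R H t0 \<rho> s u + \<gamma> *\<^sub>R (local_kernel R H t0 \<rho> (s + d) u - local_kernel R H t0 \<rho> s u))"
    "\<And>\<rho> s d. 0 < \<rho> \<Longrightarrow> \<rho> < \<rho>0 \<Longrightarrow> 0 \<le> s \<Longrightarrow> 0 \<le> d \<Longrightarrow> s + d \<le> 1 \<Longrightarrow>
      (l2sq (\<lambda>u. local_kernel R H t0 \<rho> (s + d) u - local_kernel R H t0 \<rho> s u)) \<le> K * d powr (2 * \<mu>)"
    "\<And>s d \<alpha> \<gamma>. 0 \<le> s \<Longrightarrow> 0 \<le> d \<Longrightarrow> s + d \<le> 1 \<Longrightarrow>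
      c * (\<alpha>\<^sup>2 * s powr (2 * \<nu>) + \<gamma>\<^sup>2 * d powr (2 * \<nu>))
      \<le> l2sq (\<lambda>u. \<alpha> *\<^sub>R mbm_kernel R (H t0) s u + \<gamma> *\<^sub>R (mbm_kernel R (H t0) (s + d) u - mbm_kernel R (H t0) s u))"
    "\<And>s d. 0 \<le> s \<Longrightarrow> 0 \<le> d \<Longrightarrow> s + d \<le> 1 \<Longrightarrow>
      (l2sq (\<lambda>u. mbm_kernel R (H t0) (s + d) u - mbm_kernel R (H t0) s u)) \<le> K * d powr (2 * \<mu>)"
proof -
  let ?hz = "H t0"
  obtain C c1 c2 where C: "0 \<le> C" "0 < c1"
    "\<And>h h' t. h \<in> {\<mu>..\<nu>} \<Longrightarrow> h' \<in> {\<mu>..\<nu>} \<Longrightarrow> t \<in> {0..t0 + 1} \<Longrightarrow>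
       (l2sq (\<lambda>u. mbm_kernel R h t u - mbm_kernel R h' t u)) \<le> C * (h - h')\<^sup>2"
    "\<And>h. h \<in> {\<mu>..\<nu>} \<Longrightarrow> c1 \<le> mbm_variance R h \<and> mbm_variance R h \<le> c2"
    using mbm_kernel_lipschitz[OF mu nu, of "t0 + 1" R] by blast
  define \<kappa> where "\<kappa> = min (1 - \<nu>) (1/2 :: real)"
  have k: "0 < \<kappa>" using nu by (simp add: \<kappa>_def)
  have c2: "0 \<le> c2" using C(2) C(4)[OF Hrange[OF t0]] by linarith
  \<comment> \<open>The bound for \<open>\<rho> powr (2 * (H (t0 + \<rho> * s) - H t0))\<close> and
    its reciprocal. The exponent is at most \<open>2 * CH * \<rho> powr \<beta>\<close>, and
    spending half of \<beta> on the logarithm leaves \<open>4 * CH / \<beta>\<close>.\<close>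
  define E where "E = exp (4 * CH / \<beta>)"
  have E: "1 \<le> E" using CH beta by (simp add: E_def)
  define e where "e = 2 * (\<beta> - hb)"
  have e: "0 < e" using hb by (simp add: e_def)
  define D where "D = 2 * C * CH\<^sup>2"
  have D: "0 \<le> D" using C CH by (simp add: D_def)
  \<comment> \<open>By \<open>integral_square_ge\<close> half of \<open>c1 * \<kappa>\<close>
    survives the freezing, and below \<open>\<rho>0\<close> the error takes at most a quarter. The
    remaining quarter is divided by \<open>E\<close> to pay for the power of \<rho>. In
    \<open>\<rho>0\<close> the summand 1 keeps the denominator positive when
    \<open>D = 0\<close>.\<close>
  define c where "c = c1 * \<kappa> / (4 * E)"
  have c: "0 < c" using C k E by (simp add: c_def)
  define K where "K = (D + 2 * c2) * E"
  have K: "0 \<le> K" using D c2 E by (simp add: K_def)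
  define \<rho>0 where "\<rho>0 = min 1 ((c1 * \<kappa> / (4 * (D + 1))) powr (1 / e))"
  have r0: "0 < \<rho>0" using C k D by (simp add: \<rho>0_def)
  have rD: "D * \<rho> powr e \<le> c1 * \<kappa> / 4" if r: "0 < \<rho>" "\<rho> < \<rho>0" for \<rho>
  proof -
    have "\<rho> powr e \<le> ((c1 * \<kappa> / (4 * (D + 1))) powr (1 / e)) powr e"
      using r e by (intro powr_mono2) (auto simp: \<rho>0_def)
    also have "\<dots> = c1 * \<kappa> / (4 * (D + 1))" using e C k D by (simp add: powr_powr)
    finally have "(D + 1) * \<rho> powr e \<le> (D + 1) * (c1 * \<kappa> / (4 * (D + 1)))" using D by (intro mult_left_mono) auto
    also have "\<dots> = c1 * \<kappa> / 4" using D by (simp add: field_simps add_nonneg_eq_0_iff)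
    finally have "(D + 1) * \<rho> powr e \<le> c1 * \<kappa> / 4" .
    moreover have "D * \<rho> powr e \<le> (D + 1) * \<rho> powr e" by (intro mult_right_mono) auto
    ultimately show ?thesis by linarith
  qed
  have rE: "1 / E \<le> \<rho> powr (2 * (H (t0 + \<rho> * s) - ?hz))" "\<rho> powr (2 * (H (t0 + \<rho> * s) - ?hz)) \<le> E"
    if r: "0 < \<rho>" "\<rho> < 1" and s: "0 \<le> s" "s \<le> 1" for \<rho> s
  proof -
    let ?x = "2 * (H (t0 + \<rho> * s) - ?hz)"
    have "\<bar>H (t0 + \<rho> * s) - ?hz\<bar> \<le> CH * \<bar>t0 + \<rho> * s - t0\<bar> powr \<beta>"
      using r s t0 by (intro holder) auto
    also have "\<dots> \<le> CH * \<rho> powr \<beta>"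
      using r s CH beta by (intro mult_left_mono powr_mono2) (auto simp: abs_mult mult_left_le)
    finally have 1: "\<bar>?x\<bar> \<le> 2 * (CH * \<rho> powr \<beta>)" by simp
    have 2: "\<bar>ln \<rho>\<bar> \<le> \<rho> powr (- (\<beta> / 2)) / (\<beta> / 2)"
      using abs_ln_le_powr[of \<rho> "\<beta> / 2"] r beta by simp
    have "\<bar>?x * ln \<rho>\<bar> \<le> 2 * (CH * \<rho> powr \<beta>) * (\<rho> powr (- (\<beta> / 2)) / (\<beta> / 2))"
      unfolding abs_mult using 1 2 CH by (intro mult_mono) auto
    also have "\<dots> = 4 * CH / \<beta> * (\<rho> powr \<beta> * \<rho> powr (- (\<beta> / 2)))" by simp
    also have "\<rho> powr \<beta> * \<rho> powr (- (\<beta> / 2)) = \<rho> powr (\<beta> / 2)" unfolding powr_add[symmetric] by simp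
    also have "4 * CH / \<beta> * \<rho> powr (\<beta> / 2) \<le> 4 * CH / \<beta> * 1"
      using CH beta r by (intro mult_left_mono) (auto simp: powr_le1)
    finally have 3: "\<bar>?x * ln \<rho>\<bar> \<le> 4 * CH / \<beta>" by simp
    have eq: "\<rho> powr ?x = exp (?x * ln \<rho>)" using r by (simp add: powr_def)
    have "exp (- (4 * CH / \<beta>)) \<le> exp (?x * ln \<rho>)" "exp (?x * ln \<rho>) \<le> exp (4 * CH / \<beta>)"
      using 3 by (auto simp only: exp_le_cancel_iff abs_le_iff)
    then show "1 / E \<le> \<rho> powr ?x" "\<rho> powr ?x \<le> E" unfolding eq E_def by (simp_all add: exp_minus inverse_eq_divide)
  qed
  \<comment> \<open>The Hoelder errors of order \<open>y powr (2 * \<beta>)\<close> are thus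
    absorbed into the main terms \<open>y powr (2 * H r)\<close> at a relative cost of
    \<open>\<rho> powr e\<close>.\<close>
  have ybeta: "y powr (2 * \<beta>) \<le> y powr (2 * H r) * \<rho> powr e" if "0 \<le> y" "y \<le> \<rho>" "\<rho> \<le> 1" "0 \<le> r" for y \<rho> r
  proof (cases "y = 0")
    case False
    have "y powr (2 * \<beta>) = y powr (2 * H r) * y powr (2 * (\<beta> - H r))"
      unfolding powr_add[symmetric] by (simp add: algebra_simps)
    also have "y powr (2 * (\<beta> - H r)) \<le> y powr e"
      using that False Hle[OF that(4)] by (intro powr_mono') (auto simp: e_def)
    also have "y powr e \<le> \<rho> powr e" using that e by (intro powr_mono2) auto
    finally show ?thesis by (simp add: mult_left_mono)
  qed simp
  show thesis
  proof (rule that[OF c K r0])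
    fix \<rho> s d :: real assume r: "0 < \<rho>" "\<rho> < \<rho>0" and s: "0 \<le> s" and d: "0 \<le> d" and sd: "s + d \<le> 1"
    have r1: "\<rho> < 1" using r by (simp add: \<rho>0_def)
    let ?u = "t0 + \<rho> * s" and ?v = "t0 + \<rho> * (s + d)"
    let ?h = "H ?u" and ?q = "\<rho> powr (- ?hz)"
    have u: "0 \<le> ?u" "0 \<le> ?v" "?u \<in> {0..t0 + 1}" "?v \<in> {0..t0 + 1}" "t0 \<in> {0..t0 + 1}"
      using r r1 s d sd t0 mult_mono[of \<rho> 1 s 1] mult_mono[of \<rho> 1 "s + d" 1] by auto
    have v: "?v = ?u + \<rho> * d" by (simp add: algebra_simps)
    have ds: "\<rho> * s \<le> \<rho>" "\<rho> * d \<le> \<rho>" "s \<le> 1" "d \<le> 1" using r s d sd by (auto simp: mult_left_le)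
    note h = Hrange[OF u(1)]
    have h01: "0 < ?h" "?h < 1" using H01[OF u(1)] by auto
    have err: "l2sq (\<lambda>u. mbm_kernel R x t u - mbm_kernel R y t u) \<le> C * CH\<^sup>2 * z powr (2 * \<beta>)"
      if "x \<in> {\<mu>..\<nu>}" "y \<in> {\<mu>..\<nu>}" "t \<in> {0..t0 + 1}" "\<bar>x - y\<bar> \<le> CH * z powr \<beta>" for x y t z
    proof -
      have "(x - y)\<^sup>2 \<le> (CH * z powr \<beta>)\<^sup>2" using power_mono[OF that(4), of 2] by simp
      also have "\<dots> = CH\<^sup>2 * z powr (2 * \<beta>)"
        by (simp add: power_mult_distrib) (simp add: power2_eq_square powr_add[symmetric])
      finally have "C * (x - y)\<^sup>2 \<le> C * (CH\<^sup>2 * z powr (2 * \<beta>))" using C(1) by (intro mult_left_mono)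
      then show ?thesis using C(3)[OF that(1-3)] by (simp add: mult.assoc)
    qed
    have e1: "l2sq (\<lambda>u. mbm_kernel R ?h t0 u - mbm_kernel R ?hz t0 u) \<le> C * CH\<^sup>2 * (\<rho> * s) powr (2 * \<beta>)"
    proof (rule err[OF h Hrange[OF t0] u(5)])
      have "\<bar>?u - t0\<bar> = \<rho> * s" using r s by simp
      then show "\<bar>?h - ?hz\<bar> \<le> CH * (\<rho> * s) powr \<beta>" using holder[OF u(1) t0] by (simp only:)
    qed
    have e2: "l2sq (\<lambda>u. mbm_kernel R (H ?v) ?v u - mbm_kernel R ?h ?v u) \<le> C * CH\<^sup>2 * (\<rho> * d) powr (2 * \<beta>)"
    proof (rule err[OF Hrange[OF u(2)] h u(4)])
      have "\<bar>?v - ?u\<bar> = \<rho> * d" using r d by (simp add: v)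
      then show "\<bar>H ?v - ?h\<bar> \<le> CH * (\<rho> * d) powr \<beta>" using holder[OF u(2) u(1)] by (simp only:)
    qed
    have q2: "?q\<^sup>2 * (\<rho> * y) powr (2 * ?h) = \<rho> powr (2 * (?h - ?hz)) * y powr (2 * ?h)" if "0 \<le> y" for y
    proof -
      have "?q\<^sup>2 * (\<rho> * y) powr (2 * ?h) = (?q * ?q * \<rho> powr (2 * ?h)) * y powr (2 * ?h)"
        using r that by (simp add: power2_eq_square powr_mult)
      also have "?q * ?q * \<rho> powr (2 * ?h) = \<rho> powr (2 * (?h - ?hz))"
        unfolding powr_add[symmetric] by (simp add: algebra_simps)
      finally show ?thesis .
    qed
    have sqk: "square_integrable lborel (mbm_kernel R (H a) b)" if "0 \<le> a" "0 \<le> b" for a b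
      using that by (rule square_integrable_kernel)
    show "c * (\<alpha>\<^sup>2 * s powr (2 * \<nu>) + \<gamma>\<^sup>2 * d powr (2 * \<nu>))
      \<le> l2sq (\<lambda>u. \<alpha> *\<^sub>R local_kernel R H t0 \<rho> s u + \<gamma> *\<^sub>R (local_kernel R H t0 \<rho> (s + d) u - local_kernel R H t0 \<rho> s u))" for \<alpha> \<gamma>
    proof -
      \<comment> \<open>Before scaling, \<open>f\<close> is the true combination and
        \<open>g\<close> the one with all indices equal to \<open>?h\<close>. The kernel at the
        middle time occurs identically in both, so only the endpoints \<open>t0\<close> and
        \<open>?v\<close> contribute to the difference.\<close>
      define f where "f u = \<alpha> *\<^sub>R (mbm_kernel R ?h ?u u - mbm_kernel R ?hz t0 u) + \<gamma> *\<^sub>R (mbm_kernel R (H ?v) ?v u - mbm_kernel R ?h ?u u)" for u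
      define g where "g u = \<alpha> *\<^sub>R (mbm_kernel R ?h ?u u - mbm_kernel R ?h t0 u) + \<gamma> *\<^sub>R (mbm_kernel R ?h ?v u - mbm_kernel R ?h ?u u)" for u
      have fs: "square_integrable lborel f" and gs: "square_integrable lborel g"
        unfolding f_def g_def using u t0
        by (intro square_integrable_add square_integrable_scaleR square_integrable_diff sqk; simp)+
      define Q where "Q = \<alpha>\<^sup>2 * (\<rho> * s) powr (2 * ?h) + \<gamma>\<^sup>2 * (\<rho> * d) powr (2 * ?h)"
      have Q0: "0 \<le> Q" by (simp add: Q_def)
      have "c1 * (\<kappa> * Q) \<le> mbm_variance R ?h * (\<alpha>\<^sup>2 * (\<rho> * s) powr (2 * ?h) + \<gamma>\<^sup>2 * (\<rho> * d) powr (2 * ?h)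
        + \<alpha> * \<gamma> * ((\<rho> * s + \<rho> * d) powr (2 * ?h) - (\<rho> * s) powr (2 * ?h) - (\<rho> * d) powr (2 * ?h)))"
        unfolding Q_def \<kappa>_def using r s d h01 h nu C(2) C(4)[OF h] k Q0
        by (intro mult_mono fbm_quadratic_form_lower_bound) (auto simp: \<kappa>_def)
      also have "\<dots> = l2sq g"
        unfolding g_def v using integral_square_fbm_pair[OF h01 t0, of "\<rho> * s" "\<rho> * d" \<alpha> R \<gamma>] r s d by simp
      finally have gl: "c1 * \<kappa> * Q \<le> l2sq g" by (simp add: mult.assoc)
      have "l2sq (\<lambda>u. f u - g u)
        = l2sq (\<lambda>u. \<alpha> *\<^sub>R (mbm_kernel R ?h t0 u - mbm_kernel R ?hz t0 u) + \<gamma> *\<^sub>R (mbm_kernel R (H ?v) ?v u - mbm_kernel R ?h ?v u))"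
        by (simp add: f_def g_def algebra_simps)
      also have "\<dots> \<le> 2 * l2sq (\<lambda>u. \<alpha> *\<^sub>R (mbm_kernel R ?h t0 u - mbm_kernel R ?hz t0 u))
        + 2 * l2sq (\<lambda>u. \<gamma> *\<^sub>R (mbm_kernel R (H ?v) ?v u - mbm_kernel R ?h ?v u))"
        using u t0 by (intro integral_square_add_le square_integrable_scaleR square_integrable_diff sqk) auto
      also have "\<dots> = 2 * (\<alpha>\<^sup>2 * l2sq (\<lambda>u. mbm_kernel R ?h t0 u - mbm_kernel R ?hz t0 u))
        + 2 * (\<gamma>\<^sup>2 * l2sq (\<lambda>u. mbm_kernel R (H ?v) ?v u - mbm_kernel R ?h ?v u))"
        by (simp add: power_mult_distrib)
      also have "\<dots> \<le> 2 * (\<alpha>\<^sup>2 * (C * CH\<^sup>2 * ((\<rho> * s) powr (2 * ?h) * \<rho> powr e))) + 2 * (\<gamma>\<^sup>2 * (C * CH\<^sup>2 * ((\<rho> * d) powr (2 * ?h) * \<rho> powr e)))"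
      proof (intro add_mono mult_left_mono)
        show "l2sq (\<lambda>u. mbm_kernel R ?h t0 u - mbm_kernel R ?hz t0 u) \<le> C * CH\<^sup>2 * ((\<rho> * s) powr (2 * ?h) * \<rho> powr e)"
          by (rule order_trans[OF e1]) (intro mult_left_mono ybeta, use r r1 s ds u C CH in auto)
        show "l2sq (\<lambda>u. mbm_kernel R (H ?v) ?v u - mbm_kernel R ?h ?v u) \<le> C * CH\<^sup>2 * ((\<rho> * d) powr (2 * ?h) * \<rho> powr e)"
          by (rule order_trans[OF e2]) (intro mult_left_mono ybeta, use r r1 d ds u C CH in auto)
      qed auto
      also have "\<dots> = (D * \<rho> powr e) * Q" by (simp add: D_def Q_def algebra_simps)
      also have "\<dots> \<le> c1 * \<kappa> / 4 * Q" using rD[OF r] Q0 by (rule mult_right_mono)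
      finally have fg: "l2sq (\<lambda>u. f u - g u) \<le> c1 * \<kappa> / 4 * Q" .
      have fl: "c1 * \<kappa> / 4 * Q \<le> l2sq f"
      proof -
        have "c1 * \<kappa> / 4 * Q = (c1 * \<kappa> * Q) / 4" by simp
        then show ?thesis using integral_square_ge[OF fs gs] gl fg by linarith
      qed
      have "c * (\<alpha>\<^sup>2 * s powr (2 * \<nu>) + \<gamma>\<^sup>2 * d powr (2 * \<nu>)) = c1 * \<kappa> / 4 * (\<alpha>\<^sup>2 * (1 / E * s powr (2 * \<nu>)) + \<gamma>\<^sup>2 * (1 / E * d powr (2 * \<nu>)))"
        using E by (simp add: c_def field_simps)
      also have "\<dots> \<le> c1 * \<kappa> / 4 * (\<alpha>\<^sup>2 * (\<rho> powr (2 * (?h - ?hz)) * s powr (2 * ?h)) + \<gamma>\<^sup>2 * (\<rho> powr (2 * (?h - ?hz)) * d powr (2 * ?h)))"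
      proof (intro mult_left_mono add_mono mult_mono rE)
        show "s powr (2 * \<nu>) \<le> s powr (2 * ?h)" "d powr (2 * \<nu>) \<le> d powr (2 * ?h)"
          using s d ds h by (auto intro!: powr_mono')
      qed (use r r1 s ds C k E in auto)
      also have "\<dots> = c1 * \<kappa> / 4 * (?q\<^sup>2 * Q)"
        unfolding q2[OF s, symmetric] q2[OF d, symmetric] Q_def by (simp add: algebra_simps)
      also have "\<dots> = ?q\<^sup>2 * (c1 * \<kappa> / 4 * Q)" by simp
      also have "\<dots> \<le> ?q\<^sup>2 * l2sq f" using fl by (intro mult_left_mono) auto
      also have "\<dots> = l2sq (\<lambda>u. ?q *\<^sub>R f u)" by (simp add: power_mult_distrib)
      also have "\<dots> = l2sq (\<lambda>u. \<alpha> *\<^sub>R local_kernel R H t0 \<rho> s u + \<gamma> *\<^sub>R (local_kernel R H t0 \<rho> (s + d) u - local_kernel R H t0 \<rho> s u))"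
        by (simp add: f_def local_kernel_def algebra_simps)
      finally show ?thesis .
    qed
    show "l2sq (\<lambda>u. local_kernel R H t0 \<rho> (s + d) u - local_kernel R H t0 \<rho> s u) \<le> K * d powr (2 * \<mu>)"
    proof -
      have "l2sq (\<lambda>u. mbm_kernel R (H ?v) ?v u - mbm_kernel R ?h ?u u)
        = l2sq (\<lambda>u. (mbm_kernel R (H ?v) ?v u - mbm_kernel R ?h ?v u) + (mbm_kernel R ?h ?v u - mbm_kernel R ?h ?u u))"
        by simp
      also have "\<dots> \<le> 2 * l2sq (\<lambda>u. mbm_kernel R (H ?v) ?v u - mbm_kernel R ?h ?v u)
        + 2 * l2sq (\<lambda>u. mbm_kernel R ?h ?v u - mbm_kernel R ?h ?u u)"
        using u by (intro integral_square_add_le square_integrable_diff sqk) auto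
      also have "\<dots> \<le> 2 * (C * CH\<^sup>2 * ((\<rho> * d) powr (2 * ?h) * 1)) + 2 * (c2 * (\<rho> * d) powr (2 * ?h))"
      proof (intro add_mono mult_left_mono)
        have "(\<rho> * d) powr (2 * \<beta>) \<le> (\<rho> * d) powr (2 * ?h) * \<rho> powr e" using r r1 d ds u by (intro ybeta) auto
        also have "\<dots> \<le> (\<rho> * d) powr (2 * ?h) * 1" using r r1 e by (intro mult_left_mono) (auto simp: powr_le1)
        finally have "C * CH\<^sup>2 * (\<rho> * d) powr (2 * \<beta>) \<le> C * CH\<^sup>2 * ((\<rho> * d) powr (2 * ?h) * 1)"
          using C CH by (intro mult_left_mono) auto
        then show "l2sq (\<lambda>u. mbm_kernel R (H ?v) ?v u - mbm_kernel R ?h ?v u) \<le> C * CH\<^sup>2 * ((\<rho> * d) powr (2 * ?h) * 1)"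
          using e2 by linarith
        have "l2sq (\<lambda>u. mbm_kernel R ?h ?v u - mbm_kernel R ?h ?u u) = (\<rho> * d) powr (2 * ?h) * mbm_variance R ?h"
          using integral_square_mbm_kernel_increment[OF u(1,2), of R ?h] r d by (simp add: v)
        also have "\<dots> \<le> (\<rho> * d) powr (2 * ?h) * c2" using C(4)[OF h] by (intro mult_left_mono) auto
        finally show "l2sq (\<lambda>u. mbm_kernel R ?h ?v u - mbm_kernel R ?h ?u u) \<le> c2 * (\<rho> * d) powr (2 * ?h)"
          by (simp add: mult.commute)
      qed auto
      also have "\<dots> = (D + 2 * c2) * (\<rho> * d) powr (2 * ?h)" by (simp add: D_def algebra_simps)
      finally have "?q\<^sup>2 * l2sq (\<lambda>u. mbm_kernel R (H ?v) ?v u - mbm_kernel R ?h ?u u) \<le> ?q\<^sup>2 * ((D + 2 * c2) * (\<rho> * d) powr (2 * ?h))"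
        by (intro mult_left_mono) auto
      also have "\<dots> = (D + 2 * c2) * (\<rho> powr (2 * (?h - ?hz)) * d powr (2 * ?h))"
        unfolding q2[OF d, symmetric] by simp
      also have "\<dots> \<le> (D + 2 * c2) * (E * d powr (2 * \<mu>))"
      proof (intro mult_left_mono mult_mono rE)
        show "d powr (2 * ?h) \<le> d powr (2 * \<mu>)" using d ds h by (intro powr_mono') auto
      qed (use r r1 s ds D c2 E in auto)
      also have "\<dots> = K * d powr (2 * \<mu>)" by (simp add: K_def)
      finally have b: "?q\<^sup>2 * l2sq (\<lambda>u. mbm_kernel R (H ?v) ?v u - mbm_kernel R ?h ?u u) \<le> K * d powr (2 * \<mu>)" .
      have "local_kernel R H t0 \<rho> (s + d) u - local_kernel R H t0 \<rho> s u = ?q *\<^sub>R (mbm_kernel R (H ?v) ?v u - mbm_kernel R ?h ?u u)" for u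
        by (simp add: local_kernel_def algebra_simps)
      then show ?thesis using b by (simp add: power_mult_distrib)
    qed
  next
    fix s d :: real assume s: "0 \<le> s" and d: "0 \<le> d" and sd: "s + d \<le> 1"
    note h = Hrange[OF t0] note h01 = H01[OF t0]
    have ds: "s \<le> 1" "d \<le> 1" using s d sd by auto
    show "c * (\<alpha>\<^sup>2 * s powr (2 * \<nu>) + \<gamma>\<^sup>2 * d powr (2 * \<nu>))
      \<le> l2sq (\<lambda>u. \<alpha> *\<^sub>R mbm_kernel R (H t0) s u + \<gamma> *\<^sub>R (mbm_kernel R (H t0) (s + d) u - mbm_kernel R (H t0) s u))" for \<alpha> \<gamma>
    proof -
      have "c \<le> c1 * \<kappa>"
      proof -
        have "c1 * \<kappa> / (4 * E) \<le> c1 * \<kappa> / 1" using C k E by (intro divide_left_mono) auto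
        then show ?thesis by (simp add: c_def)
      qed
      then have "c * (\<alpha>\<^sup>2 * s powr (2 * \<nu>) + \<gamma>\<^sup>2 * d powr (2 * \<nu>)) \<le> (c1 * \<kappa>) * (\<alpha>\<^sup>2 * s powr (2 * ?hz) + \<gamma>\<^sup>2 * d powr (2 * ?hz))"
        using s d ds h C k by (intro mult_mono add_mono mult_left_mono powr_mono') auto
      also have "\<dots> = c1 * (\<kappa> * (\<alpha>\<^sup>2 * s powr (2 * ?hz) + \<gamma>\<^sup>2 * d powr (2 * ?hz)))" by simp
      also have "\<dots> \<le> mbm_variance R ?hz * (\<alpha>\<^sup>2 * s powr (2 * ?hz) + \<gamma>\<^sup>2 * d powr (2 * ?hz)
        + \<alpha> * \<gamma> * ((s + d) powr (2 * ?hz) - s powr (2 * ?hz) - d powr (2 * ?hz)))"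
        unfolding \<kappa>_def using s d h01 h nu C(2) C(4)[OF h] k
        by (intro mult_mono fbm_quadratic_form_lower_bound) (auto simp: \<kappa>_def)
      also have "\<dots> = l2sq (\<lambda>u. \<alpha> *\<^sub>R mbm_kernel R (H t0) s u + \<gamma> *\<^sub>R (mbm_kernel R (H t0) (s + d) u - mbm_kernel R (H t0) s u))"
        using integral_square_fbm_pair[OF h01, of 0 s d \<alpha> R \<gamma>] s d by simp
      finally show ?thesis .
    qed
    have "l2sq (\<lambda>u. mbm_kernel R (H t0) (s + d) u - mbm_kernel R (H t0) s u) = d powr (2 * ?hz) * mbm_variance R ?hz"
      using integral_square_mbm_kernel_increment[of s "s + d" R ?hz] s d by simp
    also have "\<dots> \<le> d powr (2 * \<mu>) * c2"
      using d ds h mu C(4)[OF h] C(2) by (intro mult_mono powr_mono') auto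
    also have "\<dots> \<le> d powr (2 * \<mu>) * K"
    proof (intro mult_left_mono)
      have "c2 \<le> (D + 2 * c2) * 1" using D c2 by simp
      also have "\<dots> \<le> K" unfolding K_def using E D c2 by (intro mult_left_mono) auto
      finally show "c2 \<le> K" .
    qed simp
    finally show "l2sq (\<lambda>u. mbm_kernel R (H t0) (s + d) u - mbm_kernel R (H t0) s u) \<le> K * d powr (2 * \<mu>)"
      by (simp add: mult.commute)
  qed
qed

end

section \<open>Convergence in law of random continuous functions\<close>

interpretation C01: Metric_space "mspace C01" "mdist C01"
  by (rule Metric_space_mspace_mdist)

lemma mspace_C01: "f \<in> mspace C01 \<longleftrightarrow> f \<in> extensional {0..1} \<and> continuous_on {0..1} f"
  unfolding C01_def by (subst compactin_mspace_cfunspace) (auto simp: compactin_subtopology)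

lemma restrict_in_C01:
  assumes "continuous_on {0..1} f"
  shows "restrict f {0..1} \<in> mspace C01"
proof -
  have "continuous_on {0..1} (restrict f {0..1}) = continuous_on {0..1} f"
    by (rule continuous_on_cong) auto
  then show ?thesis using assms by (simp add: mspace_C01)
qed

lemma mdist_C01_le:
  assumes "0 \<le> B" "\<And>t. t \<in> {0..1} \<Longrightarrow> \<bar>f t - g t\<bar> \<le> B"
  shows "mdist C01 f g \<le> B"
  unfolding C01_def by (rule mdist_cfunspace_le) (use assms in \<open>auto simp: dist_real_def\<close>)

lemma continuous_map_C01_sequentially:
  assumes \<phi>: "continuous_map (mtopology_of C01) euclideanreal \<phi>"
    and f: "\<And>n. f n \<in> mspace C01" "g \<in> mspace C01" and d: "(\<lambda>n. mdist C01 (f n) g) \<longlonglongrightarrow> 0"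
  shows "(\<lambda>n. \<phi> (f n)) \<longlonglongrightarrow> \<phi> g"
proof -
  have "limitin (mtopology_of C01) f g sequentially"
    unfolding mtopology_of_def C01.limitin_metric
    using f order_tendstoD(2)[OF d] by auto
  from continuous_map_limit[OF \<phi> this] show ?thesis by (simp add: limitin_canonical_iff comp_def)
qed

text \<open>Rounding the coefficients of Bernstein approximations leaves countably many continuous
  functions, so that Borel measurability in \<open>C01\<close> follows without proving separability.\<close>

lemma measurable_sequentially_continuous_C01:
  fixes Y :: "real \<Rightarrow> 'a \<Rightarrow> real" and \<phi> :: "(real \<Rightarrow> real) \<Rightarrow> real"
  assumes Y: "\<And>t. t \<in> {0..1} \<Longrightarrow> Y t \<in> borel_measurable M"
    and c: "\<And>\<omega>. \<omega> \<in> space M \<Longrightarrow> continuous_on {0..1} (\<lambda>t. Y t \<omega>)"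
    and \<phi>: "\<And>f g. (\<And>n. f n \<in> mspace C01) \<Longrightarrow> g \<in> mspace C01 \<Longrightarrow> (\<lambda>n. mdist C01 (f n) g) \<longlonglongrightarrow> 0 \<Longrightarrow> (\<lambda>n. \<phi> (f n)) \<longlonglongrightarrow> \<phi> g"
  shows "(\<lambda>\<omega>. \<phi> (restrict (\<lambda>t. Y t \<omega>) {0..1})) \<in> borel_measurable M"
proof (rule borel_measurable_LIMSEQ_real)
  define q where "q n js = restrict (\<lambda>t. \<Sum>k\<le>n. (of_int (js ! k) / real (Suc n)) * Bernstein n k t) {0..1}" for n and js :: "int list"
  \<comment> \<open>The integer lists \<open>J n\<close> have countably many values, so every
    function of them is measurable. Rounding moves the approximation by at most
    \<open>1 / Suc n\<close>, since Bernstein polynomials sum to 1. For \<open>n = 0\<close> the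
    node \<open>k / n\<close> is 0 by the convention for division.\<close>
  define J where "J n \<omega> = map (\<lambda>k. \<lfloor>real (Suc n) * Y (real k / real n) \<omega>\<rfloor>) [0..<Suc n]" for n \<omega>
  have kn: "real k / real n \<in> {0..1}" if "k \<le> n" for k n using that by (auto simp: divide_le_eq_1)
  have Jm: "J n \<in> measurable M (count_space UNIV)" for n
  proof -
    have "J n -` {js} \<inter> space M \<in> sets M" for js
    proof -
      have "J n -` {js} \<inter> space M = {\<omega> \<in> space M. length js = Suc n \<and> (\<forall>k\<in>{..n}. \<lfloor>real (Suc n) * Y (real k / real n) \<omega>\<rfloor> = js ! k)}"
        by (auto simp: J_def list_eq_iff_nth_eq less_Suc_eq_le simp del: upt_Suc)
      also have "\<dots> \<in> sets M"
      proof (intro sets.sets_Collect sets.sets_Collect_finite_All)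
        show "{\<omega> \<in> space M. \<lfloor>real (Suc n) * Y (real k / real n) \<omega>\<rfloor> = js ! k} \<in> sets M" if "k \<in> {..n}" for k
        proof -
          have [measurable]: "Y (real k / real n) \<in> borel_measurable M" using Y[OF kn[of k n]] that by simp
          show ?thesis by measurable
        qed
      qed auto
      finally show ?thesis .
    qed
    then show ?thesis by (subst measurable_count_space_eq2_countable) auto
  qed
  show "(\<lambda>\<omega>. \<phi> (q n (J n \<omega>))) \<in> borel_measurable M" for n
    using measurable_compose[OF Jm[of n], of "\<lambda>js. \<phi> (q n js)" borel] by simp
  fix \<omega> assume w: "\<omega> \<in> space M"
  let ?Y = "\<lambda>t. Y t \<omega>"
  show "(\<lambda>n. \<phi> (q n (J n \<omega>))) \<longlonglongrightarrow> \<phi> (restrict ?Y {0..1})"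
  proof (rule \<phi>)
    show "q n (J n \<omega>) \<in> mspace C01" for n
      unfolding q_def Bernstein_def by (intro restrict_in_C01 continuous_intros)
    show "restrict ?Y {0..1} \<in> mspace C01" by (intro restrict_in_C01 c w)
    show "(\<lambda>n. mdist C01 (q n (J n \<omega>)) (restrict ?Y {0..1})) \<longlonglongrightarrow> 0"
    proof (rule tendstoI)
      fix e :: real assume e: "0 < e"
      obtain N where N: "\<And>n x. N \<le> n \<Longrightarrow> x \<in> {0..1} \<Longrightarrow> \<bar>?Y x - (\<Sum>k\<le>n. ?Y (k/n) * Bernstein n k x)\<bar> < e / 4"
        using Bernstein_Weierstrass[OF c[OF w], of "e / 4"] e by fastforce
      obtain N' :: nat where N': "4 / e < real N'" using reals_Archimedean2 by blast
      show "eventually (\<lambda>n. dist (mdist C01 (q n (J n \<omega>)) (restrict ?Y {0..1})) 0 < e) sequentially"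
        using eventually_ge_at_top[of "max N N'"]
      proof eventually_elim
        case (elim n)
        have sm: "1 / real (Suc n) \<le> e / 4"
        proof -
          have "4 / e \<le> real (Suc n)" using N' elim by linarith
          then show ?thesis using e by (simp add: field_simps)
        qed
        have "mdist C01 (q n (J n \<omega>)) (restrict ?Y {0..1}) \<le> e / 2"
        proof (rule mdist_C01_le)
          fix t :: real assume t: "t \<in> {0..1}"
          have q: "q n (J n \<omega>) t = (\<Sum>k\<le>n. (of_int \<lfloor>real (Suc n) * ?Y (real k / real n)\<rfloor> / real (Suc n)) * Bernstein n k t)"
            using t by (auto simp: q_def J_def simp del: upt_Suc intro!: sum.cong)
          have "\<bar>q n (J n \<omega>) t - (\<Sum>k\<le>n. ?Y (k/n) * Bernstein n k t)\<bar>
            = \<bar>\<Sum>k\<le>n. (of_int \<lfloor>real (Suc n) * ?Y (real k / real n)\<rfloor> / real (Suc n) - ?Y (k/n)) * Bernstein n k t\<bar>"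
            unfolding q by (simp add: sum_subtractf left_diff_distrib)
          also have "\<dots> \<le> (\<Sum>k\<le>n. \<bar>(of_int \<lfloor>real (Suc n) * ?Y (real k / real n)\<rfloor> / real (Suc n) - ?Y (k/n)) * Bernstein n k t\<bar>)"
            by (rule sum_abs)
          also have "\<dots> \<le> (\<Sum>k\<le>n. (1 / real (Suc n)) * Bernstein n k t)"
          proof (rule sum_mono)
            fix k
            have "\<bar>of_int \<lfloor>real (Suc n) * y\<rfloor> / real (Suc n) - y\<bar> \<le> 1 / real (Suc n)" for y
            proof -
              have "\<bar>of_int \<lfloor>real (Suc n) * y\<rfloor> - real (Suc n) * y\<bar> \<le> 1" by linarith
              moreover have "of_int \<lfloor>real (Suc n) * y\<rfloor> / real (Suc n) - y = (of_int \<lfloor>real (Suc n) * y\<rfloor> - real (Suc n) * y) / real (Suc n)"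
                by (simp add: diff_divide_distrib del: of_nat_Suc)
              ultimately show ?thesis by (simp add: divide_right_mono del: of_nat_Suc)
            qed
            then show "\<bar>(of_int \<lfloor>real (Suc n) * ?Y (real k / real n)\<rfloor> / real (Suc n) - ?Y (k/n)) * Bernstein n k t\<bar>
              \<le> (1 / real (Suc n)) * Bernstein n k t"
              unfolding abs_mult using t Bernstein_nonneg[of t n k]
              by (intro mult_mono) (auto simp del: of_nat_Suc)
          qed
          also have "\<dots> = 1 / real (Suc n)" unfolding sum_distrib_left[symmetric] by simp
          also note sm
          finally have "\<bar>q n (J n \<omega>) t - (\<Sum>k\<le>n. ?Y (k/n) * Bernstein n k t)\<bar> \<le> e / 4" .
          moreover have "\<bar>?Y t - (\<Sum>k\<le>n. ?Y (k/n) * Bernstein n k t)\<bar> < e / 4" using N[of n t] elim t by simp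
          moreover have "restrict ?Y {0..1} t = ?Y t" using t by simp
          ultimately show "\<bar>q n (J n \<omega>) t - restrict ?Y {0..1} t\<bar> \<le> e / 2" by linarith
        qed (use e in simp)
        then show ?case using e by simp
      qed
    qed
  qed
qed

text \<open>The Pasch-Hausdorff envelope: for \<open>\<psi>\<close> bounded below, the largest
  \<open>k\<close>-Lipschitz minorant.\<close>

definition inf_convolution :: "((real \<Rightarrow> real) \<Rightarrow> real) \<Rightarrow> real \<Rightarrow> (real \<Rightarrow> real) \<Rightarrow> real" where
  "inf_convolution \<psi> k f = (INF g\<in>mspace C01. \<psi> g + k * mdist C01 f g)"

lemma inf_convolution_bounds:
  assumes b: "\<And>g. g \<in> mspace C01 \<Longrightarrow> a \<le> \<psi> g" and k: "0 \<le> k" and f: "f \<in> mspace C01"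
  shows "bdd_below ((\<lambda>g. \<psi> g + k * mdist C01 f g) ` mspace C01)"
    and "a \<le> inf_convolution \<psi> k f" and "inf_convolution \<psi> k f \<le> \<psi> f"
proof -
  have ge: "a \<le> \<psi> g + k * mdist C01 f g" if "g \<in> mspace C01" for g
    using b[OF that] k by (simp add: add_increasing2)
  then show bd: "bdd_below ((\<lambda>g. \<psi> g + k * mdist C01 f g) ` mspace C01)" by (auto intro!: bdd_belowI2)
  show "a \<le> inf_convolution \<psi> k f" unfolding inf_convolution_def using f ge by (intro cINF_greatest) auto
  show "inf_convolution \<psi> k f \<le> \<psi> f"
    unfolding inf_convolution_def using cINF_lower[OF bd f] f by simp
qed

text \<open>By the triangle inequality each competitor in the infimum contributes a
  \<open>k\<close>-Lipschitz function, and an infimum bounded below inherits the constant.\<close>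

lemma inf_convolution_lipschitz:
  assumes b: "\<And>g. g \<in> mspace C01 \<Longrightarrow> a \<le> \<psi> g" and k: "0 \<le> k" and f: "f \<in> mspace C01" "g \<in> mspace C01"
  shows "\<bar>inf_convolution \<psi> k f - inf_convolution \<psi> k g\<bar> \<le> k * mdist C01 f g"
proof -
  have "inf_convolution \<psi> k f - k * mdist C01 f g \<le> inf_convolution \<psi> k g"
    if f: "f \<in> mspace C01" "g \<in> mspace C01" for f g
    unfolding inf_convolution_def[of _ _ g]
  proof (rule cINF_greatest)
    fix h assume h: "h \<in> mspace C01"
    have "inf_convolution \<psi> k f \<le> \<psi> h + k * mdist C01 f h"
      unfolding inf_convolution_def using cINF_lower[OF inf_convolution_bounds(1)[where \<psi>=\<psi> and a=a, OF b k f(1)] h] by simp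
    also have "\<dots> \<le> \<psi> h + k * (mdist C01 f g + mdist C01 g h)"
      using k f h by (intro add_left_mono mult_left_mono C01.triangle)
    finally show "inf_convolution \<psi> k f - k * mdist C01 f g \<le> \<psi> h + k * mdist C01 g h"
      by (simp add: algebra_simps)
  qed (use f in auto)
  from this[OF f] this[OF f(2,1)] show ?thesis using C01.commute[of f g] by (simp add: abs_le_iff)
qed

lemma lipschitz_C01_sequentially:
  assumes "\<And>f g. f \<in> mspace C01 \<Longrightarrow> g \<in> mspace C01 \<Longrightarrow> \<bar>\<psi> f - \<psi> g\<bar> \<le> k * mdist C01 f g"
    and "\<And>n. f n \<in> mspace C01" "g \<in> mspace C01" and d: "(\<lambda>n. mdist C01 (f n) g) \<longlonglongrightarrow> 0"
  shows "(\<lambda>n. \<psi> (f n)) \<longlonglongrightarrow> \<psi> g"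
proof (rule Lim_transform2[OF tendsto_const], rule Lim_null_comparison)
  show "eventually (\<lambda>n. norm (\<psi> g - \<psi> (f n)) \<le> k * mdist C01 (f n) g) sequentially"
    using assms(1)[OF assms(2,3)] by (auto simp: abs_minus_commute)
  show "(\<lambda>n. k * mdist C01 (f n) g) \<longlonglongrightarrow> 0" using tendsto_mult_right_zero[OF d] by simp
qed

text \<open>Near \<open>f\<close> continuity keeps the functional above
  \<open>\<psi> f - e / 2\<close>; at distance at least \<open>d\<close> the penalty
  \<open>n * d\<close> exceeds the whole possible drop \<open>\<psi> f - a\<close>.\<close>

lemma inf_convolution_tendsto:
  assumes b: "\<And>g. g \<in> mspace C01 \<Longrightarrow> a \<le> \<psi> g" and f: "f \<in> mspace C01"
    and c: "continuous_map (mtopology_of C01) euclideanreal \<psi>"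
  shows "(\<lambda>n. inf_convolution \<psi> (real n) f) \<longlonglongrightarrow> \<psi> f"
proof (rule LIMSEQ_I)
  fix e :: real assume e: "0 < e"
  have o: "openin (mtopology_of C01) {g \<in> topspace (mtopology_of C01). \<psi> g \<in> {\<psi> f - e / 2<..}}"
    by (rule openin_continuous_map_preimage[OF c]) simp
  obtain d where d: "0 < d" "\<And>g. g \<in> mspace C01 \<Longrightarrow> mdist C01 f g < d \<Longrightarrow> \<psi> f - e / 2 < \<psi> g"
    using o f e unfolding mtopology_of_def C01.openin_mtopology by (auto simp: C01.mball_def subset_iff)
  obtain N :: nat where N: "(\<psi> f - a) / d < real N" using reals_Archimedean2 by blast
  show "\<exists>N. \<forall>n\<ge>N. norm (inf_convolution \<psi> (real n) f - \<psi> f) < e"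
  proof (intro exI[of _ N] allI impI)
    fix n assume n: "N \<le> n"
    have "\<psi> f - e / 2 \<le> inf_convolution \<psi> (real n) f"
      unfolding inf_convolution_def
    proof (rule cINF_greatest)
      fix g assume g: "g \<in> mspace C01"
      show "\<psi> f - e / 2 \<le> \<psi> g + real n * mdist C01 f g"
      proof (cases "mdist C01 f g < d")
        case True
        then show ?thesis using d(2)[OF g] by (smt (verit) C01.nonneg mult_nonneg_nonneg of_nat_0_le_iff)
      next
        case False
        have "\<psi> f - a \<le> real N * d" using N d(1) by (simp add: pos_divide_less_eq less_imp_le)
        also have "\<dots> \<le> real n * mdist C01 f g" using False n d(1) by (intro mult_mono) auto
        finally show ?thesis using b[OF g] e by linarith
      qed
    qed (use f in auto)
    moreover have "inf_convolution \<psi> (real n) f \<le> \<psi> f" using inf_convolution_bounds(3)[where \<psi>=\<psi> and a=a, OF b _ f] by simp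
    ultimately show "norm (inf_convolution \<psi> (real n) f - \<psi> f) < e" using e by simp
  qed
qed

text \<open>The 1-Lipschitz envelope of the indicator of an open set is positive exactly on that
  set. Preimages of open sets are therefore preimages of the positive axis under a real functional
  already known to be measurable.\<close>

lemma measurable_restrict_C01:
  fixes Y :: "real \<Rightarrow> 'a \<Rightarrow> real"
  assumes Y: "\<And>t. t \<in> {0..1} \<Longrightarrow> Y t \<in> borel_measurable M"
    and c: "\<And>\<omega>. \<omega> \<in> space M \<Longrightarrow> continuous_on {0..1} (\<lambda>t. Y t \<omega>)"
  shows "(\<lambda>\<omega>. restrict (\<lambda>t. Y t \<omega>) {0..1}) \<in> measurable M (borel_metric C01)"
  unfolding borel_metric_def
proof (rule measurable_sigma_sets)
  show P: "{U. openin (mtopology_of C01) U} \<subseteq> Pow (mspace C01)"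
    using openin_subset[of "mtopology_of C01"] by auto
  show "sets (sigma (mspace C01) {U. openin (mtopology_of C01) U}) = sigma_sets (mspace C01) {U. openin (mtopology_of C01) U}"
    by (rule sets_measure_of[OF P])
  show "(\<lambda>\<omega>. restrict (\<lambda>t. Y t \<omega>) {0..1}) \<in> space M \<rightarrow> mspace C01" using restrict_in_C01[OF c] by auto
  fix U assume "U \<in> {U. openin (mtopology_of C01) U}"
  then have U: "openin (mtopology_of C01) U" by simp
  define \<psi> where "\<psi> = inf_convolution (indicat_real U) 1"
  have lip: "\<bar>\<psi> f - \<psi> g\<bar> \<le> 1 * mdist C01 f g" if "f \<in> mspace C01" "g \<in> mspace C01" for f g
    unfolding \<psi>_def by (rule inf_convolution_lipschitz[where a=0]) (use that in auto)
  have pos: "0 < \<psi> f \<longleftrightarrow> f \<in> U" if f: "f \<in> mspace C01" for f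
  proof
    assume "0 < \<psi> f"
    then show "f \<in> U" using inf_convolution_bounds(3)[of 0 "indicat_real U" 1 f] f
      by (cases "f \<in> U") (simp_all add: \<psi>_def)
  next
    assume "f \<in> U"
    then obtain d where d: "0 < d" "C01.mball f d \<subseteq> U"
      using U unfolding mtopology_of_def C01.openin_mtopology by blast
    have "min 1 d \<le> \<psi> f" unfolding \<psi>_def inf_convolution_def
    proof (rule cINF_greatest)
      fix g assume g: "g \<in> mspace C01"
      show "min 1 d \<le> indicat_real U g + 1 * mdist C01 f g"
      proof (cases "mdist C01 f g < d")
        case True
        then have "g \<in> U" using d f g by (auto simp: C01.mball_def)
        then show ?thesis by (simp add: add_increasing2)
      qed (auto simp: indicator_def)
    qed (use f in auto)
    then show "0 < \<psi> f" using d by linarith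
  qed
  have "(\<lambda>\<omega>. \<psi> (restrict (\<lambda>t. Y t \<omega>) {0..1})) \<in> borel_measurable M"
    by (rule measurable_sequentially_continuous_C01[OF Y c]) (auto intro: lipschitz_C01_sequentially[OF lip])
  then have "{\<omega> \<in> space M. 0 < \<psi> (restrict (\<lambda>t. Y t \<omega>) {0..1})} \<in> sets M" by measurable
  also have "{\<omega> \<in> space M. 0 < \<psi> (restrict (\<lambda>t. Y t \<omega>) {0..1})} = (\<lambda>\<omega>. restrict (\<lambda>t. Y t \<omega>) {0..1}) -` U \<inter> space M"
    using pos[OF restrict_in_C01[OF c]] by auto
  finally show "(\<lambda>\<omega>. restrict (\<lambda>t. Y t \<omega>) {0..1}) -` U \<inter> space M \<in> sets M" .
qed

section \<open>Weak convergence tested on bounded Lipschitz functionals\<close>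

lemma integral_law_C01:
  fixes Y :: "real \<Rightarrow> 'a \<Rightarrow> real"
  assumes Y: "\<And>t. t \<in> {0..1} \<Longrightarrow> Y t \<in> borel_measurable M"
    and c: "\<And>\<omega>. \<omega> \<in> space M \<Longrightarrow> continuous_on {0..1} (\<lambda>t. Y t \<omega>)"
    and \<phi>: "continuous_map (mtopology_of C01) euclideanreal \<phi>"
  shows "(\<integral>f. \<phi> f \<partial>law_C01 M Y) = (\<integral>\<omega>. \<phi> (restrict (\<lambda>t. Y t \<omega>) {0..1}) \<partial>M)"
  unfolding law_C01_def
proof (rule integral_distr[OF measurable_restrict_C01[OF Y c]])
  show "\<phi> \<in> borel_measurable (borel_metric C01)"
  proof (rule borel_measurableI)
    fix S :: "real set" assume "open S"
    then have "openin (mtopology_of C01) {f \<in> topspace (mtopology_of C01). \<phi> f \<in> S}"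
      by (intro openin_continuous_map_preimage[OF \<phi>]) (simp only: open_openin[symmetric])
    moreover have P: "{U. openin (mtopology_of C01) U} \<subseteq> Pow (mspace C01)"
      using openin_subset[of "mtopology_of C01"] by auto
    ultimately show "\<phi> -` S \<inter> space (borel_metric C01) \<in> sets (borel_metric C01)"
      unfolding borel_metric_def by (auto simp: space_measure_of_conv sets_measure_of Int_def vimage_def conj_commute intro!: sigma_sets.Basic)
  qed
qed auto

lemma lipschitz_C01_random_measurable:
  fixes Y :: "real \<Rightarrow> 'a \<Rightarrow> real"
  assumes Y: "\<And>t. t \<in> {0..1} \<Longrightarrow> Y t \<in> borel_measurable M"
    and c: "\<And>\<omega>. \<omega> \<in> space M \<Longrightarrow> continuous_on {0..1} (\<lambda>t. Y t \<omega>)"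
    and l: "\<And>f g. f \<in> mspace C01 \<Longrightarrow> g \<in> mspace C01 \<Longrightarrow> \<bar>\<psi> f - \<psi> g\<bar> \<le> K * mdist C01 f g"
  shows "(\<lambda>\<omega>. \<psi> (restrict (\<lambda>t. Y t \<omega>) {0..1})) \<in> borel_measurable M"
  by (rule measurable_sequentially_continuous_C01[OF Y c]) (auto intro: lipschitz_C01_sequentially[OF l])

definition bounded_lipschitz_C01 :: "real \<Rightarrow> real \<Rightarrow> ((real \<Rightarrow> real) \<Rightarrow> real) \<Rightarrow> bool" where
  "bounded_lipschitz_C01 K A \<psi> \<longleftrightarrow> 0 \<le> K \<and>
     (\<forall>f\<in>mspace C01. \<bar>\<psi> f\<bar> \<le> A \<and> (\<forall>g\<in>mspace C01. \<bar>\<psi> f - \<psi> g\<bar> \<le> K * mdist C01 f g))"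

text \<open>Lipschitz envelopes approach a bounded continuous functional from below. One of them
  almost attains the limiting expectation, its own expectations converge, and on the prelimit side
  it stays below the functional. Passing to the negative functional yields the other half.\<close>

lemma weak_convergence_lower_half:
  fixes Y :: "nat \<Rightarrow> real \<Rightarrow> 'a \<Rightarrow> real" and Y0 :: "real \<Rightarrow> 'b \<Rightarrow> real"
  assumes M: "prob_space M" and N: "prob_space N"
    and Y: "\<And>n t. t \<in> {0..1} \<Longrightarrow> Y n t \<in> borel_measurable M"
      "\<And>n \<omega>. \<omega> \<in> space M \<Longrightarrow> continuous_on {0..1} (\<lambda>t. Y n t \<omega>)"
    and Y0: "\<And>t. t \<in> {0..1} \<Longrightarrow> Y0 t \<in> borel_measurable N"
      "\<And>\<omega>. \<omega> \<in> space N \<Longrightarrow> continuous_on {0..1} (\<lambda>t. Y0 t \<omega>)"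
    and lip: "\<And>\<psi> K A. bounded_lipschitz_C01 K A \<psi> \<Longrightarrow>
       (\<lambda>n. \<integral>\<omega>. \<psi> (restrict (\<lambda>t. Y n t \<omega>) {0..1}) \<partial>M) \<longlonglongrightarrow> (\<integral>\<omega>. \<psi> (restrict (\<lambda>t. Y0 t \<omega>) {0..1}) \<partial>N)"
    and \<phi>: "continuous_map (mtopology_of C01) euclideanreal \<phi>"
    and A: "\<And>f. f \<in> mspace C01 \<Longrightarrow> \<bar>\<phi> f\<bar> \<le> A" and e: "0 < e"
  shows "eventually (\<lambda>n. (\<integral>\<omega>. \<phi> (restrict (\<lambda>t. Y0 t \<omega>) {0..1}) \<partial>N) - e < (\<integral>\<omega>. \<phi> (restrict (\<lambda>t. Y n t \<omega>) {0..1}) \<partial>M)) sequentially"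
proof -
  interpret M: prob_space M by fact
  interpret N: prob_space N by fact
  define X where "X n \<omega> = restrict (\<lambda>t. Y n t \<omega>) {0..1}" for n \<omega>
  define X0 where "X0 \<omega> = restrict (\<lambda>t. Y0 t \<omega>) {0..1}" for \<omega>
  define L where "L k = inf_convolution \<phi> (real k)" for k
  have Xin: "\<omega> \<in> space M \<Longrightarrow> X n \<omega> \<in> mspace C01" for n \<omega> unfolding X_def by (intro restrict_in_C01 Y)
  have X0in: "\<omega> \<in> space N \<Longrightarrow> X0 \<omega> \<in> mspace C01" for \<omega> unfolding X0_def by (intro restrict_in_C01 Y0)
  have lb: "- A \<le> \<phi> f" "\<phi> f \<le> A" if "f \<in> mspace C01" for f using A[OF that] by auto
  have Llip: "\<bar>L k f - L k g\<bar> \<le> real k * mdist C01 f g" if "f \<in> mspace C01" "g \<in> mspace C01" for k f g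
    unfolding L_def by (rule inf_convolution_lipschitz[where a="- A"]) (use lb that in auto)
  have Lb: "- A \<le> L k f" "L k f \<le> \<phi> f" if "f \<in> mspace C01" for k f
    using inf_convolution_bounds(2,3)[where a="- A" and \<psi>=\<phi> and k="real k" and f=f] lb(1) that by (auto simp: L_def)
  have LA: "\<bar>L k f\<bar> \<le> A" if "f \<in> mspace C01" for k f using Lb[OF that, of k] lb(2)[OF that] by (auto simp: abs_le_iff)
  have LXm[measurable]: "(\<lambda>\<omega>. L k (X n \<omega>)) \<in> borel_measurable M" "(\<lambda>\<omega>. L k (X0 \<omega>)) \<in> borel_measurable N" for k n
    unfolding X_def X0_def by (rule lipschitz_C01_random_measurable[OF _ _ Llip]; use Y Y0 in auto)+
  have pXm[measurable]: "(\<lambda>\<omega>. \<phi> (X n \<omega>)) \<in> borel_measurable M" "(\<lambda>\<omega>. \<phi> (X0 \<omega>)) \<in> borel_measurable N" for n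
    unfolding X_def X0_def
    by (rule measurable_sequentially_continuous_C01; use Y Y0 continuous_map_C01_sequentially[OF \<phi>] in auto)+
  have "(\<lambda>k. \<integral>\<omega>. L k (X0 \<omega>) \<partial>N) \<longlonglongrightarrow> (\<integral>\<omega>. \<phi> (X0 \<omega>) \<partial>N)"
  proof (rule integral_dominated_convergence[where w="\<lambda>_. A"])
    show "AE \<omega> in N. (\<lambda>k. L k (X0 \<omega>)) \<longlonglongrightarrow> \<phi> (X0 \<omega>)"
      unfolding L_def by (rule AE_I2) (rule inf_convolution_tendsto[OF lb(1) X0in \<phi>])
    show "AE \<omega> in N. norm (L k (X0 \<omega>)) \<le> A" for k using LA[OF X0in] by (auto intro: AE_I2)
  qed auto
  then have "eventually (\<lambda>k. (\<integral>\<omega>. \<phi> (X0 \<omega>) \<partial>N) - e / 2 < (\<integral>\<omega>. L k (X0 \<omega>) \<partial>N)) sequentially"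
    by (rule order_tendstoD) (use e in simp)
  then obtain k where k: "(\<integral>\<omega>. \<phi> (X0 \<omega>) \<partial>N) - e / 2 < (\<integral>\<omega>. L k (X0 \<omega>) \<partial>N)"
    by (auto simp: eventually_sequentially)
  have "(\<lambda>n. \<integral>\<omega>. L k (X n \<omega>) \<partial>M) \<longlonglongrightarrow> (\<integral>\<omega>. L k (X0 \<omega>) \<partial>N)"
    unfolding X_def X0_def by (rule lip[of "real k" A]) (use Llip LA in \<open>auto simp: bounded_lipschitz_C01_def\<close>)
  then have "eventually (\<lambda>n. (\<integral>\<omega>. L k (X0 \<omega>) \<partial>N) - e / 2 < (\<integral>\<omega>. L k (X n \<omega>) \<partial>M)) sequentially"
    by (rule order_tendstoD) (use e in simp)
  then show ?thesis unfolding X_def[symmetric] X0_def[symmetric]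
  proof eventually_elim
    case (elim n)
    have "(\<integral>\<omega>. L k (X n \<omega>) \<partial>M) \<le> (\<integral>\<omega>. \<phi> (X n \<omega>) \<partial>M)"
    proof (rule integral_mono)
      show "integrable M (\<lambda>\<omega>. L k (X n \<omega>))"
        by (rule M.integrable_const_bound[where B=A]) (use LA[OF Xin] in \<open>auto intro: AE_I2\<close>)
      show "integrable M (\<lambda>\<omega>. \<phi> (X n \<omega>))"
        by (rule M.integrable_const_bound[where B=A]) (use A[OF Xin] in \<open>auto intro: AE_I2\<close>)
    qed (use Lb Xin in auto)
    then show ?case using elim k by linarith
  qed
qed

lemma weak_convergence_from_lipschitz:
  fixes Y :: "nat \<Rightarrow> real \<Rightarrow> 'a \<Rightarrow> real" and Y0 :: "real \<Rightarrow> 'b \<Rightarrow> real"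
  assumes M: "prob_space M" and N: "prob_space N"
    and Y: "\<And>n t. t \<in> {0..1} \<Longrightarrow> Y n t \<in> borel_measurable M"
      "\<And>n \<omega>. \<omega> \<in> space M \<Longrightarrow> continuous_on {0..1} (\<lambda>t. Y n t \<omega>)"
    and Y0: "\<And>t. t \<in> {0..1} \<Longrightarrow> Y0 t \<in> borel_measurable N"
      "\<And>\<omega>. \<omega> \<in> space N \<Longrightarrow> continuous_on {0..1} (\<lambda>t. Y0 t \<omega>)"
    and lip: "\<And>\<psi> K A. bounded_lipschitz_C01 K A \<psi> \<Longrightarrow>
       (\<lambda>n. \<integral>\<omega>. \<psi> (restrict (\<lambda>t. Y n t \<omega>) {0..1}) \<partial>M) \<longlonglongrightarrow> (\<integral>\<omega>. \<psi> (restrict (\<lambda>t. Y0 t \<omega>) {0..1}) \<partial>N)"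
    and \<phi>: "continuous_map (mtopology_of C01) euclideanreal \<phi>" "bounded (\<phi> ` mspace C01)"
  shows "(\<lambda>n. \<integral>\<omega>. \<phi> (restrict (\<lambda>t. Y n t \<omega>) {0..1}) \<partial>M) \<longlonglongrightarrow> (\<integral>\<omega>. \<phi> (restrict (\<lambda>t. Y0 t \<omega>) {0..1}) \<partial>N)"
proof (rule tendstoI)
  fix e :: real assume e: "0 < e"
  obtain A where A: "\<And>f. f \<in> mspace C01 \<Longrightarrow> \<bar>\<phi> f\<bar> \<le> A" using \<phi>(2) by (auto simp: bounded_iff)
  have neg: "continuous_map (mtopology_of C01) euclideanreal (\<lambda>f. - \<phi> f)"
    by (rule continuous_map_minus[OF \<phi>(1)])
  have 1: "eventually (\<lambda>n. (\<integral>\<omega>. \<phi> (restrict (\<lambda>t. Y0 t \<omega>) {0..1}) \<partial>N) - e < (\<integral>\<omega>. \<phi> (restrict (\<lambda>t. Y n t \<omega>) {0..1}) \<partial>M)) sequentially"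
    by (rule weak_convergence_lower_half[where A=A and M=M and N=N]) (fact M N Y Y0 lip \<phi>(1) A e)+
  have "eventually (\<lambda>n. (\<integral>\<omega>. - \<phi> (restrict (\<lambda>t. Y0 t \<omega>) {0..1}) \<partial>N) - e < (\<integral>\<omega>. - \<phi> (restrict (\<lambda>t. Y n t \<omega>) {0..1}) \<partial>M)) sequentially"
    by (rule weak_convergence_lower_half[where A=A and M=M and N=N and \<phi>="\<lambda>f. - \<phi> f"])
      ((fact M N Y Y0 lip neg e)+, use A e in auto)
  with 1 show "eventually (\<lambda>n. dist (\<integral>\<omega>. \<phi> (restrict (\<lambda>t. Y n t \<omega>) {0..1}) \<partial>M) (\<integral>\<omega>. \<phi> (restrict (\<lambda>t. Y0 t \<omega>) {0..1}) \<partial>N) < e) sequentially"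
    by eventually_elim (auto simp: dist_real_def abs_less_iff)
qed

section \<open>Mixed moments and polynomial approximation on a compact cube\<close>

inductive_set monomial_span :: "nat \<Rightarrow> ((nat \<Rightarrow> real) \<Rightarrow> real) set" for m where
  monomial: "set js \<subseteq> {..<m} \<Longrightarrow> (\<lambda>v. c * (\<Prod>j\<leftarrow>js. v j)) \<in> monomial_span m"
| add: "f \<in> monomial_span m \<Longrightarrow> g \<in> monomial_span m \<Longrightarrow> (\<lambda>v. f v + g v) \<in> monomial_span m"

lemma monomial_span_mult:
  assumes f: "f \<in> monomial_span m" and g: "g \<in> monomial_span m"
  shows "(\<lambda>v. f v * g v) \<in> monomial_span m"
  using f
proof induction
  case (monomial js c)
  show ?case using g
  proof induction
    case (monomial js' c')
    have "(\<lambda>v. (c * c') * (\<Prod>j\<leftarrow>js @ js'. v j)) \<in> monomial_span m"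
      by (rule monomial_span.monomial) (use monomial \<open>set js \<subseteq> {..<m}\<close> in auto)
    then show ?case by (simp add: mult_ac)
  next
    case (add f g)
    from monomial_span.add[OF add.IH] show ?case by (simp add: algebra_simps)
  qed
next
  case (add f h)
  from monomial_span.add[OF add.IH] show ?case by (simp add: algebra_simps)
qed

text \<open>Coordinates from \<open>m\<close> on are pinned to 0. This makes the set compact in the
  infinite product, and two of its points can differ only in a coordinate below \<open>m\<close>, so
  polynomials in these coordinates separate points.\<close>

definition cube :: "nat \<Rightarrow> real \<Rightarrow> (nat \<Rightarrow> real) set" where
  "cube m A = {v. \<forall>k. v k \<in> (if k < m then {0..A} else {0})}"

lemma compact_cube: "compact (cube m A)"
proof -
  have "cube m A = PiE UNIV (\<lambda>k. if k < m then {0..A} else {0})" by (auto simp: cube_def PiE_def Pi_def)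
  then have "compactin (product_topology (\<lambda>_. euclideanreal) UNIV) (cube m A)"
    by (simp add: compactin_PiE)
  then show ?thesis by (simp add: euclidean_product_topology)
qed

lemma continuous_on_coordinate: "continuous_on S (\<lambda>v :: nat \<Rightarrow> real. v k)"
  by (rule continuous_on_subset[OF continuous_on_product_coordinates subset_UNIV])

lemma continuous_on_prod_list_coordinates: "continuous_on S (\<lambda>v :: nat \<Rightarrow> real. \<Prod>j\<leftarrow>js. v j)"
  by (induction js) (auto intro!: continuous_intros continuous_on_coordinate)

lemma function_ring_monomial_span: "function_ring_on (monomial_span m) (cube m A)"
proof
  show "compact (cube m A)" by (rule compact_cube)
  show "f \<in> monomial_span m \<Longrightarrow> continuous_on (cube m A) f" for f
  proof (induction rule: monomial_span.induct)
    case (monomial js c)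
    show ?case by (intro continuous_intros continuous_on_prod_list_coordinates)
  next
    case (add f g)
    then show ?case by (intro continuous_intros)
  qed
  show "f \<in> monomial_span m \<Longrightarrow> g \<in> monomial_span m \<Longrightarrow> (\<lambda>x. f x + g x) \<in> monomial_span m" for f g
    by (rule monomial_span.add)
  show "f \<in> monomial_span m \<Longrightarrow> g \<in> monomial_span m \<Longrightarrow> (\<lambda>x. f x * g x) \<in> monomial_span m" for f g
    by (rule monomial_span_mult)
  show "(\<lambda>_. c) \<in> monomial_span m" for c
    using monomial_span.monomial[of "[]" m c] by simp
  fix x y :: "nat \<Rightarrow> real" assume xy: "x \<in> cube m A" "y \<in> cube m A" "x \<noteq> y"
  then obtain k where k: "x k \<noteq> y k" by auto
  then have "k < m" using xy by (auto simp: cube_def split: if_splits) (metis singletonD)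
  then have "(\<lambda>v. 1 * (\<Prod>j\<leftarrow>[k]. v j)) \<in> monomial_span m" by (intro monomial_span.monomial) auto
  then show "\<exists>f\<in>monomial_span m. f x \<noteq> f y" using k by (intro bexI) auto
qed

lemma prod_list_cube_bound:
  assumes "v \<in> cube m A" "set js \<subseteq> {..<m}"
  shows "\<bar>\<Prod>j\<leftarrow>js. v j\<bar> \<le> A ^ length js" "0 \<le> A ^ length js"
proof -
  have "\<bar>\<Prod>j\<leftarrow>js. v j\<bar> \<le> A ^ length js \<and> 0 \<le> A ^ length js"
    using assms(2)
  proof (induction js)
    case (Cons j js)
    have "\<bar>v j\<bar> \<le> A" using assms(1) Cons.prems by (auto simp: cube_def dest: spec[of _ j])
    then have "\<bar>v j\<bar> * \<bar>\<Prod>j\<leftarrow>js. v j\<bar> \<le> A * A ^ length js" using Cons by (intro mult_mono) auto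
    then show ?case using Cons \<open>\<bar>v j\<bar> \<le> A\<close> by (auto simp: abs_mult intro!: mult_nonneg_nonneg)
  qed simp
  then show "\<bar>\<Prod>j\<leftarrow>js. v j\<bar> \<le> A ^ length js" "0 \<le> A ^ length js" by auto
qed

text \<open>All random vectors live in one compact cube, so a polynomial uniformly within
  \<open>e / 3\<close> of \<open>g\<close> is that close in every expectation, and expectations of
  polynomials are combinations of the given mixed moments.\<close>

lemma tendsto_expectation_of_moments:
  fixes V :: "nat \<Rightarrow> 'a \<Rightarrow> nat \<Rightarrow> real" and V0 :: "'b \<Rightarrow> nat \<Rightarrow> real"
    and g :: "(nat \<Rightarrow> real) \<Rightarrow> real"
  assumes M: "prob_space M" and N: "prob_space N"
    and V: "\<And>n k. (\<lambda>\<omega>. V n \<omega> k) \<in> borel_measurable M" "\<And>n \<omega>. V n \<omega> \<in> cube m A"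
    and V0: "\<And>k. (\<lambda>\<omega>. V0 \<omega> k) \<in> borel_measurable N" "\<And>\<omega>. V0 \<omega> \<in> cube m A"
    and mom: "\<And>js. set js \<subseteq> {..<m} \<Longrightarrow> (\<lambda>n. \<integral>\<omega>. (\<Prod>j\<leftarrow>js. V n \<omega> j) \<partial>M) \<longlonglongrightarrow> (\<integral>\<omega>. (\<Prod>j\<leftarrow>js. V0 \<omega> j) \<partial>N)"
    and g: "continuous_on (cube m A) g"
    and gm: "\<And>n. (\<lambda>\<omega>. g (V n \<omega>)) \<in> borel_measurable M" "(\<lambda>\<omega>. g (V0 \<omega>)) \<in> borel_measurable N"
  shows "(\<lambda>n. \<integral>\<omega>. g (V n \<omega>) \<partial>M) \<longlonglongrightarrow> (\<integral>\<omega>. g (V0 \<omega>) \<partial>N)"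
proof -
  interpret M: prob_space M by fact
  interpret N: prob_space N by fact
  interpret function_ring_on "monomial_span m" "cube m A" by (rule function_ring_monomial_span)
  have prodm: "(\<lambda>\<omega>. \<Prod>j\<leftarrow>js. U \<omega> j) \<in> borel_measurable Q"
    if [measurable]: "\<And>k. (\<lambda>\<omega>. U \<omega> k) \<in> borel_measurable Q" for U :: "'z \<Rightarrow> nat \<Rightarrow> real" and Q js
    by (induction js) auto
  have int: "integrable M (\<lambda>\<omega>. f (V n \<omega>))" "integrable N (\<lambda>\<omega>. f (V0 \<omega>))" if "f \<in> monomial_span m" for f n
    using that
  proof (induction)
    case (monomial js c)
    { case 1
      have "integrable M (\<lambda>\<omega>. \<Prod>j\<leftarrow>js. V n \<omega> j)"
        by (rule M.integrable_const_bound[where B="A ^ length js"])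
          (use prod_list_cube_bound(1)[OF V(2) monomial] prodm[OF V(1)] in \<open>auto intro: AE_I2\<close>)
      then show ?case by simp }
    { case 2
      have "integrable N (\<lambda>\<omega>. \<Prod>j\<leftarrow>js. V0 \<omega> j)"
        by (rule N.integrable_const_bound[where B="A ^ length js"])
          (use prod_list_cube_bound(1)[OF V0(2) monomial] prodm[OF V0(1)] in \<open>auto intro: AE_I2\<close>)
      then show ?case by simp }
  qed auto
  have conv: "(\<lambda>n. \<integral>\<omega>. f (V n \<omega>) \<partial>M) \<longlonglongrightarrow> (\<integral>\<omega>. f (V0 \<omega>) \<partial>N)" if "f \<in> monomial_span m" for f
    using that
  proof (induction)
    case (monomial js c)
    then show ?case using tendsto_mult_left[OF mom[OF monomial], of c] by simp
  next
    case (add f h)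
    then show ?case using tendsto_add[OF add.IH] int by simp
  qed
  show ?thesis
  proof (rule tendstoI)
    fix e :: real assume e: "0 < e"
    obtain f where f: "f \<in> monomial_span m" "\<And>x. x \<in> cube m A \<Longrightarrow> \<bar>g x - f x\<bar> < e / 3"
      using Stone_Weierstrass_basic[OF g, of "e / 3"] e by auto
    have i: "integrable M (\<lambda>\<omega>. g (V n \<omega>) - f (V n \<omega>))" "integrable N (\<lambda>\<omega>. g (V0 \<omega>) - f (V0 \<omega>))" for n
      using f(2)[OF V(2)] f(2)[OF V0(2)] int[OF f(1)]
      by (auto intro!: M.integrable_const_bound[where B="e / 3"] N.integrable_const_bound[where B="e / 3"] AE_I2
          borel_measurable_diff gm less_imp_le)
    have gi: "integrable M (\<lambda>\<omega>. g (V n \<omega>))" "integrable N (\<lambda>\<omega>. g (V0 \<omega>))" for n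
      using Bochner_Integration.integrable_add[OF i(1)[of n] int(1)[OF f(1), of n]] Bochner_Integration.integrable_add[OF i(2) int(2)[OF f(1)]] by simp_all
    have b1: "\<bar>(\<integral>\<omega>. g (V n \<omega>) \<partial>M) - (\<integral>\<omega>. f (V n \<omega>) \<partial>M)\<bar> \<le> e / 3" for n
    proof -
      have "\<bar>\<integral>\<omega>. g (V n \<omega>) - f (V n \<omega>) \<partial>M\<bar> \<le> (\<integral>\<omega>. \<bar>g (V n \<omega>) - f (V n \<omega>)\<bar> \<partial>M)" by (rule integral_abs_bound)
      also have "\<dots> \<le> (\<integral>\<omega>. e / 3 \<partial>M)" by (rule integral_mono) (use i f(2)[OF V(2)] in \<open>auto intro: less_imp_le\<close>)
      finally show ?thesis using gi int[OF f(1)] by (simp add: M.prob_space)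
    qed
    have b2: "\<bar>(\<integral>\<omega>. g (V0 \<omega>) \<partial>N) - (\<integral>\<omega>. f (V0 \<omega>) \<partial>N)\<bar> \<le> e / 3"
    proof -
      have "\<bar>\<integral>\<omega>. g (V0 \<omega>) - f (V0 \<omega>) \<partial>N\<bar> \<le> (\<integral>\<omega>. \<bar>g (V0 \<omega>) - f (V0 \<omega>)\<bar> \<partial>N)" by (rule integral_abs_bound)
      also have "\<dots> \<le> (\<integral>\<omega>. e / 3 \<partial>N)" by (rule integral_mono) (use i f(2)[OF V0(2)] in \<open>auto intro: less_imp_le\<close>)
      finally show ?thesis using gi int[OF f(1)] by (simp add: N.prob_space)
    qed
    have "eventually (\<lambda>n. dist (\<integral>\<omega>. f (V n \<omega>) \<partial>M) (\<integral>\<omega>. f (V0 \<omega>) \<partial>N) < e / 3) sequentially"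
      by (rule tendstoD[OF conv[OF f(1)]]) (use e in simp)
    then show "eventually (\<lambda>n. dist (\<integral>\<omega>. g (V n \<omega>) \<partial>M) (\<integral>\<omega>. g (V0 \<omega>) \<partial>N) < e) sequentially"
    proof eventually_elim
      case (elim n)
      then show ?case using b1[of n] b2 unfolding dist_real_def by linarith
    qed
  qed
qed

section \<open>Second moments of Gaussian occupation integrals\<close>

lemma ennreal_norm_integral_le:
  fixes f :: "'a \<Rightarrow> 'b::{banach, second_countable_topology}"
  shows "ennreal (norm (integral\<^sup>L M f)) \<le> (\<integral>\<^sup>+x. ennreal (norm (f x)) \<partial>M)"
proof (cases "integrable M f")
  case True
  then show ?thesis by (rule integral_norm_bound_ennreal)
qed (simp add: not_integrable_integral_eq)

text \<open>The inversion formula holds at every point rather than almost everywhere, so it may be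
  inserted under an expectation at a random argument. Real weights suffice for differences of
  centred normal densities.\<close>

definition fourier_representation :: "(real \<Rightarrow> real) \<Rightarrow> (real \<Rightarrow> real) \<Rightarrow> bool" where
  "fourier_representation q \<kappa> \<longleftrightarrow> integrable lborel \<kappa> \<and>
     (\<forall>y. complex_of_real (q y) = (\<integral>\<theta>. complex_of_real (\<kappa> \<theta>) * cis (\<theta> * y) \<partial>lborel))"

lemma fourier_representation_bound:
  assumes "fourier_representation q \<kappa>"
  shows "\<bar>q y\<bar> \<le> (\<integral>\<theta>. \<bar>\<kappa> \<theta>\<bar> \<partial>lborel)"
proof -
  have "\<bar>q y\<bar> = norm (complex_of_real (q y))" by simp
  also have "\<dots> \<le> (\<integral>\<theta>. norm (complex_of_real (\<kappa> \<theta>) * cis (\<theta> * y)) \<partial>lborel)"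
    using assms integral_norm_bound unfolding fourier_representation_def by metis
  finally show ?thesis by (simp add: norm_mult)
qed

lemma fourier_representation_measurable:
  assumes "fourier_representation q \<kappa>"
  shows "q \<in> borel_measurable borel"
proof -
  have [measurable]: "\<kappa> \<in> borel_measurable borel" using assms by (auto simp: fourier_representation_def)
  have "q y = Re (\<integral>\<theta>. complex_of_real (\<kappa> \<theta>) * cis (\<theta> * y) \<partial>lborel)" for y
    using assms by (metis fourier_representation_def Re_complex_of_real)
  moreover have "(\<lambda>y. Re (\<integral>\<theta>. complex_of_real (\<kappa> \<theta>) * cis (\<theta> * y) \<partial>lborel)) \<in> borel_measurable borel" by measurable
  ultimately show ?thesis by presburger
qed

lemma fourier_representation_diff:
  assumes q: "fourier_representation q \<kappa>" and q': "fourier_representation q' \<kappa>'"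
  shows "fourier_representation (\<lambda>y. q y - q' y) (\<lambda>\<theta>. \<kappa> \<theta> - \<kappa>' \<theta>)"
proof -
  have i: "integrable lborel (\<lambda>\<theta>. complex_of_real (\<kappa> \<theta>) * cis (\<theta> * y))" if "integrable lborel \<kappa>" for \<kappa> y
    using integrable_cis_times_real[of "\<lambda>\<theta>. \<theta> * y" lborel \<kappa>] that by (simp add: mult.commute)
  show ?thesis using q q' unfolding fourier_representation_def
    by (auto simp: left_diff_distrib i)
qed

definition gaussian_frequency :: "real \<Rightarrow> real \<Rightarrow> real" where
  "gaussian_frequency \<epsilon> \<theta> = exp (- (\<epsilon> * \<theta>)\<^sup>2 / 2) / (2 * pi)"

lemma gaussian_frequency_measurable[measurable]: "gaussian_frequency \<epsilon> \<in> borel_measurable borel"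
proof -
  have "(\<lambda>\<theta>. gaussian_frequency \<epsilon> \<theta>) \<in> borel_measurable borel" unfolding gaussian_frequency_def by measurable
  then show ?thesis by simp
qed

lemma gaussian_frequency_nonneg: "0 \<le> gaussian_frequency \<epsilon> \<theta>"
  by (simp add: gaussian_frequency_def)

lemma fourier_representation_normal_density:
  assumes e: "0 < \<epsilon>"
  shows "fourier_representation (normal_density 0 \<epsilon>) (gaussian_frequency \<epsilon>)"
  unfolding fourier_representation_def
proof (intro conjI allI)
  have "integrable lborel (\<lambda>x. complex_of_real (exp (- (\<epsilon> * x)\<^sup>2 / 2)))" by (rule integral_cis_gaussian(2)[OF e])
  then have "integrable lborel (\<lambda>x. exp (- (\<epsilon> * x)\<^sup>2 / 2))" by (simp only: complex_of_real_integrable_eq)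
  then show "integrable lborel (gaussian_frequency \<epsilon>)" unfolding gaussian_frequency_def[abs_def] by simp
  fix y
  have "(\<integral>\<theta>. complex_of_real (gaussian_frequency \<epsilon> \<theta>) * cis (\<theta> * y) \<partial>lborel)
    = (\<integral>\<theta>. complex_of_real (1 / (2 * pi)) * (complex_of_real (exp (- (\<epsilon> * \<theta>)\<^sup>2 / 2)) * cis (\<theta> * y)) \<partial>lborel)"
    by (simp add: gaussian_frequency_def)
  also have "\<dots> = complex_of_real (1 / (2 * pi)) * complex_of_real (2 * pi * normal_density 0 \<epsilon> y)"
    by (subst integral_mult_right_zero) (simp only: integral_cis_gaussian(1)[OF e])
  also have "\<dots> = complex_of_real (normal_density 0 \<epsilon> y)" by simp
  finally show "complex_of_real (normal_density 0 \<epsilon> y) = (\<integral>\<theta>. complex_of_real (gaussian_frequency \<epsilon> \<theta>) * cis (\<theta> * y) \<partial>lborel)" ..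
qed

lemma nn_integral_gaussian:
  assumes a: "0 < a"
  shows "(\<integral>\<^sup>+\<theta>. ennreal (exp (- (a * (\<theta> + b)\<^sup>2 / 2))) \<partial>lborel) = ennreal (sqrt (2 * pi / a))"
proof -
  define \<sigma> where "\<sigma> = 1 / sqrt a"
  have s: "0 < \<sigma>" "\<sigma>\<^sup>2 = 1 / a" using a by (auto simp: \<sigma>_def power_divide)
  have "exp (- (a * (\<theta> + b)\<^sup>2 / 2)) = sqrt (2 * pi / a) * normal_density (- b) \<sigma> \<theta>" for \<theta>
    using a by (simp add: normal_density_def s(2) real_sqrt_divide field_simps)
  then have "(\<integral>\<^sup>+\<theta>. ennreal (exp (- (a * (\<theta> + b)\<^sup>2 / 2))) \<partial>lborel)
    = (\<integral>\<^sup>+\<theta>. ennreal (sqrt (2 * pi / a)) * ennreal (normal_density (- b) \<sigma> \<theta>) \<partial>lborel)"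
    using a by (simp add: ennreal_mult)
  also have "\<dots> = ennreal (sqrt (2 * pi / a)) * (\<integral>\<^sup>+\<theta>. ennreal (normal_density (- b) \<sigma> \<theta>) \<partial>lborel)"
    by (rule nn_integral_cmult) simp
  also have "(\<integral>\<^sup>+\<theta>. ennreal (normal_density (- b) \<sigma> \<theta>) \<partial>lborel) = 1"
    using s integral_normal_density[of \<sigma> "- b"] by (subst nn_integral_eq_integral) auto
  finally show ?thesis by simp
qed

text \<open>When the variance of \<open>\<alpha> P\<^sub>s + \<gamma> (P\<^bsub>s+d\<^esub> - P\<^sub>s)\<close> is at least \<open>c (\<alpha>\<^sup>2s\<^bsup>2\<nu>\<^esup> + \<gamma>\<^sup>2d\<^bsup>2\<nu>\<^esup>)\<close>, the mean of
  \<open>q(P\<^sub>s) q(P\<^bsub>s+d\<^esub>)\<close> is at most \<open>s\<^bsup>-\<nu>\<^esup>\<close> times the pair weight at \<open>d\<close>, where \<open>w / (2\<pi>)\<close> dominates the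
  Fourier transform of \<open>q\<close>. The energy integrates this over pairs of times at distance at most \<open>r\<close>.\<close>

definition pair_weight :: "real \<Rightarrow> real \<Rightarrow> (real \<Rightarrow> real) \<Rightarrow> real \<Rightarrow> ennreal" where
  "pair_weight c \<nu> w d = ennreal (1 / (4 * pi\<^sup>2) * sqrt (2 * pi / c)) * (\<integral>\<^sup>+\<theta>. ennreal (w \<theta> * exp (- (c * \<theta>\<^sup>2 * d powr (2 * \<nu>) / 2))) \<partial>lborel)"

definition energy :: "real \<Rightarrow> real \<Rightarrow> (real \<Rightarrow> real) \<Rightarrow> real \<Rightarrow> ennreal" where
  "energy c \<nu> w r = 2 * ((\<integral>\<^sup>+s. indicator {0<..1} s * ennreal (s powr (- \<nu>)) \<partial>lborel)
     * (\<integral>\<^sup>+d. indicator {- r..r} d * pair_weight c \<nu> w \<bar>d\<bar> \<partial>lborel))"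

lemma pair_weight_measurable[measurable]:
  assumes [measurable]: "w \<in> borel_measurable borel"
  shows "pair_weight c \<nu> w \<in> borel_measurable borel"
proof -
  have "(\<lambda>d. pair_weight c \<nu> w d) \<in> borel_measurable borel" unfolding pair_weight_def by measurable
  then show ?thesis by simp
qed

text \<open>The assumption \<open>P_cis\<close> is where Gaussianity is recorded;
  \<open>lower\<close> is a two-point form of local nondeterminism, and \<open>modulus\<close> the
  mean square Hoelder bound. Keeping the constants as parameters allows one choice for a whole
  family of processes.\<close>

locale gaussian_process = prob_space M for M :: "'a measure" +
  fixes P :: "real \<Rightarrow> 'a \<Rightarrow> real" and k :: "real \<Rightarrow> real \<Rightarrow> complex" and c \<nu> K \<mu> :: real
  assumes c: "0 < c" and nu: "0 < \<nu>" "\<nu> < 1" and K: "0 \<le> K" and mu: "0 < \<mu>"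
    and P_measurable: "(\<lambda>(s, \<omega>). P s \<omega>) \<in> borel_measurable (borel \<Otimes>\<^sub>M M)"
    and P_cis: "\<And>(I :: nat set) a s. finite I \<Longrightarrow> (\<And>i. i \<in> I \<Longrightarrow> s i \<in> {0..1}) \<Longrightarrow>
      (\<integral>\<omega>. cis (\<Sum>i\<in>I. a i * P (s i) \<omega>) \<partial>M) = complex_of_real (exp (- l2sq (\<lambda>u. \<Sum>i\<in>I. a i *\<^sub>R k (s i) u) / 2))"
    and lower: "\<And>s d \<alpha> \<gamma>. 0 \<le> s \<Longrightarrow> 0 \<le> d \<Longrightarrow> s + d \<le> 1 \<Longrightarrow>
      c * (\<alpha>\<^sup>2 * s powr (2 * \<nu>) + \<gamma>\<^sup>2 * d powr (2 * \<nu>)) \<le> l2sq (\<lambda>u. \<alpha> *\<^sub>R k s u + \<gamma> *\<^sub>R (k (s + d) u - k s u))"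
    and modulus: "\<And>s d. 0 \<le> s \<Longrightarrow> 0 \<le> d \<Longrightarrow> s + d \<le> 1 \<Longrightarrow>
      (l2sq (\<lambda>u. k (s + d) u - k s u)) \<le> K * d powr (2 * \<mu>)"
begin

lemma P_borel[measurable]: "P s \<in> borel_measurable M"
  using measurable_Pair2[OF P_measurable, of s] by simp

lemma P_measurable'[measurable]: "(\<lambda>(\<omega>, s). P s \<omega>) \<in> borel_measurable (M \<Otimes>\<^sub>M lborel)"
proof -
  have "(\<lambda>z. (snd z, fst z)) \<in> measurable (M \<Otimes>\<^sub>M lborel) (borel \<Otimes>\<^sub>M M)"
    by (rule measurable_Pair) auto
  from measurable_compose[OF this P_measurable] show ?thesis by (simp add: case_prod_beta')
qed

text \<open>Writing the combination as \<open>(\<theta> + \<theta>') P s\<close> plus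
  \<open>\<theta>'\<close> times the increment matches the form of \<open>lower\<close>, and the
  bound factors into Gaussians in \<open>\<theta> + \<theta>'\<close> and in
  \<open>\<theta>'\<close>.\<close>

lemma pair_cis_bound:
  assumes s: "0 \<le> s" "0 \<le> d" "s + d \<le> 1"
  shows "norm (\<integral>\<omega>. cis (\<theta> * P s \<omega> + \<theta>' * P (s + d) \<omega>) \<partial>M)
    \<le> exp (- (c * (\<theta> + \<theta>')\<^sup>2 * s powr (2 * \<nu>) / 2)) * exp (- (c * \<theta>'\<^sup>2 * d powr (2 * \<nu>) / 2))"
proof -
  have "(\<integral>\<omega>. cis (\<theta> * P s \<omega> + \<theta>' * P (s + d) \<omega>) \<partial>M)
    = complex_of_real (exp (- l2sq (\<lambda>u. \<theta> *\<^sub>R k s u + \<theta>' *\<^sub>R k (s + d) u) / 2))"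
    using P_cis[of "{0, 1}" "\<lambda>i. if i = 0 then s else s + d" "\<lambda>i. if i = 0 then \<theta> else \<theta>'"] s by auto
  then have "norm (\<integral>\<omega>. cis (\<theta> * P s \<omega> + \<theta>' * P (s + d) \<omega>) \<partial>M)
    = exp (- l2sq (\<lambda>u. \<theta> *\<^sub>R k s u + \<theta>' *\<^sub>R k (s + d) u) / 2)"
    by (simp del: of_real_exp)
  also have "l2sq (\<lambda>u. \<theta> *\<^sub>R k s u + \<theta>' *\<^sub>R k (s + d) u)
    = l2sq (\<lambda>u. (\<theta> + \<theta>') *\<^sub>R k s u + \<theta>' *\<^sub>R (k (s + d) u - k s u))"
    by (simp add: algebra_simps)
  also have "exp (- \<dots> / 2) \<le> exp (- (c * ((\<theta> + \<theta>')\<^sup>2 * s powr (2 * \<nu>) + \<theta>'\<^sup>2 * d powr (2 * \<nu>))) / 2)"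
    using lower[OF s, of "\<theta> + \<theta>'" \<theta>'] by simp
  also have "\<dots> = exp (- (c * (\<theta> + \<theta>')\<^sup>2 * s powr (2 * \<nu>) / 2)) * exp (- (c * \<theta>'\<^sup>2 * d powr (2 * \<nu>) / 2))"
    unfolding exp_add[symmetric] by (simp add: algebra_simps add_divide_distrib diff_divide_distrib)
  finally show ?thesis .
qed

lemma expectation_fourier:
  assumes q: "fourier_representation q \<kappa>" and [measurable]: "f \<in> borel_measurable M" "X \<in> borel_measurable M"
    and f: "\<And>\<omega>. norm (f \<omega>) \<le> B"
  shows "(\<integral>\<omega>. f \<omega> * complex_of_real (q (X \<omega>)) \<partial>M) = (\<integral>\<theta>. complex_of_real (\<kappa> \<theta>) * (\<integral>\<omega>. f \<omega> * cis (\<theta> * X \<omega>) \<partial>M) \<partial>lborel)"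
proof -
  interpret pair_sigma_finite M lborel ..
  have "(\<integral>\<omega>. f \<omega> * complex_of_real (q (X \<omega>)) \<partial>M) = (\<integral>\<omega>. f \<omega> * (\<integral>\<theta>. complex_of_real (\<kappa> \<theta>) * cis (\<theta> * X \<omega>) \<partial>lborel) \<partial>M)"
    using q by (simp add: fourier_representation_def)
  also have "\<dots> = (\<integral>\<theta>. complex_of_real (\<kappa> \<theta>) * (\<integral>\<omega>. f \<omega> * cis (\<theta> * X \<omega>) \<partial>M) \<partial>lborel)"
  proof (rule integral_mult_kernel_swap[where C=1])
    show "integrable M f" by (rule integrable_const_bound[where B=B]) (auto intro: f)
    show "integrable lborel (\<lambda>\<theta>. complex_of_real (\<kappa> \<theta>))" using q by (simp add: fourier_representation_def)
    show "(\<lambda>(\<omega>, \<theta>). cis (\<theta> * X \<omega>)) \<in> borel_measurable (M \<Otimes>\<^sub>M lborel)" by measurable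
  qed simp
  finally show ?thesis .
qed

text \<open>Both factors are inverted. The weight \<open>w\<close> is kept for the frequency
  \<open>\<theta>'\<close> of the later time, while the other transform is bounded by
  \<open>1 / (2 * pi)\<close>. Integrating over \<open>\<theta>\<close> first is then a translated
  Gaussian integral, which yields \<open>s powr (- \<nu>)\<close>, and what remains in
  \<open>\<theta>'\<close> is the pair weight.\<close>

lemma pair_expectation_bound:
  assumes q: "fourier_representation q \<kappa>" and w: "\<And>\<theta>. \<bar>\<kappa> \<theta>\<bar> \<le> w \<theta> / (2 * pi)" "\<And>\<theta>. w \<theta> \<le> 1"
    and [measurable]: "w \<in> borel_measurable borel"
    and s: "0 < s" "0 < d" "s + d \<le> 1"
  shows "ennreal \<bar>\<integral>\<omega>. q (P s \<omega> - x) * q (P (s + d) \<omega> - x) \<partial>M\<bar> \<le> ennreal (s powr (- \<nu>)) * pair_weight c \<nu> w d"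
proof -
  have qm[measurable]: "q \<in> borel_measurable borel" by (rule fourier_representation_measurable[OF q])
  have km[measurable]: "\<kappa> \<in> borel_measurable borel" using q by (auto simp: fourier_representation_def)
  define B where "B = (\<integral>\<theta>. \<bar>\<kappa> \<theta>\<bar> \<partial>lborel)"
  have qB: "\<bar>q y\<bar> \<le> B" for y unfolding B_def by (rule fourier_representation_bound[OF q])
  have w0: "0 \<le> w \<theta>" for \<theta>
    using order_trans[OF abs_ge_zero w(1)[of \<theta>]] pi_gt_zero by (auto simp: zero_le_divide_iff)
  define S D where "S = s powr (2 * \<nu>)" and "D = d powr (2 * \<nu>)"
  have S: "0 < S" "0 < D" using s by (auto simp: S_def D_def)
  define g1 where "g1 \<theta> = exp (- (c * \<theta>\<^sup>2 * S / 2))" for \<theta>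
  define g2 where "g2 \<theta> = exp (- (c * \<theta>\<^sup>2 * D / 2))" for \<theta>
  have [measurable]: "g1 \<in> borel_measurable borel" "g2 \<in> borel_measurable borel"
    unfolding g1_def[abs_def] g2_def[abs_def] by measurable
  have inner: "ennreal (norm (\<integral>\<omega>. complex_of_real (q (P (s + d) \<omega> - x)) * cis (\<theta> * (P s \<omega> - x)) \<partial>M))
    \<le> (\<integral>\<^sup>+\<theta>'. ennreal (w \<theta>' / (2 * pi) * (g1 (\<theta> + \<theta>') * g2 \<theta>')) \<partial>lborel)" for \<theta>
  proof -
    have "(\<integral>\<omega>. complex_of_real (q (P (s + d) \<omega> - x)) * cis (\<theta> * (P s \<omega> - x)) \<partial>M)
      = (\<integral>\<omega>. cis (\<theta> * (P s \<omega> - x)) * complex_of_real (q (P (s + d) \<omega> - x)) \<partial>M)" by (simp add: mult.commute)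
    also have "\<dots> = (\<integral>\<theta>'. complex_of_real (\<kappa> \<theta>') * (\<integral>\<omega>. cis (\<theta> * (P s \<omega> - x)) * cis (\<theta>' * (P (s + d) \<omega> - x)) \<partial>M) \<partial>lborel)"
      by (rule expectation_fourier[OF q, where B=1]) auto
    finally have "ennreal (norm (\<integral>\<omega>. complex_of_real (q (P (s + d) \<omega> - x)) * cis (\<theta> * (P s \<omega> - x)) \<partial>M))
      \<le> (\<integral>\<^sup>+\<theta>'. ennreal (norm (complex_of_real (\<kappa> \<theta>') * (\<integral>\<omega>. cis (\<theta> * (P s \<omega> - x)) * cis (\<theta>' * (P (s + d) \<omega> - x)) \<partial>M))) \<partial>lborel)"
      by (simp only: ennreal_norm_integral_le)
    also have "\<dots> \<le> (\<integral>\<^sup>+\<theta>'. ennreal (w \<theta>' / (2 * pi) * (g1 (\<theta> + \<theta>') * g2 \<theta>')) \<partial>lborel)"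
    proof (intro nn_integral_mono ennreal_leI)
      fix \<theta>'
      have "cis (\<theta> * (P s \<omega> - x)) * cis (\<theta>' * (P (s + d) \<omega> - x)) = cis (- ((\<theta> + \<theta>') * x)) * cis (\<theta> * P s \<omega> + \<theta>' * P (s + d) \<omega>)" for \<omega>
        unfolding cis_mult by (simp add: algebra_simps)
      then have "norm (\<integral>\<omega>. cis (\<theta> * (P s \<omega> - x)) * cis (\<theta>' * (P (s + d) \<omega> - x)) \<partial>M)
        = norm (\<integral>\<omega>. cis (\<theta> * P s \<omega> + \<theta>' * P (s + d) \<omega>) \<partial>M)"
        by (simp add: norm_mult)
      also have "\<dots> \<le> g1 (\<theta> + \<theta>') * g2 \<theta>'"
        unfolding g1_def g2_def S_def D_def using s by (intro pair_cis_bound) auto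
      finally show "norm (complex_of_real (\<kappa> \<theta>') * (\<integral>\<omega>. cis (\<theta> * (P s \<omega> - x)) * cis (\<theta>' * (P (s + d) \<omega> - x)) \<partial>M))
        \<le> w \<theta>' / (2 * pi) * (g1 (\<theta> + \<theta>') * g2 \<theta>')"
        unfolding norm_mult norm_of_real using w(1)[of \<theta>'] w0[of \<theta>'] by (intro mult_mono) auto
    qed
    finally show ?thesis .
  qed
  have "\<bar>\<integral>\<omega>. q (P s \<omega> - x) * q (P (s + d) \<omega> - x) \<partial>M\<bar>
    = norm (\<integral>\<omega>. complex_of_real (q (P (s + d) \<omega> - x)) * complex_of_real (q (P s \<omega> - x)) \<partial>M)"
    unfolding of_real_mult[symmetric] integral_complex_of_real norm_of_real by (simp add: mult.commute)
  also have "(\<integral>\<omega>. complex_of_real (q (P (s + d) \<omega> - x)) * complex_of_real (q (P s \<omega> - x)) \<partial>M)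
    = (\<integral>\<theta>. complex_of_real (\<kappa> \<theta>) * (\<integral>\<omega>. complex_of_real (q (P (s + d) \<omega> - x)) * cis (\<theta> * (P s \<omega> - x)) \<partial>M) \<partial>lborel)"
    by (rule expectation_fourier[OF q, where B=B]) (auto simp: qB)
  finally have "ennreal \<bar>\<integral>\<omega>. q (P s \<omega> - x) * q (P (s + d) \<omega> - x) \<partial>M\<bar>
    \<le> (\<integral>\<^sup>+\<theta>. ennreal (norm (complex_of_real (\<kappa> \<theta>) * (\<integral>\<omega>. complex_of_real (q (P (s + d) \<omega> - x)) * cis (\<theta> * (P s \<omega> - x)) \<partial>M))) \<partial>lborel)"
    by (simp only: ennreal_norm_integral_le)
  also have "\<dots> \<le> (\<integral>\<^sup>+\<theta>. (\<integral>\<^sup>+\<theta>'. ennreal (w \<theta>' / (4 * pi\<^sup>2) * (g1 (\<theta> + \<theta>') * g2 \<theta>')) \<partial>lborel) \<partial>lborel)"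
  proof (rule nn_integral_mono)
    fix \<theta>
    have "\<bar>\<kappa> \<theta>\<bar> \<le> 1 / (2 * pi)" using order_trans[OF w(1) divide_right_mono[OF w(2)]] by simp
    then have "ennreal (norm (complex_of_real (\<kappa> \<theta>) * (\<integral>\<omega>. complex_of_real (q (P (s + d) \<omega> - x)) * cis (\<theta> * (P s \<omega> - x)) \<partial>M)))
      \<le> ennreal (1 / (2 * pi)) * (\<integral>\<^sup>+\<theta>'. ennreal (w \<theta>' / (2 * pi) * (g1 (\<theta> + \<theta>') * g2 \<theta>')) \<partial>lborel)"
      unfolding norm_mult norm_of_real ennreal_mult'[OF abs_ge_zero] using inner[of \<theta>]
      by (intro mult_mono ennreal_leI) auto
    also have "\<dots> = (\<integral>\<^sup>+\<theta>'. ennreal (w \<theta>' / (4 * pi\<^sup>2) * (g1 (\<theta> + \<theta>') * g2 \<theta>')) \<partial>lborel)"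
      by (subst nn_integral_cmult[symmetric]) (auto simp: ennreal_mult'[symmetric] power2_eq_square)
    finally show "ennreal (norm (complex_of_real (\<kappa> \<theta>) * (\<integral>\<omega>. complex_of_real (q (P (s + d) \<omega> - x)) * cis (\<theta> * (P s \<omega> - x)) \<partial>M)))
      \<le> (\<integral>\<^sup>+\<theta>'. ennreal (w \<theta>' / (4 * pi\<^sup>2) * (g1 (\<theta> + \<theta>') * g2 \<theta>')) \<partial>lborel)" .
  qed
  also have "\<dots> = (\<integral>\<^sup>+\<theta>'. (\<integral>\<^sup>+\<theta>. ennreal (w \<theta>' / (4 * pi\<^sup>2) * (g1 (\<theta> + \<theta>') * g2 \<theta>')) \<partial>lborel) \<partial>lborel)"
    by (rule lborel_pair.Fubini') measurable
  also have "\<dots> = (\<integral>\<^sup>+\<theta>'. ennreal (1 / (4 * pi\<^sup>2) * sqrt (2 * pi / (c * S))) * ennreal (w \<theta>' * g2 \<theta>') \<partial>lborel)"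
  proof (rule nn_integral_cong)
    fix \<theta>'
    have g: "(\<integral>\<^sup>+\<theta>. ennreal (g1 (\<theta> + \<theta>')) \<partial>lborel) = ennreal (sqrt (2 * pi / (c * S)))"
      using nn_integral_gaussian[of "c * S" \<theta>'] c S by (simp add: g1_def mult_ac)
    have g2: "0 \<le> g2 \<theta>'" by (simp add: g2_def)
    have "(\<integral>\<^sup>+\<theta>. ennreal (w \<theta>' / (4 * pi\<^sup>2) * (g1 (\<theta> + \<theta>') * g2 \<theta>')) \<partial>lborel)
      = (\<integral>\<^sup>+\<theta>. ennreal (1 / (4 * pi\<^sup>2)) * ennreal (w \<theta>' * g2 \<theta>') * ennreal (g1 (\<theta> + \<theta>')) \<partial>lborel)"
    proof (rule nn_integral_cong)
      fix \<theta>
      have "w \<theta>' / (4 * pi\<^sup>2) * (g1 (\<theta> + \<theta>') * g2 \<theta>') = (1 / (4 * pi\<^sup>2) * (w \<theta>' * g2 \<theta>')) * g1 (\<theta> + \<theta>')" by simp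
      moreover have "0 \<le> g1 (\<theta> + \<theta>')" by (simp add: g1_def)
      ultimately show "ennreal (w \<theta>' / (4 * pi\<^sup>2) * (g1 (\<theta> + \<theta>') * g2 \<theta>'))
        = ennreal (1 / (4 * pi\<^sup>2)) * ennreal (w \<theta>' * g2 \<theta>') * ennreal (g1 (\<theta> + \<theta>'))"
        using w0[of \<theta>'] g2 by (simp only: ennreal_mult[symmetric] mult_nonneg_nonneg zero_le_divide_1_iff mult_nonneg_nonneg zero_le_power2 zero_le_numeral)
    qed
    also have "\<dots> = ennreal (1 / (4 * pi\<^sup>2)) * ennreal (w \<theta>' * g2 \<theta>') * ennreal (sqrt (2 * pi / (c * S)))"
      by (subst nn_integral_cmult) (auto simp: g)
    also have "\<dots> = ennreal (1 / (4 * pi\<^sup>2) * sqrt (2 * pi / (c * S))) * ennreal (w \<theta>' * g2 \<theta>')"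
    proof -
      have "ennreal (1 / (4 * pi\<^sup>2) * sqrt (2 * pi / (c * S))) = ennreal (1 / (4 * pi\<^sup>2)) * ennreal (sqrt (2 * pi / (c * S)))"
        by (rule ennreal_mult) (use c S in auto)
      then show ?thesis by (simp only: mult_ac)
    qed
    finally show "(\<integral>\<^sup>+\<theta>. ennreal (w \<theta>' / (4 * pi\<^sup>2) * (g1 (\<theta> + \<theta>') * g2 \<theta>')) \<partial>lborel)
      = ennreal (1 / (4 * pi\<^sup>2) * sqrt (2 * pi / (c * S))) * ennreal (w \<theta>' * g2 \<theta>')" .
  qed
  also have "\<dots> = ennreal (1 / (4 * pi\<^sup>2) * sqrt (2 * pi / (c * S))) * (\<integral>\<^sup>+\<theta>'. ennreal (w \<theta>' * g2 \<theta>') \<partial>lborel)"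
    by (rule nn_integral_cmult) simp
  also have "1 / (4 * pi\<^sup>2) * sqrt (2 * pi / (c * S)) = s powr (- \<nu>) * (1 / (4 * pi\<^sup>2) * sqrt (2 * pi / c))"
  proof -
    have "sqrt S = s powr \<nu>"
    proof (rule real_sqrt_unique)
      show "(s powr \<nu>)\<^sup>2 = S" by (simp add: S_def power2_eq_square powr_add[symmetric])
    qed simp
    then have "sqrt (2 * pi / (c * S)) = s powr (- \<nu>) * sqrt (2 * pi / c)"
      by (simp add: real_sqrt_divide real_sqrt_mult powr_minus_divide)
    then show ?thesis by simp
  qed
  also have "ennreal (s powr (- \<nu>) * (1 / (4 * pi\<^sup>2) * sqrt (2 * pi / c))) * (\<integral>\<^sup>+\<theta>'. ennreal (w \<theta>' * g2 \<theta>') \<partial>lborel)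
    = ennreal (s powr (- \<nu>)) * pair_weight c \<nu> w d"
  proof -
    have "ennreal (s powr (- \<nu>) * (1 / (4 * pi\<^sup>2) * sqrt (2 * pi / c))) = ennreal (s powr (- \<nu>)) * ennreal (1 / (4 * pi\<^sup>2) * sqrt (2 * pi / c))"
      by (rule ennreal_mult) (use c in auto)
    then show ?thesis by (simp only: pair_weight_def g2_def D_def mult.assoc)
  qed
  finally show ?thesis .
qed

text \<open>The second moment of an occupation integral is a double time integral of pair
  expectations. A family of time sets is allowed so that the same bound serves one interval, for the
  smoothing error, and all cells of a grid at once, for the increments; \<open>Ar\<close> says that
  pairs sharing a set are at most \<open>r\<close> apart and share only one set.\<close>

lemma occupation_energy_bound:
  assumes q: "fourier_representation q \<kappa>" and w: "\<And>\<theta>. \<bar>\<kappa> \<theta>\<bar> \<le> w \<theta> / (2 * pi)" "\<And>\<theta>. w \<theta> \<le> 1"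
    and wm[measurable]: "w \<in> borel_measurable borel"
    and I: "finite I" and A[measurable]: "\<And>i. A i \<in> sets borel" and A01: "\<And>i. A i \<subseteq> {0<..1}"
    and Ar: "\<And>s s'. (\<Sum>i\<in>I. indicator (A i) s * indicator (A i) s') \<le> (indicator {- r..r} (s' - s) :: ennreal)"
  shows "(\<Sum>i\<in>I. \<integral>\<^sup>+\<omega>. ennreal ((\<integral>s. indicator (A i) s * q (P s \<omega> - x) \<partial>lborel)\<^sup>2) \<partial>M) \<le> energy c \<nu> w r"
proof -
  interpret MB: pair_sigma_finite M lborel ..
  have qm[measurable]: "q \<in> borel_measurable borel" by (rule fourier_representation_measurable[OF q])
  define B where "B = (\<integral>\<theta>. \<bar>\<kappa> \<theta>\<bar> \<partial>lborel)"
  have qB: "\<bar>q y\<bar> \<le> B" for y unfolding B_def by (rule fourier_representation_bound[OF q])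
  have B0: "0 \<le> B" by (simp add: B_def)
  define \<phi> where "\<phi> s \<omega> = q (P s \<omega> - x)" for s \<omega>
  have \<phi>m: "(\<lambda>(\<omega>, s). \<phi> s \<omega>) \<in> borel_measurable (M \<Otimes>\<^sub>M lborel)" unfolding \<phi>_def by measurable
  have \<phi>s[measurable]: "\<phi> s \<in> borel_measurable M" for s unfolding \<phi>_def[abs_def] by measurable
  have \<phi>B: "\<bar>\<phi> s \<omega>\<bar> \<le> B" for s \<omega> by (simp add: \<phi>_def qB)
  define pw where "pw = pair_weight c \<nu> w"
  have pwm[measurable]: "pw \<in> borel_measurable borel" unfolding pw_def by measurable
  \<comment> \<open>The singular factor belongs to the earlier time. Adding both powers gives a
    bound valid in either order; by symmetry the two halves contribute equally, whence the factor 2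
    in \<open>energy\<close>.\<close>
  define b where "b s s' = (ennreal (s powr (- \<nu>)) + ennreal (s' powr (- \<nu>))) * pw \<bar>s' - s\<bar>" for s s'
  have finA: "emeasure lborel (A i) < \<infinity>" for i
    by (rule emeasure_bounded_finite, rule bounded_subset[of "{0..1}"]) (use A01[of i] in auto)
  have single: "(\<integral>\<^sup>+\<omega>. ennreal ((\<integral>s. indicator (A i) s * \<phi> s \<omega> \<partial>lborel)\<^sup>2) \<partial>M)
    \<le> (\<integral>\<^sup>+s. (\<integral>\<^sup>+s'. indicator (A i) s * indicator (A i) s' * b s s' \<partial>lborel) \<partial>lborel)" for i
  proof -
    define U where "U \<omega> = (\<integral>s. indicator (A i) s * \<phi> s \<omega> \<partial>lborel)" for \<omega>
    have [measurable]: "(\<lambda>(\<omega>, s). \<phi> s \<omega>) \<in> borel_measurable (M \<Otimes>\<^sub>M lborel)" by (rule \<phi>m)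
    have Um[measurable]: "U \<in> borel_measurable M"
    proof -
      have "(\<lambda>\<omega>. U \<omega>) \<in> borel_measurable M" unfolding U_def by measurable
      then show ?thesis by simp
    qed
    have iA: "integrable lborel (indicator (A i) :: real \<Rightarrow> real)" using finA by simp
    have UB: "\<bar>U \<omega>\<bar> \<le> (\<integral>s. indicator (A i) s * B \<partial>lborel)" for \<omega>
    proof -
      have "\<bar>U \<omega>\<bar> \<le> (\<integral>s. \<bar>indicator (A i) s * \<phi> s \<omega>\<bar> \<partial>lborel)" unfolding U_def by (rule integral_abs_bound)
      also have "\<dots> \<le> (\<integral>s. indicator (A i) s * B \<partial>lborel)"
      proof (rule integral_mono')
        show "integrable lborel (\<lambda>s. indicator (A i) s * B)" using iA by simp
      qed (use \<phi>B B0 in \<open>auto simp: indicator_def\<close>)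
      finally show ?thesis .
    qed
    have swap: "(\<integral>\<omega>. f \<omega> * U \<omega> \<partial>M) = (\<integral>s. indicator (A i) s * (\<integral>\<omega>. f \<omega> * \<phi> s \<omega> \<partial>M) \<partial>lborel)"
      if [measurable]: "f \<in> borel_measurable M" and f: "\<And>\<omega>. \<bar>f \<omega>\<bar> \<le> D" for f D
      unfolding U_def
      by (rule MB.integral_mult_kernel_swap[where C=B])
        (auto intro!: integrable_const_bound[where B=D] f iA \<phi>m \<phi>B)
    have UU: "(\<integral>\<omega>. (U \<omega>)\<^sup>2 \<partial>M) = (\<integral>s. indicator (A i) s * (\<integral>\<omega>. U \<omega> * \<phi> s \<omega> \<partial>M) \<partial>lborel)"
      unfolding power2_eq_square by (rule swap[OF Um UB])
    have U\<phi>: "(\<integral>\<omega>. U \<omega> * \<phi> s \<omega> \<partial>M) = (\<integral>s'. indicator (A i) s' * (\<integral>\<omega>. \<phi> s \<omega> * \<phi> s' \<omega> \<partial>M) \<partial>lborel)" for s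
      using swap[OF \<phi>s \<phi>B, of s] by (simp add: mult.commute)
    have pair: "AE s' in lborel. indicator (A i) s * (indicator (A i) s' * ennreal \<bar>\<integral>\<omega>. \<phi> s \<omega> * \<phi> s' \<omega> \<partial>M\<bar>)
      \<le> indicator (A i) s * indicator (A i) s' * b s s'" for s
    proof -
      \<comment> \<open>The pair bound requires a positive lag, and the diagonal is negligible for
        fixed \<open>s\<close>.\<close>
      have "AE s' in lborel. s' \<noteq> s" by (rule AE_lborel_singleton)
      then show ?thesis
      proof eventually_elim
        case (elim s')
        have "ennreal \<bar>\<integral>\<omega>. \<phi> s \<omega> * \<phi> s' \<omega> \<partial>M\<bar> \<le> b s s'" if mem: "s \<in> A i" "s' \<in> A i"
        proof (cases "s < s'")
          case True
          have ss: "0 < s" "s \<le> 1" "0 < s'" "s' \<le> 1" using subsetD[OF A01 mem(1)] subsetD[OF A01 mem(2)] by auto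
          have "ennreal \<bar>\<integral>\<omega>. \<phi> s \<omega> * \<phi> s' \<omega> \<partial>M\<bar> \<le> ennreal (s powr (- \<nu>)) * pw (s' - s)"
            using pair_expectation_bound[OF q w wm, of s "s' - s" x] True A01[of i] ss by (auto simp: \<phi>_def pw_def)
          also have "\<dots> \<le> b s s'" unfolding b_def using True by (intro mult_mono) auto
          finally show ?thesis .
        next
          case False
          have ss: "0 < s" "s \<le> 1" "0 < s'" "s' \<le> 1" using subsetD[OF A01 mem(1)] subsetD[OF A01 mem(2)] by auto
          have "ennreal \<bar>\<integral>\<omega>. \<phi> s \<omega> * \<phi> s' \<omega> \<partial>M\<bar> = ennreal \<bar>\<integral>\<omega>. \<phi> s' \<omega> * \<phi> s \<omega> \<partial>M\<bar>" by (simp add: mult.commute)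
          also have "\<dots> \<le> ennreal (s' powr (- \<nu>)) * pw (s - s')"
            using pair_expectation_bound[OF q w wm, of s' "s - s'" x] False elim A01[of i] ss by (auto simp: \<phi>_def pw_def)
          also have "\<dots> \<le> b s s'" unfolding b_def using False by (intro mult_mono) auto
          finally show ?thesis .
        qed
        then show ?case by (auto simp: indicator_def)
      qed
    qed
    have "integrable M (\<lambda>\<omega>. (U \<omega>)\<^sup>2)"
      by (rule integrable_const_bound[where B="(\<integral>s. indicator (A i) s * B \<partial>lborel)\<^sup>2"])
        (use power_mono[OF UB abs_ge_zero, where n=2] in auto)
    then have "(\<integral>\<^sup>+\<omega>. ennreal ((U \<omega>)\<^sup>2) \<partial>M) = ennreal (\<integral>\<omega>. (U \<omega>)\<^sup>2 \<partial>M)"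
      by (rule nn_integral_eq_integral) simp
    also have "\<dots> \<le> ennreal \<bar>\<integral>\<omega>. (U \<omega>)\<^sup>2 \<partial>M\<bar>" by (intro ennreal_leI) simp
    also have "\<dots> \<le> (\<integral>\<^sup>+s. ennreal (norm (indicator (A i) s * (\<integral>\<omega>. U \<omega> * \<phi> s \<omega> \<partial>M))) \<partial>lborel)"
      unfolding UU real_norm_def[symmetric] by (rule ennreal_norm_integral_le)
    also have "\<dots> \<le> (\<integral>\<^sup>+s. indicator (A i) s * (\<integral>\<^sup>+s'. indicator (A i) s' * ennreal \<bar>\<integral>\<omega>. \<phi> s \<omega> * \<phi> s' \<omega> \<partial>M\<bar> \<partial>lborel) \<partial>lborel)"
    proof (rule nn_integral_mono)
      fix s
      have "ennreal (norm (\<integral>\<omega>. U \<omega> * \<phi> s \<omega> \<partial>M)) \<le> (\<integral>\<^sup>+s'. ennreal (norm (indicator (A i) s' * (\<integral>\<omega>. \<phi> s \<omega> * \<phi> s' \<omega> \<partial>M))) \<partial>lborel)"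
        unfolding U\<phi> by (rule ennreal_norm_integral_le)
      also have "\<dots> = (\<integral>\<^sup>+s'. indicator (A i) s' * ennreal \<bar>\<integral>\<omega>. \<phi> s \<omega> * \<phi> s' \<omega> \<partial>M\<bar> \<partial>lborel)"
        by (rule nn_integral_cong) (auto simp: indicator_def)
      finally show "ennreal (norm (indicator (A i) s * (\<integral>\<omega>. U \<omega> * \<phi> s \<omega> \<partial>M)))
        \<le> indicator (A i) s * (\<integral>\<^sup>+s'. indicator (A i) s' * ennreal \<bar>\<integral>\<omega>. \<phi> s \<omega> * \<phi> s' \<omega> \<partial>M\<bar> \<partial>lborel)"
        by (auto simp: indicator_def)
    qed
    also have "\<dots> \<le> (\<integral>\<^sup>+s. (\<integral>\<^sup>+s'. indicator (A i) s * indicator (A i) s' * b s s' \<partial>lborel) \<partial>lborel)"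
    proof (rule nn_integral_mono)
      fix s
      show "indicator (A i) s * (\<integral>\<^sup>+s'. indicator (A i) s' * ennreal \<bar>\<integral>\<omega>. \<phi> s \<omega> * \<phi> s' \<omega> \<partial>M\<bar> \<partial>lborel)
        \<le> (\<integral>\<^sup>+s'. indicator (A i) s * indicator (A i) s' * b s s' \<partial>lborel)"
      proof (cases "s \<in> A i")
        case True
        then show ?thesis using pair[of s] by (auto intro!: nn_integral_mono_AE)
      qed simp
    qed
    finally show ?thesis unfolding U_def .
  qed
  have "(\<Sum>i\<in>I. \<integral>\<^sup>+\<omega>. ennreal ((\<integral>s. indicator (A i) s * q (P s \<omega> - x) \<partial>lborel)\<^sup>2) \<partial>M)
    \<le> (\<Sum>i\<in>I. \<integral>\<^sup>+s. (\<integral>\<^sup>+s'. indicator (A i) s * indicator (A i) s' * b s s' \<partial>lborel) \<partial>lborel)"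
    using single unfolding \<phi>_def by (rule sum_mono)
  also have "\<dots> = (\<integral>\<^sup>+s. (\<integral>\<^sup>+s'. (\<Sum>i\<in>I. indicator (A i) s * indicator (A i) s' * b s s') \<partial>lborel) \<partial>lborel)"
    unfolding b_def by (simp add: nn_integral_sum)
  also have "\<dots> \<le> (\<integral>\<^sup>+s. (\<integral>\<^sup>+s'. indicator {0<..1} s * indicator {0<..1} s' * indicator {- r..r} (s' - s) * b s s' \<partial>lborel) \<partial>lborel)"
  proof (intro nn_integral_mono)
    fix s s'
    show "(\<Sum>i\<in>I. indicator (A i) s * indicator (A i) s' * b s s') \<le> indicator {0<..1} s * indicator {0<..1} s' * indicator {- r..r} (s' - s) * b s s'"
    proof (cases "s \<in> {0<..1} \<and> s' \<in> {0<..1}")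
      case True
      then show ?thesis using mult_right_mono[OF Ar[of s s'], of "b s s'"] by (simp add: sum_distrib_right)
    next
      case False
      then have "indicator (A i) s * indicator (A i) s' = (0::ennreal)" for i using A01[of i] by (auto simp: indicator_def)
      then have "(\<Sum>i\<in>I. indicator (A i) s * indicator (A i) s' * b s s') = 0" by (simp only: mult_zero_left sum.neutral_const)
      then show ?thesis by simp
    qed
  qed
  also have "\<dots> = (\<integral>\<^sup>+s. (\<integral>\<^sup>+s'. indicator {0<..1} s * indicator {0<..1} s' * indicator {- r..r} (s' - s) * ennreal (s powr (- \<nu>)) * pw \<bar>s' - s\<bar> \<partial>lborel) \<partial>lborel)
    + (\<integral>\<^sup>+s. (\<integral>\<^sup>+s'. indicator {0<..1} s * indicator {0<..1} s' * indicator {- r..r} (s' - s) * ennreal (s' powr (- \<nu>)) * pw \<bar>s' - s\<bar> \<partial>lborel) \<partial>lborel)"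
    unfolding b_def by (simp add: distrib_left distrib_right nn_integral_add mult.assoc)
  also have "(\<integral>\<^sup>+s. (\<integral>\<^sup>+s'. indicator {0<..1} s * indicator {0<..1} s' * indicator {- r..r} (s' - s) * ennreal (s' powr (- \<nu>)) * pw \<bar>s' - s\<bar> \<partial>lborel) \<partial>lborel)
    = (\<integral>\<^sup>+s'. (\<integral>\<^sup>+s. indicator {0<..1} s * indicator {0<..1} s' * indicator {- r..r} (s' - s) * ennreal (s' powr (- \<nu>)) * pw \<bar>s' - s\<bar> \<partial>lborel) \<partial>lborel)"
    by (rule lborel_pair.Fubini') measurable
  also have "\<dots> = (\<integral>\<^sup>+s. (\<integral>\<^sup>+s'. indicator {0<..1} s * indicator {0<..1} s' * indicator {- r..r} (s' - s) * ennreal (s powr (- \<nu>)) * pw \<bar>s' - s\<bar> \<partial>lborel) \<partial>lborel)"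
  proof (intro nn_integral_cong)
    fix s s' :: real
    have "indicator {- r..r} (s - s') = (indicator {- r..r} (s' - s) :: ennreal)" by (auto simp: indicator_def)
    then show "indicator {0<..1} s' * indicator {0<..1} s * indicator {- r..r} (s - s') * ennreal (s powr (- \<nu>)) * pw \<bar>s - s'\<bar>
      = indicator {0<..1} s * indicator {0<..1} s' * indicator {- r..r} (s' - s) * ennreal (s powr (- \<nu>)) * pw \<bar>s' - s\<bar>"
      by (simp add: abs_minus_commute mult_ac)
  qed
  also have "(\<integral>\<^sup>+s. (\<integral>\<^sup>+s'. indicator {0<..1} s * indicator {0<..1} s' * indicator {- r..r} (s' - s) * ennreal (s powr (- \<nu>)) * pw \<bar>s' - s\<bar> \<partial>lborel) \<partial>lborel)
    \<le> (\<integral>\<^sup>+s. indicator {0<..1} s * ennreal (s powr (- \<nu>)) * (\<integral>\<^sup>+d. indicator {- r..r} d * pw \<bar>d\<bar> \<partial>lborel) \<partial>lborel)" (is "?T \<le> ?R")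
  proof (rule nn_integral_mono)
    fix s
    have "(\<integral>\<^sup>+s'. indicator {0<..1} s * indicator {0<..1} s' * indicator {- r..r} (s' - s) * ennreal (s powr (- \<nu>)) * pw \<bar>s' - s\<bar> \<partial>lborel)
      \<le> (\<integral>\<^sup>+s'. indicator {0<..1} s * ennreal (s powr (- \<nu>)) * (indicator {- r..r} (s' - s) * pw \<bar>s' - s\<bar>) \<partial>lborel)"
      by (rule nn_integral_mono) (auto simp: indicator_def)
    also have "\<dots> = indicator {0<..1} s * ennreal (s powr (- \<nu>)) * (\<integral>\<^sup>+s'. indicator {- r..r} (s' - s) * pw \<bar>s' - s\<bar> \<partial>lborel)"
      by (rule nn_integral_cmult) measurable
    also have "(\<integral>\<^sup>+s'. indicator {- r..r} (s' - s) * pw \<bar>s' - s\<bar> \<partial>lborel) = (\<integral>\<^sup>+d. indicator {- r..r} d * pw \<bar>d\<bar> \<partial>lborel)"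
      using nn_integral_real_affine[of "\<lambda>s'. indicator {- r..r} (s' - s) * pw \<bar>s' - s\<bar>" 1 s] by simp
    finally show "(\<integral>\<^sup>+s'. indicator {0<..1} s * indicator {0<..1} s' * indicator {- r..r} (s' - s) * ennreal (s powr (- \<nu>)) * pw \<bar>s' - s\<bar> \<partial>lborel)
      \<le> indicator {0<..1} s * ennreal (s powr (- \<nu>)) * (\<integral>\<^sup>+d. indicator {- r..r} d * pw \<bar>d\<bar> \<partial>lborel)" .
  qed
  then have "?T + ?T \<le> ?R + ?R" by (intro add_mono)
  also have "?R + ?R = energy c \<nu> w r"
    unfolding energy_def pw_def by (simp add: nn_integral_multc mult_2)
  finally show ?thesis .
qed

end

section \<open>The energy vanishes for weak smoothing and for short range\<close>

lemma nn_integral_powr_Ioc_finite: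
  assumes "\<nu> < 1"
  shows "(\<integral>\<^sup>+s. indicator {0<..1} s * ennreal (s powr (- \<nu>)) \<partial>lborel) < \<infinity>"
proof -
  have i: "integrable lborel (\<lambda>u. indicat_real {0..1} u * u powr (- \<nu>))"
    by (rule integrable_powr_Icc) (use assms in simp)
  have "(\<integral>\<^sup>+s. indicator {0<..1} s * ennreal (s powr (- \<nu>)) \<partial>lborel) \<le> (\<integral>\<^sup>+s. ennreal (indicat_real {0..1} s * s powr (- \<nu>)) \<partial>lborel)"
    by (rule nn_integral_mono) (auto simp: indicator_def)
  also have "\<dots> < \<infinity>" using i by (subst nn_integral_eq_integral) auto
  finally show ?thesis .
qed

lemma pair_weight_one:
  assumes c: "0 < c" and d: "0 < d"
  shows "pair_weight c \<nu> (\<lambda>_. 1) d = ennreal (1 / (4 * pi\<^sup>2) * sqrt (2 * pi / c) * sqrt (2 * pi / (c * d powr (2 * \<nu>))))"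
proof -
  have D: "0 < c * d powr (2 * \<nu>)" using c d by simp
  have "(\<integral>\<^sup>+\<theta>. ennreal (1 * exp (- (c * \<theta>\<^sup>2 * d powr (2 * \<nu>) / 2))) \<partial>lborel)
    = (\<integral>\<^sup>+\<theta>. ennreal (exp (- ((c * d powr (2 * \<nu>)) * (\<theta> + 0)\<^sup>2 / 2))) \<partial>lborel)"
    by (simp add: mult_ac)
  also have "\<dots> = ennreal (sqrt (2 * pi / (c * d powr (2 * \<nu>))))" by (rule nn_integral_gaussian[OF D])
  finally show ?thesis unfolding pair_weight_def by (subst ennreal_mult) (use c D in auto)
qed

lemma pair_weight_mono: "(\<And>\<theta>. w \<theta> \<le> w' \<theta>) \<Longrightarrow> pair_weight c \<nu> w d \<le> pair_weight c \<nu> w' d"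
  unfolding pair_weight_def by (intro mult_left_mono nn_integral_mono ennreal_leI mult_right_mono) auto

text \<open>For the constant weight 1 the Gaussian integral is explicit and the pair weight is a
  multiple of \<open>\<bar>d\<bar> powr (- \<nu>)\<close>. This integrable function is the majorant
  for all the limits of the energy.\<close>

lemma nn_integral_pair_weight_finite:
  assumes c: "0 < c" and nu: "0 < \<nu>" "\<nu> < 1"
  shows "(\<integral>\<^sup>+d. indicator {- 1..1} d * pair_weight c \<nu> (\<lambda>_. 1) \<bar>d\<bar> \<partial>lborel) < \<infinity>"
proof -
  define C where "C = 1 / (4 * pi\<^sup>2) * sqrt (2 * pi / c) * sqrt (2 * pi / c)"
  have C: "0 \<le> C" using c by (simp add: C_def)
  have i: "integrable lborel (\<lambda>u. indicat_real {0..1} u * u powr (- \<nu>))"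
    by (rule integrable_powr_Icc) (use nu in simp)
  have i': "integrable lborel (\<lambda>u. indicat_real {0..1} (- u) * (- u) powr (- \<nu>))"
    using lborel_integrable_real_affine[OF i, of "-1" 0] by simp
  define g where "g u = C * (indicat_real {0..1} u * u powr (- \<nu>) + indicat_real {0..1} (- u) * (- u) powr (- \<nu>))" for u
  have g: "integrable lborel g" unfolding g_def using i i' by simp
  have "(\<integral>\<^sup>+d. indicator {- 1..1} d * pair_weight c \<nu> (\<lambda>_. 1) \<bar>d\<bar> \<partial>lborel) \<le> (\<integral>\<^sup>+d. ennreal (g d) \<partial>lborel)"
  proof (rule nn_integral_mono_AE)
    have "AE d in lborel. d \<noteq> (0::real)" by (rule AE_lborel_singleton)
    then show "AE d in lborel. indicator {- 1..1} d * pair_weight c \<nu> (\<lambda>_. 1) \<bar>d\<bar> \<le> ennreal (g d)"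
    proof eventually_elim
      case (elim d)
      then have d: "0 < \<bar>d\<bar>" by simp
      have "sqrt (\<bar>d\<bar> powr (2 * \<nu>)) = \<bar>d\<bar> powr \<nu>"
      proof (rule real_sqrt_unique)
        show "(\<bar>d\<bar> powr \<nu>)\<^sup>2 = \<bar>d\<bar> powr (2 * \<nu>)" by (simp add: power2_eq_square powr_add[symmetric])
      qed simp
      then have "sqrt (2 * pi / (c * \<bar>d\<bar> powr (2 * \<nu>))) = sqrt (2 * pi / c) * \<bar>d\<bar> powr (- \<nu>)"
        by (simp add: real_sqrt_divide real_sqrt_mult powr_minus_divide)
      then have eq: "pair_weight c \<nu> (\<lambda>_. 1) \<bar>d\<bar> = ennreal (C * \<bar>d\<bar> powr (- \<nu>))"
        unfolding pair_weight_one[OF c d] C_def by (simp only: mult.assoc)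
      show ?case unfolding eq using C by (auto simp: indicator_def g_def abs_if intro!: ennreal_leI mult_left_mono)
    qed
  qed
  also have "\<dots> < \<infinity>" using g C by (subst nn_integral_eq_integral) (auto simp: g_def intro!: AE_I2)
  finally show ?thesis .
qed

text \<open>Up to the factor \<open>2 * pi\<close>, the difference between the transforms of a Dirac
  mass and of the normal density. It dominates the difference of the transforms for widths \<delta>
  and \<epsilon> whenever \<delta> is at most \<epsilon>.\<close>

definition smoothing_weight :: "real \<Rightarrow> real \<Rightarrow> real" where
  "smoothing_weight \<epsilon> \<theta> = 1 - exp (- (\<epsilon> * \<theta>)\<^sup>2 / 2)"

lemma smoothing_weight_measurable[measurable]: "smoothing_weight \<epsilon> \<in> borel_measurable borel"
proof -
  have "(\<lambda>\<theta>. smoothing_weight \<epsilon> \<theta>) \<in> borel_measurable borel" unfolding smoothing_weight_def by measurable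
  then show ?thesis by simp
qed

lemma smoothing_weight_le: "smoothing_weight \<epsilon> \<theta> \<le> 1" "0 \<le> smoothing_weight \<epsilon> \<theta>"
  by (auto simp: smoothing_weight_def)

lemma ennreal_mult_tendsto_0:
  fixes f :: "nat \<Rightarrow> ennreal"
  assumes "f \<longlonglongrightarrow> 0" "a < \<infinity>"
  shows "(\<lambda>n. a * f n) \<longlonglongrightarrow> 0"
  using ennreal_tendsto_cmult[OF _ assms(1), of a] assms(2) by simp

lemma inverse_Suc_tendsto_0: "(\<lambda>n. 1 / real (Suc n)) \<longlonglongrightarrow> 0"
  by (rule LIMSEQ_inverse_real_of_nat[unfolded inverse_eq_divide])

text \<open>Dominated convergence in the lag. At each nonzero lag the pair weight vanishes when the
  smoothing weights tend to 0 pointwise, by a second dominated convergence in the frequency, while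
  for shrinking range the lag is eventually excluded.\<close>

lemma energy_tendsto_0:
  assumes c: "0 < c" and nu: "0 < \<nu>" "\<nu> < 1"
  shows "(\<lambda>n. energy c \<nu> (smoothing_weight (1 / real (Suc n))) 1) \<longlonglongrightarrow> 0"
    and "(\<lambda>n. energy c \<nu> (\<lambda>_. 1) (1 / real (Suc n))) \<longlonglongrightarrow> 0"
proof -
  have outer: "(\<lambda>n. energy c \<nu> (W n) (r n)) \<longlonglongrightarrow> 0"
    if Wm[measurable]: "\<And>n. W n \<in> borel_measurable borel" and W: "\<And>n \<theta>. W n \<theta> \<le> 1" and r: "\<And>n. r n \<le> 1"
      and lim: "\<And>d. d \<noteq> 0 \<Longrightarrow> (\<lambda>n. indicator {- r n..r n} d * pair_weight c \<nu> (W n) \<bar>d\<bar>) \<longlonglongrightarrow> 0"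
    for W r
  proof -
    have "(\<lambda>n. \<integral>\<^sup>+d. indicator {- r n..r n} d * pair_weight c \<nu> (W n) \<bar>d\<bar> \<partial>lborel) \<longlonglongrightarrow> (\<integral>\<^sup>+d. 0 \<partial>(lborel :: real measure))"
    proof (rule nn_integral_dominated_convergence[where w="\<lambda>d. indicator {- 1..1} d * pair_weight c \<nu> (\<lambda>_. 1) \<bar>d\<bar>"])
      show "(\<integral>\<^sup>+d. indicator {- 1..1} d * pair_weight c \<nu> (\<lambda>_. 1) \<bar>d\<bar> \<partial>lborel) < \<infinity>"
        by (rule nn_integral_pair_weight_finite[OF c nu])
      show "AE d in lborel. indicator {- r n..r n} d * pair_weight c \<nu> (W n) \<bar>d\<bar> \<le> indicator {- 1..1} d * pair_weight c \<nu> (\<lambda>_. 1) \<bar>d\<bar>" for n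
      proof (rule AE_I2)
        fix d
        have "indicator {- r n..r n} d \<le> (indicator {- 1..1} d :: ennreal)" using r[of n] by (auto simp: indicator_def)
        then show "indicator {- r n..r n} d * pair_weight c \<nu> (W n) \<bar>d\<bar> \<le> indicator {- 1..1} d * pair_weight c \<nu> (\<lambda>_. 1) \<bar>d\<bar>"
          by (intro mult_mono pair_weight_mono W) auto
      qed
      have "AE d in lborel. d \<noteq> (0::real)" by (rule AE_lborel_singleton)
      then show "AE d in lborel. (\<lambda>n. indicator {- r n..r n} d * pair_weight c \<nu> (W n) \<bar>d\<bar>) \<longlonglongrightarrow> 0"
        by eventually_elim (rule lim)
    qed measurable
    then have l: "(\<lambda>n. \<integral>\<^sup>+d. indicator {- r n..r n} d * pair_weight c \<nu> (W n) \<bar>d\<bar> \<partial>lborel) \<longlonglongrightarrow> 0" by simp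
    show ?thesis unfolding energy_def
      by (intro ennreal_mult_tendsto_0 l nn_integral_powr_Ioc_finite nu) simp
  qed
  show "(\<lambda>n. energy c \<nu> (\<lambda>_. 1) (1 / real (Suc n))) \<longlonglongrightarrow> 0"
  proof (rule outer)
    fix d :: real assume d: "d \<noteq> 0"
    have "eventually (\<lambda>n. 1 / real (Suc n) < \<bar>d\<bar>) sequentially"
      by (rule order_tendstoD[OF inverse_Suc_tendsto_0]) (use d in simp)
    then have "eventually (\<lambda>n. indicator {- (1 / real (Suc n))..1 / real (Suc n)} d * pair_weight c \<nu> (\<lambda>_. 1) \<bar>d\<bar> = 0) sequentially"
      by eventually_elim (auto simp: indicator_def)
    then show "(\<lambda>n. indicator {- (1 / real (Suc n))..1 / real (Suc n)} d * pair_weight c \<nu> (\<lambda>_. 1) \<bar>d\<bar>) \<longlonglongrightarrow> 0"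
      by (rule tendsto_eventually)
  qed auto
  show "(\<lambda>n. energy c \<nu> (smoothing_weight (1 / real (Suc n))) 1) \<longlonglongrightarrow> 0"
  proof (rule outer)
    fix d :: real assume d: "d \<noteq> 0"
    define D where "D = \<bar>d\<bar> powr (2 * \<nu>)"
    have D: "0 < c * D" using c d by (simp add: D_def)
    have "(\<lambda>n. \<integral>\<^sup>+\<theta>. ennreal (smoothing_weight (1 / real (Suc n)) \<theta> * exp (- (c * \<theta>\<^sup>2 * D / 2))) \<partial>lborel) \<longlonglongrightarrow> (\<integral>\<^sup>+\<theta>. 0 \<partial>(lborel :: real measure))"
    proof (rule nn_integral_dominated_convergence[where w="\<lambda>\<theta>. ennreal (exp (- (c * D * (\<theta> + 0)\<^sup>2 / 2)))"])
      show "(\<integral>\<^sup>+\<theta>. ennreal (exp (- (c * D * (\<theta> + 0)\<^sup>2 / 2))) \<partial>lborel) < \<infinity>"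
        unfolding nn_integral_gaussian[OF D] by simp
      show "AE \<theta> in lborel. ennreal (smoothing_weight (1 / real (Suc n)) \<theta> * exp (- (c * \<theta>\<^sup>2 * D / 2))) \<le> ennreal (exp (- (c * D * (\<theta> + 0)\<^sup>2 / 2)))" for n
        using smoothing_weight_le by (intro AE_I2 ennreal_leI) (simp add: mult_ac mult_left_le)
      show "AE \<theta> in lborel. (\<lambda>n. ennreal (smoothing_weight (1 / real (Suc n)) \<theta> * exp (- (c * \<theta>\<^sup>2 * D / 2)))) \<longlonglongrightarrow> 0"
      proof (rule AE_I2)
        fix \<theta>
        have "(\<lambda>n. smoothing_weight (1 / real (Suc n)) \<theta> * exp (- (c * \<theta>\<^sup>2 * D / 2)))
          \<longlonglongrightarrow> (1 - exp (- (0 * \<theta>)\<^sup>2 / 2)) * exp (- (c * \<theta>\<^sup>2 * D / 2))"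
          unfolding smoothing_weight_def by (intro tendsto_intros inverse_Suc_tendsto_0) simp
        then show "(\<lambda>n. ennreal (smoothing_weight (1 / real (Suc n)) \<theta> * exp (- (c * \<theta>\<^sup>2 * D / 2)))) \<longlonglongrightarrow> 0"
          using tendsto_ennrealI by fastforce
      qed
    qed measurable
    then have "(\<lambda>n. pair_weight c \<nu> (smoothing_weight (1 / real (Suc n))) \<bar>d\<bar>) \<longlonglongrightarrow> 0"
      unfolding pair_weight_def D_def by (intro ennreal_mult_tendsto_0) simp_all
    then show "(\<lambda>n. indicator {- 1..1} d * pair_weight c \<nu> (smoothing_weight (1 / real (Suc n))) \<bar>d\<bar>) \<longlonglongrightarrow> 0"
      by (rule ennreal_mult_tendsto_0) (simp add: indicator_def)
  qed (auto simp: smoothing_weight_le)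
qed

lemma gaussian_frequency_moments_finite:
  assumes e: "0 < \<epsilon>"
  shows "(\<integral>\<^sup>+\<theta>. ennreal (gaussian_frequency \<epsilon> \<theta>) \<partial>lborel) < \<infinity>"
    and "(\<integral>\<^sup>+\<theta>. ennreal (gaussian_frequency \<epsilon> \<theta> * \<theta>\<^sup>2) \<partial>lborel) < \<infinity>"
proof -
  have s: "0 < 1 / \<epsilon>" using e by simp
  define C where "C = sqrt (2 * pi * (1 / \<epsilon>)\<^sup>2) / (2 * pi)"
  have eq: "gaussian_frequency \<epsilon> \<theta> = C * normal_density 0 (1 / \<epsilon>) \<theta>" for \<theta>
    using e unfolding normal_density_def gaussian_frequency_def C_def by (simp add: power_mult_distrib power_divide field_simps)
  have i: "integrable lborel (\<lambda>\<theta>. gaussian_frequency \<epsilon> \<theta>)" "integrable lborel (\<lambda>\<theta>. gaussian_frequency \<epsilon> \<theta> * \<theta>\<^sup>2)"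
    unfolding eq using integrable_normal_density[OF s, of 0] integrable_normal_moment[OF s, of 0 2]
    by (simp_all add: mult.assoc)
  show "(\<integral>\<^sup>+\<theta>. ennreal (gaussian_frequency \<epsilon> \<theta>) \<partial>lborel) < \<infinity>"
    using i(1) by (subst nn_integral_eq_integral) (auto simp: gaussian_frequency_nonneg)
  show "(\<integral>\<^sup>+\<theta>. ennreal (gaussian_frequency \<epsilon> \<theta> * \<theta>\<^sup>2) \<partial>lborel) < \<infinity>"
    using i(2) by (subst nn_integral_eq_integral) (auto simp: gaussian_frequency_nonneg)
qed

section \<open>Uniform approximation of Gaussian local times\<close>

text \<open>The coefficient is the length of the part of cell \<open>j\<close> that lies before
  \<open>t\<close>. The sum is thus continuous in \<open>t\<close> and, as a path, a continuous
  function of finitely many values of the process.\<close>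

definition riemann_local_time :: "(real \<Rightarrow> 'a \<Rightarrow> real) \<Rightarrow> real \<Rightarrow> real \<Rightarrow> nat \<Rightarrow> real \<Rightarrow> 'a \<Rightarrow> real" where
  "riemann_local_time P x \<epsilon> N t \<omega> =
     (\<Sum>j<N. max 0 (min t (real (Suc j) / real N) - real j / real N) * normal_density 0 \<epsilon> (P (real j / real N) \<omega> - x))"

text \<open>The three lines bound the smoothing error at the \<open>n + 1\<close> grid points, the
  increments of the local time over the \<open>n\<close> cells, and the time discretization with
  \<open>N\<close> cells. Each \<open>\<eta>\<close> is the splitting level of an estimate
  \<open>y \<le> \<eta> + y\<^sup>2 / \<eta>\<close>.\<close>

definition approximation_error :: "real \<Rightarrow> real \<Rightarrow> real \<Rightarrow> real \<Rightarrow> nat \<Rightarrow> nat \<Rightarrow> real \<Rightarrow> real \<Rightarrow> real \<Rightarrow> real \<Rightarrow> ennreal" where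
  "approximation_error c \<nu> K \<mu> n N \<epsilon> \<eta>1 \<eta>2 \<eta>3 =
     of_nat (Suc n) * (ennreal \<eta>1 + ennreal (1 / \<eta>1) * energy c \<nu> (smoothing_weight \<epsilon>) 1)
     + (ennreal \<eta>2 + ennreal (1 / \<eta>2) * energy c \<nu> (\<lambda>_. 1) (1 / real n))
     + (ennreal \<eta>3 * (\<integral>\<^sup>+\<theta>. ennreal (gaussian_frequency \<epsilon> \<theta>) \<partial>lborel)
        + ennreal (K * (1 / real N) powr (2 * \<mu>) / \<eta>3) * (\<integral>\<^sup>+\<theta>. ennreal (gaussian_frequency \<epsilon> \<theta> * \<theta>\<^sup>2) \<partial>lborel))"

text \<open>The order of choices matters: \<open>n\<close> makes the increments small, then
  \<epsilon> must beat the factor \<open>n + 1\<close>, then \<open>\<eta>3\<close> the total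
  frequency mass for this \<epsilon>, and finally \<open>N\<close> the second frequency moment and
  \<open>\<eta>3\<close>.\<close>

lemma approximation_error_small:
  assumes c: "0 < c" and nu: "0 < \<nu>" "\<nu> < 1" and mu: "0 < \<mu>" and \<eta>: "0 < \<eta>"
  obtains n N \<epsilon> \<eta>1 \<eta>2 \<eta>3 where "0 < n" "0 < N" "0 < \<epsilon>" "0 < \<eta>1" "0 < \<eta>2" "0 < \<eta>3"
    "approximation_error c \<nu> K \<mu> n N \<epsilon> \<eta>1 \<eta>2 \<eta>3 < ennreal \<eta>"
proof -
  define \<eta>2 where "\<eta>2 = \<eta> / 8"
  have h2: "0 < \<eta>2" using \<eta> by (simp add: \<eta>2_def)
  have "(\<lambda>n. ennreal (1 / \<eta>2) * energy c \<nu> (\<lambda>_. 1) (1 / real (Suc n))) \<longlonglongrightarrow> 0"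
    by (intro ennreal_mult_tendsto_0 energy_tendsto_0 c nu) simp
  then have "eventually (\<lambda>n. ennreal (1 / \<eta>2) * energy c \<nu> (\<lambda>_. 1) (1 / real (Suc n)) < ennreal (\<eta> / 8)) sequentially"
    by (rule order_tendstoD) (use \<eta> in simp)
  then obtain m where m: "ennreal (1 / \<eta>2) * energy c \<nu> (\<lambda>_. 1) (1 / real (Suc m)) < ennreal (\<eta> / 8)"
    by (auto simp: eventually_sequentially)
  define n where "n = Suc m"
  define \<eta>1 where "\<eta>1 = \<eta> / (8 * real (Suc n))"
  have h1: "0 < \<eta>1" using \<eta> by (simp add: \<eta>1_def)
  have "(\<lambda>k. ennreal (1 / \<eta>1) * energy c \<nu> (smoothing_weight (1 / real (Suc k))) 1) \<longlonglongrightarrow> 0"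
    by (intro ennreal_mult_tendsto_0 energy_tendsto_0 c nu) simp
  then have "eventually (\<lambda>k. ennreal (1 / \<eta>1) * energy c \<nu> (smoothing_weight (1 / real (Suc k))) 1 < ennreal \<eta>1) sequentially"
    by (rule order_tendstoD) (use h1 in simp)
  then obtain k where k: "ennreal (1 / \<eta>1) * energy c \<nu> (smoothing_weight (1 / real (Suc k))) 1 < ennreal \<eta>1"
    by (auto simp: eventually_sequentially)
  define \<epsilon> where "\<epsilon> = 1 / real (Suc k)"
  have e: "0 < \<epsilon>" by (simp add: \<epsilon>_def)
  note fin = gaussian_frequency_moments_finite[OF e]
  have "(\<lambda>i. ennreal (1 / real (Suc i))) \<longlonglongrightarrow> ennreal 0" by (intro tendsto_ennrealI inverse_Suc_tendsto_0)
  then have "(\<lambda>i. (\<integral>\<^sup>+\<theta>. ennreal (gaussian_frequency \<epsilon> \<theta>) \<partial>lborel) * ennreal (1 / real (Suc i))) \<longlonglongrightarrow> 0"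
    by (intro ennreal_mult_tendsto_0 fin) simp
  then have "eventually (\<lambda>i. (\<integral>\<^sup>+\<theta>. ennreal (gaussian_frequency \<epsilon> \<theta>) \<partial>lborel) * ennreal (1 / real (Suc i)) < ennreal (\<eta> / 8)) sequentially"
    by (rule order_tendstoD) (use \<eta> in simp)
  then obtain i where i: "(\<integral>\<^sup>+\<theta>. ennreal (gaussian_frequency \<epsilon> \<theta>) \<partial>lborel) * ennreal (1 / real (Suc i)) < ennreal (\<eta> / 8)"
    by (auto simp: eventually_sequentially)
  define \<eta>3 where "\<eta>3 = 1 / real (Suc i)"
  have h3: "0 < \<eta>3" by (simp add: \<eta>3_def)
  have "(\<lambda>N. K * (1 / real (Suc N)) powr (2 * \<mu>) / \<eta>3) \<longlonglongrightarrow> K * 0 powr (2 * \<mu>) / \<eta>3"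
    using mu h3 by (intro tendsto_intros tendsto_powr' inverse_Suc_tendsto_0) auto
  then have "(\<lambda>N. ennreal (K * (1 / real (Suc N)) powr (2 * \<mu>) / \<eta>3)) \<longlonglongrightarrow> ennreal 0"
    by (intro tendsto_ennrealI) simp
  then have "(\<lambda>N. (\<integral>\<^sup>+\<theta>. ennreal (gaussian_frequency \<epsilon> \<theta> * \<theta>\<^sup>2) \<partial>lborel) * ennreal (K * (1 / real (Suc N)) powr (2 * \<mu>) / \<eta>3)) \<longlonglongrightarrow> 0"
    by (intro ennreal_mult_tendsto_0 fin) simp
  then have "eventually (\<lambda>N. (\<integral>\<^sup>+\<theta>. ennreal (gaussian_frequency \<epsilon> \<theta> * \<theta>\<^sup>2) \<partial>lborel) * ennreal (K * (1 / real (Suc N)) powr (2 * \<mu>) / \<eta>3) < ennreal (\<eta> / 8)) sequentially"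
    by (rule order_tendstoD) (use \<eta> in simp)
  then obtain j where j: "(\<integral>\<^sup>+\<theta>. ennreal (gaussian_frequency \<epsilon> \<theta> * \<theta>\<^sup>2) \<partial>lborel) * ennreal (K * (1 / real (Suc j)) powr (2 * \<mu>) / \<eta>3) < ennreal (\<eta> / 8)"
    by (auto simp: eventually_sequentially)
  define N where "N = Suc j"
  show thesis
  proof (rule that[OF _ _ e h1 h2 h3])
    have "approximation_error c \<nu> K \<mu> n N \<epsilon> \<eta>1 \<eta>2 \<eta>3
      \<le> of_nat (Suc n) * (ennreal \<eta>1 + ennreal \<eta>1) + (ennreal \<eta>2 + ennreal (\<eta> / 8)) + (ennreal (\<eta> / 8) + ennreal (\<eta> / 8))"
      unfolding approximation_error_def
      using k m i j by (intro add_mono mult_left_mono) (auto simp: \<epsilon>_def n_def N_def \<eta>3_def mult.commute intro: less_imp_le)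
    also have "\<dots> = ennreal (real (Suc n) * (\<eta>1 + \<eta>1) + (\<eta>2 + \<eta> / 8) + (\<eta> / 8 + \<eta> / 8))"
      using \<eta> h1 h2
      by (simp add: ennreal_plus[symmetric] ennreal_mult[symmetric] ennreal_of_nat_eq_real_of_nat del: ennreal_plus of_nat_Suc)
    also have "real (Suc n) * (\<eta>1 + \<eta>1) + (\<eta>2 + \<eta> / 8) + (\<eta> / 8 + \<eta> / 8) = 3 / 4 * \<eta>"
      by (simp add: \<eta>1_def \<eta>2_def del: of_nat_Suc)
    also have "ennreal (3 / 4 * \<eta>) < ennreal \<eta>" using \<eta> by (simp add: ennreal_less_iff)
    finally show "approximation_error c \<nu> K \<mu> n N \<epsilon> \<eta>1 \<eta>2 \<eta>3 < ennreal \<eta>" .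
  qed (auto simp: n_def N_def)
qed

text \<open>The local time at \<open>x\<close> is recorded as the limit of occupation integrals of
  normal densities of width \<open>1 / Suc n\<close>, for all times outside one null set. In this
  form the Fourier estimates and Fatou's lemma apply to it.\<close>

locale gaussian_local_time = gaussian_process M P k c \<nu> K \<mu> for M :: "'a measure" and P k c \<nu> K \<mu> +
  fixes x :: real and \<Lambda> :: "real \<Rightarrow> 'a \<Rightarrow> real"
  assumes \<Lambda>_measurable: "\<And>t. t \<in> {0..1} \<Longrightarrow> \<Lambda> t \<in> borel_measurable M"
    and \<Lambda>_lim: "AE \<omega> in M. \<forall>t\<in>{0..1}. (\<lambda>n. \<integral>s. indicator {0<..t} s * normal_density 0 (1 / real (Suc n)) (P s \<omega> - x) \<partial>lborel) \<longlonglongrightarrow> \<Lambda> t \<omega>"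
begin

definition smoothed :: "real \<Rightarrow> real \<Rightarrow> 'a \<Rightarrow> real" where
  "smoothed \<epsilon> t \<omega> = (\<integral>s. indicator {0<..t} s * normal_density 0 \<epsilon> (P s \<omega> - x) \<partial>lborel)"

lemma smoothed_measurable[measurable]: "smoothed \<epsilon> t \<in> borel_measurable M"
proof -
  have "(\<lambda>\<omega>. smoothed \<epsilon> t \<omega>) \<in> borel_measurable M" unfolding smoothed_def by measurable
  then show ?thesis by simp
qed

lemma path_measurable: "\<omega> \<in> space M \<Longrightarrow> (\<lambda>s. P s \<omega>) \<in> borel_measurable borel"
  using measurable_Pair1[OF P_measurable, of \<omega>] by simp

lemma density_path_integrable:
  assumes w: "\<omega> \<in> space M" and e: "0 < \<epsilon>" and A[measurable]: "A \<in> sets borel" and Ab: "A \<subseteq> {0..1}"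
  shows "integrable lborel (\<lambda>s. indicator A s * normal_density 0 \<epsilon> (P s \<omega> - x))"
proof (rule Bochner_Integration.integrable_bound)
  have [measurable]: "(\<lambda>s. P s \<omega>) \<in> borel_measurable borel" by (rule path_measurable[OF w])
  show "integrable lborel (\<lambda>s::real. indicat_real {0..1} s * (1 / (sqrt (2 * pi) * \<epsilon>)))"
    by (intro integrable_mult_left integrable_real_indicator emeasure_bounded_finite) auto
  show "(\<lambda>s. indicator A s * normal_density 0 \<epsilon> (P s \<omega> - x)) \<in> borel_measurable lborel" by measurable
  show "AE s in lborel. norm (indicator A s * normal_density 0 \<epsilon> (P s \<omega> - x)) \<le> norm (indicat_real {0..1} s * (1 / (sqrt (2 * pi) * \<epsilon>)))"
    using Ab normal_density_le[OF e] e by (intro AE_I2) (auto simp: indicator_def)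
qed

lemma smoothed_diff:
  assumes w: "\<omega> \<in> space M" and e: "0 < \<epsilon>" and t: "0 \<le> t" "t \<le> t'" "t' \<le> 1"
  shows "smoothed \<epsilon> t' \<omega> - smoothed \<epsilon> t \<omega> = (\<integral>s. indicator {t<..t'} s * normal_density 0 \<epsilon> (P s \<omega> - x) \<partial>lborel)"
proof -
  have "smoothed \<epsilon> t' \<omega> - smoothed \<epsilon> t \<omega>
    = (\<integral>s. indicator {0<..t'} s * normal_density 0 \<epsilon> (P s \<omega> - x) - indicator {0<..t} s * normal_density 0 \<epsilon> (P s \<omega> - x) \<partial>lborel)"
    unfolding smoothed_def using t
    by (intro Bochner_Integration.integral_diff[symmetric] density_path_integrable[OF w e]) auto
  also have "\<dots> = (\<integral>s. indicator {t<..t'} s * normal_density 0 \<epsilon> (P s \<omega> - x) \<partial>lborel)"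
    by (rule Bochner_Integration.integral_cong) (use t in \<open>auto simp: indicator_def\<close>)
  finally show ?thesis .
qed

lemma smoothed_mono:
  assumes "\<omega> \<in> space M" "0 < \<epsilon>" "0 \<le> t" "t \<le> t'" "t' \<le> 1"
  shows "smoothed \<epsilon> t \<omega> \<le> smoothed \<epsilon> t' \<omega>"
proof -
  have "0 \<le> (\<integral>s. indicator {t<..t'} s * normal_density 0 \<epsilon> (P s \<omega> - x) \<partial>lborel)" by (rule integral_nonneg_AE) simp
  then show ?thesis using smoothed_diff[OF assms] by linarith
qed

lemma \<Lambda>_lim_smoothed: "AE \<omega> in M. \<forall>t\<in>{0..1}. (\<lambda>n. smoothed (1 / real (Suc n)) t \<omega>) \<longlonglongrightarrow> \<Lambda> t \<omega>"
  using \<Lambda>_lim unfolding smoothed_def .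

lemma \<Lambda>_mono: "AE \<omega> in M. \<forall>t t'. 0 \<le> t \<longrightarrow> t \<le> t' \<longrightarrow> t' \<le> 1 \<longrightarrow> \<Lambda> t \<omega> \<le> \<Lambda> t' \<omega>"
  using \<Lambda>_lim_smoothed AE_space
proof eventually_elim
  case (elim \<omega>)
  show ?case
  proof (intro allI impI)
    fix t t' :: real assume t: "0 \<le> t" "t \<le> t'" "t' \<le> 1"
    show "\<Lambda> t \<omega> \<le> \<Lambda> t' \<omega>"
    proof (rule LIMSEQ_le)
      show "(\<lambda>n. smoothed (1 / real (Suc n)) t \<omega>) \<longlonglongrightarrow> \<Lambda> t \<omega>" "(\<lambda>n. smoothed (1 / real (Suc n)) t' \<omega>) \<longlonglongrightarrow> \<Lambda> t' \<omega>"
        using elim(1) t by auto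
      show "\<exists>N. \<forall>n\<ge>N. smoothed (1 / real (Suc n)) t \<omega> \<le> smoothed (1 / real (Suc n)) t' \<omega>"
        using smoothed_mono[OF elim(2) _ t] by auto
    qed
  qed
qed

text \<open>Two smoothings are compared first: for any width \<delta> below \<epsilon> the
  difference of the transforms is dominated by the same weight, so the bound is uniform in \<delta>.
  Fatou's lemma then sends \<delta> to 0.\<close>

lemma smoothing_error:
  assumes e: "0 < \<epsilon>" and t: "t \<in> {0..1}"
  shows "(\<integral>\<^sup>+\<omega>. ennreal ((\<Lambda> t \<omega> - smoothed \<epsilon> t \<omega>)\<^sup>2) \<partial>M) \<le> energy c \<nu> (smoothing_weight \<epsilon>) 1"
proof -
  let ?d = "\<lambda>n. 1 / real (Suc n)"
  have "(\<integral>\<^sup>+\<omega>. ennreal ((\<Lambda> t \<omega> - smoothed \<epsilon> t \<omega>)\<^sup>2) \<partial>M) = (\<integral>\<^sup>+\<omega>. liminf (\<lambda>n. ennreal ((smoothed (?d n) t \<omega> - smoothed \<epsilon> t \<omega>)\<^sup>2)) \<partial>M)"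
  proof (rule nn_integral_cong_AE, use \<Lambda>_lim_smoothed in eventually_elim)
    case (elim \<omega>)
    then have "(\<lambda>n. smoothed (?d n) t \<omega>) \<longlonglongrightarrow> \<Lambda> t \<omega>" using t by blast
    then have "(\<lambda>n. ennreal ((smoothed (?d n) t \<omega> - smoothed \<epsilon> t \<omega>)\<^sup>2)) \<longlonglongrightarrow> ennreal ((\<Lambda> t \<omega> - smoothed \<epsilon> t \<omega>)\<^sup>2)"
      by (intro tendsto_intros tendsto_ennrealI)
    then show ?case by (rule lim_imp_Liminf[OF sequentially_bot, symmetric])
  qed
  also have "\<dots> \<le> liminf (\<lambda>n. \<integral>\<^sup>+\<omega>. ennreal ((smoothed (?d n) t \<omega> - smoothed \<epsilon> t \<omega>)\<^sup>2) \<partial>M)"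
    by (rule nn_integral_liminf) measurable
  also have "\<dots> \<le> limsup (\<lambda>n. \<integral>\<^sup>+\<omega>. ennreal ((smoothed (?d n) t \<omega> - smoothed \<epsilon> t \<omega>)\<^sup>2) \<partial>M)"
    by (rule Liminf_le_Limsup) simp
  also have "\<dots> \<le> energy c \<nu> (smoothing_weight \<epsilon>) 1"
  proof (rule Limsup_bounded)
    have "eventually (\<lambda>n. ?d n < \<epsilon>) sequentially" by (rule order_tendstoD(2)[OF inverse_Suc_tendsto_0 e])
    then show "eventually (\<lambda>n. (\<integral>\<^sup>+\<omega>. ennreal ((smoothed (?d n) t \<omega> - smoothed \<epsilon> t \<omega>)\<^sup>2) \<partial>M) \<le> energy c \<nu> (smoothing_weight \<epsilon>) 1) sequentially"
    proof eventually_elim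
      case (elim n)
      define \<delta> where "\<delta> = ?d n"
      have d: "0 < \<delta>" "\<delta> \<le> \<epsilon>" using elim by (auto simp: \<delta>_def)
      let ?q = "\<lambda>y. normal_density 0 \<delta> y - normal_density 0 \<epsilon> y"
      have F: "fourier_representation ?q (\<lambda>\<theta>. gaussian_frequency \<delta> \<theta> - gaussian_frequency \<epsilon> \<theta>)"
        by (intro fourier_representation_diff fourier_representation_normal_density d e)
      have b: "\<bar>gaussian_frequency \<delta> \<theta> - gaussian_frequency \<epsilon> \<theta>\<bar> \<le> smoothing_weight \<epsilon> \<theta> / (2 * pi)" for \<theta>
      proof -
        have "(\<delta> * \<theta>)\<^sup>2 \<le> (\<epsilon> * \<theta>)\<^sup>2" using d by (simp add: power_mult_distrib mult_right_mono power_mono)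
        then have "exp (- (\<epsilon> * \<theta>)\<^sup>2 / 2) \<le> exp (- (\<delta> * \<theta>)\<^sup>2 / 2)" by simp
        moreover have "exp (- (\<delta> * \<theta>)\<^sup>2 / 2) \<le> 1" by simp
        ultimately have "\<bar>exp (- (\<delta> * \<theta>)\<^sup>2 / 2) - exp (- (\<epsilon> * \<theta>)\<^sup>2 / 2)\<bar> \<le> smoothing_weight \<epsilon> \<theta>"
          unfolding smoothing_weight_def by linarith
        then show ?thesis
          unfolding gaussian_frequency_def diff_divide_distrib[symmetric] abs_divide by (simp add: divide_right_mono)
      qed
      have "(\<integral>\<^sup>+\<omega>. ennreal ((smoothed \<delta> t \<omega> - smoothed \<epsilon> t \<omega>)\<^sup>2) \<partial>M)
        = (\<Sum>i\<in>{()}. \<integral>\<^sup>+\<omega>. ennreal ((\<integral>s. indicator {0<..t} s * ?q (P s \<omega> - x) \<partial>lborel)\<^sup>2) \<partial>M)"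
      proof -
        have "smoothed \<delta> t \<omega> - smoothed \<epsilon> t \<omega> = (\<integral>s. indicator {0<..t} s * ?q (P s \<omega> - x) \<partial>lborel)" if "\<omega> \<in> space M" for \<omega>
          unfolding smoothed_def right_diff_distrib using t d e
          by (intro Bochner_Integration.integral_diff[symmetric] density_path_integrable[OF that]) auto
        then show ?thesis by (simp cong: nn_integral_cong_simp)
      qed
      also have "\<dots> \<le> energy c \<nu> (smoothing_weight \<epsilon>) 1"
        by (rule occupation_energy_bound[OF F b]) (use t in \<open>auto simp: smoothing_weight_le indicator_def\<close>)
      finally show ?case by (simp add: \<delta>_def)
    qed
  qed
  finally show ?thesis .
qed

text \<open>Summed over the cells, the squared increments involve only pairs of times in a common
  cell, hence at distance at most \<open>1 / n\<close>. The bound for smoothed increments is uniform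
  in the width, and Fatou's lemma transfers it to the local time.\<close>

lemma increment_error:
  assumes n: "0 < n"
  shows "(\<Sum>i<n. \<integral>\<^sup>+\<omega>. ennreal ((\<Lambda> (real (Suc i) / real n) \<omega> - \<Lambda> (real i / real n) \<omega>)\<^sup>2) \<partial>M) \<le> energy c \<nu> (\<lambda>_. 1) (1 / real n)"
proof -
  let ?d = "\<lambda>m. 1 / real (Suc m)"
  let ?t = "\<lambda>i. real i / real n"
  have t01: "?t i \<in> {0..1}" if "i \<le> n" for i using that n by (auto simp: divide_le_eq_1)
  define Q where "Q m \<omega> = (\<Sum>i<n. ennreal ((smoothed (?d m) (?t (Suc i)) \<omega> - smoothed (?d m) (?t i) \<omega>)\<^sup>2))" for m \<omega>
  have Qm[measurable]: "Q m \<in> borel_measurable M" for m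
  proof -
    have "(\<lambda>\<omega>. Q m \<omega>) \<in> borel_measurable M" unfolding Q_def by measurable
    then show ?thesis by simp
  qed
  have m: "\<Lambda> (?t i) \<in> borel_measurable M" if "i \<le> n" for i using \<Lambda>_measurable[OF t01[OF that]] .
  have "(\<Sum>i<n. \<integral>\<^sup>+\<omega>. ennreal ((\<Lambda> (?t (Suc i)) \<omega> - \<Lambda> (?t i) \<omega>)\<^sup>2) \<partial>M) = (\<integral>\<^sup>+\<omega>. (\<Sum>i<n. ennreal ((\<Lambda> (?t (Suc i)) \<omega> - \<Lambda> (?t i) \<omega>)\<^sup>2)) \<partial>M)"
    by (intro nn_integral_sum[symmetric] measurable_compose[OF _ measurable_ennreal] borel_measurable_power borel_measurable_diff m) auto
  also have "\<dots> = (\<integral>\<^sup>+\<omega>. liminf (\<lambda>m. Q m \<omega>) \<partial>M)"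
  proof (rule nn_integral_cong_AE, use \<Lambda>_lim_smoothed in eventually_elim)
    case (elim \<omega>)
    have "(\<lambda>m. Q m \<omega>) \<longlonglongrightarrow> (\<Sum>i<n. ennreal ((\<Lambda> (?t (Suc i)) \<omega> - \<Lambda> (?t i) \<omega>)\<^sup>2))"
      unfolding Q_def
    proof (intro tendsto_sum tendsto_ennrealI tendsto_power tendsto_diff)
      fix i assume "i \<in> {..<n}"
      then show "(\<lambda>m. smoothed (?d m) (?t (Suc i)) \<omega>) \<longlonglongrightarrow> \<Lambda> (?t (Suc i)) \<omega>" "(\<lambda>m. smoothed (?d m) (?t i) \<omega>) \<longlonglongrightarrow> \<Lambda> (?t i) \<omega>"
        using elim t01[of i] t01[of "Suc i"] by auto
    qed
    then show ?case by (rule lim_imp_Liminf[OF sequentially_bot, symmetric])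
  qed
  also have "\<dots> \<le> liminf (\<lambda>m. \<integral>\<^sup>+\<omega>. Q m \<omega> \<partial>M)" by (rule nn_integral_liminf) measurable
  also have "\<dots> \<le> limsup (\<lambda>m. \<integral>\<^sup>+\<omega>. Q m \<omega> \<partial>M)" by (rule Liminf_le_Limsup) simp
  also have "\<dots> \<le> energy c \<nu> (\<lambda>_. 1) (1 / real n)"
  proof (rule Limsup_bounded, rule always_eventually, rule allI)
    fix m
    \<comment> \<open>\<open>occupation_energy_bound\<close> wants every member of the family inside
      the unit interval, so indices beyond the grid receive the empty set.\<close>
    define A where "A i = (if i < n then {?t i<..?t (Suc i)} else {})" for i
    have "(\<integral>\<^sup>+\<omega>. Q m \<omega> \<partial>M) = (\<Sum>i<n. \<integral>\<^sup>+\<omega>. ennreal ((smoothed (?d m) (?t (Suc i)) \<omega> - smoothed (?d m) (?t i) \<omega>)\<^sup>2) \<partial>M)"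
      unfolding Q_def by (rule nn_integral_sum) measurable
    also have "\<dots> = (\<Sum>i<n. \<integral>\<^sup>+\<omega>. ennreal ((\<integral>s. indicator (A i) s * normal_density 0 (?d m) (P s \<omega> - x) \<partial>lborel)\<^sup>2) \<partial>M)"
    proof (intro sum.cong refl nn_integral_cong)
      fix i \<omega> assume i: "i \<in> {..<n}" and w: "\<omega> \<in> space M"
      have "?t i \<le> ?t (Suc i)" by (simp add: divide_right_mono)
      then show "ennreal ((smoothed (?d m) (?t (Suc i)) \<omega> - smoothed (?d m) (?t i) \<omega>)\<^sup>2) = ennreal ((\<integral>s. indicator (A i) s * normal_density 0 (?d m) (P s \<omega> - x) \<partial>lborel)\<^sup>2)"
        using smoothed_diff[OF w, of "?d m" "?t i" "?t (Suc i)"] t01[of i] t01[of "Suc i"] i by (simp add: A_def)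
    qed
    also have "\<dots> \<le> energy c \<nu> (\<lambda>_. 1) (1 / real n)"
    proof (rule occupation_energy_bound[OF fourier_representation_normal_density])
      show "\<bar>gaussian_frequency (?d m) \<theta>\<bar> \<le> 1 / (2 * pi)" for \<theta> by (auto simp: gaussian_frequency_def divide_right_mono)
      show "A i \<subseteq> {0<..1}" for i
      proof (cases "i < n")
        case True
        then have "0 \<le> ?t i" "?t (Suc i) \<le> 1" using t01[of i] t01[of "Suc i"] by (auto simp del: of_nat_Suc)
        then show ?thesis using True order.strict_trans1[of 0 "?t i"] order_trans[of _ "?t (Suc i)" 1]
          unfolding A_def by (metis greaterThanAtMost_iff subsetI)
      qed (simp add: A_def)
      fix s s' :: real
      show "(\<Sum>i<n. indicator (A i) s * indicator (A i) s') \<le> (indicator {- (1 / real n)..1 / real n} (s' - s) :: ennreal)"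
      proof (cases "\<exists>i<n. s \<in> A i")
        case True
        then obtain i where i: "i < n" "s \<in> A i" by blast
        have uniq: "j = i" if "j < n" "s \<in> A j" for j
        proof (rule ccontr)
          assume "j \<noteq> i"
          then have "Suc j \<le> i \<or> Suc i \<le> j" by linarith
          then have "?t (Suc j) \<le> ?t i \<or> ?t (Suc i) \<le> ?t j" using n by (auto simp: divide_right_mono simp flip: of_nat_Suc)
          then show False using i that by (auto simp: A_def)
        qed
        have "(\<Sum>j<n. indicator (A j) s * indicator (A j) s') = (\<Sum>j<n. if j = i then indicator (A i) s' else 0 :: ennreal)"
        proof (intro sum.cong refl)
          fix j assume "j \<in> {..<n}"
          then have "s \<in> A j \<longleftrightarrow> j = i" using uniq[of j] i(2) by blast
          then show "indicator (A j) s * indicator (A j) s' = (if j = i then indicator (A i) s' else 0 :: ennreal)" using i(2) by auto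
        qed
        also have "\<dots> = indicator (A i) s'" using i by simp
        also have "\<dots> \<le> indicator {- (1 / real n)..1 / real n} (s' - s)"
        proof (cases "s' \<in> A i")
          case True
          have "?t (Suc i) = ?t i + 1 / real n" by (simp add: add_divide_distrib)
          then show ?thesis using True i by (auto simp: A_def indicator_def)
        qed simp
        finally show ?thesis .
      next
        case False
        then have "(\<Sum>i<n. indicator (A i) s * indicator (A i) s') = (0 :: ennreal)" by (auto intro!: sum.neutral)
        then show ?thesis by simp
      qed
    qed (auto simp: A_def)
    finally show "(\<integral>\<^sup>+\<omega>. Q m \<omega> \<partial>M) \<le> energy c \<nu> (\<lambda>_. 1) (1 / real n)" .
  qed
  finally show ?thesis .
qed

end

section \<open>From mean square bounds at grid points to bounds uniform in time\<close>

lemma le_plus_square_divide: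
  fixes y \<eta> :: real
  assumes "0 < \<eta>"
  shows "y \<le> \<eta> + y\<^sup>2 / \<eta>"
proof (cases "y \<le> \<eta>")
  case True
  then show ?thesis using assms by (smt (verit) divide_nonneg_pos zero_le_power2)
next
  case False
  then have "\<eta> * y \<le> y * y" using assms by (intro mult_right_mono) auto
  then have "y \<le> y\<^sup>2 / \<eta>" using assms by (simp add: pos_le_divide_eq power2_eq_square mult.commute)
  then show ?thesis using assms by linarith
qed

lemma ennreal_le_plus_square_divide:
  assumes "0 < \<eta>"
  shows "ennreal \<bar>y\<bar> \<le> ennreal \<eta> + ennreal (1 / \<eta>) * ennreal (y\<^sup>2)"
  using le_plus_square_divide[OF assms, of "\<bar>y\<bar>"] assms
  by (simp add: ennreal_plus[symmetric] ennreal_mult[symmetric] ennreal_leI del: ennreal_plus)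

lemma grid_cell:
  fixes t :: real
  assumes t: "0 \<le> t" "t \<le> 1" and n: "0 < n"
  obtains i where "i < n" "real i / real n \<le> t" "t \<le> real (Suc i) / real n"
proof (cases "t = 1")
  \<comment> \<open>At \<open>t = 1\<close> rounding down would give the index \<open>n\<close>; the
    last cell is taken instead, as cells are closed here.\<close>
  case True
  obtain m where m: "n = Suc m" using n gr0_implies_Suc by blast
  show thesis by (rule that[of m]) (use True m in auto)
next
  case False
  define i where "i = nat \<lfloor>t * real n\<rfloor>"
  have tn: "0 \<le> t * real n" "t * real n < real n" using t False n by auto
  have i: "real i \<le> t * real n" "t * real n < real i + 1"
    using tn by (auto simp: i_def)
  show thesis
  proof (rule that[of i])
    show "i < n" using i(1) tn(2) by linarith
    show "real i / real n \<le> t" "t \<le> real (Suc i) / real n" using i n by (auto simp: pos_divide_le_eq pos_le_divide_eq)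
  qed
qed

context gaussian_local_time
begin

text \<open>After Fourier inversion each frequency contributes \<open>norm (cis a - cis b)\<close>,
  which is split at level \<eta>. Its square has the expectation
  \<open>2 - 2 * exp (- \<theta>\<^sup>2 * v / 2)\<close>, at most
  \<open>\<theta>\<^sup>2 * v\<close>, where \<open>v\<close> is the variance of the increment; this
  is why the second frequency moment appears.\<close>

lemma density_increment:
  assumes e: "0 < \<epsilon>" and \<eta>: "0 < \<eta>" and s: "0 \<le> s" "0 \<le> d" "s + d \<le> 1" "d \<le> \<delta>"
  shows "(\<integral>\<^sup>+\<omega>. ennreal \<bar>normal_density 0 \<epsilon> (P (s + d) \<omega> - x) - normal_density 0 \<epsilon> (P s \<omega> - x)\<bar> \<partial>M)
    \<le> ennreal \<eta> * (\<integral>\<^sup>+\<theta>. ennreal (gaussian_frequency \<epsilon> \<theta>) \<partial>lborel)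
      + ennreal (K * \<delta> powr (2 * \<mu>) / \<eta>) * (\<integral>\<^sup>+\<theta>. ennreal (gaussian_frequency \<epsilon> \<theta> * \<theta>\<^sup>2) \<partial>lborel)"
proof -
  interpret MP: pair_sigma_finite M lborel ..
  let ?\<kappa> = "gaussian_frequency \<epsilon>"
  let ?y = "\<lambda>\<omega>. P (s + d) \<omega> - x" and ?y' = "\<lambda>\<omega>. P s \<omega> - x"
  define Q where "Q \<theta> \<omega> = ?\<kappa> \<theta> * (\<eta> + (norm (cis (\<theta> * ?y \<omega>) - cis (\<theta> * ?y' \<omega>)))\<^sup>2 / \<eta>)" for \<theta> \<omega>
  have F: "fourier_representation (normal_density 0 \<epsilon>) ?\<kappa>" by (rule fourier_representation_normal_density[OF e])
  have i: "integrable lborel (\<lambda>\<theta>. complex_of_real (?\<kappa> \<theta>) * cis (\<theta> * y))" for y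
    using integrable_cis_times_real[of "\<lambda>\<theta>. \<theta> * y" lborel ?\<kappa>] F by (simp add: mult.commute fourier_representation_def)
  have pointwise: "ennreal \<bar>normal_density 0 \<epsilon> (?y \<omega>) - normal_density 0 \<epsilon> (?y' \<omega>)\<bar> \<le> (\<integral>\<^sup>+\<theta>. ennreal (Q \<theta> \<omega>) \<partial>lborel)" for \<omega>
  proof -
    have "complex_of_real (normal_density 0 \<epsilon> (?y \<omega>) - normal_density 0 \<epsilon> (?y' \<omega>))
      = (\<integral>\<theta>. complex_of_real (?\<kappa> \<theta>) * cis (\<theta> * ?y \<omega>) - complex_of_real (?\<kappa> \<theta>) * cis (\<theta> * ?y' \<omega>) \<partial>lborel)"
      using F i unfolding fourier_representation_def by (subst Bochner_Integration.integral_diff) auto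
    then have "ennreal \<bar>normal_density 0 \<epsilon> (?y \<omega>) - normal_density 0 \<epsilon> (?y' \<omega>)\<bar>
      = ennreal (norm (\<integral>\<theta>. complex_of_real (?\<kappa> \<theta>) * cis (\<theta> * ?y \<omega>) - complex_of_real (?\<kappa> \<theta>) * cis (\<theta> * ?y' \<omega>) \<partial>lborel))"
      by (metis norm_of_real)
    also have "\<dots> \<le> (\<integral>\<^sup>+\<theta>. ennreal (norm (complex_of_real (?\<kappa> \<theta>) * cis (\<theta> * ?y \<omega>) - complex_of_real (?\<kappa> \<theta>) * cis (\<theta> * ?y' \<omega>))) \<partial>lborel)"
      by (rule ennreal_norm_integral_le)
    also have "\<dots> \<le> (\<integral>\<^sup>+\<theta>. ennreal (Q \<theta> \<omega>) \<partial>lborel)"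
    proof (intro nn_integral_mono ennreal_leI)
      fix \<theta>
      show "norm (complex_of_real (?\<kappa> \<theta>) * cis (\<theta> * ?y \<omega>) - complex_of_real (?\<kappa> \<theta>) * cis (\<theta> * ?y' \<omega>)) \<le> Q \<theta> \<omega>"
        unfolding Q_def right_diff_distrib[symmetric] norm_mult
        using gaussian_frequency_nonneg[of \<epsilon> \<theta>] by (intro mult_mono le_plus_square_divide[OF \<eta>]) auto
    qed
    finally show ?thesis .
  qed
  have sq: "(norm (cis a - cis b))\<^sup>2 = 2 - 2 * cos (a - b)" for a b
    by (simp add: cmod_power2 cos_diff power2_diff) (use sin_cos_squared_add[of a] sin_cos_squared_add[of b] in \<open>simp add: algebra_simps; linarith\<close>)
  have expect: "(\<integral>\<^sup>+\<omega>. ennreal (Q \<theta> \<omega>) \<partial>M) \<le> ennreal \<eta> * ennreal (?\<kappa> \<theta>) + ennreal (K * \<delta> powr (2 * \<mu>) / \<eta>) * ennreal (?\<kappa> \<theta> * \<theta>\<^sup>2)" for \<theta>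
  proof -
    define v where "v = l2sq (\<lambda>u. k (s + d) u - k s u)"
    have Q0: "0 \<le> Q \<theta> \<omega>" for \<omega> unfolding Q_def using \<eta> gaussian_frequency_nonneg by simp
    have c1: "(\<integral>\<omega>. cis (\<theta> * P (s + d) \<omega> - \<theta> * P s \<omega>) \<partial>M) = complex_of_real (exp (- (\<theta>\<^sup>2 * v) / 2))"
    proof -
      have "(\<integral>\<omega>. cis (\<theta> * P (s + d) \<omega> - \<theta> * P s \<omega>) \<partial>M)
        = complex_of_real (exp (- l2sq (\<lambda>u. - \<theta> *\<^sub>R k s u + \<theta> *\<^sub>R k (s + d) u) / 2))"
        using P_cis[of "{0, 1}" "\<lambda>i. if i = 0 then s else s + d" "\<lambda>i. if i = 0 then - \<theta> else \<theta>"] s by simp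
      also have "(\<lambda>u. (norm (- \<theta> *\<^sub>R k s u + \<theta> *\<^sub>R k (s + d) u))\<^sup>2) = (\<lambda>u. \<theta>\<^sup>2 * (norm (k (s + d) u - k s u))\<^sup>2)"
      proof
        fix u
        have "- \<theta> *\<^sub>R k s u + \<theta> *\<^sub>R k (s + d) u = \<theta> *\<^sub>R (k (s + d) u - k s u)" by (simp add: scaleR_right_diff_distrib)
        then show "(norm (- \<theta> *\<^sub>R k s u + \<theta> *\<^sub>R k (s + d) u))\<^sup>2 = \<theta>\<^sup>2 * (norm (k (s + d) u - k s u))\<^sup>2"
          by (simp only: norm_scaleR power_mult_distrib power2_abs)
      qed
      finally show ?thesis by (simp add: v_def)
    qed
    have ci: "integrable M (\<lambda>\<omega>. cis (\<theta> * P (s + d) \<omega> - \<theta> * P s \<omega>))" by (rule integrable_const_bound[where B=1]) auto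
    have c2: "(\<integral>\<omega>. cos (\<theta> * P (s + d) \<omega> - \<theta> * P s \<omega>) \<partial>M) = exp (- (\<theta>\<^sup>2 * v) / 2)"
      using integral_Re[OF ci] by (simp add: c1 del: of_real_exp)
    have cosi: "integrable M (\<lambda>\<omega>. cos (\<theta> * P (s + d) \<omega> - \<theta> * P s \<omega>))" by (rule integrable_const_bound[where B=1]) auto
    have Qc: "Q \<theta> \<omega> = ?\<kappa> \<theta> * (\<eta> + (2 - 2 * cos (\<theta> * P (s + d) \<omega> - \<theta> * P s \<omega>)) / \<eta>)" for \<omega>
      unfolding Q_def sq by (simp add: right_diff_distrib)
    have Qi: "integrable M (\<lambda>\<omega>. Q \<theta> \<omega>)" unfolding Qc using cosi by simp
    have "(\<integral>\<^sup>+\<omega>. ennreal (Q \<theta> \<omega>) \<partial>M) = ennreal (\<integral>\<omega>. Q \<theta> \<omega> \<partial>M)" using Qi Q0 by (intro nn_integral_eq_integral) auto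
    also have "(\<integral>\<omega>. Q \<theta> \<omega> \<partial>M) = ?\<kappa> \<theta> * (\<eta> + (2 - 2 * exp (- (\<theta>\<^sup>2 * v) / 2)) / \<eta>)"
      unfolding Qc using cosi by (simp add: c2 prob_space)
    also have "ennreal \<dots> \<le> ennreal (\<eta> * ?\<kappa> \<theta> + K * \<delta> powr (2 * \<mu>) / \<eta> * (?\<kappa> \<theta> * \<theta>\<^sup>2))"
    proof (rule ennreal_leI)
      have v: "v \<le> K * \<delta> powr (2 * \<mu>)"
      proof -
        have "v \<le> K * d powr (2 * \<mu>)" unfolding v_def by (rule modulus) (use s in auto)
        also have "\<dots> \<le> K * \<delta> powr (2 * \<mu>)" using s mu K by (intro mult_left_mono powr_mono2) auto
        finally show ?thesis .
      qed
      have "1 - \<theta>\<^sup>2 * v / 2 \<le> exp (- (\<theta>\<^sup>2 * v) / 2)" using exp_ge_add_one_self[of "- (\<theta>\<^sup>2 * v) / 2"] by simp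
      then have "2 - 2 * exp (- (\<theta>\<^sup>2 * v) / 2) \<le> \<theta>\<^sup>2 * v" by linarith
      also have "\<dots> \<le> \<theta>\<^sup>2 * (K * \<delta> powr (2 * \<mu>))" using v by (rule mult_left_mono) simp
      finally have "?\<kappa> \<theta> * (\<eta> + (2 - 2 * exp (- (\<theta>\<^sup>2 * v) / 2)) / \<eta>) \<le> ?\<kappa> \<theta> * (\<eta> + \<theta>\<^sup>2 * (K * \<delta> powr (2 * \<mu>)) / \<eta>)"
        using \<eta> gaussian_frequency_nonneg by (intro mult_left_mono add_left_mono divide_right_mono) auto
      then show "?\<kappa> \<theta> * (\<eta> + (2 - 2 * exp (- (\<theta>\<^sup>2 * v) / 2)) / \<eta>) \<le> \<eta> * ?\<kappa> \<theta> + K * \<delta> powr (2 * \<mu>) / \<eta> * (?\<kappa> \<theta> * \<theta>\<^sup>2)"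
        by (simp add: algebra_simps)
    qed
    also have "\<dots> = ennreal \<eta> * ennreal (?\<kappa> \<theta>) + ennreal (K * \<delta> powr (2 * \<mu>) / \<eta>) * ennreal (?\<kappa> \<theta> * \<theta>\<^sup>2)"
    proof -
      have "ennreal (\<eta> * ?\<kappa> \<theta>) = ennreal \<eta> * ennreal (?\<kappa> \<theta>)"
        by (rule ennreal_mult) (use \<eta> gaussian_frequency_nonneg in auto)
      moreover have "ennreal (K * \<delta> powr (2 * \<mu>) / \<eta> * (?\<kappa> \<theta> * \<theta>\<^sup>2)) = ennreal (K * \<delta> powr (2 * \<mu>) / \<eta>) * ennreal (?\<kappa> \<theta> * \<theta>\<^sup>2)"
        by (rule ennreal_mult) (use \<eta> K gaussian_frequency_nonneg in auto)
      ultimately show ?thesis using \<eta> K gaussian_frequency_nonneg by (subst ennreal_plus) auto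
    qed
    finally show ?thesis .
  qed
  have [measurable]: "(\<lambda>(\<omega>, \<theta>). Q \<theta> \<omega>) \<in> borel_measurable (M \<Otimes>\<^sub>M lborel)" unfolding Q_def by measurable
  have "(\<integral>\<^sup>+\<omega>. ennreal \<bar>normal_density 0 \<epsilon> (?y \<omega>) - normal_density 0 \<epsilon> (?y' \<omega>)\<bar> \<partial>M) \<le> (\<integral>\<^sup>+\<omega>. (\<integral>\<^sup>+\<theta>. ennreal (Q \<theta> \<omega>) \<partial>lborel) \<partial>M)"
    by (intro nn_integral_mono pointwise)
  also have "\<dots> = (\<integral>\<^sup>+\<theta>. (\<integral>\<^sup>+\<omega>. ennreal (Q \<theta> \<omega>) \<partial>M) \<partial>lborel)"
    by (rule MP.Fubini'[symmetric]) measurable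
  also have "\<dots> \<le> (\<integral>\<^sup>+\<theta>. ennreal \<eta> * ennreal (?\<kappa> \<theta>) + ennreal (K * \<delta> powr (2 * \<mu>) / \<eta>) * ennreal (?\<kappa> \<theta> * \<theta>\<^sup>2) \<partial>lborel)"
    by (intro nn_integral_mono expect)
  also have "\<dots> = ennreal \<eta> * (\<integral>\<^sup>+\<theta>. ennreal (?\<kappa> \<theta>) \<partial>lborel) + ennreal (K * \<delta> powr (2 * \<mu>) / \<eta>) * (\<integral>\<^sup>+\<theta>. ennreal (?\<kappa> \<theta> * \<theta>\<^sup>2) \<partial>lborel)"
    by (simp add: nn_integral_add nn_integral_cmult)
  finally show ?thesis .
qed

text \<open>The error up to time \<open>t\<close> lives on parts of cells, and enlarging these parts
  to the full cells gives a random bound \<open>Z\<close> that does not involve \<open>t\<close>.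
  Its expectation needs only the mean increment of the density within a cell.\<close>

lemma riemann_error:
  assumes e: "0 < \<epsilon>" and \<eta>: "0 < \<eta>" and N: "0 < N"
  shows "\<exists>Z\<in>borel_measurable M. (\<forall>\<omega>\<in>space M. \<forall>t\<in>{0..1}. ennreal \<bar>smoothed \<epsilon> t \<omega> - riemann_local_time P x \<epsilon> N t \<omega>\<bar> \<le> Z \<omega>) \<and>
    (\<integral>\<^sup>+\<omega>. Z \<omega> \<partial>M) \<le> ennreal \<eta> * (\<integral>\<^sup>+\<theta>. ennreal (gaussian_frequency \<epsilon> \<theta>) \<partial>lborel)
      + ennreal (K * (1 / real N) powr (2 * \<mu>) / \<eta>) * (\<integral>\<^sup>+\<theta>. ennreal (gaussian_frequency \<epsilon> \<theta> * \<theta>\<^sup>2) \<partial>lborel)"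
proof -
  interpret MP: pair_sigma_finite M lborel ..
  let ?t = "\<lambda>j. real j / real N"
  let ?p = "\<lambda>s \<omega>. normal_density 0 \<epsilon> (P s \<omega> - x)"
  define I where "I j = {?t j<..?t (Suc j)}" for j
  have [measurable]: "I j \<in> sets borel" for j by (simp add: I_def)
  define Z where "Z \<omega> = (\<Sum>j<N. \<integral>\<^sup>+s. indicator (I j) s * ennreal \<bar>?p s \<omega> - ?p (?t j) \<omega>\<bar> \<partial>lborel)" for \<omega>
  define b where "b = ennreal \<eta> * (\<integral>\<^sup>+\<theta>. ennreal (gaussian_frequency \<epsilon> \<theta>) \<partial>lborel)
      + ennreal (K * (1 / real N) powr (2 * \<mu>) / \<eta>) * (\<integral>\<^sup>+\<theta>. ennreal (gaussian_frequency \<epsilon> \<theta> * \<theta>\<^sup>2) \<partial>lborel)"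
  have Zm: "(\<lambda>\<omega>. Z \<omega>) \<in> borel_measurable M" unfolding Z_def by measurable
  have step: "?t (Suc j) = ?t j + 1 / real N" for j by (simp add: add_divide_distrib)
  have mI: "emeasure lborel (I j) = ennreal (1 / real N)" for j
  proof -
    have "emeasure lborel (I j) = ennreal (?t (Suc j) - ?t j)"
      unfolding I_def by (rule emeasure_lborel_Ioc) (simp add: divide_right_mono)
    then show ?thesis by (simp only: step add_diff_cancel_left')
  qed
  have "ennreal \<bar>smoothed \<epsilon> t \<omega> - riemann_local_time P x \<epsilon> N t \<omega>\<bar> \<le> Z \<omega>" if w: "\<omega> \<in> space M" and t: "t \<in> {0..1}" for \<omega> t
  proof -
    have [measurable]: "(\<lambda>s. P s \<omega>) \<in> borel_measurable borel" by (rule path_measurable[OF w])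
    \<comment> \<open>The part of cell \<open>j\<close> before \<open>t\<close>. Truncating the grid
      points at \<open>t\<close> makes the smoothed local time telescope exactly up to
      \<open>t\<close>.\<close>
    define J where "J j = {min t (?t j)<..min t (?t (Suc j))}" for j
    have le: "0 \<le> min t (?t j)" "min t (?t j) \<le> min t (?t (Suc j))" "min t (?t (Suc j)) \<le> 1" for j
      using t divide_right_mono[of "real j" "real (Suc j)" "real N"] by (auto simp: min_def simp del: of_nat_Suc)
    have JI: "J j \<subseteq> I j" for j by (auto simp: J_def I_def)
    have J01: "J j \<subseteq> {0..1}" for j using order.strict_trans1[OF le(1)] order_trans[OF _ le(3)] unfolding J_def by (fastforce simp only: greaterThanAtMost_iff atLeastAtMost_iff intro: less_imp_le)
    have [measurable]: "J j \<in> sets borel" for j by (simp add: J_def)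
    have s0: "smoothed \<epsilon> 0 \<omega> = 0" by (simp add: smoothed_def)
    have "smoothed \<epsilon> t \<omega> = (\<Sum>j<N. smoothed \<epsilon> (min t (?t (Suc j))) \<omega> - smoothed \<epsilon> (min t (?t j)) \<omega>)"
      using sum_lessThan_telescope[of "\<lambda>j. smoothed \<epsilon> (min t (?t j)) \<omega>" N] t N s0 by simp
    also have "\<dots> = (\<Sum>j<N. \<integral>s. indicator (J j) s * ?p s \<omega> \<partial>lborel)"
      unfolding J_def by (intro sum.cong refl smoothed_diff[OF w e] le)
    finally have 1: "smoothed \<epsilon> t \<omega> = (\<Sum>j<N. \<integral>s. indicator (J j) s * ?p s \<omega> \<partial>lborel)" .
    have 2: "riemann_local_time P x \<epsilon> N t \<omega> = (\<Sum>j<N. \<integral>s. indicator (J j) s * ?p (?t j) \<omega> \<partial>lborel)"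
      unfolding riemann_local_time_def
    proof (intro sum.cong refl)
      fix j
      have "(\<integral>s. indicator (J j) s * ?p (?t j) \<omega> \<partial>lborel) = measure lborel (J j) * ?p (?t j) \<omega>" by simp
      also have "measure lborel (J j) = min t (?t (Suc j)) - min t (?t j)" unfolding J_def using le(2)[of j] by simp
      also have "\<dots> = max 0 (min t (?t (Suc j)) - ?t j)"
      proof -
        have "min t b - min t a = max 0 (min t b - a)" if "a \<le> b" for a b :: real using that by auto
        then show ?thesis using divide_right_mono[of "real j" "real (Suc j)" "real N"] by simp
      qed
      finally show "max 0 (min t (?t (Suc j)) - ?t j) * ?p (?t j) \<omega> = (\<integral>s. indicator (J j) s * ?p (?t j) \<omega> \<partial>lborel)" ..
    qed
    have Ji: "integrable lborel (\<lambda>s. indicat_real (J j) s * ?p (?t j) \<omega>)" for j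
      by (intro integrable_mult_left integrable_real_indicator emeasure_bounded_finite bounded_subset[OF _ J01]) auto
    have eq: "\<bar>smoothed \<epsilon> t \<omega> - riemann_local_time P x \<epsilon> N t \<omega>\<bar>
      = \<bar>\<Sum>j<N. \<integral>s. indicator (J j) s * (?p s \<omega> - ?p (?t j) \<omega>) \<partial>lborel\<bar>"
      unfolding 1 2 sum_subtractf[symmetric] right_diff_distrib
      by (subst Bochner_Integration.integral_diff[OF density_path_integrable[OF w e _ J01] Ji]) auto
    have "ennreal \<bar>smoothed \<epsilon> t \<omega> - riemann_local_time P x \<epsilon> N t \<omega>\<bar> \<le> ennreal (\<Sum>j<N. \<bar>\<integral>s. indicator (J j) s * (?p s \<omega> - ?p (?t j) \<omega>) \<partial>lborel\<bar>)"
      unfolding eq by (intro ennreal_leI sum_abs)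
    also have "\<dots> = (\<Sum>j<N. ennreal (norm (\<integral>s. indicator (J j) s * (?p s \<omega> - ?p (?t j) \<omega>) \<partial>lborel)))"
      unfolding real_norm_def by (rule sum_ennreal[symmetric]) simp
    also have "\<dots> \<le> Z \<omega>" unfolding Z_def
    proof (rule sum_mono)
      fix j
      have "ennreal (norm (\<integral>s. indicator (J j) s * (?p s \<omega> - ?p (?t j) \<omega>) \<partial>lborel))
        \<le> (\<integral>\<^sup>+s. ennreal (norm (indicator (J j) s * (?p s \<omega> - ?p (?t j) \<omega>))) \<partial>lborel)" by (rule ennreal_norm_integral_le)
      also have "\<dots> \<le> (\<integral>\<^sup>+s. indicator (I j) s * ennreal \<bar>?p s \<omega> - ?p (?t j) \<omega>\<bar> \<partial>lborel)"
        by (rule nn_integral_mono) (use JI[of j] in \<open>auto simp: indicator_def\<close>)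
      finally show "ennreal (norm (\<integral>s. indicator (J j) s * (?p s \<omega> - ?p (?t j) \<omega>) \<partial>lborel))
        \<le> (\<integral>\<^sup>+s. indicator (I j) s * ennreal \<bar>?p s \<omega> - ?p (?t j) \<omega>\<bar> \<partial>lborel)" .
    qed
    finally show ?thesis .
  qed
  moreover have "(\<integral>\<^sup>+\<omega>. Z \<omega> \<partial>M) \<le> b"
  proof -
    have "(\<integral>\<^sup>+\<omega>. Z \<omega> \<partial>M) = (\<Sum>j<N. \<integral>\<^sup>+\<omega>. (\<integral>\<^sup>+s. indicator (I j) s * ennreal \<bar>?p s \<omega> - ?p (?t j) \<omega>\<bar> \<partial>lborel) \<partial>M)"
      unfolding Z_def by (rule nn_integral_sum) measurable
    also have "\<dots> = (\<Sum>j<N. \<integral>\<^sup>+s. (\<integral>\<^sup>+\<omega>. indicator (I j) s * ennreal \<bar>?p s \<omega> - ?p (?t j) \<omega>\<bar> \<partial>M) \<partial>lborel)"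
      by (intro sum.cong refl MP.Fubini'[symmetric]) measurable
    also have "\<dots> \<le> (\<Sum>j<N. \<integral>\<^sup>+s. b * indicator (I j) s \<partial>lborel)"
    proof (intro sum_mono nn_integral_mono)
      fix j s assume j: "j \<in> {..<N}"
      show "(\<integral>\<^sup>+\<omega>. indicator (I j) s * ennreal \<bar>?p s \<omega> - ?p (?t j) \<omega>\<bar> \<partial>M) \<le> b * indicator (I j) s"
      proof (cases "s \<in> I j")
        case True
        have "?t (Suc j) \<le> 1" using j N by (simp del: of_nat_Suc)
        then have "s \<le> 1" "?t j \<le> s" "s - ?t j \<le> 1 / real N" using True step[of j] by (auto simp: I_def)
        then have "(\<integral>\<^sup>+\<omega>. ennreal \<bar>?p (?t j + (s - ?t j)) \<omega> - ?p (?t j) \<omega>\<bar> \<partial>M) \<le> b"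
          unfolding b_def by (intro density_increment[OF e \<eta>]) auto
        then show ?thesis using True by simp
      qed simp
    qed
    also have "\<dots> = (\<Sum>j<N. b * ennreal (1 / real N))"
      by (simp add: nn_integral_cmult mI)
    also have "\<dots> = b"
    proof -
      have "(\<Sum>j<N. b * ennreal (1 / real N)) = b * (ennreal (real N) * ennreal (1 / real N))"
        by (simp add: ennreal_of_nat_eq_real_of_nat mult_ac)
      also have "ennreal (real N) * ennreal (1 / real N) = 1" using N by (simp add: ennreal_mult[symmetric])
      finally show ?thesis by simp
    qed
    finally show ?thesis .
  qed
  ultimately show ?thesis using Zm unfolding b_def by blast
qed

text \<open>Both \<open>\<Lambda>\<close> and its smoothed version increase in time, so their distance is controlled by the distance at
  grid points and the increments of \<open>\<Lambda>\<close> over the cells of the grid.\<close>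

theorem uniform_approximation:
  assumes n: "0 < n" and N: "0 < N" and e: "0 < \<epsilon>" and \<eta>: "0 < \<eta>1" "0 < \<eta>2" "0 < \<eta>3"
  shows "\<exists>Z\<in>borel_measurable M. (AE \<omega> in M. \<forall>t\<in>{0..1}. ennreal \<bar>\<Lambda> t \<omega> - riemann_local_time P x \<epsilon> N t \<omega>\<bar> \<le> Z \<omega>) \<and>
    (\<integral>\<^sup>+\<omega>. Z \<omega> \<partial>M) \<le> approximation_error c \<nu> K \<mu> n N \<epsilon> \<eta>1 \<eta>2 \<eta>3"
proof -
  let ?t = "\<lambda>i. real i / real n"
  have t01: "?t i \<in> {0..1}" if "i \<le> n" for i using that n by (auto simp: divide_le_eq_1)
  have \<Lambda>m: "\<Lambda> (?t i) \<in> borel_measurable M" if "i \<le> n" for i using \<Lambda>_measurable[OF t01[OF that]] .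
  obtain Z3 where Z3m[measurable]: "Z3 \<in> borel_measurable M"
    and Z3: "\<And>\<omega> t. \<omega> \<in> space M \<Longrightarrow> t \<in> {0..1} \<Longrightarrow> ennreal \<bar>smoothed \<epsilon> t \<omega> - riemann_local_time P x \<epsilon> N t \<omega>\<bar> \<le> Z3 \<omega>"
    and Z3b: "(\<integral>\<^sup>+\<omega>. Z3 \<omega> \<partial>M) \<le> ennreal \<eta>3 * (\<integral>\<^sup>+\<theta>. ennreal (gaussian_frequency \<epsilon> \<theta>) \<partial>lborel)
      + ennreal (K * (1 / real N) powr (2 * \<mu>) / \<eta>3) * (\<integral>\<^sup>+\<theta>. ennreal (gaussian_frequency \<epsilon> \<theta> * \<theta>\<^sup>2) \<partial>lborel)"
    using riemann_error[OF e \<eta>(3) N] by blast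
  define D where "D i \<omega> = ennreal ((\<Lambda> (?t i) \<omega> - smoothed \<epsilon> (?t i) \<omega>)\<^sup>2)" for i \<omega>
  define E where "E i \<omega> = ennreal ((\<Lambda> (?t (Suc i)) \<omega> - \<Lambda> (?t i) \<omega>)\<^sup>2)" for i \<omega>
  have Dm: "(\<lambda>\<omega>. D i \<omega>) \<in> borel_measurable M" if "i \<le> n" for i
    unfolding D_def by (intro measurable_compose[OF _ measurable_ennreal] borel_measurable_power borel_measurable_diff \<Lambda>m smoothed_measurable that)
  have Em: "(\<lambda>\<omega>. E i \<omega>) \<in> borel_measurable M" if "i < n" for i
    unfolding E_def by (intro measurable_compose[OF _ measurable_ennreal] borel_measurable_power borel_measurable_diff \<Lambda>m) (use that in auto)
  \<comment> \<open>A sum over all grid points dominates the error at whichever endpoint is selected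
    by \<open>t\<close>, whence the factor \<open>n + 1\<close>. In \<open>Z2\<close> the level
    \<open>\<eta>2\<close> occurs once, because only the squares are summed over the cells.\<close>
  define Z1 where "Z1 \<omega> = (\<Sum>i\<le>n. ennreal \<eta>1 + ennreal (1 / \<eta>1) * D i \<omega>)" for \<omega>
  define Z2 where "Z2 \<omega> = ennreal \<eta>2 + ennreal (1 / \<eta>2) * (\<Sum>i<n. E i \<omega>)" for \<omega>
  have Z1m: "(\<lambda>\<omega>. Z1 \<omega>) \<in> borel_measurable M" unfolding Z1_def
    by (intro borel_measurable_sum borel_measurable_add borel_measurable_times_ennreal borel_measurable_const Dm) auto
  have Z2m: "(\<lambda>\<omega>. Z2 \<omega>) \<in> borel_measurable M" unfolding Z2_def
    by (intro borel_measurable_sum borel_measurable_add borel_measurable_times_ennreal borel_measurable_const Em) auto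
  have Z1b: "(\<integral>\<^sup>+\<omega>. Z1 \<omega> \<partial>M) \<le> of_nat (Suc n) * (ennreal \<eta>1 + ennreal (1 / \<eta>1) * energy c \<nu> (smoothing_weight \<epsilon>) 1)"
  proof -
    have "(\<integral>\<^sup>+\<omega>. Z1 \<omega> \<partial>M) = (\<Sum>i\<le>n. \<integral>\<^sup>+\<omega>. ennreal \<eta>1 + ennreal (1 / \<eta>1) * D i \<omega> \<partial>M)"
      unfolding Z1_def by (intro nn_integral_sum borel_measurable_add borel_measurable_times_ennreal borel_measurable_const Dm) auto
    also have "\<dots> \<le> (\<Sum>i\<le>n. ennreal \<eta>1 + ennreal (1 / \<eta>1) * energy c \<nu> (smoothing_weight \<epsilon>) 1)"
    proof (rule sum_mono)
      fix i assume "i \<in> {..n}"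
      then have i: "i \<le> n" by simp
      have "(\<integral>\<^sup>+\<omega>. ennreal \<eta>1 + ennreal (1 / \<eta>1) * D i \<omega> \<partial>M) = ennreal \<eta>1 + ennreal (1 / \<eta>1) * (\<integral>\<^sup>+\<omega>. D i \<omega> \<partial>M)"
        using Dm[OF i] by (simp add: nn_integral_add nn_integral_cmult emeasure_space_1)
      also have "\<dots> \<le> ennreal \<eta>1 + ennreal (1 / \<eta>1) * energy c \<nu> (smoothing_weight \<epsilon>) 1"
        unfolding D_def by (intro add_mono mult_left_mono smoothing_error[OF e t01[OF i]]) auto
      finally show "(\<integral>\<^sup>+\<omega>. ennreal \<eta>1 + ennreal (1 / \<eta>1) * D i \<omega> \<partial>M) \<le> ennreal \<eta>1 + ennreal (1 / \<eta>1) * energy c \<nu> (smoothing_weight \<epsilon>) 1" .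
    qed
    finally show ?thesis by simp
  qed
  have Z2b: "(\<integral>\<^sup>+\<omega>. Z2 \<omega> \<partial>M) \<le> ennreal \<eta>2 + ennreal (1 / \<eta>2) * energy c \<nu> (\<lambda>_. 1) (1 / real n)"
  proof -
    have sm: "(\<lambda>\<omega>. \<Sum>i<n. E i \<omega>) \<in> borel_measurable M" by (intro borel_measurable_sum Em) auto
    have "(\<integral>\<^sup>+\<omega>. Z2 \<omega> \<partial>M) = ennreal \<eta>2 + ennreal (1 / \<eta>2) * (\<integral>\<^sup>+\<omega>. (\<Sum>i<n. E i \<omega>) \<partial>M)"
      unfolding Z2_def using sm by (simp add: nn_integral_add nn_integral_cmult emeasure_space_1)
    also have "(\<integral>\<^sup>+\<omega>. (\<Sum>i<n. E i \<omega>) \<partial>M) = (\<Sum>i<n. \<integral>\<^sup>+\<omega>. E i \<omega> \<partial>M)" by (intro nn_integral_sum Em) auto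
    also have "ennreal \<eta>2 + ennreal (1 / \<eta>2) * \<dots> \<le> ennreal \<eta>2 + ennreal (1 / \<eta>2) * energy c \<nu> (\<lambda>_. 1) (1 / real n)"
      unfolding E_def by (intro add_mono mult_left_mono increment_error[OF n]) auto
    finally show ?thesis .
  qed
  have "AE \<omega> in M. \<forall>t\<in>{0..1}. ennreal \<bar>\<Lambda> t \<omega> - riemann_local_time P x \<epsilon> N t \<omega>\<bar> \<le> Z1 \<omega> + Z2 \<omega> + Z3 \<omega>"
    using \<Lambda>_mono AE_space
  proof eventually_elim
    case (elim \<omega>)
    show ?case
    proof
      fix t :: real assume t: "t \<in> {0..1}"
      then obtain i where i: "i < n" "?t i \<le> t" "t \<le> ?t (Suc i)" using grid_cell[of t n] n by auto
      have T: "0 \<le> ?t i" "?t (Suc i) \<le> 1" using t01[of i] t01[of "Suc i"] i(1) by (auto simp del: of_nat_Suc)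
      define a where "a = \<Lambda> (?t i) \<omega> - smoothed \<epsilon> (?t i) \<omega>"
      define a' where "a' = \<Lambda> (?t (Suc i)) \<omega> - smoothed \<epsilon> (?t (Suc i)) \<omega>"
      define r where "r = \<Lambda> (?t (Suc i)) \<omega> - \<Lambda> (?t i) \<omega>"
      have "smoothed \<epsilon> (?t i) \<omega> \<le> smoothed \<epsilon> t \<omega>" "smoothed \<epsilon> t \<omega> \<le> smoothed \<epsilon> (?t (Suc i)) \<omega>"
        using i T t by (auto intro!: smoothed_mono[OF elim(2) e])
      moreover have "\<Lambda> (?t i) \<omega> \<le> \<Lambda> t \<omega>" "\<Lambda> t \<omega> \<le> \<Lambda> (?t (Suc i)) \<omega>"
        using elim(1) i T t by (auto simp del: of_nat_Suc)
      \<comment> \<open>By monotonicity the difference is at most \<open>\<Lambda>\<close> at the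
        right endpoint minus the smoothed value at the left one, which is \<open>a + r\<close>, and
        at least the opposite choice, which is \<open>a' - r\<close>.\<close>
      ultimately have "\<bar>\<Lambda> t \<omega> - smoothed \<epsilon> t \<omega>\<bar> \<le> \<bar>a\<bar> + \<bar>r\<bar> \<or> \<bar>\<Lambda> t \<omega> - smoothed \<epsilon> t \<omega>\<bar> \<le> \<bar>a'\<bar> + \<bar>r\<bar>"
        unfolding a_def a'_def r_def by linarith
      then obtain j where j: "j \<le> n" "\<bar>\<Lambda> t \<omega> - smoothed \<epsilon> t \<omega>\<bar> \<le> \<bar>\<Lambda> (?t j) \<omega> - smoothed \<epsilon> (?t j) \<omega>\<bar> + \<bar>r\<bar>"
        unfolding a_def a'_def using i(1) by (metis Suc_leI less_imp_le)
      have "ennreal \<bar>\<Lambda> t \<omega> - riemann_local_time P x \<epsilon> N t \<omega>\<bar>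
        \<le> ennreal (\<bar>\<Lambda> (?t j) \<omega> - smoothed \<epsilon> (?t j) \<omega>\<bar> + \<bar>r\<bar> + \<bar>smoothed \<epsilon> t \<omega> - riemann_local_time P x \<epsilon> N t \<omega>\<bar>)"
        using j(2) by (intro ennreal_leI) linarith
      also have "\<dots> = ennreal \<bar>\<Lambda> (?t j) \<omega> - smoothed \<epsilon> (?t j) \<omega>\<bar> + ennreal \<bar>r\<bar> + ennreal \<bar>smoothed \<epsilon> t \<omega> - riemann_local_time P x \<epsilon> N t \<omega>\<bar>"
        by simp
      also have "\<dots> \<le> Z1 \<omega> + Z2 \<omega> + Z3 \<omega>"
      proof (intro add_mono Z3 elim(2) t)
        have "ennreal \<bar>\<Lambda> (?t j) \<omega> - smoothed \<epsilon> (?t j) \<omega>\<bar> \<le> ennreal \<eta>1 + ennreal (1 / \<eta>1) * D j \<omega>"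
          unfolding D_def by (rule ennreal_le_plus_square_divide[OF \<eta>(1)])
        also have "\<dots> \<le> Z1 \<omega>" unfolding Z1_def by (rule member_le_sum) (use j(1) in auto)
        finally show "ennreal \<bar>\<Lambda> (?t j) \<omega> - smoothed \<epsilon> (?t j) \<omega>\<bar> \<le> Z1 \<omega>" .
        have "ennreal \<bar>r\<bar> \<le> ennreal \<eta>2 + ennreal (1 / \<eta>2) * E i \<omega>"
          unfolding E_def r_def by (rule ennreal_le_plus_square_divide[OF \<eta>(2)])
        also have "\<dots> \<le> Z2 \<omega>" unfolding Z2_def
          by (intro add_left_mono mult_left_mono member_le_sum) (use i(1) in auto)
        finally show "ennreal \<bar>r\<bar> \<le> Z2 \<omega>" .
      qed
      finally show "ennreal \<bar>\<Lambda> t \<omega> - riemann_local_time P x \<epsilon> N t \<omega>\<bar> \<le> Z1 \<omega> + Z2 \<omega> + Z3 \<omega>" .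
    qed
  qed
  moreover have "(\<integral>\<^sup>+\<omega>. Z1 \<omega> + Z2 \<omega> + Z3 \<omega> \<partial>M) \<le> approximation_error c \<nu> K \<mu> n N \<epsilon> \<eta>1 \<eta>2 \<eta>3"
  proof -
    have "(\<integral>\<^sup>+\<omega>. Z1 \<omega> + Z2 \<omega> + Z3 \<omega> \<partial>M) = (\<integral>\<^sup>+\<omega>. Z1 \<omega> \<partial>M) + (\<integral>\<^sup>+\<omega>. Z2 \<omega> \<partial>M) + (\<integral>\<^sup>+\<omega>. Z3 \<omega> \<partial>M)"
      using Z1m Z2m Z3m by (simp add: nn_integral_add)
    also have "\<dots> \<le> approximation_error c \<nu> K \<mu> n N \<epsilon> \<eta>1 \<eta>2 \<eta>3"
      unfolding approximation_error_def by (intro add_mono Z1b Z2b Z3b)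
    finally show ?thesis .
  qed
  moreover have "(\<lambda>\<omega>. Z1 \<omega> + Z2 \<omega> + Z3 \<omega>) \<in> borel_measurable M" using Z1m Z2m Z3m by simp
  ultimately show ?thesis by (intro bexI[where x="\<lambda>\<omega>. Z1 \<omega> + Z2 \<omega> + Z3 \<omega>"] conjI)
qed

end

section \<open>Convergence of Gaussian local times\<close>

text \<open>The constants are shared by the whole sequence and by its limit, so one choice of
  approximation parameters works for all. The limit process may live on another probability space;
  \<open>variance_tendsto\<close> is the link between the two.\<close>

locale gaussian_local_times =
  fixes M :: "'a measure" and N :: "'b measure"
    and P :: "nat \<Rightarrow> real \<Rightarrow> 'a \<Rightarrow> real" and k :: "nat \<Rightarrow> real \<Rightarrow> real \<Rightarrow> complex" and \<Lambda> :: "nat \<Rightarrow> real \<Rightarrow> 'a \<Rightarrow> real"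
    and P0 :: "real \<Rightarrow> 'b \<Rightarrow> real" and k0 :: "real \<Rightarrow> real \<Rightarrow> complex" and \<Lambda>0 :: "real \<Rightarrow> 'b \<Rightarrow> real"
    and c \<nu> K \<mu> x :: real
  assumes member: "\<And>n. gaussian_local_time M (P n) (k n) c \<nu> K \<mu> x (\<Lambda> n)"
    and limit: "gaussian_local_time N P0 k0 c \<nu> K \<mu> x \<Lambda>0"
    and variance_tendsto: "\<And>(I :: nat set) a s. finite I \<Longrightarrow> (\<And>i. i \<in> I \<Longrightarrow> s i \<in> {0..1}) \<Longrightarrow>
      (\<lambda>n. \<integral>u. (norm (\<Sum>i\<in>I. a i *\<^sub>R k n (s i) u))\<^sup>2 \<partial>lborel) \<longlonglongrightarrow> l2sq (\<lambda>u. \<Sum>i\<in>I. a i *\<^sub>R k0 (s i) u)"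
    and \<Lambda>_cont: "\<And>n \<omega>. \<omega> \<in> space M \<Longrightarrow> continuous_on {0..1} (\<lambda>t. \<Lambda> n t \<omega>)"
    and \<Lambda>0_cont: "\<And>\<omega>. \<omega> \<in> space N \<Longrightarrow> continuous_on {0..1} (\<lambda>t. \<Lambda>0 t \<omega>)"

section \<open>Laws of the Riemann sums\<close>

lemma prod_list_abs_le:
  fixes f :: "'a \<Rightarrow> real"
  assumes "\<And>x. \<bar>f x\<bar> \<le> B"
  shows "\<bar>\<Prod>x\<leftarrow>xs. f x\<bar> \<le> B ^ length xs"
proof (induction xs)
  case (Cons y xs)
  have "0 \<le> B" using assms[of y] by linarith
  then show ?case using Cons assms[of y] by (auto simp: abs_mult intro!: mult_mono)
qed simp

lemma borel_measurable_prod_list: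
  fixes f :: "'b \<Rightarrow> 'a \<Rightarrow> real"
  assumes "\<And>x. f x \<in> borel_measurable M"
  shows "(\<lambda>\<omega>. \<Prod>x\<leftarrow>xs. f x \<omega>) \<in> borel_measurable M"
  using assms by (induction xs) auto

lemma lipschitz_C01_approximation:
  fixes X Y :: "real \<Rightarrow> 'a \<Rightarrow> real"
  assumes M: "prob_space M" and \<psi>: "bounded_lipschitz_C01 K A \<psi>"
    and X: "\<And>t. t \<in> {0..1} \<Longrightarrow> X t \<in> borel_measurable M" "\<And>\<omega>. \<omega> \<in> space M \<Longrightarrow> continuous_on {0..1} (\<lambda>t. X t \<omega>)"
    and Y: "\<And>t. t \<in> {0..1} \<Longrightarrow> Y t \<in> borel_measurable M" "\<And>\<omega>. \<omega> \<in> space M \<Longrightarrow> continuous_on {0..1} (\<lambda>t. Y t \<omega>)"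
    and [measurable]: "Z \<in> borel_measurable M" and Z: "AE \<omega> in M. \<forall>t\<in>{0..1}. ennreal \<bar>X t \<omega> - Y t \<omega>\<bar> \<le> Z \<omega>"
    and Zb: "(\<integral>\<^sup>+\<omega>. Z \<omega> \<partial>M) \<le> ennreal \<eta>" and \<eta>: "0 \<le> \<eta>"
  shows "\<bar>(\<integral>\<omega>. \<psi> (restrict (\<lambda>t. X t \<omega>) {0..1}) \<partial>M) - (\<integral>\<omega>. \<psi> (restrict (\<lambda>t. Y t \<omega>) {0..1}) \<partial>M)\<bar> \<le> K * \<eta>"
proof -
  interpret prob_space M by (rule M)
  have K: "0 \<le> K" and b: "\<And>f. f \<in> mspace C01 \<Longrightarrow> \<bar>\<psi> f\<bar> \<le> A"
    and l: "\<And>f g. f \<in> mspace C01 \<Longrightarrow> g \<in> mspace C01 \<Longrightarrow> \<bar>\<psi> f - \<psi> g\<bar> \<le> K * mdist C01 f g"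
    using \<psi> by (auto simp: bounded_lipschitz_C01_def)
  have int: "integrable M (\<lambda>\<omega>. \<psi> (restrict (\<lambda>t. X t \<omega>) {0..1}))"
    if "\<And>t. t \<in> {0..1} \<Longrightarrow> X t \<in> borel_measurable M" "\<And>\<omega>. \<omega> \<in> space M \<Longrightarrow> continuous_on {0..1} (\<lambda>t. X t \<omega>)"
    for X :: "real \<Rightarrow> 'a \<Rightarrow> real"
  proof (rule integrable_const_bound[where B=A])
    show "(\<lambda>\<omega>. \<psi> (restrict (\<lambda>t. X t \<omega>) {0..1})) \<in> borel_measurable M"
      by (rule lipschitz_C01_random_measurable[OF that l])
    show "AE \<omega> in M. norm (\<psi> (restrict (\<lambda>t. X t \<omega>) {0..1})) \<le> A"
      using that(2) by (intro AE_I2) (auto intro!: b restrict_in_C01)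
  qed
  have iX: "integrable M (\<lambda>\<omega>. \<psi> (restrict (\<lambda>t. X t \<omega>) {0..1}))" by (rule int[OF X])
  have iY: "integrable M (\<lambda>\<omega>. \<psi> (restrict (\<lambda>t. Y t \<omega>) {0..1}))" by (rule int[OF Y])
  have "ennreal \<bar>(\<integral>\<omega>. \<psi> (restrict (\<lambda>t. X t \<omega>) {0..1}) \<partial>M) - (\<integral>\<omega>. \<psi> (restrict (\<lambda>t. Y t \<omega>) {0..1}) \<partial>M)\<bar>
    = ennreal (norm (\<integral>\<omega>. \<psi> (restrict (\<lambda>t. X t \<omega>) {0..1}) - \<psi> (restrict (\<lambda>t. Y t \<omega>) {0..1}) \<partial>M))"
    by (simp add: Bochner_Integration.integral_diff[OF iX iY])
  also have "\<dots> \<le> (\<integral>\<^sup>+\<omega>. ennreal (norm (\<psi> (restrict (\<lambda>t. X t \<omega>) {0..1}) - \<psi> (restrict (\<lambda>t. Y t \<omega>) {0..1}))) \<partial>M)"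
    by (rule ennreal_norm_integral_le)
  also have "\<dots> \<le> (\<integral>\<^sup>+\<omega>. ennreal K * Z \<omega> \<partial>M)"
  proof (rule nn_integral_mono_AE, use Z AE_space in eventually_elim)
    case (elim \<omega>)
    let ?X = "restrict (\<lambda>t. X t \<omega>) {0..1}" and ?Y = "restrict (\<lambda>t. Y t \<omega>) {0..1}"
    have L: "\<bar>\<psi> ?X - \<psi> ?Y\<bar> \<le> K * mdist C01 ?X ?Y" using elim(2) by (intro l restrict_in_C01 X(2) Y(2))
    show ?case
    proof (cases "Z \<omega>")
      case (real z)
      have "mdist C01 ?X ?Y \<le> z" using elim(1) real by (intro mdist_C01_le) auto
      then have "K * mdist C01 ?X ?Y \<le> K * z" using K by (rule mult_left_mono)
      then show ?thesis using L real K by (simp add: ennreal_mult[symmetric] ennreal_leI)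
    next
      \<comment> \<open>An infinite bound is trivially sufficient unless \<open>K = 0\<close>, and
        then the functional does not vary.\<close>
      case top
      then show ?thesis using L K by (cases "K = 0") (auto simp: ennreal_mult_top)
    qed
  qed
  also have "\<dots> = ennreal K * (\<integral>\<^sup>+\<omega>. Z \<omega> \<partial>M)" by (rule nn_integral_cmult) measurable
  also have "\<dots> \<le> ennreal K * ennreal \<eta>" by (intro mult_left_mono Zb) simp
  also have "\<dots> = ennreal (K * \<eta>)" using K \<eta> by (simp add: ennreal_mult)
  finally show ?thesis using K \<eta> by (simp add: ennreal_le_iff)
qed

definition cell_weight :: "nat \<Rightarrow> nat \<Rightarrow> real \<Rightarrow> real" where
  "cell_weight m j t = max 0 (min t (real (Suc j) / real m) - real j / real m)"

lemma cell_weight_bounds: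
  assumes "0 < m"
  shows "0 \<le> cell_weight m j t" "cell_weight m j t \<le> 1"
proof -
  have "real (Suc j) / real m = real j / real m + 1 / real m" by (simp add: add_divide_distrib)
  moreover have "1 / real m \<le> 1" using assms by (simp add: divide_le_eq_1)
  ultimately show "0 \<le> cell_weight m j t" "cell_weight m j t \<le> 1" by (auto simp: cell_weight_def)
qed

lemma riemann_local_time_eq:
  "riemann_local_time P x \<epsilon> m t \<omega> = (\<Sum>j<m. cell_weight m j t * normal_density 0 \<epsilon> (P (real j / real m) \<omega> - x))"
  by (simp add: riemann_local_time_def cell_weight_def)

lemma continuous_on_cell_sum: "continuous_on S (\<lambda>t. \<Sum>j<m. cell_weight m j t * v j)"
  unfolding cell_weight_def by (intro continuous_intros)

lemma continuous_on_riemann_local_time: "continuous_on S (\<lambda>t. riemann_local_time P x \<epsilon> m t \<omega>)"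
  unfolding riemann_local_time_eq by (rule continuous_on_cell_sum)

text \<open>The cell weights are at most 1, so the sup distance of two such paths is at most the sum
  of the coordinate distances, which is continuous in the product topology. This puts the functional
  in reach of \<open>tendsto_expectation_of_moments\<close>.\<close>

lemma continuous_on_lipschitz_cell_sum:
  assumes \<psi>: "bounded_lipschitz_C01 K A \<psi>" and m: "0 < m"
  shows "continuous_on S (\<lambda>v :: nat \<Rightarrow> real. \<psi> (restrict (\<lambda>t. \<Sum>j<m. cell_weight m j t * v j) {0..1}))"
  unfolding continuous_on_def
proof (intro ballI, rule Lim_transform2[OF tendsto_const], rule Lim_null_comparison)
  fix v :: "nat \<Rightarrow> real"
  let ?f = "\<lambda>v. restrict (\<lambda>t. \<Sum>j<m. cell_weight m j t * v j) {0..1}"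
  have K: "0 \<le> K" using \<psi> by (simp add: bounded_lipschitz_C01_def)
  have "((\<lambda>v'. K * (\<Sum>j<m. \<bar>v j - v' j\<bar>)) \<longlongrightarrow> K * (\<Sum>j<m. \<bar>v j - v j\<bar>)) (at v within S)"
    using continuous_on_coordinate[of UNIV]
    by (intro tendsto_intros) (auto simp: continuous_on_def intro: tendsto_within_subset)
  then show "((\<lambda>v'. K * (\<Sum>j<m. \<bar>v j - v' j\<bar>)) \<longlongrightarrow> 0) (at v within S)" by simp
  have le: "\<bar>\<psi> (?f v) - \<psi> (?f v')\<bar> \<le> K * (\<Sum>j<m. \<bar>v j - v' j\<bar>)" for v'
  proof -
    have "\<bar>\<psi> (?f v) - \<psi> (?f v')\<bar> \<le> K * mdist C01 (?f v) (?f v')"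
      using \<psi> restrict_in_C01[OF continuous_on_cell_sum] by (auto simp: bounded_lipschitz_C01_def)
    also have "\<dots> \<le> K * (\<Sum>j<m. \<bar>v j - v' j\<bar>)"
    proof (intro mult_left_mono K mdist_C01_le sum_nonneg)
      fix t :: real assume t: "t \<in> {0..1}"
      have "\<bar>?f v t - ?f v' t\<bar> = \<bar>\<Sum>j<m. cell_weight m j t * (v j - v' j)\<bar>"
        using t by (simp add: right_diff_distrib sum_subtractf)
      also have "\<dots> \<le> (\<Sum>j<m. \<bar>cell_weight m j t * (v j - v' j)\<bar>)" by (rule sum_abs)
      also have "\<dots> \<le> (\<Sum>j<m. \<bar>v j - v' j\<bar>)"
        using cell_weight_bounds[OF m] by (intro sum_mono) (simp add: abs_mult mult_left_le_one_le)
      finally show "\<bar>?f v t - ?f v' t\<bar> \<le> (\<Sum>j<m. \<bar>v j - v' j\<bar>)" .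
    qed simp
    finally show ?thesis .
  qed
  show "eventually (\<lambda>v'. norm (\<psi> (?f v) - \<psi> (?f v')) \<le> K * (\<Sum>j<m. \<bar>v j - v' j\<bar>)) (at v within S)"
    by (rule always_eventually) (simp add: le)
qed

context gaussian_local_time
begin

text \<open>The fresh index \<open>i0\<close> gives the time \<open>t\<close> a frequency of its
  own, even when \<open>t\<close> already occurs among the \<open>s i\<close>, so the shape of the
  statement is preserved under induction on the product.\<close>

lemma mixed_moment_Cons:
  assumes e: "0 < \<epsilon>" and I: "finite (I :: nat set)" and i0: "i0 \<notin> I"
  shows "(\<integral>\<omega>. cis (\<Sum>i\<in>I. a i * P (s i) \<omega>) * complex_of_real (\<Prod>t\<leftarrow>t # ts. normal_density 0 \<epsilon> (P t \<omega> - x)) \<partial>M)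
    = (\<integral>\<theta>. complex_of_real (gaussian_frequency \<epsilon> \<theta>) * (cis (- \<theta> * x) *
        (\<integral>\<omega>. cis (\<Sum>i\<in>insert i0 I. (a(i0 := \<theta>)) i * P ((s(i0 := t)) i) \<omega>) * complex_of_real (\<Prod>t\<leftarrow>ts. normal_density 0 \<epsilon> (P t \<omega> - x)) \<partial>M)) \<partial>lborel)"
proof -
  let ?\<kappa> = "gaussian_frequency \<epsilon>" and ?q = "normal_density 0 \<epsilon>"
  define D where "D = 1 / (sqrt (2 * pi) * \<epsilon>)"
  have q: "\<bar>?q y\<bar> \<le> D" for y using normal_density_le[OF e] by (simp add: D_def)
  have F: "fourier_representation ?q ?\<kappa>" by (rule fourier_representation_normal_density[OF e])
  define s' where "s' = s(i0 := t)"
  define a' where "a' \<theta> = a(i0 := \<theta>)" for \<theta>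
  define f where "f \<omega> = cis (\<Sum>i\<in>I. a i * P (s i) \<omega>) * complex_of_real (\<Prod>t\<leftarrow>ts. ?q (P t \<omega> - x))" for \<omega>
  have [measurable]: "(\<lambda>\<omega>. \<Prod>t\<leftarrow>ts. ?q (P t \<omega> - x)) \<in> borel_measurable M"
    by (rule borel_measurable_prod_list) measurable
  have fm[measurable]: "f \<in> borel_measurable M" unfolding f_def[abs_def] by measurable
  have "(\<integral>\<omega>. cis (\<Sum>i\<in>I. a i * P (s i) \<omega>) * complex_of_real (\<Prod>t\<leftarrow>t # ts. ?q (P t \<omega> - x)) \<partial>M)
    = (\<integral>\<omega>. f \<omega> * complex_of_real (?q (P t \<omega> - x)) \<partial>M)"
    by (rule Bochner_Integration.integral_cong) (auto simp: f_def mult_ac)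
  also have "\<dots> = (\<integral>\<theta>. complex_of_real (?\<kappa> \<theta>) * (\<integral>\<omega>. f \<omega> * cis (\<theta> * (P t \<omega> - x)) \<partial>M) \<partial>lborel)"
  proof (rule expectation_fourier[OF F fm])
    show "norm (f \<omega>) \<le> D ^ length ts" for \<omega>
      unfolding f_def norm_mult using prod_list_abs_le[of "\<lambda>t. ?q (P t \<omega> - x)" D ts] q by simp
  qed measurable
  also have "\<dots> = (\<integral>\<theta>. complex_of_real (?\<kappa> \<theta>) * (cis (- \<theta> * x) * (\<integral>\<omega>. cis (\<Sum>i\<in>insert i0 I. a' \<theta> i * P (s' i) \<omega>) * complex_of_real (\<Prod>t\<leftarrow>ts. ?q (P t \<omega> - x)) \<partial>M)) \<partial>lborel)"
  proof (rule Bochner_Integration.integral_cong[OF refl])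
    fix \<theta>
    have "(\<Sum>i\<in>I. a' \<theta> i * P (s' i) \<omega>) = (\<Sum>i\<in>I. a i * P (s i) \<omega>)" for \<omega>
      by (rule sum.cong) (use i0 in \<open>auto simp: a'_def s'_def\<close>)
    then have S: "(\<Sum>i\<in>insert i0 I. a' \<theta> i * P (s' i) \<omega>) = \<theta> * P t \<omega> + (\<Sum>i\<in>I. a i * P (s i) \<omega>)" for \<omega>
      using i0 I by (simp add: a'_def s'_def)
    have "f \<omega> * cis (\<theta> * (P t \<omega> - x)) = cis (- \<theta> * x) * (cis (\<Sum>i\<in>insert i0 I. a' \<theta> i * P (s' i) \<omega>) * complex_of_real (\<Prod>t\<leftarrow>ts. ?q (P t \<omega> - x)))" for \<omega>
    proof -
      have eq: "cis (\<theta> * (P t \<omega> - x)) * cis (\<Sum>i\<in>I. a i * P (s i) \<omega>) = cis (- \<theta> * x) * cis (\<theta> * P t \<omega> + (\<Sum>i\<in>I. a i * P (s i) \<omega>))"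
        unfolding cis_mult by (simp add: algebra_simps)
      have "f \<omega> * cis (\<theta> * (P t \<omega> - x)) = (cis (\<theta> * (P t \<omega> - x)) * cis (\<Sum>i\<in>I. a i * P (s i) \<omega>)) * complex_of_real (\<Prod>t\<leftarrow>ts. ?q (P t \<omega> - x))"
        unfolding f_def by (simp only: mult_ac)
      also have "\<dots> = cis (- \<theta> * x) * (cis (\<theta> * P t \<omega> + (\<Sum>i\<in>I. a i * P (s i) \<omega>)) * complex_of_real (\<Prod>t\<leftarrow>ts. ?q (P t \<omega> - x)))"
        unfolding eq by (simp only: mult.assoc)
      finally show ?thesis unfolding S .
    qed
    then show "complex_of_real (?\<kappa> \<theta>) * (\<integral>\<omega>. f \<omega> * cis (\<theta> * (P t \<omega> - x)) \<partial>M)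
      = complex_of_real (?\<kappa> \<theta>) * (cis (- \<theta> * x) * (\<integral>\<omega>. cis (\<Sum>i\<in>insert i0 I. a' \<theta> i * P (s' i) \<omega>) * complex_of_real (\<Prod>t\<leftarrow>ts. ?q (P t \<omega> - x)) \<partial>M))"
      by simp
  qed
  finally show ?thesis unfolding a'_def s'_def .
qed

lemma mixed_moment_measurable:
  shows "(\<lambda>\<theta>. \<integral>\<omega>. cis (\<Sum>i\<in>I. (a(j := \<theta>)) i * P (s i) \<omega>) * complex_of_real (\<Prod>t\<leftarrow>ts. normal_density 0 \<epsilon> (P t \<omega> - x)) \<partial>M) \<in> borel_measurable lborel"
proof -
  have [measurable]: "(\<lambda>\<omega>. \<Prod>t\<leftarrow>ts. normal_density 0 \<epsilon> (P t \<omega> - x)) \<in> borel_measurable M"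
    by (rule borel_measurable_prod_list) measurable
  have [measurable]: "(\<lambda>\<theta>. (a(j := \<theta>)) i) \<in> borel_measurable borel" for i by (cases "i = j") auto
  show ?thesis by measurable
qed

end

context gaussian_local_times
begin

text \<open>Fourier inversion turns one factor of the product at a time into a further frequency of the
  exponential.\<close>

lemma mixed_moment_tendsto:
  assumes e: "0 < \<epsilon>" and I: "finite (I :: nat set)" "\<And>i. i \<in> I \<Longrightarrow> s i \<in> {0..1}" and ts: "set ts \<subseteq> {0..1}"
  shows "(\<lambda>n. \<integral>\<omega>. cis (\<Sum>i\<in>I. a i * P n (s i) \<omega>) * complex_of_real (\<Prod>t\<leftarrow>ts. normal_density 0 \<epsilon> (P n t \<omega> - x)) \<partial>M)
    \<longlonglongrightarrow> (\<integral>\<omega>. cis (\<Sum>i\<in>I. a i * P0 (s i) \<omega>) * complex_of_real (\<Prod>t\<leftarrow>ts. normal_density 0 \<epsilon> (P0 t \<omega> - x)) \<partial>N)"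
  using I ts
proof (induction ts arbitrary: I a s)
  case Nil
  interpret A: gaussian_local_time M "P n" "k n" c \<nu> K \<mu> x "\<Lambda> n" for n by (rule member)
  interpret B: gaussian_local_time N P0 k0 c \<nu> K \<mu> x \<Lambda>0 by (rule limit)
  have "(\<lambda>n. complex_of_real (exp (- l2sq (\<lambda>u. \<Sum>i\<in>I. a i *\<^sub>R k n (s i) u) / 2)))
    \<longlonglongrightarrow> complex_of_real (exp (- l2sq (\<lambda>u. \<Sum>i\<in>I. a i *\<^sub>R k0 (s i) u) / 2))"
    by (intro tendsto_of_real tendsto_exp tendsto_divide tendsto_minus tendsto_const variance_tendsto Nil) auto
  then show ?case using A.P_cis[OF Nil(1,2)] B.P_cis[OF Nil(1,2)] by simp
next
  case (Cons t ts)
  interpret A: gaussian_local_time M "P n" "k n" c \<nu> K \<mu> x "\<Lambda> n" for n by (rule member)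
  interpret B: gaussian_local_time N P0 k0 c \<nu> K \<mu> x \<Lambda>0 by (rule limit)
  let ?\<kappa> = "gaussian_frequency \<epsilon>" and ?q = "normal_density 0 \<epsilon>"
  define D where "D = 1 / (sqrt (2 * pi) * \<epsilon>)"
  have q: "\<bar>?q y\<bar> \<le> D" for y using normal_density_le[OF e] by (simp add: D_def)
  have D: "0 \<le> D" using e by (simp add: D_def)
  have F: "fourier_representation ?q ?\<kappa>" by (rule fourier_representation_normal_density[OF e])
  obtain i0 where i0: "i0 \<notin> I" using Cons.prems(1) infinite_UNIV_nat ex_new_if_finite by blast
  define s' where "s' = s(i0 := t)"
  define a' where "a' \<theta> = a(i0 := \<theta>)" for \<theta>
  have inner_bound: "norm (\<integral>\<omega>. cis (\<Sum>i\<in>insert i0 I. a' \<theta> i * P n (s' i) \<omega>) * complex_of_real (\<Prod>t\<leftarrow>ts. ?q (P n t \<omega> - x)) \<partial>M) \<le> D ^ length ts" for \<theta> n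
  proof -
    let ?f = "\<lambda>\<omega>. cis (\<Sum>i\<in>insert i0 I. a' \<theta> i * P n (s' i) \<omega>) * complex_of_real (\<Prod>t\<leftarrow>ts. ?q (P n t \<omega> - x))"
    have "norm (?f \<omega>) \<le> D ^ length ts" for \<omega>
      unfolding norm_mult using prod_list_abs_le[of "\<lambda>t. ?q (P n t \<omega> - x)" D ts] q by simp
    then have "(\<integral>\<^sup>+\<omega>. ennreal (norm (?f \<omega>)) \<partial>M) \<le> (\<integral>\<^sup>+\<omega>. ennreal (D ^ length ts) \<partial>M)"
      by (intro nn_integral_mono ennreal_leI)
    then have "ennreal (norm (\<integral>\<omega>. ?f \<omega> \<partial>M)) \<le> ennreal (D ^ length ts)"
      using ennreal_norm_integral_le[of M ?f] by (simp add: A.emeasure_space_1 del: norm_mult)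
    then show ?thesis using D by (simp add: ennreal_le_iff)
  qed
  have \<kappa>i: "integrable lborel ?\<kappa>" using F by (simp add: fourier_representation_def)
  show ?case unfolding A.mixed_moment_Cons[OF e Cons.prems(1) i0] B.mixed_moment_Cons[OF e Cons.prems(1) i0] s'_def[symmetric] a'_def[symmetric]
  proof (rule integral_dominated_convergence[where w="\<lambda>\<theta>. ?\<kappa> \<theta> * D ^ length ts"])
    show "(\<lambda>\<theta>. complex_of_real (?\<kappa> \<theta>) * (cis (- \<theta> * x) * (\<integral>\<omega>. cis (\<Sum>i\<in>insert i0 I. a' \<theta> i * P0 (s' i) \<omega>) * complex_of_real (\<Prod>t\<leftarrow>ts. ?q (P0 t \<omega> - x)) \<partial>N))) \<in> borel_measurable lborel"
      using B.mixed_moment_measurable[where I="insert i0 I" and a=a and j=i0 and s=s' and ts=ts and \<epsilon>=\<epsilon>, folded a'_def] by measurable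
    show "(\<lambda>\<theta>. complex_of_real (?\<kappa> \<theta>) * (cis (- \<theta> * x) * (\<integral>\<omega>. cis (\<Sum>i\<in>insert i0 I. a' \<theta> i * P n (s' i) \<omega>) * complex_of_real (\<Prod>t\<leftarrow>ts. ?q (P n t \<omega> - x)) \<partial>M))) \<in> borel_measurable lborel" for n
      using A.mixed_moment_measurable[where I="insert i0 I" and a=a and j=i0 and s=s' and ts=ts and \<epsilon>=\<epsilon>, folded a'_def] by measurable
    show "integrable lborel (\<lambda>\<theta>. ?\<kappa> \<theta> * D ^ length ts)" using \<kappa>i by simp
    show "AE \<theta> in lborel. norm (complex_of_real (?\<kappa> \<theta>) * (cis (- \<theta> * x) * (\<integral>\<omega>. cis (\<Sum>i\<in>insert i0 I. a' \<theta> i * P n (s' i) \<omega>) * complex_of_real (\<Prod>t\<leftarrow>ts. ?q (P n t \<omega> - x)) \<partial>M))) \<le> ?\<kappa> \<theta> * D ^ length ts" for n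
      unfolding norm_mult norm_of_real norm_cis using gaussian_frequency_nonneg
      by (intro AE_I2 mult_mono) (auto intro: inner_bound)
    show "AE \<theta> in lborel. (\<lambda>n. complex_of_real (?\<kappa> \<theta>) * (cis (- \<theta> * x) * (\<integral>\<omega>. cis (\<Sum>i\<in>insert i0 I. a' \<theta> i * P n (s' i) \<omega>) * complex_of_real (\<Prod>t\<leftarrow>ts. ?q (P n t \<omega> - x)) \<partial>M)))
      \<longlonglongrightarrow> complex_of_real (?\<kappa> \<theta>) * (cis (- \<theta> * x) * (\<integral>\<omega>. cis (\<Sum>i\<in>insert i0 I. a' \<theta> i * P0 (s' i) \<omega>) * complex_of_real (\<Prod>t\<leftarrow>ts. ?q (P0 t \<omega> - x)) \<partial>N))"
      using Cons.prems by (intro AE_I2 tendsto_mult tendsto_const Cons.IH) (auto simp: s'_def)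
  qed
qed

lemma moment_tendsto:
  assumes "0 < \<epsilon>" "set ts \<subseteq> {0..1}"
  shows "(\<lambda>n. \<integral>\<omega>. (\<Prod>t\<leftarrow>ts. normal_density 0 \<epsilon> (P n t \<omega> - x)) \<partial>M) \<longlonglongrightarrow> (\<integral>\<omega>. (\<Prod>t\<leftarrow>ts. normal_density 0 \<epsilon> (P0 t \<omega> - x)) \<partial>N)"
  using tendsto_Re[OF mixed_moment_tendsto[OF assms(1) finite.emptyI _ assms(2)]]
  by simp

text \<open>The path of the Riemann sum is a continuous function of finitely many normal densities
  evaluated along the process. These lie between 0 and the maximal density value, so they form a
  vector in a cube whose mixed moments converge.\<close>

lemma riemann_tendsto:
  assumes \<psi>: "bounded_lipschitz_C01 K' A \<psi>" and m: "0 < m" and e: "0 < \<epsilon>"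
  shows "(\<lambda>n. \<integral>\<omega>. \<psi> (restrict (\<lambda>t. riemann_local_time (P n) x \<epsilon> m t \<omega>) {0..1}) \<partial>M)
    \<longlonglongrightarrow> (\<integral>\<omega>. \<psi> (restrict (\<lambda>t. riemann_local_time P0 x \<epsilon> m t \<omega>) {0..1}) \<partial>N)"
proof -
  interpret A: gaussian_local_time M "P n" "k n" c \<nu> K \<mu> x "\<Lambda> n" for n by (rule member)
  interpret B: gaussian_local_time N P0 k0 c \<nu> K \<mu> x \<Lambda>0 by (rule limit)
  let ?q = "normal_density 0 \<epsilon>"
  define g where "g v = \<psi> (restrict (\<lambda>t. \<Sum>j<m. cell_weight m j t * v j) {0..1})" for v :: "nat \<Rightarrow> real"
  define V where "V n \<omega> j = (if j < m then ?q (P n (real j / real m) \<omega> - x) else 0)" for n \<omega> j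
  define V0 where "V0 \<omega> j = (if j < m then ?q (P0 (real j / real m) \<omega> - x) else 0)" for \<omega> j
  have Vm: "(\<lambda>\<omega>. V n \<omega> j) \<in> borel_measurable M" for n j unfolding V_def by measurable
  have V0m: "(\<lambda>\<omega>. V0 \<omega> j) \<in> borel_measurable N" for j unfolding V0_def by measurable
  have l: "\<And>f g. f \<in> mspace C01 \<Longrightarrow> g \<in> mspace C01 \<Longrightarrow> \<bar>\<psi> f - \<psi> g\<bar> \<le> K' * mdist C01 f g"
    using \<psi> by (auto simp: bounded_lipschitz_C01_def)
  have "(\<lambda>n. \<integral>\<omega>. g (V n \<omega>) \<partial>M) \<longlonglongrightarrow> (\<integral>\<omega>. g (V0 \<omega>) \<partial>N)"
  proof (rule tendsto_expectation_of_moments[OF A.prob_space_axioms B.prob_space_axioms Vm _ V0m])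
    show "V n \<omega> \<in> cube m (1 / (sqrt (2 * pi) * \<epsilon>))" for n \<omega>
      using normal_density_le[OF e] by (auto simp: cube_def V_def)
    show "V0 \<omega> \<in> cube m (1 / (sqrt (2 * pi) * \<epsilon>))" for \<omega>
      using normal_density_le[OF e] by (auto simp: cube_def V0_def)
    show "continuous_on (cube m (1 / (sqrt (2 * pi) * \<epsilon>))) g"
      unfolding g_def by (rule continuous_on_lipschitz_cell_sum[OF \<psi> m])
    show "(\<lambda>\<omega>. g (V n \<omega>)) \<in> borel_measurable M" for n
      unfolding g_def by (rule lipschitz_C01_random_measurable[OF _ continuous_on_cell_sum l])
        (intro borel_measurable_sum borel_measurable_times borel_measurable_const Vm)
    show "(\<lambda>\<omega>. g (V0 \<omega>)) \<in> borel_measurable N"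
      unfolding g_def by (rule lipschitz_C01_random_measurable[OF _ continuous_on_cell_sum l])
        (intro borel_measurable_sum borel_measurable_times borel_measurable_const V0m)
    fix js assume js: "set js \<subseteq> {..<m}"
    have 1: "(\<Prod>j\<leftarrow>js. V n \<omega> j) = (\<Prod>t\<leftarrow>map (\<lambda>j. real j / real m) js. ?q (P n t \<omega> - x))" for n \<omega>
      using js by (intro arg_cong[where f=prod_list]) (auto simp: V_def)
    have 2: "(\<Prod>j\<leftarrow>js. V0 \<omega> j) = (\<Prod>t\<leftarrow>map (\<lambda>j. real j / real m) js. ?q (P0 t \<omega> - x))" for \<omega>
      using js by (intro arg_cong[where f=prod_list]) (auto simp: V0_def)
    show "(\<lambda>n. \<integral>\<omega>. (\<Prod>j\<leftarrow>js. V n \<omega> j) \<partial>M) \<longlonglongrightarrow> (\<integral>\<omega>. (\<Prod>j\<leftarrow>js. V0 \<omega> j) \<partial>N)"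
      unfolding 1 2 by (rule moment_tendsto[OF e]) (use js m in \<open>auto simp: divide_le_eq_1\<close>)
  qed
  then show ?thesis by (simp add: g_def V_def V0_def riemann_local_time_eq)
qed

text \<open>The approximation parameters depend on the common constants alone and are fixed before
  \<open>n\<close>. The two approximation errors and the convergence of the Riemann sums then each
  take a third of \<open>r\<close>.\<close>

lemma lipschitz_tendsto:
  assumes \<psi>: "bounded_lipschitz_C01 K' A \<psi>"
  shows "(\<lambda>n. \<integral>\<omega>. \<psi> (restrict (\<lambda>t. \<Lambda> n t \<omega>) {0..1}) \<partial>M) \<longlonglongrightarrow> (\<integral>\<omega>. \<psi> (restrict (\<lambda>t. \<Lambda>0 t \<omega>) {0..1}) \<partial>N)"
proof (rule LIMSEQ_I)
  fix r :: real assume r: "0 < r"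
  interpret A: gaussian_local_time M "P n" "k n" c \<nu> K \<mu> x "\<Lambda> n" for n by (rule member)
  interpret B: gaussian_local_time N P0 k0 c \<nu> K \<mu> x \<Lambda>0 by (rule limit)
  have K': "0 \<le> K'" using \<psi> by (simp add: bounded_lipschitz_C01_def)
  \<comment> \<open>The summand 1 keeps the denominator positive when \<open>K' = 0\<close>.\<close>
  define \<eta> where "\<eta> = r / 3 / (K' + 1)"
  have \<eta>: "0 < \<eta>" using r K' by (simp add: \<eta>_def)
  have "K' * \<eta> \<le> (K' + 1) * \<eta>" using \<eta> by (intro mult_right_mono) auto
  also have "\<dots> = r / 3" using K' iffD1[OF nonzero_eq_divide_eq \<eta>_def] by (simp add: mult.commute)
  finally have K\<eta>: "K' * \<eta> \<le> r / 3" .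
  obtain i m \<epsilon> \<eta>1 \<eta>2 \<eta>3 where p: "0 < i" "0 < m" "0 < \<epsilon>" "0 < \<eta>1" "0 < \<eta>2" "0 < \<eta>3"
    and err: "approximation_error c \<nu> K \<mu> i m \<epsilon> \<eta>1 \<eta>2 \<eta>3 < ennreal \<eta>"
    using approximation_error_small[OF B.c B.nu B.mu \<eta>] by metis
  let ?R = "\<lambda>n \<omega>. restrict (\<lambda>t. riemann_local_time (P n) x \<epsilon> m t \<omega>) {0..1}"
  let ?S = "\<lambda>\<omega>. restrict (\<lambda>t. riemann_local_time P0 x \<epsilon> m t \<omega>) {0..1}"
  have 1: "\<bar>(\<integral>\<omega>. \<psi> (restrict (\<lambda>t. \<Lambda> n t \<omega>) {0..1}) \<partial>M) - (\<integral>\<omega>. \<psi> (?R n \<omega>) \<partial>M)\<bar> \<le> r / 3" for n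
  proof -
    obtain Z where Z: "Z \<in> borel_measurable M" "AE \<omega> in M. \<forall>t\<in>{0..1}. ennreal \<bar>\<Lambda> n t \<omega> - riemann_local_time (P n) x \<epsilon> m t \<omega>\<bar> \<le> Z \<omega>"
      "(\<integral>\<^sup>+\<omega>. Z \<omega> \<partial>M) \<le> approximation_error c \<nu> K \<mu> i m \<epsilon> \<eta>1 \<eta>2 \<eta>3"
      using A.uniform_approximation[OF p, of n] by blast
    have rm: "riemann_local_time (P n) x \<epsilon> m t \<in> borel_measurable M" for t
      unfolding riemann_local_time_def[abs_def] by measurable
    have "\<bar>(\<integral>\<omega>. \<psi> (restrict (\<lambda>t. \<Lambda> n t \<omega>) {0..1}) \<partial>M) - (\<integral>\<omega>. \<psi> (?R n \<omega>) \<partial>M)\<bar> \<le> K' * \<eta>"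
      by (rule lipschitz_C01_approximation[OF A.prob_space_axioms \<psi> _ _ _ _ Z(1,2)])
        (use A.\<Lambda>_measurable \<Lambda>_cont rm continuous_on_riemann_local_time Z(3) err \<eta> in auto)
    then show ?thesis using K\<eta> by linarith
  qed
  have 2: "\<bar>(\<integral>\<omega>. \<psi> (restrict (\<lambda>t. \<Lambda>0 t \<omega>) {0..1}) \<partial>N) - (\<integral>\<omega>. \<psi> (?S \<omega>) \<partial>N)\<bar> \<le> r / 3"
  proof -
    obtain Z where Z: "Z \<in> borel_measurable N" "AE \<omega> in N. \<forall>t\<in>{0..1}. ennreal \<bar>\<Lambda>0 t \<omega> - riemann_local_time P0 x \<epsilon> m t \<omega>\<bar> \<le> Z \<omega>"
      "(\<integral>\<^sup>+\<omega>. Z \<omega> \<partial>N) \<le> approximation_error c \<nu> K \<mu> i m \<epsilon> \<eta>1 \<eta>2 \<eta>3"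
      using B.uniform_approximation[OF p] by blast
    have rm: "riemann_local_time P0 x \<epsilon> m t \<in> borel_measurable N" for t
      unfolding riemann_local_time_def[abs_def] by measurable
    have "\<bar>(\<integral>\<omega>. \<psi> (restrict (\<lambda>t. \<Lambda>0 t \<omega>) {0..1}) \<partial>N) - (\<integral>\<omega>. \<psi> (?S \<omega>) \<partial>N)\<bar> \<le> K' * \<eta>"
      by (rule lipschitz_C01_approximation[OF B.prob_space_axioms \<psi> _ _ _ _ Z(1,2)])
        (use B.\<Lambda>_measurable \<Lambda>0_cont rm continuous_on_riemann_local_time Z(3) err \<eta> in auto)
    then show ?thesis using K\<eta> by linarith
  qed
  obtain n0 where n0: "\<And>n. n0 \<le> n \<Longrightarrow> norm ((\<integral>\<omega>. \<psi> (?R n \<omega>) \<partial>M) - (\<integral>\<omega>. \<psi> (?S \<omega>) \<partial>N)) < r / 3"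
    using LIMSEQ_D[OF riemann_tendsto[OF \<psi> p(2,3)], of "r / 3"] r by auto
  show "\<exists>no. \<forall>n\<ge>no. norm ((\<integral>\<omega>. \<psi> (restrict (\<lambda>t. \<Lambda> n t \<omega>) {0..1}) \<partial>M) - (\<integral>\<omega>. \<psi> (restrict (\<lambda>t. \<Lambda>0 t \<omega>) {0..1}) \<partial>N)) < r"
  proof (intro exI[of _ n0] allI impI)
    fix n assume "n0 \<le> n"
    then show "norm ((\<integral>\<omega>. \<psi> (restrict (\<lambda>t. \<Lambda> n t \<omega>) {0..1}) \<partial>M) - (\<integral>\<omega>. \<psi> (restrict (\<lambda>t. \<Lambda>0 t \<omega>) {0..1}) \<partial>N)) < r"
      using n0[of n] 1[of n] 2 unfolding real_norm_def by linarith
  qed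
qed

theorem expectation_tendsto:
  assumes \<phi>: "continuous_map (mtopology_of C01) euclideanreal \<phi>" "bounded (\<phi> ` mspace C01)"
  shows "(\<lambda>n. \<integral>f. \<phi> f \<partial>law_C01 M (\<Lambda> n)) \<longlonglongrightarrow> (\<integral>f. \<phi> f \<partial>law_C01 N \<Lambda>0)"
proof -
  interpret A: gaussian_local_time M "P n" "k n" c \<nu> K \<mu> x "\<Lambda> n" for n by (rule member)
  interpret B: gaussian_local_time N P0 k0 c \<nu> K \<mu> x \<Lambda>0 by (rule limit)
  have 1: "(\<integral>f. \<phi> f \<partial>law_C01 M (\<Lambda> n)) = (\<integral>\<omega>. \<phi> (restrict (\<lambda>t. \<Lambda> n t \<omega>) {0..1}) \<partial>M)" for n
    by (rule integral_law_C01[OF A.\<Lambda>_measurable \<Lambda>_cont \<phi>(1)])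
  have 2: "(\<integral>f. \<phi> f \<partial>law_C01 N \<Lambda>0) = (\<integral>\<omega>. \<phi> (restrict (\<lambda>t. \<Lambda>0 t \<omega>) {0..1}) \<partial>N)"
    by (rule integral_law_C01[OF B.\<Lambda>_measurable \<Lambda>0_cont \<phi>(1)])
  show ?thesis unfolding 1 2
    by (rule weak_convergence_from_lipschitz[OF A.prob_space_axioms B.prob_space_axioms A.\<Lambda>_measurable \<Lambda>_cont
          B.\<Lambda>_measurable \<Lambda>0_cont lipschitz_tendsto \<phi>])
qed

end

section \<open>Continuous occupation densities\<close>

text \<open>From \<open>a \<le> exp a\<close> the Gaussian factor is at most \<open>1 / a\<close>.
  The resulting bound tends to 0 with the width uniformly away from the centre, where it must tame a
  function that may be unbounded.\<close>

lemma normal_density_le_divide: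
  assumes e: "0 < \<delta>" and z: "z \<noteq> 0"
  shows "normal_density 0 \<delta> z \<le> \<delta> / z\<^sup>2"
proof -
  define a where "a = z\<^sup>2 / (2 * \<delta>\<^sup>2)"
  have a: "0 < a" using e z by (simp add: a_def)
  have "a \<le> exp a" using exp_ge_add_one_self[of a] by linarith
  then have ea: "exp (- a) \<le> 1 / a" using a by (simp add: exp_minus field_simps)
  have "2 \<le> sqrt (2 * pi)" using pi_ge_two by (intro real_le_rsqrt) auto
  then have "1 / sqrt (2 * pi * \<delta>\<^sup>2) \<le> 1 / (2 * \<delta>)"
    using e by (intro divide_left_mono) (auto simp: real_sqrt_mult)
  then have "1 / sqrt (2 * pi * \<delta>\<^sup>2) * exp (- a) \<le> 1 / (2 * \<delta>) * (1 / a)"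
    using ea e by (intro mult_mono) auto
  also have "\<dots> = \<delta> / z\<^sup>2" using e z by (simp add: a_def power2_eq_square)
  finally show ?thesis by (simp add: normal_density_def a_def)
qed

text \<open>Within distance \<open>d\<close> continuity controls the error. Outside, the part with
  \<open>f y\<close> is bounded by the uniformly small density times the L1 norm of
  \<open>f\<close>, and the part with the constant \<open>f x\<close> by Chebyshev's inequality with
  second moment \<open>\<delta>\<^sup>2\<close>.\<close>

lemma gaussian_approximate_identity:
  fixes f :: "real \<Rightarrow> real"
  assumes f: "integrable lborel f" and c: "isCont f x"
  shows "(\<lambda>n. \<integral>y. normal_density 0 (1 / real (Suc n)) (y - x) * f y \<partial>lborel) \<longlonglongrightarrow> f x"
proof (rule LIMSEQ_I)
  fix r :: real assume r: "0 < r"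
  obtain d where d: "0 < d" "\<And>y. \<bar>y - x\<bar> < d \<Longrightarrow> \<bar>f y - f x\<bar> < r / 2"
    using c r unfolding continuous_at_eps_delta dist_real_def by (metis half_gt_zero)
  define E where "E \<delta> = \<delta> / d\<^sup>2 * (\<integral>y. \<bar>f y\<bar> \<partial>lborel) + \<bar>f x\<bar> * (\<delta>\<^sup>2 / d\<^sup>2)" for \<delta>
  have "(\<lambda>n. E (1 / real (Suc n))) \<longlonglongrightarrow> 0 / d\<^sup>2 * (\<integral>y. \<bar>f y\<bar> \<partial>lborel) + \<bar>f x\<bar> * (0\<^sup>2 / d\<^sup>2)"
    unfolding E_def using d(1) by (intro tendsto_intros inverse_Suc_tendsto_0) auto
  then have "eventually (\<lambda>n. E (1 / real (Suc n)) < r / 2) sequentially"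
    using r by (intro order_tendstoD(2)) auto
  then obtain n0 where n0: "\<And>n. n0 \<le> n \<Longrightarrow> E (1 / real (Suc n)) < r / 2" by (auto simp: eventually_sequentially)
  show "\<exists>n0. \<forall>n\<ge>n0. norm ((\<integral>y. normal_density 0 (1 / real (Suc n)) (y - x) * f y \<partial>lborel) - f x) < r"
  proof (intro exI[of _ n0] allI impI)
    fix n assume n: "n0 \<le> n"
    define \<delta> where "\<delta> = 1 / real (Suc n)"
    have \<delta>: "0 < \<delta>" by (simp add: \<delta>_def)
    let ?p = "\<lambda>y. normal_density x \<delta> y"
    have shift: "normal_density 0 \<delta> (y - x) = ?p y" for y by (simp add: normal_density_def)
    have m2: "has_bochner_integral lborel (\<lambda>y. ?p y * (y - x)\<^sup>2) (\<delta>\<^sup>2)"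
      using normal_moment_even[OF \<delta>, of x 1] by simp
    have pi: "integrable lborel ?p" "(\<integral>y. ?p y \<partial>lborel) = 1" using \<delta> by simp_all
    have pB: "?p y \<le> 1 / (sqrt (2 * pi) * \<delta>)" for y by (rule normal_density_le[OF \<delta>])
    have pf: "integrable lborel (\<lambda>y. ?p y * f y)"
    proof (rule Bochner_Integration.integrable_bound)
      show "integrable lborel (\<lambda>y. 1 / (sqrt (2 * pi) * \<delta>) * f y)" using f by simp
      show "(\<lambda>y. ?p y * f y) \<in> borel_measurable lborel" using f by measurable
      show "AE y in lborel. norm (?p y * f y) \<le> norm (1 / (sqrt (2 * pi) * \<delta>) * f y)"
        unfolding norm_mult using pB \<delta> by (intro AE_I2 mult_right_mono) auto
    qed
    have bound: "\<bar>?p y * f y - ?p y * f x\<bar> \<le> r / 2 * ?p y + \<delta> / d\<^sup>2 * \<bar>f y\<bar> + \<bar>f x\<bar> * ((?p y * (y - x)\<^sup>2) / d\<^sup>2)" for y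
    proof (cases "\<bar>y - x\<bar> < d")
      case True
      have "?p y * f y - ?p y * f x = (f y - f x) * ?p y" by (simp add: left_diff_distrib)
      then have "\<bar>?p y * f y - ?p y * f x\<bar> = \<bar>f y - f x\<bar> * ?p y" by (simp only: abs_mult abs_of_nonneg normal_density_nonneg)
      moreover have "\<bar>f y - f x\<bar> * ?p y \<le> r / 2 * ?p y" using d(2)[OF True] by (intro mult_right_mono) auto
      moreover have "0 \<le> \<delta> / d\<^sup>2 * \<bar>f y\<bar>" "0 \<le> \<bar>f x\<bar> * ((?p y * (y - x)\<^sup>2) / d\<^sup>2)" using \<delta> by auto
      ultimately show ?thesis by linarith
    next
      case False
      then have z: "d\<^sup>2 \<le> (y - x)\<^sup>2" using d(1) power_mono[of d "\<bar>y - x\<bar>" 2] by simp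
      have "?p y \<le> \<delta> / (y - x)\<^sup>2" using normal_density_le_divide[OF \<delta>, of "y - x"] False d(1) shift[of y] by auto
      also have "\<dots> \<le> \<delta> / d\<^sup>2" using z d(1) \<delta> less_le_trans[OF _ z, of 0] by (intro divide_left_mono mult_pos_pos) auto
      finally have 1: "?p y * \<bar>f y\<bar> \<le> \<delta> / d\<^sup>2 * \<bar>f y\<bar>" by (rule mult_right_mono) simp
      have "?p y * d\<^sup>2 \<le> ?p y * (y - x)\<^sup>2" using z by (intro mult_left_mono) auto
      then have "?p y \<le> (?p y * (y - x)\<^sup>2) / d\<^sup>2" using d(1) by (simp add: pos_le_divide_eq)
      then have 2: "\<bar>f x\<bar> * ?p y \<le> \<bar>f x\<bar> * ((?p y * (y - x)\<^sup>2) / d\<^sup>2)" by (rule mult_left_mono) simp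
      have "\<bar>?p y * f y - ?p y * f x\<bar> \<le> \<bar>?p y * f y\<bar> + \<bar>?p y * f x\<bar>" by (rule abs_triangle_ineq4)
      also have "\<dots> = ?p y * \<bar>f y\<bar> + \<bar>f x\<bar> * ?p y" by (simp add: abs_mult mult.commute)
      finally have "\<bar>?p y * f y - ?p y * f x\<bar> \<le> ?p y * \<bar>f y\<bar> + \<bar>f x\<bar> * ?p y" .
      moreover have "0 \<le> r / 2 * ?p y" using r by simp
      ultimately show ?thesis using 1 2 by linarith
    qed
    have "(\<integral>y. ?p y * f y \<partial>lborel) - f x = (\<integral>y. ?p y * f y - ?p y * f x \<partial>lborel)"
      using pf pi by simp
    then have "\<bar>(\<integral>y. ?p y * f y \<partial>lborel) - f x\<bar> \<le> (\<integral>y. \<bar>?p y * f y - ?p y * f x\<bar> \<partial>lborel)"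
      by (simp only: integral_abs_bound)
    also have "\<dots> \<le> (\<integral>y. r / 2 * ?p y + \<delta> / d\<^sup>2 * \<bar>f y\<bar> + \<bar>f x\<bar> * ((?p y * (y - x)\<^sup>2) / d\<^sup>2) \<partial>lborel)"
      using pf pi f has_bochner_integral_integrable[of lborel] m2 bound
      by (intro integral_mono) (auto simp: has_bochner_integral_iff)
    also have "\<dots> = r / 2 + E \<delta>"
      using pi f m2 by (simp add: has_bochner_integral_iff E_def)
    also have "\<dots> < r" using n0[OF n] by (simp add: \<delta>_def)
    finally show "norm ((\<integral>y. normal_density 0 (1 / real (Suc n)) (y - x) * f y \<partial>lborel) - f x) < r"
      unfolding real_norm_def \<delta>_def[symmetric] shift .
  qed
qed

text \<open>A deterministic setting for one path at a time. Composing with \<open>max 0\<close>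
  expresses measurability on nonnegative times for a function defined on the whole line.\<close>

locale continuous_occupation_density =
  fixes b :: "real \<Rightarrow> real" and L :: "real \<Rightarrow> real \<Rightarrow> real"
  assumes path: "(\<lambda>s. b (max 0 s)) \<in> borel_measurable borel"
    and occupation: "\<And>t. 0 \<le> t \<Longrightarrow> occupation_measure b {0..t} = density lborel (\<lambda>x. ennreal (L t x))"
    and nonneg: "\<And>t x. 0 \<le> t \<Longrightarrow> 0 \<le> L t x"
    and cont: "\<And>t. 0 \<le> t \<Longrightarrow> continuous_on UNIV (L t)"
begin

lemma L_measurable: "0 \<le> t \<Longrightarrow> L t \<in> borel_measurable borel"
  by (rule borel_measurable_continuous_onI[OF cont])

lemma occupation_integral:
  assumes T: "0 \<le> T" and [measurable]: "\<phi> \<in> borel_measurable borel"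
  shows "(\<integral>\<^sup>+u. indicator {0..T} u * \<phi> (b u) \<partial>lborel) = (\<integral>\<^sup>+z. ennreal (L T z) * \<phi> z \<partial>lborel)"
proof -
  have [measurable]: "L T \<in> borel_measurable borel" by (rule L_measurable[OF T])
  have "(\<lambda>s. b (max 0 s)) \<in> borel_measurable (restrict_space lborel {0..T})"
    using path by (intro measurable_restrict_space1) simp
  then have bm: "b \<in> measurable (restrict_space lborel {0..T}) borel"
    by (rule measurable_cong[THEN iffD1, rotated]) (simp add: space_restrict_space)
  have "(\<integral>\<^sup>+z. ennreal (L T z) * \<phi> z \<partial>lborel) = (\<integral>\<^sup>+z. \<phi> z \<partial>density lborel (\<lambda>z. ennreal (L T z)))"
    by (rule nn_integral_density[symmetric]) auto
  also have "\<dots> = (\<integral>\<^sup>+u. \<phi> (b u) \<partial>restrict_space lborel {0..T})"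
    unfolding occupation[OF T, symmetric] occupation_measure_def
    by (rule nn_integral_distr[OF bm]) simp
  also have "\<dots> = (\<integral>\<^sup>+u. \<phi> (b u) * indicator {0..T} u \<partial>lborel)"
    by (rule nn_integral_restrict_space) simp
  finally show ?thesis by (simp add: mult.commute)
qed

lemma integrable_L:
  assumes T: "0 \<le> T"
  shows "integrable lborel (L T)"
proof (rule integrableI_bounded)
  show "L T \<in> borel_measurable lborel" using L_measurable[OF T] by simp
  have "(\<integral>\<^sup>+z. ennreal (norm (L T z)) \<partial>lborel) = (\<integral>\<^sup>+u. indicator {0..T} u \<partial>lborel)"
    using occupation_integral[OF T, of "\<lambda>_. 1"] nonneg[OF T] by simp
  also have "\<dots> < \<infinity>" by (simp add: T)
  finally show "(\<integral>\<^sup>+z. ennreal (norm (L T z)) \<partial>lborel) < \<infinity>" .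
qed

text \<open>The occupation formula turns the time integral into a space integral against the
  density, and an affine substitution with Jacobian \<open>r\<close> centres it at level
  \<open>y0\<close>.\<close>

lemma smoothed_occupation_eq:
  assumes T: "0 \<le> T" and r: "0 < r" and e: "0 < \<epsilon>"
  shows "(\<integral>u. indicator {0..T} u * normal_density 0 \<epsilon> ((b u - y0) / r - x) \<partial>lborel)
    = r * (\<integral>y. normal_density 0 \<epsilon> (y - x) * L T (r * y + y0) \<partial>lborel)"
proof -
  have [measurable]: "L T \<in> borel_measurable borel" by (rule L_measurable[OF T])
  let ?\<phi> = "\<lambda>z. normal_density 0 \<epsilon> ((z - y0) / r - x)"
  have "(\<lambda>u. indicator {0..T} u * ?\<phi> (b (max 0 u))) \<in> borel_measurable borel" using path by measurable
  then have m: "(\<lambda>u. indicator {0..T} u * ?\<phi> (b u)) \<in> borel_measurable borel"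
    by (rule measurable_cong[THEN iffD1, rotated]) (auto simp: indicator_def)
  have "(\<integral>u. indicator {0..T} u * ?\<phi> (b u) \<partial>lborel) = enn2real (\<integral>\<^sup>+u. ennreal (indicator {0..T} u * ?\<phi> (b u)) \<partial>lborel)"
    using m by (intro integral_eq_nn_integral) auto
  also have "(\<integral>\<^sup>+u. ennreal (indicator {0..T} u * ?\<phi> (b u)) \<partial>lborel) = (\<integral>\<^sup>+u. indicator {0..T} u * ennreal (?\<phi> (b u)) \<partial>lborel)"
    by (intro nn_integral_cong) (auto simp: indicator_def)
  also have "\<dots> = (\<integral>\<^sup>+z. ennreal (L T z) * ennreal (?\<phi> z) \<partial>lborel)"
    by (rule occupation_integral[OF T]) measurable
  also have "\<dots> = (\<integral>\<^sup>+z. ennreal (L T z * ?\<phi> z) \<partial>lborel)"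
    using nonneg[OF T] by (simp add: ennreal_mult)
  also have "enn2real \<dots> = (\<integral>z. L T z * ?\<phi> z \<partial>lborel)"
    using nonneg[OF T] by (intro integral_eq_nn_integral[symmetric]) auto
  also have "\<dots> = r * (\<integral>y. L T (y0 + r * y) * ?\<phi> (y0 + r * y) \<partial>lborel)"
    using lborel_integral_real_affine[of r "\<lambda>z. L T z * ?\<phi> z" y0] r by simp
  also have "(\<integral>y. L T (y0 + r * y) * ?\<phi> (y0 + r * y) \<partial>lborel) = (\<integral>y. normal_density 0 \<epsilon> (y - x) * L T (r * y + y0) \<partial>lborel)"
    using r by (intro Bochner_Integration.integral_cong) (auto simp: add.commute mult.commute)
  finally show ?thesis .
qed

lemma smoothed_occupation_tendsto:
  assumes T: "0 \<le> T" and r: "0 < r"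
  shows "(\<lambda>n. \<integral>u. indicator {0..T} u * normal_density 0 (1 / real (Suc n)) ((b u - y0) / r - x) \<partial>lborel) \<longlonglongrightarrow> r * L T (r * x + y0)"
proof -
  have i: "integrable lborel (\<lambda>y. L T (r * y + y0))"
    using lborel_integrable_real_affine[OF integrable_L[OF T], of r y0] r by (simp add: add.commute)
  have "continuous_on UNIV (\<lambda>y. L T (r * y + y0))"
    by (rule continuous_on_compose2[OF cont[OF T]]) (auto intro!: continuous_intros)
  then have c: "isCont (\<lambda>y. L T (r * y + y0)) x" by (simp add: continuous_on_eq_continuous_at)
  have e: "0 < 1 / real (Suc n)" for n by simp
  show ?thesis unfolding smoothed_occupation_eq[OF T r e]
    by (intro tendsto_mult_left gaussian_approximate_identity i c)
qed

text \<open>The occupation measure of a single instant is zero, which determines its density only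
  almost everywhere. The pointwise limit of smoothed occupation integrals, available by continuity
  in space, gives the value at every level.\<close>

lemma L_0: "L 0 x = 0"
proof (rule LIMSEQ_unique)
  show "(\<lambda>n. \<integral>u. indicator {0..0} u * normal_density 0 (1 / real (Suc n)) ((b u - 0) / 1 - x) \<partial>lborel) \<longlonglongrightarrow> L 0 x"
    using smoothed_occupation_tendsto[of 0 1 0 x] by simp
  have "(\<integral>u. indicator {0..0} u * normal_density 0 (1 / real (Suc n)) ((b u - 0) / 1 - x) \<partial>lborel) = 0" for n
  proof (rule integral_eq_zero_AE)
    have "AE u in lborel. u \<noteq> (0::real)" by (rule AE_lborel_singleton)
    then show "AE u in lborel. indicator {0..0} u * normal_density 0 (1 / real (Suc n)) ((b u - 0) / 1 - x) = 0"
      by eventually_elim simp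
  qed
  then show "(\<lambda>n. \<integral>u. indicator {0..0} u * normal_density 0 (1 / real (Suc n)) ((b u - 0) / 1 - x) \<partial>lborel) \<longlonglongrightarrow> 0"
    by simp
qed

text \<open>Substituting \<open>t0 + \<rho> * s\<close> for time costs a factor
  \<open>1 / \<rho>\<close>, and scaling space by \<open>r\<close> gains a factor \<open>r\<close>.
  For \<open>r = \<rho> powr H t0\<close> their quotient is the normalization
  \<open>1 / \<rho> powr (1 - H t0)\<close>, the source of the self-similarity parameter.\<close>

lemma rescaled_occupation_tendsto:
  assumes t0: "0 \<le> t0" and \<rho>: "0 < \<rho>" and r: "0 < r" and t: "0 \<le> t"
  shows "(\<lambda>n. \<integral>s. indicator {0<..t} s * normal_density 0 (1 / real (Suc n)) ((b (t0 + \<rho> * max 0 s) - y0) / r - x) \<partial>lborel)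
    \<longlonglongrightarrow> (L (t0 + \<rho> * t) (r * x + y0) - L t0 (r * x + y0)) * (r / \<rho>)"
proof -
  let ?T = "t0 + \<rho> * t"
  have T: "0 \<le> ?T" "t0 \<le> ?T" using t0 \<rho> t by auto
  have eq: "(\<integral>s. indicator {0<..t} s * normal_density 0 \<epsilon> ((b (t0 + \<rho> * max 0 s) - y0) / r - x) \<partial>lborel)
    = ((\<integral>u. indicator {0..?T} u * normal_density 0 \<epsilon> ((b u - y0) / r - x) \<partial>lborel)
       - (\<integral>u. indicator {0..t0} u * normal_density 0 \<epsilon> ((b u - y0) / r - x) \<partial>lborel)) / \<rho>" (is "?l = (?a - ?b) / \<rho>")
    if e: "0 < \<epsilon>" for \<epsilon>
  proof -
    have i: "integrable lborel (\<lambda>u. indicator {0..T} u * normal_density 0 \<epsilon> ((b u - y0) / r - x))" if "0 \<le> T" for T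
    proof (rule Bochner_Integration.integrable_bound)
      have "(\<lambda>u. indicator {0..T} u * normal_density 0 \<epsilon> ((b (max 0 u) - y0) / r - x)) \<in> borel_measurable borel" using path by measurable
      then have "(\<lambda>u. indicator {0..T} u * normal_density 0 \<epsilon> ((b u - y0) / r - x)) \<in> borel_measurable borel"
        by (rule measurable_cong[THEN iffD1, rotated]) (auto simp: indicator_def)
      then show "(\<lambda>u. indicator {0..T} u * normal_density 0 \<epsilon> ((b u - y0) / r - x)) \<in> borel_measurable lborel" by simp
      show "integrable lborel (\<lambda>u. indicat_real {0..T} u * (1 / (sqrt (2 * pi) * \<epsilon>)))"
        by (intro integrable_mult_left integrable_real_indicator emeasure_bounded_finite) auto
      show "AE u in lborel. norm (indicator {0..T} u * normal_density 0 \<epsilon> ((b u - y0) / r - x)) \<le> norm (indicat_real {0..T} u * (1 / (sqrt (2 * pi) * \<epsilon>)))"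
        using normal_density_le[OF e] e by (intro AE_I2) (auto simp: indicator_def)
    qed
    have "?a - ?b = (\<integral>u. indicator {0..?T} u * normal_density 0 \<epsilon> ((b u - y0) / r - x) - indicator {0..t0} u * normal_density 0 \<epsilon> ((b u - y0) / r - x) \<partial>lborel)"
      by (rule Bochner_Integration.integral_diff[symmetric]) (use i T t0 in auto)
    also have "\<dots> = (\<integral>u. indicator {t0<..?T} u * normal_density 0 \<epsilon> ((b u - y0) / r - x) \<partial>lborel)"
      by (rule Bochner_Integration.integral_cong) (use T t0 in \<open>auto simp: indicator_def\<close>)
    also have "\<dots> = \<rho> * (\<integral>s. indicator {t0<..?T} (t0 + \<rho> * s) * normal_density 0 \<epsilon> ((b (t0 + \<rho> * s) - y0) / r - x) \<partial>lborel)"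
      using lborel_integral_real_affine[of \<rho> "\<lambda>u. indicator {t0<..?T} u * normal_density 0 \<epsilon> ((b u - y0) / r - x)" t0] \<rho> by simp
    also have "(\<integral>s. indicator {t0<..?T} (t0 + \<rho> * s) * normal_density 0 \<epsilon> ((b (t0 + \<rho> * s) - y0) / r - x) \<partial>lborel) = ?l"
    proof (rule Bochner_Integration.integral_cong[OF refl])
      fix s
      have "t0 + \<rho> * s \<in> {t0<..?T} \<longleftrightarrow> s \<in> {0<..t}" using \<rho> by (auto simp: zero_less_mult_iff)
      then show "indicator {t0<..?T} (t0 + \<rho> * s) * normal_density 0 \<epsilon> ((b (t0 + \<rho> * s) - y0) / r - x)
        = indicator {0<..t} s * normal_density 0 \<epsilon> ((b (t0 + \<rho> * max 0 s) - y0) / r - x)"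
        by (auto simp: indicator_def max_def)
    qed
    finally show ?thesis using \<rho> by simp
  qed
  have "(\<lambda>n. ((\<integral>u. indicator {0..?T} u * normal_density 0 (1 / real (Suc n)) ((b u - y0) / r - x) \<partial>lborel)
       - (\<integral>u. indicator {0..t0} u * normal_density 0 (1 / real (Suc n)) ((b u - y0) / r - x) \<partial>lborel)) / \<rho>)
    \<longlonglongrightarrow> (r * L ?T (r * x + y0) - r * L t0 (r * x + y0)) / \<rho>"
    using \<rho> by (intro tendsto_divide tendsto_diff tendsto_const smoothed_occupation_tendsto T t0 r) auto
  moreover have "(r * L ?T (r * x + y0) - r * L t0 (r * x + y0)) / \<rho> = (L ?T (r * x + y0) - L t0 (r * x + y0)) * (r / \<rho>)"
    by (simp add: algebra_simps diff_divide_distrib)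
  ultimately show ?thesis by (simp add: eq del: of_nat_Suc)
qed

end

text \<open>Rounding the random argument to multiples of \<open>1 / Suc n\<close> leaves countably
  many values, and continuity recovers the limit. It is used to evaluate the local time at the
  random level that contains \<open>B t0\<close>.\<close>

lemma measurable_continuous_composition:
  fixes f :: "real \<Rightarrow> 'a \<Rightarrow> real"
  assumes f: "\<And>y. f y \<in> borel_measurable M" and c: "\<And>\<omega>. \<omega> \<in> space M \<Longrightarrow> continuous_on UNIV (\<lambda>y. f y \<omega>)"
    and [measurable]: "Y \<in> borel_measurable M"
  shows "(\<lambda>\<omega>. f (Y \<omega>) \<omega>) \<in> borel_measurable M"
proof (rule borel_measurable_LIMSEQ_real)
  let ?y = "\<lambda>n \<omega>. of_int \<lfloor>Y \<omega> * real (Suc n)\<rfloor> / real (Suc n)"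
  show "(\<lambda>\<omega>. f (?y n \<omega>) \<omega>) \<in> borel_measurable M" for n
  proof (rule measurable_compose_countable[where f="\<lambda>i \<omega>. f (of_int i / real (Suc n)) \<omega>"])
    show "(\<lambda>\<omega>. \<lfloor>Y \<omega> * real (Suc n)\<rfloor>) \<in> measurable M (count_space UNIV)" by measurable
  qed (rule f)
  fix \<omega> assume w: "\<omega> \<in> space M"
  have "(\<lambda>n. ?y n \<omega>) \<longlonglongrightarrow> Y \<omega>"
  proof (rule LIMSEQ_I)
    fix e :: real assume e: "0 < e"
    obtain m where m: "1 / real (Suc m) < e" using nat_approx_posE[OF e] by blast
    show "\<exists>m. \<forall>n\<ge>m. norm (?y n \<omega> - Y \<omega>) < e"
    proof (intro exI[of _ m] allI impI)
      fix n assume n: "m \<le> n"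
      have "\<bar>of_int \<lfloor>Y \<omega> * real (Suc n)\<rfloor> - Y \<omega> * real (Suc n)\<bar> \<le> 1" by linarith
      then have "\<bar>(of_int \<lfloor>Y \<omega> * real (Suc n)\<rfloor> - Y \<omega> * real (Suc n)) / real (Suc n)\<bar> \<le> 1 / real (Suc n)"
        unfolding abs_divide by (simp add: divide_right_mono)
      also have "\<dots> \<le> 1 / real (Suc m)" using n by (intro divide_left_mono) auto
      finally show "norm (?y n \<omega> - Y \<omega>) < e" using m by (simp add: diff_divide_distrib del: of_nat_Suc)
    qed
  qed
  moreover have "isCont (\<lambda>y. f y \<omega>) (Y \<omega>)" using c[OF w] by (simp add: continuous_on_eq_continuous_at)
  ultimately show "(\<lambda>n. f (?y n \<omega>) \<omega>) \<longlonglongrightarrow> f (Y \<omega>) \<omega>" by (rule isCont_tendsto_compose[rotated])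
qed

section \<open>The local time of multifractional Brownian motion\<close>

lemma mbm_prob_space: "multifractional_brownian_motion R M H B \<Longrightarrow> prob_space M"
  by (auto simp: multifractional_brownian_motion_def two_sided_brownian_motion_def)

lemma mbm_joint_measurable:
  assumes B: "multifractional_brownian_motion R M H B" and t0: "0 \<le> t0" and \<rho>: "0 \<le> \<rho>"
  shows "(\<lambda>(s, \<omega>). B (t0 + \<rho> * max 0 s) \<omega>) \<in> borel_measurable (borel \<Otimes>\<^sub>M M)"
proof -
  have m: "(\<lambda>z. (t0 + \<rho> * max 0 (fst z), snd z)) \<in> measurable (borel \<Otimes>\<^sub>M M) (restrict_space borel {0..} \<Otimes>\<^sub>M M)"
    using t0 \<rho> by (intro measurable_Pair measurable_restrict_space2) auto
  have "(\<lambda>(t, \<omega>). B t \<omega>) \<in> borel_measurable (restrict_space borel {0..} \<Otimes>\<^sub>M M)"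
    using B by (simp add: multifractional_brownian_motion_def)
  from measurable_compose[OF m this] show ?thesis by (simp add: case_prod_beta')
qed

lemma local_time_continuous_in_time:
  assumes L: "jointly_continuous_local_time M B L" and w: "\<omega> \<in> space M" and t0: "0 \<le> t0" and \<rho>: "0 \<le> \<rho>"
  shows "continuous_on {0..1} (\<lambda>t. L (t0 + \<rho> * t) y \<omega>)"
proof -
  have c: "continuous_on ({0..} \<times> UNIV) (\<lambda>(t, x). L t x \<omega>)" using L w by (simp add: jointly_continuous_local_time_def)
  have "continuous_on {0..1} (\<lambda>t. (\<lambda>(t, x). L t x \<omega>) (t0 + \<rho> * t, y))"
    by (rule continuous_on_compose2[OF c]) (use t0 \<rho> in \<open>auto intro!: continuous_intros\<close>)
  then show ?thesis by simp
qed

lemma local_time_continuous_in_space: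
  assumes L: "jointly_continuous_local_time M B L" and w: "\<omega> \<in> space M" and t: "0 \<le> t"
  shows "continuous_on UNIV (\<lambda>x. L t x \<omega>)"
proof -
  have c: "continuous_on ({0..} \<times> UNIV) (\<lambda>(t, x). L t x \<omega>)" using L w by (simp add: jointly_continuous_local_time_def)
  have "continuous_on UNIV (\<lambda>x. (\<lambda>(t, x). L t x \<omega>) (t, x))"
    by (rule continuous_on_compose2[OF c]) (use t in \<open>auto intro!: continuous_intros\<close>)
  then show ?thesis by simp
qed

lemma AE_continuous_occupation_density:
  assumes B: "multifractional_brownian_motion R M H B" and L: "jointly_continuous_local_time M B L"
  shows "AE \<omega> in M. continuous_occupation_density (\<lambda>s. B s \<omega>) (\<lambda>t x. L t x \<omega>)"
proof -
  have "AE \<omega> in M. \<forall>t\<ge>0. occupation_measure (\<lambda>s. B s \<omega>) {0..t} = density lborel (\<lambda>x. ennreal (L t x \<omega>))"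
    using L by (simp add: jointly_continuous_local_time_def)
  then show ?thesis using AE_space
  proof eventually_elim
    case (elim \<omega>)
    show ?case
    proof
      show "(\<lambda>s. B (max 0 s) \<omega>) \<in> borel_measurable borel"
        using measurable_Pair1[OF mbm_joint_measurable[OF B order_refl zero_le_one] elim(2)] by simp
      fix t :: real assume t: "0 \<le> t"
      show "occupation_measure (\<lambda>s. B s \<omega>) {0..t} = density lborel (\<lambda>x. ennreal (L t x \<omega>))" using elim(1) t by blast
      show "0 \<le> L t x \<omega>" for x using L t elim(2) by (simp add: jointly_continuous_local_time_def)
      show "continuous_on UNIV (\<lambda>x. L t x \<omega>)" by (rule local_time_continuous_in_space[OF L elim(2) t])
    qed
  qed
qed

lemma local_time_measurable_at:
  assumes L: "jointly_continuous_local_time M B L" and t: "0 \<le> t" and Y: "Y \<in> borel_measurable M"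
  shows "(\<lambda>\<omega>. L t (Y \<omega>) \<omega>) \<in> borel_measurable M"
proof (rule measurable_continuous_composition[OF _ _ Y])
  show "L t y \<in> borel_measurable M" for y using L t by (simp add: jointly_continuous_local_time_def)
qed (rule local_time_continuous_in_space[OF L _ t])

text \<open>The paths are measurable on nonnegative times only, hence the \<open>max\<close>.\<close>

definition local_process :: "(real \<Rightarrow> real) \<Rightarrow> (real \<Rightarrow> 'a \<Rightarrow> real) \<Rightarrow> real \<Rightarrow> real \<Rightarrow> real \<Rightarrow> 'a \<Rightarrow> real" where
  "local_process H B t0 \<rho> s \<omega> = (B (t0 + \<rho> * max 0 s) \<omega> - B t0 \<omega>) / \<rho> powr H t0"

lemma sum_insert_None: "finite I \<Longrightarrow> (\<Sum>j\<in>insert None (Some ` I). g j) = g None + (\<Sum>i\<in>I. g (Some i))"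
  by (simp add: sum.reindex)

text \<open>All increments share the base time \<open>t0\<close>. The index \<open>None\<close>
  collects it with minus the sum of the coefficients, kept apart from the other indices even if some
  \<open>s i\<close> is 0, so \<open>mbm_expectation_cis\<close> applies to the enlarged
  family.\<close>

lemma local_process_expectation_cis:
  assumes B: "multifractional_brownian_motion R M H B" and t0: "0 \<le> t0" and \<rho>: "0 < \<rho>"
    and I: "finite I" "\<And>i. i \<in> I \<Longrightarrow> s i \<in> {0..1}"
  shows "(\<integral>\<omega>. cis (\<Sum>i\<in>I. a i * local_process H B t0 \<rho> (s i) \<omega>) \<partial>M)
    = complex_of_real (exp (- l2sq (\<lambda>u. \<Sum>i\<in>I. a i *\<^sub>R local_kernel R H t0 \<rho> (s i) u) / 2))"
proof -
  let ?r = "\<rho> powr (- H t0)"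
  define J where "J = insert None (Some ` I)"
  define T where "T = case_option t0 (\<lambda>i. t0 + \<rho> * s i)"
  define A where "A = case_option (- (\<Sum>i\<in>I. a i * ?r)) (\<lambda>i. a i * ?r)"
  have s0: "0 \<le> s i" if "i \<in> I" for i using I(2)[OF that] by simp
  have T: "0 \<le> T j" if "j \<in> J" for j using that t0 \<rho> s0 by (auto simp: T_def J_def)
  have 1: "(\<Sum>i\<in>I. a i * local_process H B t0 \<rho> (s i) \<omega>) = (\<Sum>j\<in>J. A j * B (T j) \<omega>)" for \<omega>
  proof -
    have "(\<Sum>i\<in>I. a i * local_process H B t0 \<rho> (s i) \<omega>) = (\<Sum>i\<in>I. a i * ?r * B (t0 + \<rho> * s i) \<omega> - a i * ?r * B t0 \<omega>)"
      by (rule sum.cong) (use s0 in \<open>auto simp: local_process_def powr_minus divide_inverse algebra_simps max_absorb2\<close>)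
    then show ?thesis by (simp add: sum_insert_None[OF I(1)] J_def A_def T_def sum_subtractf sum_distrib_right)
  qed
  have 2: "(\<Sum>i\<in>I. a i *\<^sub>R local_kernel R H t0 \<rho> (s i) u) = (\<Sum>j\<in>J. A j *\<^sub>R mbm_kernel R (H (T j)) (T j) u)" for u
  proof -
    have "(\<Sum>i\<in>I. a i *\<^sub>R local_kernel R H t0 \<rho> (s i) u)
      = (\<Sum>i\<in>I. (a i * ?r) *\<^sub>R mbm_kernel R (H (t0 + \<rho> * s i)) (t0 + \<rho> * s i) u - (a i * ?r) *\<^sub>R mbm_kernel R (H t0) t0 u)"
      by (simp add: local_kernel_def scaleR_right_diff_distrib)
    then show ?thesis by (simp add: sum_insert_None[OF I(1)] J_def A_def T_def sum_subtractf scaleR_left.sum)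
  qed
  show ?thesis unfolding 1 2 by (rule mbm_expectation_cis[OF B T])
qed

lemma local_time_lim:
  assumes B: "multifractional_brownian_motion R M H B" and L: "jointly_continuous_local_time M B L"
    and t0: "0 \<le> t0" and \<rho>: "0 < \<rho>"
  shows "AE \<omega> in M. \<forall>t\<in>{0..1}. (\<lambda>n. \<integral>s. indicator {0<..t} s * normal_density 0 (1 / real (Suc n)) (local_process H B t0 \<rho> s \<omega> - x) \<partial>lborel)
    \<longlonglongrightarrow> rescaled_local_time H B L t0 \<rho> x t \<omega>"
  using AE_continuous_occupation_density[OF B L]
proof eventually_elim
  case (elim \<omega>)
  interpret continuous_occupation_density "\<lambda>s. B s \<omega>" "\<lambda>t x. L t x \<omega>" by (rule elim)
  let ?r = "\<rho> powr H t0"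
  have r: "0 < ?r" using \<rho> by simp
  have e: "?r / \<rho> = 1 / \<rho> powr (1 - H t0)" using \<rho> by (simp add: powr_diff)
  show ?case
  proof
    fix t :: real assume "t \<in> {0..1}"
    then show "(\<lambda>n. \<integral>s. indicator {0<..t} s * normal_density 0 (1 / real (Suc n)) (local_process H B t0 \<rho> s \<omega> - x) \<partial>lborel)
      \<longlonglongrightarrow> rescaled_local_time H B L t0 \<rho> x t \<omega>"
      using rescaled_occupation_tendsto[OF t0 \<rho> r, of t "B t0 \<omega>" x]
      by (simp add: local_process_def rescaled_local_time_def e del: of_nat_Suc)
  qed
qed

theorem theorem5p1:
  fixes M :: "'a measure" and N :: "'b measure"
    and H :: "real \<Rightarrow> real" and \<mu> \<nu> \<beta> t0 x :: real
    and R :: mbm_representation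
    and B :: "real \<Rightarrow> 'a \<Rightarrow> real" and L :: "real \<Rightarrow> real \<Rightarrow> 'a \<Rightarrow> real"
    and B0 :: "real \<Rightarrow> 'b \<Rightarrow> real" and l :: "real \<Rightarrow> real \<Rightarrow> 'b \<Rightarrow> real"
  assumes "0 < \<mu>" and "\<nu> < 1" and "H ` {0..} \<subseteq> {\<mu>..\<nu>}"
    and "holder_continuous_on {0..} \<beta> H" and "(SUP s\<in>{0..}. H s) < \<beta>"
    and "multifractional_brownian_motion R M H B"
    and "jointly_continuous_local_time M B L"
    and "0 \<le> t0"
    and "fractional_brownian_motion R N (H t0) B0"
    and "jointly_continuous_local_time N B0 l"
  shows "weakly_converges C01
           (\<lambda>\<rho>. law_C01 M (rescaled_local_time H B L t0 \<rho> x))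
           (law_C01 N (\<lambda>t \<omega>. l t x \<omega>))
           (at_right 0)"
proof -
  note B = assms(6) and L = assms(7) and t0 = assms(8) and l = assms(10)
  have B0: "multifractional_brownian_motion R N (\<lambda>_. H t0) B0"
    using assms(9) by (simp add: fractional_brownian_motion_def)
  interpret PM: prob_space M by (rule mbm_prob_space[OF B])
  interpret PN: prob_space N by (rule mbm_prob_space[OF B0])
  obtain C where C: "\<And>s t. 0 \<le> s \<Longrightarrow> 0 \<le> t \<Longrightarrow> \<bar>H s - H t\<bar> \<le> C * \<bar>s - t\<bar> powr \<beta>" and \<beta>: "0 < \<beta>"
    using assms(4) by (auto simp: holder_continuous_on_def)
  have range: "H s \<in> {\<mu>..\<nu>}" if "0 \<le> s" for s using assms(3) that by (auto simp: image_subset_iff)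
  \<comment> \<open>The constant in the Hoelder condition carries no sign, so its maximum with 0 is
    used. The supremum of \<open>H\<close> plays the part of \<open>hb\<close>; it is finite because
    \<open>H\<close> is bounded by \<nu>.\<close>
  interpret mbm_hurst H \<mu> \<nu> \<beta> "max 0 C" "SUP s\<in>{0..}. H s" t0 R
  proof
    show "\<bar>H s - H t\<bar> \<le> max 0 C * \<bar>s - t\<bar> powr \<beta>" if "0 \<le> s" "0 \<le> t" for s t
      using order_trans[OF C[OF that] mult_right_mono[of C "max 0 C"]] by simp
    show "H s \<le> (SUP s\<in>{0..}. H s)" if "0 \<le> s" for s
      using that range by (intro cSUP_upper bdd_aboveI2[where M=\<nu>]) auto
  qed (use assms range \<beta> in auto)
  have \<nu>: "0 < \<nu>" using range[of 0] assms(1) by auto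
  obtain c K \<rho>0 where cK: "0 < c" "0 \<le> K" "0 < \<rho>0"
    and b1: "\<And>\<rho> s d \<alpha> \<gamma>. 0 < \<rho> \<Longrightarrow> \<rho> < \<rho>0 \<Longrightarrow> 0 \<le> s \<Longrightarrow> 0 \<le> d \<Longrightarrow> s + d \<le> 1 \<Longrightarrow>
      c * (\<alpha>\<^sup>2 * s powr (2 * \<nu>) + \<gamma>\<^sup>2 * d powr (2 * \<nu>))
      \<le> l2sq (\<lambda>u. \<alpha> *\<^sub>R local_kernel R H t0 \<rho> s u + \<gamma> *\<^sub>R (local_kernel R H t0 \<rho> (s + d) u - local_kernel R H t0 \<rho> s u))"
    and b2: "\<And>\<rho> s d. 0 < \<rho> \<Longrightarrow> \<rho> < \<rho>0 \<Longrightarrow> 0 \<le> s \<Longrightarrow> 0 \<le> d \<Longrightarrow> s + d \<le> 1 \<Longrightarrow>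
      (l2sq (\<lambda>u. local_kernel R H t0 \<rho> (s + d) u - local_kernel R H t0 \<rho> s u)) \<le> K * d powr (2 * \<mu>)"
    and b3: "\<And>s d \<alpha> \<gamma>. 0 \<le> s \<Longrightarrow> 0 \<le> d \<Longrightarrow> s + d \<le> 1 \<Longrightarrow>
      c * (\<alpha>\<^sup>2 * s powr (2 * \<nu>) + \<gamma>\<^sup>2 * d powr (2 * \<nu>))
      \<le> l2sq (\<lambda>u. \<alpha> *\<^sub>R mbm_kernel R (H t0) s u + \<gamma> *\<^sub>R (mbm_kernel R (H t0) (s + d) u - mbm_kernel R (H t0) s u))"
    and b4: "\<And>s d. 0 \<le> s \<Longrightarrow> 0 \<le> d \<Longrightarrow> s + d \<le> 1 \<Longrightarrow>
      (l2sq (\<lambda>u. mbm_kernel R (H t0) (s + d) u - mbm_kernel R (H t0) s u)) \<le> K * d powr (2 * \<mu>)"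
    using local_kernel_bounds by blast
  \<comment> \<open>The constants \<open>c\<close> and \<open>K\<close> are the same for all \<rho>
    below \<open>\<rho>0\<close> and, in \<open>limit\<close>, for the fractional process; this
    uniformity is what \<open>gaussian_local_times\<close> asks for.\<close>
  have local: "gaussian_local_time M (local_process H B t0 \<rho>) (local_kernel R H t0 \<rho>) c \<nu> K \<mu> x (rescaled_local_time H B L t0 \<rho> x)"
    if \<rho>: "0 < \<rho>" "\<rho> < \<rho>0" for \<rho>
  proof (intro_locales; (intro gaussian_process_axioms.intro gaussian_local_time_axioms.intro)?)
    have "(\<lambda>z. B t0 (snd z)) \<in> borel_measurable (borel \<Otimes>\<^sub>M M)"
      by (rule measurable_compose[OF measurable_snd mbm_measurable[OF B t0]])
    with mbm_joint_measurable[OF B t0 less_imp_le[OF \<rho>(1)]]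
    show "(\<lambda>(s, \<omega>). local_process H B t0 \<rho> s \<omega>) \<in> borel_measurable (borel \<Otimes>\<^sub>M M)"
      unfolding local_process_def case_prod_beta' by (intro borel_measurable_divide borel_measurable_diff borel_measurable_const)
    have y: "(\<lambda>\<omega>. \<rho> powr H t0 * x + B t0 \<omega>) \<in> borel_measurable M" using mbm_measurable[OF B t0] by measurable
    show "rescaled_local_time H B L t0 \<rho> x t \<in> borel_measurable M" if "t \<in> {0..1}" for t
      unfolding rescaled_local_time_def[abs_def] using that t0 \<rho>
      by (intro borel_measurable_divide borel_measurable_diff local_time_measurable_at[OF L _ y] borel_measurable_const) auto
    show "(\<integral>\<omega>. cis (\<Sum>i\<in>I. a i * local_process H B t0 \<rho> (s i) \<omega>) \<partial>M)
      = complex_of_real (exp (- l2sq (\<lambda>u. \<Sum>i\<in>I. a i *\<^sub>R local_kernel R H t0 \<rho> (s i) u) / 2))"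
      if "finite I" "\<And>i. i \<in> I \<Longrightarrow> s i \<in> {0..1}" for I :: "nat set" and a s
      by (rule local_process_expectation_cis[OF B t0 \<rho>(1) that])
    show "AE \<omega> in M. \<forall>t\<in>{0..1}. (\<lambda>n. \<integral>s. indicator {0<..t} s * normal_density 0 (1 / real (Suc n)) (local_process H B t0 \<rho> s \<omega> - x) \<partial>lborel)
      \<longlonglongrightarrow> rescaled_local_time H B L t0 \<rho> x t \<omega>"
      by (rule local_time_lim[OF B L t0 \<rho>(1)])
  qed (fact cK \<nu> nu mu b1[OF \<rho>] b2[OF \<rho>])+
  have limit: "gaussian_local_time N (\<lambda>s. B0 (max 0 s)) (mbm_kernel R (H t0)) c \<nu> K \<mu> x (\<lambda>t. l t x)"
  proof (intro_locales; (intro gaussian_process_axioms.intro gaussian_local_time_axioms.intro)?)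
    show "(\<lambda>(s, \<omega>). B0 (max 0 s) \<omega>) \<in> borel_measurable (borel \<Otimes>\<^sub>M N)"
      using mbm_joint_measurable[OF B0 order_refl zero_le_one] by simp
    show "(\<integral>\<omega>. cis (\<Sum>i\<in>I. a i * B0 (max 0 (s i)) \<omega>) \<partial>N)
      = complex_of_real (exp (- l2sq (\<lambda>u. \<Sum>i\<in>I. a i *\<^sub>R mbm_kernel R (H t0) (s i) u) / 2))"
      if "finite I" "\<And>i. i \<in> I \<Longrightarrow> s i \<in> {0..1}" for I :: "nat set" and a s
    proof -
      have "(\<Sum>i\<in>I. a i * B0 (max 0 (s i)) \<omega>) = (\<Sum>i\<in>I. a i * B0 (s i) \<omega>)" for \<omega>
        by (rule sum.cong) (use that in \<open>auto simp: max_absorb2\<close>)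
      then show ?thesis using mbm_expectation_cis[OF B0, of I s a] that by simp
    qed
    show "l t x \<in> borel_measurable N" if "t \<in> {0..1}" for t
      using l that by (simp add: jointly_continuous_local_time_def)
    show "AE \<omega> in N. \<forall>t\<in>{0..1}. (\<lambda>n. \<integral>s. indicator {0<..t} s * normal_density 0 (1 / real (Suc n)) (B0 (max 0 s) \<omega> - x) \<partial>lborel) \<longlonglongrightarrow> l t x \<omega>"
      using AE_continuous_occupation_density[OF B0 l]
    proof eventually_elim
      case (elim \<omega>)
      interpret continuous_occupation_density "\<lambda>s. B0 s \<omega>" "\<lambda>t x. l t x \<omega>" by (rule elim)
      \<comment> \<open>The unscaled case, with base time 0, both scales 1 and level 0, in which the
        subtracted local time at time 0 vanishes by \<open>L_0\<close>.\<close>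
      show ?case
        using rescaled_occupation_tendsto[of 0 1 1 _ 0 x] L_0[of x] by (simp del: of_nat_Suc)
    qed
  qed (fact cK \<nu> nu mu b3 b4)+
  show ?thesis unfolding weakly_converges_def
  proof (intro allI impI, elim conjE)
    fix \<phi> :: "(real \<Rightarrow> real) \<Rightarrow> real"
    assume \<phi>: "continuous_map (mtopology_of C01) euclideanreal \<phi>" "bounded (\<phi> ` mspace C01)"
    show "((\<lambda>\<rho>. \<integral>f. \<phi> f \<partial>law_C01 M (rescaled_local_time H B L t0 \<rho> x)) \<longlongrightarrow> (\<integral>f. \<phi> f \<partial>law_C01 N (\<lambda>t. l t x))) (at_right 0)"
    \<comment> \<open>The one-sided limit is tested along sequences in the interval below
      \<open>\<rho>0\<close>, because the dominated convergence arguments are sequential.\<close>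
    proof (rule tendsto_at_right_sequentially[OF cK(3)])
      fix S :: "nat \<Rightarrow> real" assume S: "\<And>n. 0 < S n" "\<And>n. S n < \<rho>0" "S \<longlonglongrightarrow> 0"
      have S0: "filterlim S (at_right 0) sequentially"
        using S by (intro tendsto_imp_filterlim_at_right) auto
      interpret gaussian_local_times M N "\<lambda>n. local_process H B t0 (S n)" "\<lambda>n. local_kernel R H t0 (S n)"
        "\<lambda>n. rescaled_local_time H B L t0 (S n) x" "\<lambda>s. B0 (max 0 s)" "mbm_kernel R (H t0)" "\<lambda>t. l t x" c \<nu> K \<mu> x
      proof (rule gaussian_local_times.intro)
        show "gaussian_local_time M (local_process H B t0 (S n)) (local_kernel R H t0 (S n)) c \<nu> K \<mu> x (rescaled_local_time H B L t0 (S n) x)" for n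
          by (rule local[OF S(1,2)])
        show "gaussian_local_time N (\<lambda>s. B0 (max 0 s)) (mbm_kernel R (H t0)) c \<nu> K \<mu> x (\<lambda>t. l t x)" by (rule limit)
        show "(\<lambda>n. \<integral>u. (norm (\<Sum>i\<in>I. a i *\<^sub>R local_kernel R H t0 (S n) (s i) u))\<^sup>2 \<partial>lborel)
          \<longlonglongrightarrow> l2sq (\<lambda>u. \<Sum>i\<in>I. a i *\<^sub>R mbm_kernel R (H t0) (s i) u)"
          if "finite I" "\<And>i. i \<in> I \<Longrightarrow> s i \<in> {0..1}" for I :: "nat set" and a s
          by (rule filterlim_compose[OF local_kernel_tendsto[OF that] S0])
        show "continuous_on {0..1} (\<lambda>t. rescaled_local_time H B L t0 (S n) x t \<omega>)" if "\<omega> \<in> space M" for n \<omega>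
          unfolding rescaled_local_time_def using S(1)[of n]
          by (intro continuous_intros local_time_continuous_in_time[OF L that t0]) auto
        show "continuous_on {0..1} (\<lambda>t. l t x \<omega>)" if "\<omega> \<in> space N" for \<omega>
          using local_time_continuous_in_time[OF l that, of 0 1 x] by simp
      qed
      show "(\<lambda>n. \<integral>f. \<phi> f \<partial>law_C01 M (rescaled_local_time H B L t0 (S n) x)) \<longlonglongrightarrow> (\<integral>f. \<phi> f \<partial>law_C01 N (\<lambda>t. l t x))"
        by (rule expectation_tendsto[OF \<phi>])
    qed
  qed
qed

end
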